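(* Let $G$ be a finite group such that $Sub(G) = 23$. Then $G$ is a $p$-group for some prime $p$, and hence $G$ is nilpotent.
   Context: For a finite group $G$, $Sub(G)$ denotes the number of subgroups of $G$, including the trivial subgroup and $G$ itself (subgroups are counted as subsets, not up to conjugacy or isomorphism). *)

theory Defs
  imports "HOL-Algebra.Generated_Groups" "HOL-Computational_Algebra.Primes"
begin

definition num_subgroups :: "('a, 'b) monoid_scheme \<Rightarrow> nat" where
  "num_subgroups G = card {H. subgroup H G}"

text \<open>For finite groups only: \<^const>\<open>order\<close> of an infinite group is 0. The case
  \<open>k = 0\<close> is allowed, so the trivial group is a \<open>p\<close>-group for every prime \<open>p\<close>.\<close>

definition finite_p_group :: "nat \<Rightarrow> ('a, 'b) monoid_scheme \<Rightarrow> bool" where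
  "finite_p_group p G \<longleftrightarrow> group G \<and> prime p \<and> (\<exists>k. order G = p ^ k)"

text \<open>The subgroup \<open>[H, K]\<close>, with the commutator convention of \<^const>\<open>derived\<close>.\<close>

definition commutator_subgroup :: "('a, 'b) monoid_scheme \<Rightarrow> 'a set \<Rightarrow> 'a set \<Rightarrow> 'a set" where
  "commutator_subgroup G H K =
     generate G (\<Union>h \<in> H. \<Union>k \<in> K. {h \<otimes>\<^bsub>G\<^esub> k \<otimes>\<^bsub>G\<^esub> inv\<^bsub>G\<^esub> h \<otimes>\<^bsub>G\<^esub> inv\<^bsub>G\<^esub> k})"

primrec lower_central_series :: "('a, 'b) monoid_scheme \<Rightarrow> nat \<Rightarrow> 'a set" where
  "lower_central_series G 0 = carrier G"
| "lower_central_series G (Suc n) =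
     commutator_subgroup G (lower_central_series G n) (carrier G)"

definition nilpotent_group :: "('a, 'b) monoid_scheme \<Rightarrow> bool" where
  "nilpotent_group G \<longleftrightarrow> group G \<and> (\<exists>n. lower_central_series G n = {\<one>\<^bsub>G\<^esub>})"

end

theory Submission
  imports Defs "HOL-Algebra.Sylow" "HOL-Algebra.Multiplicative_Group"
begin

text \<open>
Write s(H) for the number of subgroups of H, and suppose that s(G) = 23 although the order of G is
not a prime power. Counting subgroups refutes this in two cases.

Some Sylow p-subgroup P is normal. The subgroups H are sorted by the product PH; the fibre over P
consists of the subgroups of P. If all other Sylow subgroups centralized P, then G would be a
direct product of P and a complement T, and s(G) = s(P) s(T) would not be prime
(\<open>prime_count_nontrivial_action\<close>). So some Sylow q-subgroup S acts nontrivially on P.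
Let C be its centralizer in P and n the index of C in P, which is the number of P-conjugates of S:
a power of p congruent to 1 modulo q. The fibre over PS contains s(C) n + 1 subgroups, whence s(P)
+ s(C) n + 1 \<le> 23 (\<open>general_bound\<close>). This leaves a short list of possibilities
for p, q, n and P, and each of them either has further subgroups or meets a divisibility argument:
s(G) is even if P has odd prime order (\<open>even_subs_normal_sylow_prime_order\<close>), and if
G = PS, then every fibre has s(P) elements modulo q, so that q cannot divide s(P)
(\<open>dvd_subs_imp_dvd_num\<close>). The primes p \<ge> 5, p = 3 and p = 2 are treated in
\<open>no_normal_sylow_ge5\<close>, \<open>no_normal_sylow_3\<close> and
\<open>no_normal_sylow_2\<close>.

No Sylow subgroup is normal. Each prime divisor r of the order then provides at least r + 1 Sylow
subgroups and, unless they are their own normalizers, as many further subgroups as their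
normalizers. Counting these excludes three different prime divisors
(\<open>no_three_primes\<close>). For two primes p < q the number of Sylow subgroups for each is a
power of the other, and the count leaves p = 2 with very few Sylow numbers
(\<open>no_two_primes\<close>). Most of them are excluded by counting elements
(\<open>prime_order_self_normalizing_contra\<close>); in the remaining ones q = 3 has exactly 4
Sylow subgroups, and 24 subgroups can be listed (\<open>many_subs_3_4\<close>,
\<open>many_subs_9_4\<close>). These lists rest on the fact that r + 1 Sylow r-subgroups have the
same pairwise intersection, which is normal in G and of index r in each of them
(\<open>sylow_intersection\<close>).

Hence G has prime power order. Its upper central series increases strictly until it reaches G, and
it bounds the lower central series (\<open>prime_power_nilpotent\<close>).
\<close>

section \<open>Counting in finite sets\<close>

text \<open>The elements that are not fixed fall into pairs.\<close>

lemma involution_parity: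
  assumes f: "finite X" and g: "\<And>x. x \<in> X \<Longrightarrow> g x \<in> X" "\<And>x. x \<in> X \<Longrightarrow> g (g x) = x"
  shows "card X mod 2 = card {x \<in> X. g x = x} mod 2"
proof -
  define N where "N = {x \<in> X. g x \<noteq> x}"
  have fN: "finite N" using f by (simp add: N_def)
  have "card N = (\<Sum>y\<in>(\<lambda>x. {x, g x}) ` N. card {x \<in> N. {x, g x} = y})"
    using sum.image_gen[OF fN, of "\<lambda>_. 1::nat" "\<lambda>x. {x, g x}"] by simp
  also have "even \<dots>"
  proof (rule dvd_sum)
    fix y assume "y \<in> (\<lambda>x. {x, g x}) ` N"
    then obtain x where x: "x \<in> N" "y = {x, g x}" by blast
    have gx: "g x \<in> N" "g (g x) = x" "g x \<noteq> x" using x(1) g unfolding N_def by auto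
    have "{z \<in> N. {z, g z} = y} = {x, g x}"
    proof (intro equalityI subsetI)
      fix z assume "z \<in> {z \<in> N. {z, g z} = y}"
      then have "z \<in> {x, g x}" using x(2) by blast
      then show "z \<in> {x, g x}" .
    next
      fix z assume "z \<in> {x, g x}"
      then show "z \<in> {z \<in> N. {z, g z} = y}" using x gx by auto
    qed
    then show "2 dvd card {z \<in> N. {z, g z} = y}" using gx(3) by simp
  qed
  finally have "even (card N)" .
  moreover have "card X = card N + card {x \<in> X. g x = x}"
  proof -
    have "X = N \<union> {x \<in> X. g x = x}" by (auto simp: N_def)
    then show ?thesis using card_Un_disjoint[OF fN, of "{x \<in> X. g x = x}"] f by (auto simp: N_def)
  qed
  ultimately show ?thesis by (auto elim!: evenE)
qed

text \<open>This is how subgroups are counted below: families of subgroups are told apart by a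
label, such as the order or the position relative to given subgroups, and lower bounds for the
families add up.\<close>

lemma tagged_card_bound:
  assumes "finite X" "distinct (map fst L)" "\<And>i m. (i, m) \<in> set L \<Longrightarrow> m \<le> card {x \<in> X. \<kappa> x = i}"
  shows "sum_list (map snd L) \<le> card X"
  using assms
proof (induction L arbitrary: X)
  case (Cons a L)
  obtain i m where a: "a = (i, m)" by (cases a)
  let ?Y = "{x \<in> X. \<kappa> x \<noteq> i}"
  have "sum_list (map snd L) \<le> card ?Y"
  proof (rule Cons.IH)
    show "finite ?Y" "distinct (map fst L)" using Cons.prems by auto
    fix j k assume j: "(j, k) \<in> set L"
    then have "j \<noteq> i" using Cons.prems(2) a by force
    then have "{x \<in> ?Y. \<kappa> x = j} = {x \<in> X. \<kappa> x = j}" by auto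
    then show "k \<le> card {x \<in> ?Y. \<kappa> x = j}" using Cons.prems(3)[of j k] j by simp
  qed
  moreover have "m \<le> card {x \<in> X. \<kappa> x = i}" using Cons.prems(3)[of i m] a by simp
  moreover have "card X = card {x \<in> X. \<kappa> x = i} + card ?Y"
  proof -
    have "X = {x \<in> X. \<kappa> x = i} \<union> ?Y" by auto
    then show ?thesis using card_Un_disjoint[of "{x \<in> X. \<kappa> x = i}" ?Y] Cons.prems(1) by auto
  qed
  ultimately show ?case using a by simp
qed simp

lemma disjoint_list_card:
  assumes "finite X" "\<And>A. A \<in> set As \<Longrightarrow> A \<subseteq> X" "sorted_wrt (\<lambda>A B. A \<inter> B = {}) As"
  shows "sum_list (map card As) \<le> card X"
proof -
  have "sum_list (map card As) = card (\<Union>(set As))" using assms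
  proof (induction As)
    case (Cons A As)
    have "A \<inter> \<Union>(set As) = {}" using Cons.prems(3) by auto
    moreover have "finite A" "finite (\<Union>(set As))" using Cons.prems(1,2) by (auto intro: finite_subset)
    ultimately have "card (A \<union> \<Union>(set As)) = card A + card (\<Union>(set As))" by (simp add: card_Un_disjoint)
    moreover have "sum_list (map card As) = card (\<Union>(set As))" using Cons by simp
    ultimately show ?case by simp
  qed simp
  moreover have "\<Union>(set As) \<subseteq> X" using assms(2) by blast
  ultimately show ?thesis using card_mono[OF assms(1)] by simp
qed

lemma single_prime_power:
  fixes n q :: nat
  assumes "n \<noteq> 0" "prime q" "\<And>r. prime r \<Longrightarrow> r dvd n \<Longrightarrow> r = q" shows "\<exists>i. n = q ^ i"
proof -
  obtain k where k: "n = q ^ multiplicity q n * k" "\<not> q dvd k"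
    using multiplicity_decompose'[of n q] assms(1,2) by (metis not_prime_unit)
  have "k = 1"
  proof (rule ccontr)
    assume "k \<noteq> 1"
    then obtain r where r: "prime r" "r dvd k" using prime_factor_nat by blast
    then have "r dvd n" using k(1) by (metis dvd_mult)
    then show False using assms(3)[OF r(1)] r(2) k(2) by simp
  qed
  then show ?thesis using k(1) by auto
qed

section \<open>Subgroups, conjugation and actions of a finite group\<close>

locale fin_grp = group G for G (structure) +
  assumes fin: "finite (carrier G)"
begin

definition subs :: "'a set \<Rightarrow> 'a set set" where
  "subs K = {H. subgroup H G \<and> H \<subseteq> K}"

definition cj :: "'a \<Rightarrow> 'a set \<Rightarrow> 'a set" where
  "cj x H = (\<lambda>h. x \<otimes> h \<otimes> inv x) ` H"

definition nrm :: "'a set \<Rightarrow> 'a set \<Rightarrow> 'a set" where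
  "nrm K H = {x \<in> K. cj x H = H}"

definition cen :: "'a set \<Rightarrow> 'a set \<Rightarrow> 'a set" where
  "cen K H = {x \<in> K. \<forall>h\<in>H. x \<otimes> h = h \<otimes> x}"

definition cjs :: "'a set \<Rightarrow> 'a set \<Rightarrow> 'a set set" where
  "cjs K H = (\<lambda>x. cj x H) ` K"

text \<open>The acting function is explicit because the same subgroup acts on elements and on
subgroups by conjugation, and on cosets by translation.\<close>

definition acts :: "'a set \<Rightarrow> ('a \<Rightarrow> 'c \<Rightarrow> 'c) \<Rightarrow> 'c set \<Rightarrow> bool" where
  "acts S \<phi> E \<longleftrightarrow> (\<forall>e\<in>E. \<phi> \<one> e = e) \<and> (\<forall>s\<in>S. \<forall>e\<in>E. \<phi> s e \<in> E) \<and>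
     (\<forall>s\<in>S. \<forall>t\<in>S. \<forall>e\<in>E. \<phi> (s \<otimes> t) e = \<phi> s (\<phi> t e))"

lemma sgD:
  assumes "subgroup H G"
  shows "H \<subseteq> carrier G" "finite H" "\<one> \<in> H" "card H > 0"
    "\<And>x. x \<in> H \<Longrightarrow> x \<in> carrier G" "\<And>x. x \<in> H \<Longrightarrow> inv x \<in> H"
    "\<And>x y. x \<in> H \<Longrightarrow> y \<in> H \<Longrightarrow> x \<otimes> y \<in> H"
proof -
  show a: "H \<subseteq> carrier G" by (rule subgroup.subset[OF assms])
  show b: "finite H" using a fin finite_subset by blast
  show c: "\<one> \<in> H" by (rule subgroup.one_closed[OF assms])
  show "card H > 0" using b c card_gt_0_iff by blast
qed (auto intro: subgroup.m_inv_closed[OF assms] subgroup.m_closed[OF assms] subgroup.mem_carrier[OF assms])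

lemma sg_one: "subgroup {\<one>} G" by (rule triv_subgroup)

lemma sg_carrier: "subgroup (carrier G) G" by (rule subgroup_self)

lemma subs_finite [simp]: "finite (subs K)"
  using fin sgD(1) by (auto simp: subs_def intro: finite_subset[of _ "Pow (carrier G)"])

lemma subs_carrier: "num_subgroups G = card (subs (carrier G))"
  unfolding num_subgroups_def subs_def using sgD(1) by (metis (no_types, lifting))

lemma subs_mono: "K \<subseteq> L \<Longrightarrow> subs K \<subseteq> subs L" by (auto simp: subs_def)

lemma sg_dvd: assumes "subgroup A G" "subgroup B G" "A \<subseteq> B" shows "card A dvd card B"
proof -
  interpret B: group "G\<lparr>carrier := B\<rparr>" by (rule subgroup_imp_group[OF assms(2)])
  have "subgroup A (G\<lparr>carrier := B\<rparr>)" using subgroup_incl assms by blast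
  from B.lagrange[OF this] show ?thesis unfolding order_def by (simp, metis dvd_triv_right)
qed

lemma sg_dvd_carrier: "subgroup A G \<Longrightarrow> card A dvd card (carrier G)"
  using sg_dvd sg_carrier sgD(1) by blast

lemma sg_eqI:
  assumes "subgroup A G" "subgroup B G" "A \<subseteq> B" "card B \<le> card A" shows "A = B"
  using assms sgD(2) card_seteq by metis

lemma sg_Int: "subgroup A G \<Longrightarrow> subgroup B G \<Longrightarrow> subgroup (A \<inter> B) G"
  by (rule subgroups_Inter_pair)

lemma sg_exists_prime_power:
  assumes "subgroup H G" "prime p" "p ^ k dvd card H"
  shows "\<exists>A. subgroup A G \<and> A \<subseteq> H \<and> card A = p ^ k"
proof -
  interpret H: group "G\<lparr>carrier := H\<rparr>" by (rule subgroup_imp_group[OF assms(1)])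
  obtain m where "card H = p ^ k * m" using assms(3) by blast
  then obtain A where A: "subgroup A (G\<lparr>carrier := H\<rparr>)" "card A = p ^ k"
    using sylow_thm[of p "G\<lparr>carrier := H\<rparr>" k m] assms sgD(2)[OF assms(1)] H.is_group
    by (auto simp: order_def)
  have "subgroup A G" using incl_subgroup[OF assms(1) A(1)] .
  moreover have "A \<subseteq> H" using subgroup.subset[OF A(1)] by simp
  ultimately show ?thesis using A(2) by blast
qed

lemma sg_coprime_Int:
  assumes "subgroup A G" "subgroup B G" "coprime (card A) (card B)" shows "A \<inter> B = {\<one>}"
proof -
  have "card (A \<inter> B) dvd card A" "card (A \<inter> B) dvd card B"
    using sg_dvd[OF sg_Int[OF assms(1,2)]] assms by auto
  then have "card (A \<inter> B) = 1" using assms(3) by (metis coprime_common_divisor_nat)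
  then obtain x where "A \<inter> B = {x}" using card_1_singletonE by blast
  moreover have "\<one> \<in> A \<inter> B" using sgD(3)[OF assms(1)] sgD(3)[OF assms(2)] by simp
  ultimately show ?thesis by simp
qed

lemma sg_card1: "subgroup A G \<Longrightarrow> card A = 1 \<Longrightarrow> A = {\<one>}"
  by (metis card_1_singletonE sgD(3) singletonD)

lemma pow_card_one: assumes "subgroup H G" "x \<in> H" shows "x [^] card H = \<one>"
proof -
  interpret H: group "G\<lparr>carrier := H\<rparr>" by (rule subgroup_imp_group[OF assms(1)])
  show ?thesis using H.pow_order_eq_1[of x] assms(2) by (simp add: order_def nat_pow_consistent[symmetric])
qed

lemma sg_pow: "subgroup H G \<Longrightarrow> x \<in> H \<Longrightarrow> x [^] (n::nat) \<in> H"
  by (induction n) (auto simp: sgD)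

lemma cj_one: "H \<subseteq> carrier G \<Longrightarrow> cj \<one> H = H"
  by (force simp: cj_def image_def)

lemma cj_carrier: "x \<in> carrier G \<Longrightarrow> H \<subseteq> carrier G \<Longrightarrow> cj x H \<subseteq> carrier G"
  by (auto simp: cj_def)

lemma cj_mult: "x \<in> carrier G \<Longrightarrow> y \<in> carrier G \<Longrightarrow> H \<subseteq> carrier G \<Longrightarrow> cj (x \<otimes> y) H = cj x (cj y H)"
  unfolding cj_def image_image by (rule image_cong) (auto simp: inv_mult_group m_assoc subset_iff)

lemma cj_mono: "A \<subseteq> B \<Longrightarrow> cj x A \<subseteq> cj x B" by (auto simp: cj_def)

lemma cj_inv: "x \<in> carrier G \<Longrightarrow> H \<subseteq> carrier G \<Longrightarrow> cj (inv x) (cj x H) = H"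
  by (simp add: cj_mult[symmetric] cj_one)

lemma cj_inv': "x \<in> carrier G \<Longrightarrow> H \<subseteq> carrier G \<Longrightarrow> cj x (cj (inv x) H) = H"
  by (simp add: cj_mult[symmetric] cj_one)

lemma cj_inj: "x \<in> carrier G \<Longrightarrow> inj_on (\<lambda>h. x \<otimes> h \<otimes> inv x) (carrier G)"
  by (auto simp: inj_on_def)

lemma cj_card: "x \<in> carrier G \<Longrightarrow> H \<subseteq> carrier G \<Longrightarrow> card (cj x H) = card H"
  unfolding cj_def by (rule card_image) (rule inj_on_subset[OF cj_inj])

lemma cj_Int: "x \<in> carrier G \<Longrightarrow> A \<subseteq> carrier G \<Longrightarrow> B \<subseteq> carrier G \<Longrightarrow> cj x (A \<inter> B) = cj x A \<inter> cj x B"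
  unfolding cj_def by (rule inj_on_image_Int[OF cj_inj])

lemma cj_eq_iff: "x \<in> carrier G \<Longrightarrow> A \<subseteq> carrier G \<Longrightarrow> B \<subseteq> carrier G \<Longrightarrow> cj x A = cj x B \<longleftrightarrow> A = B"
  by (metis cj_inv)

lemma cj_subset_iff: "x \<in> carrier G \<Longrightarrow> A \<subseteq> carrier G \<Longrightarrow> B \<subseteq> carrier G \<Longrightarrow> cj x A \<subseteq> cj x B \<longleftrightarrow> A \<subseteq> B"
  by (metis cj_inv cj_mono)

lemma cj_sg: assumes "x \<in> carrier G" "subgroup H G" shows "subgroup (cj x H) G"
proof (rule subgroupI)
  show "cj x H \<subseteq> carrier G" using assms sgD(1) cj_carrier by blast
  show "cj x H \<noteq> {}" using sgD(3)[OF assms(2)] by (auto simp: cj_def)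
next
  fix a assume "a \<in> cj x H"
  then obtain h where h: "h \<in> H" "a = x \<otimes> h \<otimes> inv x" by (auto simp: cj_def)
  have "inv a = x \<otimes> inv h \<otimes> inv x" using h assms sgD(5)[OF assms(2)] by (simp add: inv_mult_group m_assoc)
  then show "inv a \<in> cj x H" using h sgD(6)[OF assms(2)] by (auto simp: cj_def)
next
  fix a b assume "a \<in> cj x H" "b \<in> cj x H"
  then obtain h k where h: "h \<in> H" "a = x \<otimes> h \<otimes> inv x" "k \<in> H" "b = x \<otimes> k \<otimes> inv x" by (auto simp: cj_def)
  have "a \<otimes> b = x \<otimes> (h \<otimes> k) \<otimes> inv x" using h assms sgD(5)[OF assms(2)]
    by (simp add: m_assoc inv_solve_left l_inv_ex) (metis inv_closed m_assoc m_closed l_inv l_one)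
  then show "a \<otimes> b \<in> cj x H" using h sgD(7)[OF assms(2)] by (auto simp: cj_def)
qed

lemma cj_self: assumes "subgroup H G" "x \<in> H" shows "cj x H = H"
proof -
  have "cj x H \<subseteq> H" using assms sgD[OF assms(1)] by (auto simp: cj_def)
  then show ?thesis using sg_eqI[OF cj_sg[OF _ assms(1)] assms(1)] sgD[OF assms(1)] assms(2)
    by (simp add: cj_card)
qed

lemma nrm_sg: assumes "subgroup K G" "H \<subseteq> carrier G" shows "subgroup (nrm K H) G"
proof (rule subgroupI)
  show "nrm K H \<subseteq> carrier G" using sgD(1)[OF assms(1)] by (auto simp: nrm_def)
  show "nrm K H \<noteq> {}" using sgD(3)[OF assms(1)] cj_one[OF assms(2)] by (auto simp: nrm_def)
  show "inv a \<in> nrm K H" if "a \<in> nrm K H" for a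
    using that cj_inv[of a H] assms(2) sgD(5,6)[OF assms(1)] by (auto simp: nrm_def)
  show "a \<otimes> b \<in> nrm K H" if "a \<in> nrm K H" "b \<in> nrm K H" for a b
    using that assms(2) sgD(5,7)[OF assms(1)] by (auto simp: nrm_def cj_mult)
qed

lemma nrm_sub: "nrm K H \<subseteq> K" by (auto simp: nrm_def)

lemma sub_nrm: "subgroup H G \<Longrightarrow> H \<subseteq> K \<Longrightarrow> H \<subseteq> nrm K H"
  using cj_self by (auto simp: nrm_def)

lemma cen_sg: assumes "subgroup K G" "H \<subseteq> carrier G" shows "subgroup (cen K H) G"
proof (rule subgroupI)
  show "cen K H \<subseteq> carrier G" using sgD(1)[OF assms(1)] by (auto simp: cen_def)
  show "cen K H \<noteq> {}" using sgD(3)[OF assms(1)] assms(2) by (auto simp: cen_def intro!: exI[of _ \<one>])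
  show "inv a \<in> cen K H" if a: "a \<in> cen K H" for a
  proof -
    have "inv a \<otimes> h = h \<otimes> inv a" if "h \<in> H" for h
    proof -
      have c: "a \<in> carrier G" "h \<in> carrier G" using a that assms sgD(1)[OF assms(1)] by (auto simp: cen_def)
      have "a \<otimes> h = h \<otimes> a" using a that by (auto simp: cen_def)
      then show ?thesis using c by (metis inv_closed inv_solve_left' inv_solve_right m_assoc m_closed)
    qed
    then show ?thesis using a sgD(6)[OF assms(1)] by (auto simp: cen_def)
  qed
  show "a \<otimes> b \<in> cen K H" if a: "a \<in> cen K H" "b \<in> cen K H" for a b
  proof -
    have "a \<otimes> b \<otimes> h = h \<otimes> (a \<otimes> b)" if "h \<in> H" for h
    proof -
      have c: "a \<in> carrier G" "b \<in> carrier G" "h \<in> carrier G" using a that assms sgD(1)[OF assms(1)] by (auto simp: cen_def)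
      have "a \<otimes> h = h \<otimes> a" "b \<otimes> h = h \<otimes> b" using a that by (auto simp: cen_def)
      then show ?thesis using c by (metis m_assoc)
    qed
    then show ?thesis using a sgD(7)[OF assms(1)] by (auto simp: cen_def)
  qed
qed

lemma cen_sub: "cen K H \<subseteq> K" by (auto simp: cen_def)

lemma orbit_stabilizer:
  assumes S: "subgroup S G" and a: "acts S \<phi> E" and e: "e \<in> E"
  shows "card ((\<lambda>s. \<phi> s e) ` S) * card {s \<in> S. \<phi> s e = e} = card S"
proof -
  have *: "card {s \<in> S. \<phi> s e = d} = card {s \<in> S. \<phi> s e = e}" if dd: "d \<in> (\<lambda>s. \<phi> s e) ` S" for d
  proof -
    obtain s where s: "s \<in> S" "d = \<phi> s e" using dd by blast
    have inv: "\<phi> (inv s) d = e"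
    proof -
      have "\<phi> (inv s \<otimes> s) e = \<phi> (inv s) (\<phi> s e)" using s a e sgD(6)[OF S s(1)] unfolding acts_def by blast
      moreover have "\<phi> \<one> e = e" using a e by (simp add: acts_def)
      ultimately show ?thesis using s sgD(5)[OF S s(1)] by simp
    qed
    have "bij_betw (\<lambda>t. s \<otimes> t) {t \<in> S. \<phi> t e = e} {t \<in> S. \<phi> t e = d}"
    proof (rule bij_betw_byWitness[where f' = "\<lambda>t. inv s \<otimes> t"])
      show "\<forall>t\<in>{t \<in> S. \<phi> t e = e}. inv s \<otimes> (s \<otimes> t) = t"
        using s(1) sgD[OF S] by (simp add: m_assoc[symmetric])
      show "\<forall>t\<in>{t \<in> S. \<phi> t e = d}. s \<otimes> (inv s \<otimes> t) = t"
        using s(1) sgD[OF S] by (simp add: m_assoc[symmetric])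
      have m: "\<phi> (u \<otimes> t) e = \<phi> u (\<phi> t e)" if "u \<in> S" "t \<in> S" for u t
        using that a e unfolding acts_def by blast
      show "(\<lambda>t. s \<otimes> t) ` {t \<in> S. \<phi> t e = e} \<subseteq> {t \<in> S. \<phi> t e = d}"
        using s m[OF s(1)] sgD(7)[OF S s(1)] by auto
      show "(\<lambda>t. inv s \<otimes> t) ` {t \<in> S. \<phi> t e = d} \<subseteq> {t \<in> S. \<phi> t e = e}"
      proof (rule image_subsetI)
        fix t assume t: "t \<in> {t \<in> S. \<phi> t e = d}"
        have "\<phi> (inv s \<otimes> t) e = \<phi> (inv s) (\<phi> t e)" by (rule m) (use t s sgD(6)[OF S] in auto)
        then have "\<phi> (inv s \<otimes> t) e = e" using t inv by simp
        then show "inv s \<otimes> t \<in> {t \<in> S. \<phi> t e = e}" using t sgD(7)[OF S sgD(6)[OF S s(1)]] by blast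
      qed
    qed
    from bij_betw_same_card[OF this] show ?thesis by (rule sym)
  qed
  have "card S = (\<Sum>d\<in>(\<lambda>s. \<phi> s e) ` S. card {s \<in> S. \<phi> s e = d})"
    using sum.image_gen[OF sgD(2)[OF S], of "\<lambda>_. 1::nat" "\<lambda>s. \<phi> s e"] by simp
  also have "\<dots> = (\<Sum>d\<in>(\<lambda>s. \<phi> s e) ` S. card {s \<in> S. \<phi> s e = e})"
    using * by (intro sum.cong) auto
  finally show ?thesis by simp
qed

lemma orbit_prime_power:
  assumes S: "subgroup S G" "card S = q ^ k" "prime q" and a: "acts S \<phi> E" and e: "e \<in> E"
    and nf: "\<exists>s\<in>S. \<phi> s e \<noteq> e"
  shows "\<exists>j>0. card ((\<lambda>s. \<phi> s e) ` S) = q ^ j"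
proof -
  have "card ((\<lambda>s. \<phi> s e) ` S) dvd q ^ k"
    using orbit_stabilizer[OF S(1) a e] S(2) by (metis dvd_triv_left)
  then obtain j where j: "card ((\<lambda>s. \<phi> s e) ` S) = q ^ j" using S(3) by (auto simp: divides_primepow_nat)
  have "j \<noteq> 0"
  proof
    assume "j = 0"
    then obtain d where d: "(\<lambda>s. \<phi> s e) ` S = {d}" using j card_1_singletonE by auto
    have "\<phi> s e = d" if "s \<in> S" for s using d that by blast
    moreover have "\<phi> \<one> e = e" using a e by (auto simp: acts_def)
    ultimately show False using nf sgD(3)[OF S(1)] by metis
  qed
  then show ?thesis using j by blast
qed

text \<open>An orbit with more than one element has a positive power of q as its length.\<close>

lemma fixed_points_mod:
  assumes S: "subgroup S G" "card S = q ^ k" "prime q" and a: "acts S \<phi> E" and f: "finite E"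
  shows "card E mod q = card {e \<in> E. \<forall>s\<in>S. \<phi> s e = e} mod q"
proof -
  define O' where "O' e = (\<lambda>s. \<phi> s e) ` S" for e
  define N where "N = {e \<in> E. \<exists>s\<in>S. \<phi> s e \<noteq> e}"
  have Oe: "O' d = O' e" if dd: "d \<in> O' e" "e \<in> E" for d e
  proof -
    obtain s where s: "s \<in> S" "d = \<phi> s e" using dd by (auto simp: O'_def)
    have d: "\<phi> t d = \<phi> (t \<otimes> s) e" if "t \<in> S" for t using s \<open>e \<in> E\<close> a that by (auto simp: acts_def)
    show ?thesis
    proof
      show "O' d \<subseteq> O' e" using d s sgD(7)[OF S(1)] by (auto simp: O'_def)
      show "O' e \<subseteq> O' d"
      proof
        fix y assume "y \<in> O' e"
        then obtain t where t: "t \<in> S" "y = \<phi> t e" by (auto simp: O'_def)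
        have "\<phi> (t \<otimes> inv s) d = \<phi> t e" using d[of "t \<otimes> inv s"] t s sgD[OF S(1)] by (simp add: m_assoc)
        then show "y \<in> O' d" using t s sgD[OF S(1)] by (auto simp: O'_def image_def intro!: bexI[of _ "t \<otimes> inv s"])
      qed
    qed
  qed
  have self: "e \<in> O' e" if "e \<in> E" for e
    using that a sgD(3)[OF S(1)] by (auto simp: O'_def acts_def image_def intro!: bexI[of _ \<one>])
  have ON: "O' e \<subseteq> N" if "e \<in> N" for e
  proof
    fix d assume d: "d \<in> O' e"
    have e: "e \<in> E" using that by (auto simp: N_def)
    have dE: "d \<in> E" using d e a by (auto simp: O'_def acts_def)
    have "d \<in> N"
    proof (rule ccontr)
      assume "d \<notin> N"
      then have "O' d \<subseteq> {d}" using dE by (auto simp: N_def O'_def)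
      then have "O' e = {d}" using Oe[OF d e] self[OF dE] by auto
      then have "e = d" using self[OF e] by simp
      then show False using that \<open>d \<notin> N\<close> by simp
    qed
    then show "d \<in> N" .
  qed
  have NE: "N \<subseteq> E" by (auto simp: N_def)
  have fN: "finite N" using f NE finite_subset by blast
  have "card N = (\<Sum>o'\<in>O' ` N. card {e \<in> N. O' e = o'})"
    using sum.image_gen[OF fN, of "\<lambda>_. 1::nat" O'] by simp
  moreover have "q dvd card {e \<in> N. O' e = o'}" if oo: "o' \<in> O' ` N" for o'
  proof -
    obtain d where d: "d \<in> N" "o' = O' d" using oo by blast
    have dE: "d \<in> E" using d NE by auto
    have "{e \<in> N. O' e = o'} = O' d"
      using d Oe[OF _ dE] ON[OF d(1)] self NE by blast
    moreover obtain j where "j > 0" "card (O' d) = q ^ j"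
      using orbit_prime_power[OF S a dE] d(1) by (auto simp: N_def O'_def)
    ultimately show ?thesis by (simp add: dvd_power)
  qed
  ultimately have "q dvd card N" by (simp add: dvd_sum)
  moreover have "card E = card N + card {e \<in> E. \<forall>s\<in>S. \<phi> s e = e}"
  proof -
    have "E = N \<union> {e \<in> E. \<forall>s\<in>S. \<phi> s e = e}" "N \<inter> {e \<in> E. \<forall>s\<in>S. \<phi> s e = e} = {}"
      by (auto simp: N_def)
    then show ?thesis using card_Un_disjoint[OF fN, of "{e \<in> E. \<forall>s\<in>S. \<phi> s e = e}"] f by auto
  qed
  ultimately show ?thesis by (auto elim!: dvdE)
qed

lemma acts_cj:
  assumes "subgroup S G" "\<And>X. X \<in> F \<Longrightarrow> X \<subseteq> carrier G" "\<And>s X. s \<in> S \<Longrightarrow> X \<in> F \<Longrightarrow> cj s X \<in> F"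
  shows "acts S cj F"
  unfolding acts_def using assms sgD(5)[OF assms(1)] by (auto simp: cj_one cj_mult)

lemma acts_elem:
  assumes "subgroup S G" "X \<subseteq> carrier G" "\<And>s. s \<in> S \<Longrightarrow> cj s X \<subseteq> X"
  shows "acts S (\<lambda>s x. s \<otimes> x \<otimes> inv s) X"
proof -
  have "s \<otimes> x \<otimes> inv s \<in> X" if "s \<in> S" "x \<in> X" for s x using assms(3)[OF that(1)] that(2) by (auto simp: cj_def)
  then show ?thesis
  unfolding acts_def using assms(2) sgD(5)[OF assms(1)]
  by (auto simp: inv_mult_group m_assoc subset_iff)
qed

lemma card_cjs:
  assumes "subgroup K G" "H \<subseteq> carrier G"
  shows "card (cjs K H) * card (nrm K H) = card K"
proof -
  have "acts K cj (cjs (carrier G) H)"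
  proof (rule acts_cj[OF assms(1)])
    show "X \<subseteq> carrier G" if "X \<in> cjs (carrier G) H" for X using that assms by (auto simp: cjs_def dest: cj_carrier)
    show "cj s X \<in> cjs (carrier G) H" if sX: "s \<in> K" "X \<in> cjs (carrier G) H" for s X
    proof -
      obtain x where "x \<in> carrier G" "X = cj x H" using sX by (auto simp: cjs_def)
      then show ?thesis using sgD(5)[OF assms(1) sX(1)] assms(2) by (auto simp: cjs_def cj_mult[symmetric])
    qed
  qed
  moreover have "H \<in> cjs (carrier G) H" unfolding cjs_def using cj_one[OF assms(2)] by (metis imageI one_closed)
  ultimately show ?thesis using orbit_stabilizer[OF assms(1), of cj] unfolding cjs_def nrm_def by blast
qed

section \<open>Products of subgroups\<close>

lemma set_multI: "a \<in> A \<Longrightarrow> s \<in> S \<Longrightarrow> a \<otimes> s \<in> A <#> S"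
  by (auto simp: set_mult_def)

lemma set_multE: "x \<in> A <#> S \<Longrightarrow> (\<And>a s. a \<in> A \<Longrightarrow> s \<in> S \<Longrightarrow> x = a \<otimes> s \<Longrightarrow> thesis) \<Longrightarrow> thesis"
  by (auto simp: set_mult_def)

lemma prod_sg:
  assumes A: "subgroup A G" and S: "subgroup S G" and n: "\<And>s. s \<in> S \<Longrightarrow> cj s A = A"
  shows "subgroup (A <#> S) G"
proof (rule subgroupI)
  have nn: "s \<otimes> a \<otimes> inv s \<in> A" if "s \<in> S" "a \<in> A" for s a
    using n[OF that(1)] that(2) by (auto simp: cj_def)
  show "A <#> S \<subseteq> carrier G" using sgD(5)[OF A] sgD(5)[OF S] by (auto elim!: set_multE)
  show "A <#> S \<noteq> {}" using set_multI[OF sgD(3)[OF A] sgD(3)[OF S]] by auto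
  show "inv x \<in> A <#> S" if x: "x \<in> A <#> S" for x
  proof -
    obtain a s where as: "a \<in> A" "s \<in> S" "x = a \<otimes> s" using x by (rule set_multE)
    have c: "a \<in> carrier G" "s \<in> carrier G" using as sgD(5)[OF A] sgD(5)[OF S] by auto
    have "inv x = (inv s \<otimes> inv a \<otimes> inv (inv s)) \<otimes> inv s"
      using as c by (simp add: inv_mult_group m_assoc)
    then show ?thesis using nn[of "inv s" "inv a"] as sgD(6)[OF A] sgD(6)[OF S] by (metis set_multI)
  qed
  show "x \<otimes> y \<in> A <#> S" if xy: "x \<in> A <#> S" "y \<in> A <#> S" for x y
  proof -
    obtain a s where as: "a \<in> A" "s \<in> S" "x = a \<otimes> s" using xy(1) by (rule set_multE)
    obtain b t where bt: "b \<in> A" "t \<in> S" "y = b \<otimes> t" using xy(2) by (rule set_multE)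
    have c: "a \<in> carrier G" "s \<in> carrier G" "b \<in> carrier G" "t \<in> carrier G"
      using as bt sgD(5)[OF A] sgD(5)[OF S] by auto
    have "x \<otimes> y = (a \<otimes> (s \<otimes> b \<otimes> inv s)) \<otimes> (s \<otimes> t)"
      using c by (simp add: as bt m_assoc) (metis inv_closed l_inv l_one m_assoc m_closed)
    moreover have "a \<otimes> (s \<otimes> b \<otimes> inv s) \<in> A" "s \<otimes> t \<in> S"
      using as bt nn sgD(7)[OF A] sgD(7)[OF S] by auto
    ultimately show ?thesis using set_multI by metis
  qed
qed

lemma prod_sub1: "subgroup S G \<Longrightarrow> A \<subseteq> carrier G \<Longrightarrow> A \<subseteq> A <#> S"
  using set_multI[of _ A \<one> S] sgD(3)[of S] by (force simp: subset_iff)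

lemma prod_sub2: "subgroup A G \<Longrightarrow> S \<subseteq> carrier G \<Longrightarrow> S \<subseteq> A <#> S"
  using set_multI[of \<one> A _ S] sgD(3)[of A] by (force simp: subset_iff)

lemma prod_least: "subgroup K G \<Longrightarrow> A \<subseteq> K \<Longrightarrow> S \<subseteq> K \<Longrightarrow> A <#> S \<subseteq> K"
  using sgD(7)[of K] by (auto elim!: set_multE)

lemma prod_mono: "A \<subseteq> B \<Longrightarrow> S \<subseteq> T \<Longrightarrow> A <#> S \<subseteq> B <#> T"
  by (auto simp: set_mult_def)

lemma prod_unique:
  assumes "subgroup A G" "subgroup S G" "A \<inter> S = {\<one>}"
    "a \<in> A" "b \<in> A" "s \<in> S" "t \<in> S" "a \<otimes> s = b \<otimes> t"
  shows "a = b \<and> s = t"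
proof -
  have c: "a \<in> carrier G" "s \<in> carrier G" "b \<in> carrier G" "t \<in> carrier G"
    using assms sgD(5)[of A] sgD(5)[of S] by auto
  have "inv b \<otimes> a = t \<otimes> inv s" using c assms(8)
    by (metis inv_closed inv_solve_left' inv_solve_right m_assoc m_closed)
  moreover have "inv b \<otimes> a \<in> A" "t \<otimes> inv s \<in> S"
    using assms sgD(6,7)[of A] sgD(6,7)[of S] by auto
  ultimately have "inv b \<otimes> a = \<one>" "t \<otimes> inv s = \<one>" using assms(3) by auto
  then show ?thesis using c by (metis inv_closed inv_equality inv_inv)
qed

lemma prod_card:
  assumes "subgroup A G" "subgroup S G" "A \<inter> S = {\<one>}"
  shows "card (A <#> S) = card A * card S"
proof -
  have "A <#> S = (\<lambda>(a, s). a \<otimes> s) ` (A \<times> S)" by (auto simp: set_mult_def)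
  moreover have "inj_on (\<lambda>(a, s). a \<otimes> s) (A \<times> S)"
    using prod_unique[OF assms] by (auto simp: inj_on_def)
  ultimately show ?thesis by (simp add: card_image card_cartesian_product)
qed

text \<open>Dedekind's modular law, first for a subgroup containing the right factor and then for
one containing the left factor.\<close>

lemma dedekind:
  assumes H: "subgroup H G" and P: "subgroup P G" and S: "subgroup S G" and "S \<subseteq> H" "H \<subseteq> P <#> S"
  shows "H = (H \<inter> P) <#> S"
proof
  show "(H \<inter> P) <#> S \<subseteq> H" by (rule prod_least) (use assms in auto)
  show "H \<subseteq> (H \<inter> P) <#> S"
  proof
    fix h assume h: "h \<in> H"
    then obtain a s where as: "a \<in> P" "s \<in> S" "h = a \<otimes> s" using assms(5) by (meson set_multE subsetD)
    have "a = h \<otimes> inv s" using as sgD(5)[OF P] sgD(5)[OF S] by (simp add: m_assoc)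
    then have "a \<in> H" using h as(2) assms(4) sgD(6,7)[OF H] by (metis subsetD)
    then show "h \<in> (H \<inter> P) <#> S" using as set_multI[of a "H \<inter> P" s S] by auto
  qed
qed

lemma dedekind_left:
  assumes P: "subgroup P G" and Q: "subgroup Q G" and M: "subgroup M G" "P \<subseteq> M" "M \<subseteq> P <#> Q"
  shows "M = P <#> (M \<inter> Q)"
proof
  show "P <#> (M \<inter> Q) \<subseteq> M" by (rule prod_least[OF M(1,2)]) auto
  show "M \<subseteq> P <#> (M \<inter> Q)"
  proof
    fix m assume m: "m \<in> M"
    then have "m \<in> P <#> Q" using M(3) by blast
    then obtain a s where as: "a \<in> P" "s \<in> Q" "m = a \<otimes> s" by (rule set_multE)
    have "s = inv a \<otimes> m" using as sgD(5)[OF P] sgD(5)[OF Q(1)] by (simp add: m_assoc[symmetric])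
    then have "s \<in> M" using m as(1) M(2) sgD(6,7)[OF M(1)] by (metis subsetD)
    then show "m \<in> P <#> (M \<inter> Q)" using as by (auto intro: set_multI)
  qed
qed

lemma prod_Int:
  assumes P: "subgroup P G" and S: "subgroup S G" and "P \<inter> S = {\<one>}" "A \<subseteq> P"
  shows "(A <#> S) \<inter> P = A"
proof
  show "A \<subseteq> (A <#> S) \<inter> P" using prod_sub1[OF S, of A] assms sgD(1)[OF P] by auto
  show "(A <#> S) \<inter> P \<subseteq> A"
  proof
    fix x assume x: "x \<in> (A <#> S) \<inter> P"
    then obtain a s where as: "a \<in> A" "s \<in> S" "x = a \<otimes> s" by (meson set_multE IntD1)
    have aP: "a \<in> P" using as assms(4) by auto
    have c: "a \<in> carrier G" "s \<in> carrier G" using aP as sgD(5)[OF P] sgD(5)[OF S] by auto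
    have "x \<otimes> \<one> = a \<otimes> s" using as c by simp
    then have "x = a" using prod_unique[OF P S assms(3), of x a \<one> s] x aP as sgD(3)[OF S] sgD(5)[OF P] by auto
    then show "x \<in> A" using as by simp
  qed
qed

lemma cj_prod: "x \<in> carrier G \<Longrightarrow> A \<subseteq> carrier G \<Longrightarrow> B \<subseteq> carrier G \<Longrightarrow> cj x (A <#> B) = cj x A <#> cj x B"
proof -
  assume x: "x \<in> carrier G" "A \<subseteq> carrier G" "B \<subseteq> carrier G"
  have e: "x \<otimes> (a \<otimes> b) \<otimes> inv x = (x \<otimes> a \<otimes> inv x) \<otimes> (x \<otimes> b \<otimes> inv x)" if "a \<in> carrier G" "b \<in> carrier G" for a b
    using that x(1) by (simp add: m_assoc) (metis inv_closed l_inv l_one m_assoc m_closed)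
  show "cj x (A <#> B) = cj x A <#> cj x B"
  proof (intro equalityI subsetI)
    fix y assume "y \<in> cj x (A <#> B)"
    then obtain a b where "a \<in> A" "b \<in> B" "y = x \<otimes> (a \<otimes> b) \<otimes> inv x" by (auto simp: cj_def set_mult_def)
    then show "y \<in> cj x A <#> cj x B" using e[of a b] x by (auto simp: cj_def set_mult_def)
  next
    fix y assume "y \<in> cj x A <#> cj x B"
    then obtain a b where "a \<in> A" "b \<in> B" "y = (x \<otimes> a \<otimes> inv x) \<otimes> (x \<otimes> b \<otimes> inv x)" by (auto simp: cj_def set_mult_def)
    then have "y = x \<otimes> (a \<otimes> b) \<otimes> inv x" using e[of a b] x by (metis subsetD)
    with \<open>a \<in> A\<close> \<open>b \<in> B\<close> show "y \<in> cj x (A <#> B)" unfolding cj_def set_mult_def by blast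
  qed
qed

lemma cj_pow: "s \<in> carrier G \<Longrightarrow> x \<in> carrier G \<Longrightarrow> s \<otimes> (x [^] (n::nat)) \<otimes> inv s = (s \<otimes> x \<otimes> inv s) [^] n"
proof (induction n)
  case (Suc n)
  then show ?case by (simp add: m_assoc[symmetric]) (metis (no_types, lifting) Suc.IH inv_closed l_inv m_assoc m_closed nat_pow_closed r_one)
qed simp

section \<open>Sylow subgroups\<close>

text \<open>The trivial subgroup is a Sylow subgroup for every prime that does not divide the
order.\<close>

definition is_syl :: "nat \<Rightarrow> 'a set \<Rightarrow> 'a set \<Rightarrow> bool" where
  "is_syl q M S \<longleftrightarrow> prime q \<and> subgroup S G \<and> S \<subseteq> M \<and> (\<exists>k. card S = q ^ k) \<and> \<not> q dvd card M div card S"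

definition Syl :: "nat \<Rightarrow> 'a set \<Rightarrow> 'a set set" where
  "Syl q M = {S. is_syl q M S}"

abbreviation lc :: "'a \<Rightarrow> 'a set \<Rightarrow> 'a set" where
  "lc x A \<equiv> l_coset G x A"

lemma lc_eq_iff: assumes S: "subgroup S G" and x: "x \<in> carrier G" shows "lc x S = S \<longleftrightarrow> x \<in> S"
proof
  assume "lc x S = S"
  moreover have "x \<otimes> \<one> \<in> lc x S" unfolding l_coset_def using sgD(3)[OF S] by blast
  ultimately show "x \<in> S" using x by simp
next
  assume x: "x \<in> S"
  then have "lc x S \<subseteq> S" unfolding l_coset_def using sgD(7)[OF S] by auto
  moreover have "y \<in> lc x S" if "y \<in> S" for y
  proof -
    have "y = x \<otimes> (inv x \<otimes> y)" using x that sgD[OF S] by (simp add: m_assoc[symmetric])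
    then show ?thesis unfolding l_coset_def using x that sgD(6,7)[OF S] by blast
  qed
  ultimately show "lc x S = S" by auto
qed

text \<open>The coset xS is fixed by T under left translation exactly if T lies in the conjugate
of S by x. This count yields both the Sylow theorems and the growth of normalizers in
p-groups.\<close>

lemma coset_fixed:
  assumes M: "subgroup M G" and S: "subgroup S G" "S \<subseteq> M" and T: "subgroup T G" "T \<subseteq> M" "card T = q ^ k" "prime q"
  defines "F \<equiv> (\<lambda>x. lc x S) ` M"
  shows "card F * card S = card M"
    and "card F mod q = card {X \<in> F. \<exists>x\<in>M. X = lc x S \<and> T \<subseteq> cj x S} mod q"
proof -
  have Sc: "S \<subseteq> carrier G" by (rule sgD(1)[OF S(1)])
  have a: "acts K (\<lambda>x X. lc x X) F" if "subgroup K G" "K \<subseteq> M" for K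
  proof -
    have "k \<in> carrier G \<and> k \<in> M" if "k \<in> K" for k using that \<open>K \<subseteq> M\<close> sgD(5)[OF M] by auto
    moreover have "x \<in> carrier G" if "x \<in> M" for x using that sgD(5)[OF M] by auto
    ultimately show ?thesis unfolding acts_def F_def
      using Sc sgD(7)[OF M] by (auto simp: lcos_m_assoc lcos_mult_one m_assoc)
  qed
  have SF: "S \<in> F" unfolding F_def using sgD(3)[OF M] lcos_mult_one[OF Sc] by force
  have st: "{x \<in> M. lc x S = S} = S"
    using lc_eq_iff[OF S(1)] sgD(5)[OF M] S(2) by blast
  show "card F * card S = card M"
    using orbit_stabilizer[OF M a[OF M] SF] st by (simp add: F_def)
  have fx: "lc t (lc x S) = lc x S \<longleftrightarrow> t \<in> cj x S" if "t \<in> T" "x \<in> M" for t x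
  proof -
    have c: "t \<in> carrier G" "x \<in> carrier G" using that T(2) sgD(5)[OF M] by auto
    have "lc t (lc x S) = lc x S \<longleftrightarrow> lc (inv x \<otimes> t \<otimes> x) S = S"
    proof
      assume "lc t (lc x S) = lc x S"
      then have "lc (inv x) (lc t (lc x S)) = lc (inv x) (lc x S)" by simp
      then show "lc (inv x \<otimes> t \<otimes> x) S = S" using c Sc by (simp add: lcos_m_assoc lcos_mult_one m_assoc)
    next
      assume "lc (inv x \<otimes> t \<otimes> x) S = S"
      then have "lc x (lc (inv x \<otimes> t \<otimes> x) S) = lc x S" by simp
      moreover have "x \<otimes> (inv x \<otimes> t \<otimes> x) = t \<otimes> x" using c by (simp add: m_assoc[symmetric])
      ultimately show "lc t (lc x S) = lc x S" using c Sc by (simp add: lcos_m_assoc)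
    qed
    also have "\<dots> \<longleftrightarrow> inv x \<otimes> t \<otimes> x \<in> S"
    proof -
      have "inv x \<otimes> t \<otimes> x \<in> M" using that T(2) sgD(6,7)[OF M] by auto
      then show ?thesis using st by blast
    qed
    also have "\<dots> \<longleftrightarrow> t \<in> cj x S"
    proof
      assume h: "inv x \<otimes> t \<otimes> x \<in> S"
      have "t = x \<otimes> (inv x \<otimes> t \<otimes> x) \<otimes> inv x" using c by (simp add: m_assoc) (simp add: m_assoc[symmetric])
      then show "t \<in> cj x S" using h unfolding cj_def by blast
    next
      assume "t \<in> cj x S"
      then obtain s where s: "s \<in> S" "t = x \<otimes> s \<otimes> inv x" by (auto simp: cj_def)
      then have "inv x \<otimes> t \<otimes> x = s" using c sgD(5)[OF S(1)] by (simp add: m_assoc) (simp add: m_assoc[symmetric])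
      then show "inv x \<otimes> t \<otimes> x \<in> S" using s by simp
    qed
    finally show ?thesis .
  qed
  have "finite F" unfolding F_def using sgD(2)[OF M] by simp
  from fixed_points_mod[OF T(1,3,4) a[OF T(1,2)] this]
  have "card F mod q = card {e \<in> F. \<forall>s\<in>T. lc s e = e} mod q" .
  moreover have "{e \<in> F. \<forall>s\<in>T. lc s e = e} = {X \<in> F. \<exists>x\<in>M. X = lc x S \<and> T \<subseteq> cj x S}"
  proof (intro Collect_cong conj_cong refl iffI)
    fix X assume "X \<in> F" and h: "\<forall>s\<in>T. lc s X = X"
    then obtain x where x: "x \<in> M" "X = lc x S" unfolding F_def by blast
    then show "\<exists>x\<in>M. X = lc x S \<and> T \<subseteq> cj x S" using h fx[OF _ x(1)] by (intro bexI[of _ x]) auto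
  next
    fix X assume "\<exists>x\<in>M. X = lc x S \<and> T \<subseteq> cj x S"
    then obtain x where x: "x \<in> M" "X = lc x S" "T \<subseteq> cj x S" by blast
    then show "\<forall>s\<in>T. lc s X = X" using fx[OF _ x(1)] by auto
  qed
  ultimately show "card F mod q = card {X \<in> F. \<exists>x\<in>M. X = lc x S \<and> T \<subseteq> cj x S} mod q" by (rule trans[OF _ arg_cong])
qed

text \<open>The number of cosets of S is prime to q, so that T fixes one of them.\<close>

lemma syl_contains:
  assumes M: "subgroup M G" and S: "is_syl q M S" and T: "subgroup T G" "T \<subseteq> M" "card T = q ^ k"
  shows "\<exists>x\<in>M. T \<subseteq> cj x S"
proof -
  have S': "subgroup S G" "S \<subseteq> M" "prime q" "\<not> q dvd card M div card S" using S by (auto simp: is_syl_def)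
  note c = coset_fixed[OF M S'(1,2) T S'(3)]
  have "card ((\<lambda>x. lc x S) ` M) = card M div card S" using c(1) sgD(4)[OF S'(1)] by (metis nonzero_mult_div_cancel_right not_gr_zero)
  then have "card ((\<lambda>x. lc x S) ` M) mod q \<noteq> 0" using S'(4) by (simp add: dvd_eq_mod_eq_0)
  then have "{X \<in> (\<lambda>x. lc x S) ` M. \<exists>x\<in>M. X = lc x S \<and> T \<subseteq> cj x S} \<noteq> {}" using c(2) by (metis card.empty mod_0)
  then show ?thesis by blast
qed

lemma sylD: assumes "is_syl q M S" shows "subgroup S G" "S \<subseteq> M" "prime q" "\<not> q dvd card M div card S" "\<exists>k. card S = q ^ k"
  using assms by (auto simp: is_syl_def)

lemma syl_ex: assumes "subgroup M G" "prime q" shows "\<exists>S. is_syl q M S"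
proof -
  have c: "card M \<noteq> 0" using sgD(4)[OF assms(1)] by simp
  have d: "q ^ multiplicity q (card M) dvd card M" by (rule multiplicity_dvd)
  then obtain S where S: "subgroup S G" "S \<subseteq> M" "card S = q ^ multiplicity q (card M)"
    using sg_exists_prime_power[OF assms] by blast
  have "\<not> q dvd card M div q ^ multiplicity q (card M)"
    using multiplicity_decompose[of "card M" q] c assms(2) by (metis not_prime_unit)
  then show ?thesis using S assms(2) by (auto simp: is_syl_def)
qed

lemma syl_dvd: assumes "is_syl q M S" "subgroup M G" "q ^ j dvd card M" shows "q ^ j dvd card S"
proof -
  obtain k where k: "card S = q ^ k" using sylD(5)[OF assms(1)] by blast
  have "card S dvd card M" using sg_dvd sylD(1,2)[OF assms(1)] assms(2) by blast
  then have e: "card M = q ^ k * (card M div card S)" using k by simp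
  have p: "prime q" using sylD(3)[OF assms(1)] .
  have "j \<le> k"
  proof (rule ccontr)
    assume "\<not> j \<le> k"
    then have "q ^ Suc k dvd card M" using assms(3) by (meson dvd_trans le_imp_power_dvd not_less_eq_eq)
    then have "q ^ k * q dvd q ^ k * (card M div card S)" using e by (simp add: mult.commute)
    then have "q dvd card M div card S" using p by (simp add: prime_gt_0_nat)
    then show False using sylD(4)[OF assms(1)] by simp
  qed
  then show ?thesis using k by (simp add: le_imp_power_dvd)
qed

lemma syl_card_eq: assumes "is_syl q M S" "is_syl q M T" "subgroup M G" shows "card S = card T"
proof (rule dvd_antisym)
  show "card S dvd card T" using sylD(5)[OF assms(1)] syl_dvd[OF assms(2,3)] sg_dvd[OF sylD(1)[OF assms(1)] assms(3) sylD(2)[OF assms(1)]] by auto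
  show "card T dvd card S" using sylD(5)[OF assms(2)] syl_dvd[OF assms(1,3)] sg_dvd[OF sylD(1)[OF assms(2)] assms(3) sylD(2)[OF assms(2)]] by auto
qed

lemma syl_cj: assumes "is_syl q M S" "subgroup M G" "x \<in> M" shows "is_syl q M (cj x S)"
proof -
  have x: "x \<in> carrier G" using assms sgD(5) by blast
  have "cj x S \<subseteq> cj x M" using sylD(2)[OF assms(1)] cj_mono by blast
  then have "cj x S \<subseteq> M" using cj_self[OF assms(2,3)] by simp
  then show ?thesis using assms(1) x cj_sg cj_card[OF x] sgD(1) by (auto simp: is_syl_def)
qed

lemma syl_conj: assumes "subgroup M G" "is_syl q M S" "is_syl q M T" shows "\<exists>x\<in>M. T = cj x S"
proof -
  obtain k where "card T = q ^ k" using sylD(5)[OF assms(3)] by blast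
  then obtain x where x: "x \<in> M" "T \<subseteq> cj x S" using syl_contains[OF assms(1,2) sylD(1,2)[OF assms(3)]] by blast
  then have "T = cj x S" using sg_eqI[OF sylD(1)[OF assms(3)] sylD(1)[OF syl_cj[OF assms(2,1) x(1)]]]
      syl_card_eq[OF assms(3) syl_cj[OF assms(2,1) x(1)] assms(1)] by simp
  then show ?thesis using x by blast
qed

lemma Syl_cjs: assumes "subgroup M G" "is_syl q M S" shows "Syl q M = cjs M S"
  using syl_conj[OF assms] syl_cj[OF assms(2,1)] by (auto simp: Syl_def cjs_def)

lemma syl_normal:
  assumes "subgroup M G" "is_syl q M S" "\<And>x. x \<in> M \<Longrightarrow> cj x S = S" "subgroup T G" "T \<subseteq> M" "card T = q ^ k"
  shows "T \<subseteq> S"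
  using syl_contains[OF assms(1,2,4-6)] assms(3) by auto

lemma syl_mono: assumes "is_syl q M S" "subgroup M G" "subgroup L G" "S \<subseteq> L" "L \<subseteq> M" shows "is_syl q L S"
proof -
  have d: "card S dvd card L" "card L dvd card M" using assms sg_dvd sylD(1)[OF assms(1)] by auto
  have "\<not> q dvd card L div card S"
  proof
    assume "q dvd card L div card S"
    moreover have "card L div card S dvd card M div card S" using d by (meson div_dvd_div dvd_trans)
    ultimately show False using sylD(4)[OF assms(1)] by (meson dvd_trans)
  qed
  then show ?thesis using assms by (auto simp: is_syl_def)
qed

text \<open>S permutes the Sylow subgroups by conjugation. If S normalizes T, then S lies in the
normalizer of T, where T is the only Sylow q-subgroup; hence S is the only fixed point.\<close>

lemma Syl_count_mod: assumes "subgroup M G" "is_syl q M S" shows "card (Syl q M) mod q = 1"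
proof -
  have S: "subgroup S G" "S \<subseteq> M" "prime q" using sylD[OF assms(2)] by auto
  obtain k where k: "card S = q ^ k" using sylD(5)[OF assms(2)] by blast
  have fF: "finite (Syl q M)" unfolding Syl_cjs[OF assms] cjs_def using sgD(2)[OF assms(1)] by simp
  have a: "acts S cj (Syl q M)"
  proof (rule acts_cj[OF S(1)])
    show "X \<subseteq> carrier G" if "X \<in> Syl q M" for X using that sylD(1) sgD(1) by (auto simp: Syl_def)
    show "cj s X \<in> Syl q M" if "s \<in> S" "X \<in> Syl q M" for s X
      using that S(2) syl_cj[OF _ assms(1)] by (auto simp: Syl_def)
  qed
  have "{T \<in> Syl q M. \<forall>s\<in>S. cj s T = T} = {S}"
  proof (intro equalityI subsetI)
    fix T assume "T \<in> {S}"
    then show "T \<in> {T \<in> Syl q M. \<forall>s\<in>S. cj s T = T}" using assms cj_self[OF S(1)] by (auto simp: Syl_def)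
  next
    fix T assume "T \<in> {T \<in> Syl q M. \<forall>s\<in>S. cj s T = T}"
    then have T: "is_syl q M T" "\<forall>s\<in>S. cj s T = T" by (auto simp: Syl_def)
    have N: "subgroup (nrm M T) G" using nrm_sg[OF assms(1)] sgD(1)[OF sylD(1)[OF T(1)]] by blast
    have TN: "is_syl q (nrm M T) T" using syl_mono[OF T(1) assms(1) N] sub_nrm[OF sylD(1)[OF T(1)] sylD(2)[OF T(1)]] nrm_sub by blast
    have "S \<subseteq> nrm M T" using T(2) S(2) by (auto simp: nrm_def)
    then have "S \<subseteq> T" using syl_normal[OF N TN _ S(1) _ k] by (auto simp: nrm_def)
    then have "S = T" using sg_eqI[OF S(1) sylD(1)[OF T(1)]] syl_card_eq[OF T(1) assms(2,1)] by simp
    then show "T \<in> {S}" by simp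
  qed
  then show ?thesis using fixed_points_mod[OF S(1) k S(3) a fF] prime_gt_1_nat[OF S(3)] by simp
qed

text \<open>The number of cosets of A in P is divisible by p, and A fixes the coset A under
translation. So it fixes another coset xA, and then x normalizes A.\<close>

lemma normalizer_grows:
  assumes P: "subgroup P G" "card P = p ^ m" "prime p" and A: "subgroup A G" "A \<subset> P"
  shows "\<exists>x\<in>P - A. cj x A = A"
proof -
  have "card A dvd p ^ m" using sg_dvd[OF A(1) P(1)] A(2) P(2) by auto
  then obtain k where k: "card A = p ^ k" using P(3) by (auto simp: divides_primepow_nat)
  have lt: "card A < card P" using A(2) sgD(2)[OF P(1)] psubset_card_mono by blast
  have AP: "A \<subseteq> P" using A(2) by auto
  note c = coset_fixed[OF P(1) A(1) AP A(1) AP k P(3)]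
  let ?F = "(\<lambda>x. lc x A) ` P"
  let ?X = "{X \<in> ?F. \<exists>x\<in>P. X = lc x A \<and> A \<subseteq> cj x A}"
  have "card ?F dvd p ^ m" using c(1) P(2) by (metis dvd_triv_left)
  then obtain j where j: "card ?F = p ^ j" using P(3) by (auto simp: divides_primepow_nat)
  have "j \<noteq> 0" using j c(1) lt by (intro notI) simp
  then have "p dvd card ?F" using j by (simp add: dvd_power)
  then have pd: "p dvd card ?X" using c(2) by (simp add: dvd_eq_mod_eq_0)
  have fX: "finite ?X" using sgD(2)[OF P(1)] by simp
  have Ac: "A \<subseteq> carrier G" by (rule sgD(1)[OF A(1)])
  have "A \<in> ?X" using sgD(3)[OF P(1)] lcos_mult_one[OF Ac] cj_one[OF Ac] by (auto simp: image_def intro!: bexI[of _ \<one>])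
  then have "card ?X > 0" using fX card_gt_0_iff by blast
  then have "card ?X \<ge> 2" using pd prime_ge_2_nat[OF P(3)] dvd_imp_le order_trans by blast
  then have "\<not> ?X \<subseteq> {A}" using card_mono[of "{A}" ?X] by auto
  then obtain X where X: "X \<in> ?X" "X \<noteq> A" by blast
  then obtain x where x: "x \<in> P" "X = lc x A" "A \<subseteq> cj x A" by blast
  have xc: "x \<in> carrier G" using x sgD(5)[OF P(1)] by auto
  have "cj x A = A" using x(3) sg_eqI[OF A(1) cj_sg[OF xc A(1)]] cj_card[OF xc Ac] by simp
  moreover have "x \<notin> A"
  proof
    assume xA: "x \<in> A"
    then have "lc x A \<subseteq> A" unfolding l_coset_def using sgD(7)[OF A(1)] by auto
    moreover have "card (lc x A) = card A"
    proof -
      have "inj_on (\<lambda>h. x \<otimes> h) A" using xc Ac by (auto simp: inj_on_def subset_iff)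
      moreover have "lc x A = (\<lambda>h. x \<otimes> h) ` A" by (auto simp: l_coset_def)
      ultimately show ?thesis by (simp add: card_image)
    qed
    ultimately show False using X(2) x(2) card_subset_eq[OF sgD(2)[OF A(1)]] by auto
  qed
  ultimately show ?thesis using x(1) by blast
qed

section \<open>Cyclic subgroups of p-groups\<close>

abbreviation cyc :: "'a \<Rightarrow> 'a set" where "cyc x \<equiv> generate G {x}"

lemma cyc_sg: "x \<in> carrier G \<Longrightarrow> subgroup (cyc x) G"
  by (rule generate_is_subgroup) simp

lemma cyc_self: "x \<in> cyc x" by (rule generate.incl) simp

lemma cyc_least: "subgroup H G \<Longrightarrow> x \<in> H \<Longrightarrow> cyc x \<subseteq> H"
  by (rule generate_subgroup_incl) auto

lemma cyc_pow: "x \<in> carrier G \<Longrightarrow> cyc x = {x [^] k | k. k \<in> (UNIV :: nat set)}"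
  using generate_pow_on_finite_carrier[OF fin] by blast

lemma cyc_powE: "x \<in> carrier G \<Longrightarrow> y \<in> cyc x \<Longrightarrow> (\<And>k::nat. y = x [^] k \<Longrightarrow> thesis) \<Longrightarrow> thesis"
  using cyc_pow by blast

lemma cyc_comm: assumes "x \<in> carrier G" "y \<in> cyc x" "z \<in> cyc x" shows "y \<otimes> z = z \<otimes> y"
proof -
  obtain k l :: nat where "y = x [^] k" "z = x [^] l" using assms cyc_powE by metis
  then show ?thesis using assms(1) by (simp add: nat_pow_mult add.commute)
qed

lemma cj_cyc_eq:
  assumes "x \<in> carrier G" "s \<in> carrier G" "s \<otimes> x \<otimes> inv s \<in> cyc x" shows "cj s (cyc x) = cyc x"
proof -
  have "cj s (cyc x) \<subseteq> cyc x"
  proof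
    fix y assume "y \<in> cj s (cyc x)"
    then obtain z where z: "z \<in> cyc x" "y = s \<otimes> z \<otimes> inv s" by (auto simp: cj_def)
    then obtain k :: nat where "z = x [^] k" using cyc_powE assms(1) by blast
    then have "y = (s \<otimes> x \<otimes> inv s) [^] k" using z cj_pow assms by simp
    then show "y \<in> cyc x" using sg_pow[OF cyc_sg[OF assms(1)] assms(3)] by simp
  qed
  then show ?thesis using sg_eqI[OF cj_sg[OF assms(2) cyc_sg[OF assms(1)]] cyc_sg[OF assms(1)]]
      cj_card[OF assms(2) sgD(1)[OF cyc_sg[OF assms(1)]]] by simp
qed

lemma roots_sg:
  assumes x: "x \<in> carrier G" shows "subgroup {z \<in> cyc x. z [^] (p::nat) = \<one>} G"
proof (rule subgroupI)
  note c = sgD[OF cyc_sg[OF x]]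
  show "{z \<in> cyc x. z [^] p = \<one>} \<subseteq> carrier G" using c(5) by auto
  show "{z \<in> cyc x. z [^] p = \<one>} \<noteq> {}" using c(3) by auto
  show "inv a \<in> {z \<in> cyc x. z [^] p = \<one>}" if "a \<in> {z \<in> cyc x. z [^] p = \<one>}" for a
    using that c(5,6) by (auto simp: nat_pow_inv)
  show "a \<otimes> b \<in> {z \<in> cyc x. z [^] p = \<one>}" if "a \<in> {z \<in> cyc x. z [^] p = \<one>}" "b \<in> {z \<in> cyc x. z [^] p = \<one>}" for a b
    using that c(5,7) cyc_comm[OF x] by (auto simp: pow_mult_distrib)
qed

text \<open>By induction S fixes the p-th power of x. The elements of the cyclic group with this
p-th power form a coset of the subgroup of elements z with \<open>z [^] p = \<one>\<close>. Their
number is a power of p, so that S, permuting them, fixes one of them, xz say. Since S fixes z, it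
fixes x.\<close>

lemma cyc_centralized:
  assumes pq: "prime p" "prime q" "p \<noteq> q" and S: "subgroup S G" "card S = q ^ k"
  shows "x \<in> carrier G \<Longrightarrow> x [^] (p ^ m) = \<one> \<Longrightarrow> \<forall>s\<in>S. s \<otimes> x \<otimes> inv s \<in> cyc x \<Longrightarrow>
    \<forall>z\<in>cyc x. z [^] p = \<one> \<longrightarrow> (\<forall>s\<in>S. s \<otimes> z \<otimes> inv s = z) \<Longrightarrow> \<forall>s\<in>S. s \<otimes> x \<otimes> inv s = x"
proof (induction m arbitrary: x)
  case 0
  then show ?case using sgD(5)[OF S(1)] by auto
next
  case (Suc m)
  note x = Suc.prems(1)
  note c = sgD[OF cyc_sg[OF x]]
  have xp: "x [^] p \<in> carrier G" using x by simp
  have sub: "cyc (x [^] p) \<subseteq> cyc x" by (rule cyc_least[OF cyc_sg[OF x] sg_pow[OF cyc_sg[OF x] cyc_self]])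
  have fix_p: "\<forall>s\<in>S. s \<otimes> (x [^] p) \<otimes> inv s = x [^] p"
  proof (rule Suc.IH[OF xp])
    show "(x [^] p) [^] (p ^ m) = \<one>" using Suc.prems(2) x by (simp add: nat_pow_pow)
    show "\<forall>s\<in>S. s \<otimes> x [^] p \<otimes> inv s \<in> cyc (x [^] p)"
    proof
      fix s assume s: "s \<in> S"
      obtain j :: nat where j: "s \<otimes> x \<otimes> inv s = x [^] j" using Suc.prems(3) s cyc_powE[OF x] by metis
      have "s \<otimes> x [^] p \<otimes> inv s = (x [^] p) [^] j"
        using j cj_pow[of s x p] x sgD(5)[OF S(1) s] by (simp add: nat_pow_pow mult.commute)
      then show "s \<otimes> x [^] p \<otimes> inv s \<in> cyc (x [^] p)" using cyc_pow[OF xp] by blast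
    qed
    show "\<forall>z\<in>cyc (x [^] p). z [^] p = \<one> \<longrightarrow> (\<forall>s\<in>S. s \<otimes> z \<otimes> inv s = z)"
      using Suc.prems(4) sub by auto
  qed
  define Z where "Z = {z \<in> cyc x. z [^] p = \<one>}"
  define F where "F = {g \<in> cyc x. g [^] p = x [^] p}"
  have Z: "subgroup Z G" unfolding Z_def by (rule roots_sg[OF x])
  have FZ: "F = (\<lambda>z. x \<otimes> z) ` Z"
  proof (intro equalityI subsetI)
    fix g assume g: "g \<in> F"
    then have gc: "g \<in> cyc x" "g \<in> carrier G" using c(5) by (auto simp: F_def)
    have "(inv x \<otimes> g) [^] p = inv (x [^] p) \<otimes> g [^] p"
      using pow_mult_distrib[OF cyc_comm[OF x c(6)[OF cyc_self] gc(1)], of p] x gc by (simp add: nat_pow_inv)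
    then have "(inv x \<otimes> g) [^] p = \<one>" using g x by (simp add: F_def)
    then have "inv x \<otimes> g \<in> Z" using c(6,7) cyc_self gc by (auto simp: Z_def)
    moreover have "g = x \<otimes> (inv x \<otimes> g)" using x gc by (simp add: m_assoc[symmetric])
    ultimately show "g \<in> (\<lambda>z. x \<otimes> z) ` Z" by blast
  next
    fix g assume "g \<in> (\<lambda>z. x \<otimes> z) ` Z"
    then obtain z where z: "z \<in> cyc x" "z [^] p = \<one>" "g = x \<otimes> z" by (auto simp: Z_def)
    then show "g \<in> F" using pow_mult_distrib[OF cyc_comm[OF x cyc_self z(1)], of p] x c(5,7) cyc_self
      by (auto simp: F_def)
  qed
  have "card F = card Z"
    unfolding FZ by (rule card_image) (use x sgD(5)[OF Z] in \<open>auto simp: inj_on_def\<close>)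
  moreover have "card Z dvd p ^ Suc m"
  proof -
    have "card (cyc x) dvd p ^ Suc m"
      using Suc.prems(2) generate_pow_card[OF x] pow_eq_id[OF x] by simp
    then show ?thesis using sg_dvd[OF Z cyc_sg[OF x]] by (auto simp: Z_def intro: dvd_trans)
  qed
  ultimately obtain j where j: "card F = p ^ j" using pq(1) by (metis divides_primepow_nat)
  have nq: "\<not> q dvd card F" using j pq by (metis prime_dvd_power primes_dvd_imp_eq)
  have a: "acts S (\<lambda>s x. s \<otimes> x \<otimes> inv s) F"
  proof (rule acts_elem[OF S(1)])
    show "F \<subseteq> carrier G" using c(5) by (auto simp: F_def)
    show "cj s F \<subseteq> F" if s: "s \<in> S" for s
    proof
      fix y assume "y \<in> cj s F"
      then obtain g where g: "g \<in> cyc x" "g [^] p = x [^] p" "y = s \<otimes> g \<otimes> inv s" by (auto simp: cj_def F_def)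
      have sc: "s \<in> carrier G" using s sgD(5)[OF S(1)] by simp
      have "y \<in> cj s (cyc x)" using g by (auto simp: cj_def)
      then have "y \<in> cyc x" using cj_cyc_eq[OF x sc] Suc.prems(3) s by simp
      moreover have "y [^] p = x [^] p" using g cj_pow[of s g p] sc c(5) fix_p s by auto
      ultimately show "y \<in> F" by (simp add: F_def)
    qed
  qed
  have "finite F" using c(2) by (auto simp: F_def)
  from fixed_points_mod[OF S pq(2) a this] nq
  have "card {e \<in> F. \<forall>s\<in>S. s \<otimes> e \<otimes> inv s = e} \<noteq> 0" by (metis dvd_eq_mod_eq_0 mod_0)
  then have "{e \<in> F. \<forall>s\<in>S. s \<otimes> e \<otimes> inv s = e} \<noteq> {}" by (intro notI) simp
  then obtain g where g: "g \<in> F" "\<forall>s\<in>S. s \<otimes> g \<otimes> inv s = g" by blast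
  then obtain z where z: "z \<in> Z" "g = x \<otimes> z" using FZ by blast
  show ?case
  proof
    fix s assume s: "s \<in> S"
    have cc: "s \<in> carrier G" "z \<in> carrier G" using s z sgD(5)[OF S(1)] sgD(5)[OF Z] by auto
    have "s \<otimes> z \<otimes> inv s = z" using Suc.prems(4) z s by (auto simp: Z_def)
    moreover have "s \<otimes> (x \<otimes> z) \<otimes> inv s = (s \<otimes> x \<otimes> inv s) \<otimes> (s \<otimes> z \<otimes> inv s)"
      using cc x by (simp add: m_assoc) (metis inv_closed l_inv l_one m_assoc m_closed)
    ultimately have "x \<otimes> z = (s \<otimes> x \<otimes> inv s) \<otimes> z" using g s z by auto
    then show "s \<otimes> x \<otimes> inv s = x" using cc x by simp
  qed
qed

text \<open>The equation \<open>z [^] p = \<one>\<close> has at most p solutions in a cyclic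
p-group.\<close>

lemma cyc_prime_subgroup_unique:
  assumes x: "x \<in> carrier G" "card (cyc x) = p ^ m" "prime p"
    and A: "subgroup A G" "A \<subseteq> cyc x" "card A = p" and B: "subgroup B G" "B \<subseteq> cyc x" "card B = p"
  shows "A = B"
proof -
  have m: "m > 0"
  proof (rule ccontr)
    assume "\<not> m > 0"
    then have "p dvd 1" using sg_dvd[OF A(1) cyc_sg[OF x(1)] A(2)] x(2) A(3) by simp
    then show False using x(3) by simp
  qed
  define Z where "Z = {z \<in> cyc x. z [^] p = \<one>}"
  define y where "y = x [^] (p ^ (m - 1))"
  have yc: "y \<in> carrier G" using x by (simp add: y_def)
  have o: "ord x = p ^ m" using generate_pow_card[OF x(1)] x(2) by simp
  have pp: "p ^ m = p * p ^ (m - 1)" using m by (simp add: power_eq_if)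
  have "y [^] p = x [^] (p ^ m)" unfolding y_def using x(1) pp by (simp add: nat_pow_pow mult.commute)
  then have yp: "y [^] p = \<one>" using o x(1) pow_eq_id by simp
  have "Z \<subseteq> (\<lambda>j. y [^] j) ` {..<p}"
  proof
    fix z assume z: "z \<in> Z"
    then obtain k :: nat where k: "z = x [^] k" using cyc_powE[OF x(1)] by (auto simp: Z_def)
    have "x [^] (k * p) = \<one>" using z k x(1) by (simp add: Z_def nat_pow_pow)
    then have "p ^ m dvd k * p" using pow_eq_id[OF x(1)] o by simp
    then have "p ^ (m - 1) dvd k" using pp prime_gt_0_nat[OF x(3)] by (simp add: mult.commute)
    then obtain j where j: "k = p ^ (m - 1) * j" by blast
    have "z = y [^] j" using k j x(1) by (simp add: y_def nat_pow_pow)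
    also have "\<dots> = y [^] (j mod p + p * (j div p))" by simp
    also have "\<dots> = y [^] (j mod p)" using yc yp by (simp only: nat_pow_mult[symmetric] nat_pow_pow[symmetric]) simp
    finally show "z \<in> (\<lambda>j. y [^] j) ` {..<p}" using prime_gt_0_nat[OF x(3)] by auto
  qed
  then have cZ: "card Z \<le> p" using card_mono[of "(\<lambda>j. y [^] j) ` {..<p}" Z] card_image_le[of "{..<p}" "\<lambda>j. y [^] j"] by simp
  have Z: "subgroup Z G" unfolding Z_def by (rule roots_sg[OF x(1)])
  have "A = Z" using A pow_card_one[OF A(1)] cZ by (intro sg_eqI[OF A(1) Z]) (auto simp: Z_def)
  moreover have "B = Z" using B pow_card_one[OF B(1)] cZ by (intro sg_eqI[OF B(1) Z]) (auto simp: Z_def)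
  ultimately show ?thesis by simp
qed

text \<open>The cyclic subgroups generated by the nontrivial elements are proper subgroups and
cover P, so there are more than p of them. The trivial subgroup and P come on top.\<close>

lemma noncyclic_card_subs:
  assumes P: "subgroup P G" "card P = p ^ m" "prime p" and nc: "\<And>x. x \<in> P \<Longrightarrow> P \<noteq> cyc x"
  shows "card (subs P) \<ge> p + 3"
proof -
  define C where "C = cyc ` (P - {\<one>})"
  have p2: "p \<ge> 2" using prime_ge_2_nat[OF P(3)] .
  have cP: "P \<noteq> {\<one>}" using nc[of \<one>] generate_one sgD(3)[OF P(1)] by auto
  have m: "m > 0" using sg_card1[OF P(1)] P(2) cP by (intro gr0I) auto
  have C: "subgroup c G" "c \<subseteq> P" "c \<noteq> P" "c \<noteq> {\<one>}" if "c \<in> C" for c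
    using that nc cyc_sg cyc_least[OF P(1)] sgD(5)[OF P(1)] cyc_self unfolding C_def by (blast, blast, blast, force)
  have fC: "finite C" unfolding C_def using sgD(2)[OF P(1)] by simp
  have ccard: "card c - 1 \<le> p ^ (m - 1) - 1" if c: "c \<in> C" for c
  proof -
    have "card c dvd p ^ m" using sg_dvd[OF C(1)[OF c] P(1) C(2)[OF c]] P(2) by simp
    then obtain j where j: "card c = p ^ j" "j \<le> m" using P(3) by (auto simp: divides_primepow_nat)
    have "j \<noteq> m" using sg_eqI[OF C(1)[OF c] P(1) C(2)[OF c]] C(3)[OF c] j P(2) by auto
    then have "p ^ j \<le> p ^ (m - 1)" using j p2 by (intro power_increasing) auto
    then show ?thesis using j by simp
  qed
  have "P - {\<one>} \<subseteq> (\<Union>c\<in>C. c - {\<one>})" unfolding C_def using cyc_self by force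
  then have "card (P - {\<one>}) \<le> card (\<Union>c\<in>C. c - {\<one>})"
    by (rule card_mono[rotated]) (use fC C(1) sgD(2) in auto)
  also have "\<dots> \<le> (\<Sum>c\<in>C. card (c - {\<one>}))" by (rule card_UN_le[OF fC])
  also have "\<dots> \<le> (\<Sum>c\<in>C. p ^ (m - 1) - 1)"
    using ccard C(1) sgD(2,3) by (intro sum_mono) (auto simp: card_Diff_singleton)
  also have "\<dots> = card C * (p ^ (m - 1) - 1)" by simp
  finally have le: "p ^ m - 1 \<le> card C * (p ^ (m - 1) - 1)"
    using P(2) sgD(3)[OF P(1)] by (simp add: card_Diff_singleton)
  have "card C > p"
  proof (rule ccontr)
    assume "\<not> card C > p"
    then have "card C * (p ^ (m - 1) - 1) \<le> p * (p ^ (m - 1) - 1)" by simp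
    also have "\<dots> = p ^ m - p"
      using m by (cases m) (simp_all add: diff_mult_distrib2)
    finally have "p ^ m - 1 \<le> p ^ m - p" using le by linarith
    moreover have "p ^ m \<ge> p" using m p2 by (simp add: self_le_power)
    ultimately show False using p2 by linarith
  qed
  moreover have "insert P (insert {\<one>} C) \<subseteq> subs P" using C P sg_one sgD(3)[OF P(1)] by (auto simp: subs_def)
  then have "card (insert P (insert {\<one>} C)) \<le> card (subs P)" by (rule card_mono[OF subs_finite])
  moreover have "card (insert P (insert {\<one>} C)) = card C + 2"
  proof -
    have "{\<one>} \<notin> C" "P \<notin> insert {\<one>} C" using C(3,4) cP by blast+
    then show ?thesis using fC by simp
  qed
  ultimately show ?thesis by simp
qed

section \<open>Coprime action on p-groups\<close>

lemma cjs_power: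
  assumes S: "subgroup S G" "card S = q ^ k" "prime q" and X: "subgroup X G" and nf: "\<exists>s\<in>S. cj s X \<noteq> X"
  shows "\<exists>j>0. card (cjs S X) = q ^ j"
proof -
  have "acts S cj (cjs (carrier G) X)"
  proof (rule acts_cj[OF S(1)])
    show "Y \<subseteq> carrier G" if "Y \<in> cjs (carrier G) X" for Y using that sgD(1)[OF X] by (auto simp: cjs_def dest: cj_carrier)
    show "cj s Y \<in> cjs (carrier G) X" if sX: "s \<in> S" "Y \<in> cjs (carrier G) X" for s Y
    proof -
      obtain x where "x \<in> carrier G" "Y = cj x X" using sX by (auto simp: cjs_def)
      then show ?thesis using sgD(5)[OF S(1) sX(1)] sgD(1)[OF X] by (auto simp: cjs_def cj_mult[symmetric])
    qed
  qed
  moreover have "X \<in> cjs (carrier G) X" unfolding cjs_def using cj_one[OF sgD(1)[OF X]] by (metis imageI one_closed)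
  ultimately show ?thesis using orbit_prime_power[OF S, of cj _ X] nf unfolding cjs_def by blast
qed

lemma cjs_ge:
  assumes "subgroup S G" "card S = q ^ k" "prime q" "subgroup X G" "\<exists>s\<in>S. cj s X \<noteq> X"
  shows "card (cjs S X) \<ge> q"
  using cjs_power[OF assms] prime_gt_1_nat[OF assms(3)] by (auto simp: self_le_power)

lemma subs_inv_mod:
  assumes S: "subgroup S G" "card S = q ^ k" "prime q" and P: "subgroup P G" "\<And>s. s \<in> S \<Longrightarrow> cj s P = P"
  shows "card (subs P) mod q = card {A \<in> subs P. \<forall>s\<in>S. cj s A = A} mod q"
proof (rule fixed_points_mod[OF S _ subs_finite])
  show "acts S cj (subs P)"
  proof (rule acts_cj[OF S(1)])
    show "X \<subseteq> carrier G" if "X \<in> subs P" for X using that sgD(1) by (auto simp: subs_def)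
    show "cj s X \<in> subs P" if "s \<in> S" "X \<in> subs P" for s X
      using that P cj_sg sgD(5)[OF S(1)] cj_mono[of X P s] by (auto simp: subs_def)
  qed
qed

lemma fixed_iff: "s \<in> carrier G \<Longrightarrow> x \<in> carrier G \<Longrightarrow> s \<otimes> x \<otimes> inv s = x \<longleftrightarrow> x \<otimes> s = s \<otimes> x"
  by (metis inv_solve_right m_closed)

lemma elem_inv_mod:
  assumes S: "subgroup S G" "card S = q ^ k" "prime q" and P: "subgroup P G" "\<And>s. s \<in> S \<Longrightarrow> cj s P = P"
  shows "card P mod q = card (cen P S) mod q"
proof -
  have "acts S (\<lambda>s x. s \<otimes> x \<otimes> inv s) P"
    by (rule acts_elem[OF S(1) sgD(1)[OF P(1)]]) (use P(2) in auto)
  from fixed_points_mod[OF S this sgD(2)[OF P(1)]]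
  have "card P mod q = card {e \<in> P. \<forall>s\<in>S. s \<otimes> e \<otimes> inv s = e} mod q" .
  moreover have "{e \<in> P. \<forall>s\<in>S. s \<otimes> e \<otimes> inv s = e} = cen P S"
    using fixed_iff sgD(5)[OF S(1)] sgD(5)[OF P(1)] by (auto simp: cen_def)
  ultimately show ?thesis by simp
qed

text \<open>A cyclic 2-group has at most one involution, which every group normalizing it
centralizes. By \<open>cyc_centralized\<close>, S would centralize every element of P if it
normalized all cyclic subgroups.\<close>

lemma moved_cyclic:
  assumes S: "subgroup S G" "card S = q ^ k" "prime q" "q \<noteq> 2" and P: "subgroup P G" "card P = 2 ^ m" "\<And>s. s \<in> S \<Longrightarrow> cj s P = P"
    and nt: "cen P S \<noteq> P"
  shows "\<exists>x\<in>P. \<exists>s\<in>S. cj s (cyc x) \<noteq> cyc x"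
proof (rule ccontr)
  assume "\<not> ?thesis"
  then have f: "cj s (cyc x) = cyc x" if "x \<in> P" "s \<in> S" for x s using that by blast
  have "s \<otimes> x \<otimes> inv s = x" if x: "x \<in> P" and s: "s \<in> S" for x s
  proof -
    have xc: "x \<in> carrier G" using x sgD(5)[OF P(1)] by simp
    have "\<forall>s\<in>S. s \<otimes> x \<otimes> inv s = x"
    proof (rule cyc_centralized[OF two_is_prime_nat S(3) _ S(1,2) xc])
      show "2 \<noteq> q" using S(4) by simp
      show "x [^] (2 ^ m :: nat) = \<one>" using pow_card_one[OF P(1) x] P(2) by simp
      show "\<forall>s\<in>S. s \<otimes> x \<otimes> inv s \<in> cyc x" using f[OF x] cyc_self[of x] by (auto simp: cj_def)
      show "\<forall>z\<in>cyc x. z [^] (2::nat) = \<one> \<longrightarrow> (\<forall>s\<in>S. s \<otimes> z \<otimes> inv s = z)"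
      proof (intro ballI impI)
        fix z s assume z: "z \<in> cyc x" "z [^] (2::nat) = \<one>" and s: "s \<in> S"
        have zP: "z \<in> P" using z cyc_least[OF P(1) x] by auto
        have zc: "z \<in> carrier G" using zP sgD(5)[OF P(1)] by simp
        have sc: "s \<in> carrier G" using s sgD(5)[OF S(1)] by simp
        have zz: "z \<otimes> z = \<one>" using z(2) zc by (simp add: numeral_2_eq_2)
        have "subgroup {\<one>, z} G"
          using zc zz by (intro subgroupI) (auto simp: inv_equality)
        then have "cyc z \<subseteq> {\<one>, z}" using cyc_least by simp
        moreover have "s \<otimes> z \<otimes> inv s \<in> cyc z" using f[OF zP s] cyc_self[of z] by (auto simp: cj_def)
        ultimately have "s \<otimes> z \<otimes> inv s = \<one> \<or> s \<otimes> z \<otimes> inv s = z" by auto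
        then show "s \<otimes> z \<otimes> inv s = z"
        proof
          assume "s \<otimes> z \<otimes> inv s = \<one>"
          then have "s \<otimes> z \<otimes> inv s = s \<otimes> \<one> \<otimes> inv s" using sc by simp
          then have "z = \<one>" using inj_onD[OF cj_inj[OF sc], of z \<one>] zc by simp
          then show ?thesis using sc by simp
        qed
      qed
    qed
    then show ?thesis using s by simp
  qed
  then have "cen P S = P" using fixed_iff sgD(5)[OF S(1)] sgD(5)[OF P(1)] by (auto simp: cen_def)
  then show False using nt by simp
qed

text \<open>This is the standing situation of coprime action: \<open>cen P S\<close> is the
subgroup of fixed points, and \<open>cjs P S\<close> is the set of Sylow q-subgroups of the
product PS.\<close>

definition coact :: "nat \<Rightarrow> 'a set \<Rightarrow> nat \<Rightarrow> 'a set \<Rightarrow> bool" where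
  "coact p P q S \<longleftrightarrow> prime p \<and> prime q \<and> p \<noteq> q \<and> subgroup P G \<and> subgroup S G \<and>
     (\<exists>m. card P = p ^ m) \<and> (\<exists>k. card S = q ^ k) \<and> (\<forall>s\<in>S. cj s P = P)"

lemma coactD:
  assumes "coact p P q S"
  shows "prime p" "prime q" "p \<noteq> q" "subgroup P G" "subgroup S G" "\<exists>m. card P = p ^ m" "\<exists>k. card S = q ^ k"
    "\<And>s. s \<in> S \<Longrightarrow> cj s P = P" "P \<inter> S = {\<one>}" "\<not> q dvd card P" "\<not> p dvd card S"
    "subgroup (P <#> S) G" "card (P <#> S) = card P * card S" "is_syl q (P <#> S) S" "subgroup (cen P S) G"
    "P \<subseteq> P <#> S" "S \<subseteq> P <#> S"
proof -
  show b: "prime p" "prime q" "p \<noteq> q" "subgroup P G" "subgroup S G" "\<exists>m. card P = p ^ m" "\<exists>k. card S = q ^ k"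
    "\<And>s. s \<in> S \<Longrightarrow> cj s P = P" using assms by (auto simp: coact_def)
  show nd: "\<not> q dvd card P" "\<not> p dvd card S" using b by (metis prime_dvd_power primes_dvd_imp_eq)+
  have "coprime (card P) (card S)" using b primes_coprime[OF b(1,2)] by auto
  then show i: "P \<inter> S = {\<one>}" by (rule sg_coprime_Int[OF b(4,5)])
  show s: "subgroup (P <#> S) G" by (rule prod_sg[OF b(4,5,8)])
  show c: "card (P <#> S) = card P * card S" by (rule prod_card[OF b(4,5) i])
  show "subgroup (cen P S) G" by (rule cen_sg[OF b(4) sgD(1)[OF b(5)]])
  show "P \<subseteq> P <#> S" by (rule prod_sub1[OF b(5) sgD(1)[OF b(4)]])
  show s2: "S \<subseteq> P <#> S" by (rule prod_sub2[OF b(4) sgD(1)[OF b(5)]])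
  show "is_syl q (P <#> S) S" unfolding is_syl_def using b c s2 nd sgD(4)[OF b(5)] by simp
qed

text \<open>If x in P normalizes S, then its commutators with S lie both in P and in S.\<close>

lemma coact_nrm: assumes "coact p P q S" shows "nrm P S = cen P S"
proof -
  note c = coactD[OF assms]
  show ?thesis
  proof (intro equalityI subsetI)
    fix x assume x: "x \<in> nrm P S"
    then have xP: "x \<in> P" "cj x S = S" by (auto simp: nrm_def)
    have xc: "x \<in> carrier G" using xP sgD(5)[OF c(4)] by simp
    have "x \<otimes> s = s \<otimes> x" if s: "s \<in> S" for s
    proof -
      have sc: "s \<in> carrier G" using s sgD(5)[OF c(5)] by simp
      have "x \<otimes> s \<otimes> inv x \<in> S" using xP s by (auto simp: cj_def)
      then have "x \<otimes> s \<otimes> inv x \<otimes> inv s \<in> S" using s sgD(6,7)[OF c(5)] by auto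
      moreover have "s \<otimes> inv x \<otimes> inv s \<in> P" using c(8)[OF s] xP sgD(6)[OF c(4)] by (auto simp: cj_def)
      then have "x \<otimes> (s \<otimes> inv x \<otimes> inv s) \<in> P" using xP sgD(7)[OF c(4)] by auto
      then have "x \<otimes> s \<otimes> inv x \<otimes> inv s \<in> P" using xc sc by (simp add: m_assoc)
      ultimately have "x \<otimes> s \<otimes> inv x \<otimes> inv s = \<one>" using c(9) by auto
      then have "(x \<otimes> s) \<otimes> inv (s \<otimes> x) = \<one>" using xc sc by (simp add: inv_mult_group m_assoc)
      then show ?thesis using xc sc by (metis inv_equality inv_inv m_closed inv_closed)
    qed
    then show "x \<in> cen P S" using xP by (auto simp: cen_def)
  next
    fix x assume x: "x \<in> cen P S"
    then have xP: "x \<in> P" by (auto simp: cen_def)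
    have xc: "x \<in> carrier G" using xP sgD(5)[OF c(4)] by simp
    have "x \<otimes> s \<otimes> inv x = s" if "s \<in> S" for s
      using that x fixed_iff[OF xc, of s] sgD(5)[OF c(5)] by (auto simp: cen_def)
    then have "cj x S = S" by (auto simp: cj_def)
    then show "x \<in> nrm P S" using xP by (simp add: nrm_def)
  qed
qed

lemma coact_card: assumes "coact p P q S" shows "card (cjs P S) * card (cen P S) = card P"
  using card_cjs[OF coactD(4)[OF assms] sgD(1)[OF coactD(5)[OF assms]]] coact_nrm[OF assms] by simp

lemma coact_Syl: assumes "coact p P q S" shows "Syl q (P <#> S) = cjs P S"
proof -
  note c = coactD[OF assms]
  have "cj y S \<in> cjs P S" if y: "y \<in> P <#> S" for y
  proof -
    obtain x s where xs: "x \<in> P" "s \<in> S" "y = x \<otimes> s" using y by (rule set_multE)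
    have "cj y S = cj x S" using xs cj_mult[of x s S] sgD(5)[OF c(4)] sgD(1,5)[OF c(5)] cj_self[OF c(5) xs(2)] by simp
    then show ?thesis using xs by (auto simp: cjs_def)
  qed
  then show ?thesis using Syl_cjs[OF c(12,14)] c(16) by (auto simp: cjs_def)
qed

lemma coact_mod: assumes "coact p P q S" shows "card (cjs P S) mod q = 1"
  using Syl_count_mod[OF coactD(12,14)[OF assms]] coact_Syl[OF assms] by simp

lemma coact_index:
  assumes "coact p P q S" "cen P S \<noteq> P"
  shows "\<exists>a>0. card (cjs P S) = p ^ a" "card (cjs P S) \<ge> q + 1"
proof -
  note c = coactD[OF assms(1)]
  obtain m where m: "card P = p ^ m" using c(6) by blast
  have "card (cjs P S) dvd p ^ m" using coact_card[OF assms(1)] m by (metis dvd_triv_left)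
  then obtain a where a: "card (cjs P S) = p ^ a" using c(1) by (auto simp: divides_primepow_nat)
  have n1: "card (cjs P S) \<noteq> 1"
  proof
    assume "card (cjs P S) = 1"
    then have "card (cen P S) = card P" using coact_card[OF assms(1)] by simp
    then show False using assms(2) sg_eqI[OF c(15,4) cen_sub] by simp
  qed
  then show "\<exists>a>0. card (cjs P S) = p ^ a" using a by (intro exI[of _ a]) (auto intro: gr0I)
  have "card (cjs P S) \<noteq> 0" using a c(1) by auto
  then show "card (cjs P S) \<ge> q + 1" using n1 coact_mod[OF assms(1)]
    by (metis One_nat_def Suc_eq_plus1 Suc_leI less_one linorder_neqE_nat mod_less not_less_eq mod_self prime_gt_1_nat[OF c(2)] neq0_conv)
qed

section \<open>Sorting subgroups by their product with a normal subgroup\<close>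

definition nml :: "'a set \<Rightarrow> bool" where
  "nml P \<longleftrightarrow> subgroup P G \<and> (\<forall>x\<in>carrier G. cj x P = P)"

text \<open>The fibre over M of the map sending a subgroup H to PH.\<close>

definition fibre :: "'a set \<Rightarrow> 'a set \<Rightarrow> 'a set set" where
  "fibre P M = {H. subgroup H G \<and> P <#> H = M}"

lemma nmlD: assumes "nml P" shows "subgroup P G" "\<And>x. x \<in> carrier G \<Longrightarrow> cj x P = P"
  using assms by (auto simp: nml_def)

lemma nmlI: assumes "subgroup P G" "\<And>x. x \<in> carrier G \<Longrightarrow> cj x P \<subseteq> P" shows "nml P"
  using assms sg_eqI[OF cj_sg[OF _ assms(1)] assms(1)] cj_card sgD(1)[OF assms(1)] by (auto simp: nml_def)

lemma nml_prod: "nml P \<Longrightarrow> subgroup H G \<Longrightarrow> subgroup (P <#> H) G"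
  using prod_sg nmlD sgD(5) by metis

lemma coactI:
  assumes "nml P" "prime p" "prime q" "p \<noteq> q" "card P = p ^ m" "subgroup S G" "card S = q ^ k"
  shows "coact p P q S"
  using assms sgD(5)[OF assms(6)] unfolding coact_def nml_def by auto

lemma fibre_finite [simp]: "finite (fibre P M)"
  by (rule finite_subset[OF _ subs_finite[of "carrier G"]]) (auto simp: fibre_def subs_def dest: sgD(1))

lemma fibre_disj: "M \<noteq> N \<Longrightarrow> fibre P M \<inter> fibre P N = {}" by (auto simp: fibre_def)

lemma fibre_subs: "fibre P M \<subseteq> subs (carrier G)" using sgD(1) by (auto simp: fibre_def subs_def)

lemma fibre_self: assumes "subgroup P G" shows "fibre P P = subs P"
proof (intro equalityI subsetI)
  fix H assume "H \<in> fibre P P"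
  then have H: "subgroup H G" "P <#> H = P" by (auto simp: fibre_def)
  then show "H \<in> subs P" using prod_sub2[OF assms sgD(1)[OF H(1)]] by (simp add: subs_def)
next
  fix H assume "H \<in> subs P"
  then have H: "subgroup H G" "H \<subseteq> P" by (auto simp: subs_def)
  have "P <#> H = P" using prod_least[OF assms subset_refl H(2)] prod_sub1[OF H(1) sgD(1)[OF assms]] by auto
  then show "H \<in> fibre P P" using H by (simp add: fibre_def)
qed

lemma fibre_two:
  assumes "M \<noteq> N" shows "card (fibre P M) + card (fibre P N) \<le> num_subgroups G"
proof -
  have "card (fibre P M) + card (fibre P N) = card (fibre P M \<union> fibre P N)"
    using fibre_disj[OF assms] by (subst card_Un_disjoint) auto
  also have "\<dots> \<le> card (subs (carrier G))" using fibre_subs by (intro card_mono) auto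
  finally show ?thesis by (simp add: subs_carrier)
qed

lemma fibre_three:
  assumes "M \<noteq> N" "M \<noteq> L" "N \<noteq> L" shows "card (fibre P M) + card (fibre P N) + card (fibre P L) \<le> num_subgroups G"
proof -
  have "card (fibre P M) + card (fibre P N) + card (fibre P L) = card (fibre P M \<union> fibre P N \<union> fibre P L)"
    using fibre_disj[of _ _ P] assms by (simp add: card_Un_disjoint Int_Un_distrib2)
  also have "\<dots> \<le> card (subs (carrier G))" using fibre_subs by (intro card_mono) auto
  finally show ?thesis by (simp add: subs_carrier)
qed

lemma num_eq_sum_fibre:
  assumes "nml P"
  shows "num_subgroups G = (\<Sum>M\<in>{M. subgroup M G \<and> P \<subseteq> M}. card (fibre P M))"
proof -
  note P = nmlD[OF assms]
  let ?\<M> = "{M. subgroup M G \<and> P \<subseteq> M}"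
  have f: "finite ?\<M>" by (rule finite_subset[OF _ subs_finite[of "carrier G"]]) (auto simp: subs_def dest: sgD(1))
  have "subs (carrier G) = (\<Union>M\<in>?\<M>. fibre P M)"
  proof (intro equalityI subsetI)
    fix H assume "H \<in> subs (carrier G)"
    then have H: "subgroup H G" by (simp add: subs_def)
    have "H \<in> fibre P (P <#> H)" using H by (simp add: fibre_def)
    then show "H \<in> (\<Union>M\<in>?\<M>. fibre P M)"
      using nml_prod[OF assms H] prod_sub1[OF H sgD(1)[OF P(1)]] by blast
  qed (use fibre_subs in blast)
  then have "num_subgroups G = card (\<Union>M\<in>?\<M>. fibre P M)" by (simp add: subs_carrier)
  also have "\<dots> = (\<Sum>M\<in>?\<M>. card (fibre P M))" using f fibre_disj by (intro card_UN_disjoint) auto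
  finally show ?thesis .
qed

lemma nml_prod_card:
  assumes P: "nml P" and H: "subgroup H G"
  shows "card (P <#> H) * card (H \<inter> P) = card P * card H"
proof -
  note P' = nmlD[OF P]
  let ?E = "(\<lambda>x. lc x P) ` carrier G"
  have Pc: "P \<subseteq> carrier G" by (rule sgD(1)[OF P'(1)])
  have ac: "acts K lc ?E" if "subgroup K G" for K
    unfolding acts_def using Pc sgD(5)[OF that] by (auto simp: lcos_m_assoc lcos_mult_one m_assoc)
  have PE: "P \<in> ?E" using lcos_mult_one[OF Pc] by force
  have st: "{x \<in> K. lc x P = P} = K \<inter> P" if "subgroup K G" for K
    using lc_eq_iff[OF P'(1)] sgD(5)[OF that] by auto
  note K = nml_prod[OF P H]
  have HK: "H \<subseteq> P <#> H" by (rule prod_sub2[OF P'(1) sgD(1)[OF H]])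
  have "lc k P \<in> (\<lambda>h. lc h P) ` H" if k: "k \<in> P <#> H" for k
  proof -
    obtain a h where ah: "a \<in> P" "h \<in> H" "k = a \<otimes> h" using k by (rule set_multE)
    have c: "a \<in> carrier G" "h \<in> carrier G" using ah Pc sgD(5)[OF H] by auto
    have "inv h \<otimes> a \<otimes> inv (inv h) \<in> P" using P'(2)[of "inv h"] c ah by (auto simp: cj_def)
    then have b: "inv h \<otimes> a \<otimes> h \<in> P" using c by simp
    have "k = h \<otimes> (inv h \<otimes> a \<otimes> h)" using c ah by (simp add: m_assoc[symmetric])
    then have "lc k P = lc h (lc (inv h \<otimes> a \<otimes> h) P)" using c Pc by (simp add: lcos_m_assoc)
    also have "lc (inv h \<otimes> a \<otimes> h) P = P" using lc_eq_iff[OF P'(1), of "inv h \<otimes> a \<otimes> h"] b Pc by (simp add: subsetD)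
    finally show ?thesis using ah by blast
  qed
  then have orb: "(\<lambda>h. lc h P) ` (P <#> H) = (\<lambda>h. lc h P) ` H" using HK by auto
  have PK: "(P <#> H) \<inter> P = P" using prod_sub1[OF H Pc] by auto
  let ?n = "card ((\<lambda>h. lc h P) ` H)"
  have "?n * card (H \<inter> P) = card H"
    using orbit_stabilizer[OF H ac[OF H] PE] st[OF H] by simp
  moreover have "?n * card P = card (P <#> H)"
    using orbit_stabilizer[OF K ac[OF K] PE] st[OF K] orb PK by simp
  ultimately show ?thesis by (metis mult.assoc mult.commute)
qed

text \<open>A Sylow q-subgroup of H is one of PS, hence a P-conjugate of S, and the modular law
applies to it.\<close>

lemma fibre_form:
  assumes c: "coact p P q S" and P: "nml P" and H: "H \<in> fibre P (P <#> S)"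
  shows "\<exists>x\<in>P. cj x S \<subseteq> H \<and> H = (H \<inter> P) <#> cj x S"
proof -
  note d = coactD[OF c]
  have Hs: "subgroup H G" "P <#> H = P <#> S" using H by (auto simp: fibre_def)
  have HM: "H \<subseteq> P <#> S" using prod_sub2[OF d(4) sgD(1)[OF Hs(1)]] Hs(2) by simp
  obtain k where k: "card S = q ^ k" using d(7) by blast
  have "card P * card S * card (H \<inter> P) = card P * card H"
    using nml_prod_card[OF P Hs(1)] Hs(2) d(13) by simp
  then have "card H = card S * card (H \<inter> P)" using sgD(4)[OF d(4)] by simp
  then obtain R where R: "subgroup R G" "R \<subseteq> H" "card R = q ^ k"
    using sg_exists_prime_power[OF Hs(1) d(2), of k] k by auto
  have "is_syl q (P <#> S) R"
    using d(14) R HM k by (auto simp: is_syl_def)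
  then have "R \<in> cjs P S" using coact_Syl[OF c] by (auto simp: Syl_def)
  then obtain x where x: "x \<in> P" "R = cj x S" by (auto simp: cjs_def)
  have xc: "x \<in> carrier G" using x sgD(5)[OF d(4)] by simp
  have "P <#> R = P <#> S"
  proof -
    have "cj x (P <#> S) = cj x P <#> cj x S" by (rule cj_prod[OF xc sgD(1)[OF d(4)] sgD(1)[OF d(5)]])
    moreover have "x \<in> P <#> S" using x d(16) by auto
    ultimately show ?thesis using cj_self[OF d(12)] cj_self[OF d(4) x(1)] x(2) by metis
  qed
  then have "H = (H \<inter> P) <#> R" using dedekind[OF Hs(1) d(4) R(1,2)] HM by simp
  then show ?thesis using x R by auto
qed

lemma fibre_mem:
  assumes c: "coact p P q S" and P: "nml P" and A: "A \<in> subs P" "\<And>s. s \<in> S \<Longrightarrow> cj s A = A" and x: "x \<in> P"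
  shows "cj x (A <#> S) \<in> fibre P (P <#> S)"
proof -
  note d = coactD[OF c]
  have As: "subgroup A G" "A \<subseteq> P" using A(1) by (auto simp: subs_def)
  note AS = prod_sg[OF As(1) d(5) A(2)]
  have xc: "x \<in> carrier G" using x sgD(5)[OF d(4)] by simp
  have Sc: "S \<subseteq> carrier G" by (rule sgD(1)[OF d(5)])
  have "A <#> S \<subseteq> P <#> S" by (rule prod_mono[OF As(2) subset_refl])
  then have 1: "P <#> (A <#> S) \<subseteq> P <#> S" by (rule prod_least[OF d(12,16)])
  have "S \<subseteq> A <#> S" by (rule prod_sub2[OF As(1) Sc])
  then have "P <#> S \<subseteq> P <#> (A <#> S)" by (rule prod_mono[OF subset_refl])
  then have e: "P <#> (A <#> S) = P <#> S" using 1 by simp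
  have "P <#> cj x (A <#> S) = cj x P <#> cj x (A <#> S)" using nmlD(2)[OF P xc] by simp
  also have "\<dots> = cj x (P <#> S)" using cj_prod[OF xc sgD(1)[OF d(4)] sgD(1)[OF AS]] e by simp
  also have "\<dots> = P <#> S" using cj_self[OF d(12)] x d(16) by auto
  finally show ?thesis using cj_sg[OF xc AS] by (simp add: fibre_def)
qed

lemma cen_inv: assumes "subgroup P G" "subgroup S G" "A \<subseteq> cen P S" "s \<in> S" shows "cj s A = A"
proof -
  have "s \<otimes> a \<otimes> inv s = a" if "a \<in> A" for a
  proof -
    have "a \<in> P" "a \<otimes> s = s \<otimes> a" using that assms by (auto simp: cen_def)
    then show ?thesis using fixed_iff[of s a] sgD(5)[OF assms(1)] sgD(5)[OF assms(2)] assms(4) by simp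
  qed
  then show ?thesis by (auto simp: cj_def)
qed

text \<open>S is normal in the direct product AS and therefore its only Sylow q-subgroup.\<close>

lemma cen_syl:
  assumes c: "coact p P q S" and A: "subgroup A G" "A \<subseteq> cen P S"
    and T: "subgroup T G" "T \<subseteq> A <#> S" "card T = q ^ j"
  shows "T \<subseteq> S"
proof -
  note d = coactD[OF c]
  have AP: "A \<subseteq> P" using A cen_sub by blast
  have i: "cj s A = A" if "s \<in> S" for s using cen_inv[OF d(4,5) A(2) that] .
  note AS = prod_sg[OF A(1) d(5) i]
  have S2: "S \<subseteq> A <#> S" by (rule prod_sub2[OF A(1) sgD(1)[OF d(5)]])
  have "A <#> S \<subseteq> P <#> S" by (rule prod_mono[OF AP subset_refl])
  then have sy: "is_syl q (A <#> S) S" using syl_mono[OF d(14,12) AS S2] by simp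
  show ?thesis
  proof (rule syl_normal[OF AS sy _ T])
    fix y assume "y \<in> A <#> S"
    then obtain a s where as: "a \<in> A" "s \<in> S" "y = a \<otimes> s" by (rule set_multE)
    have "cj y S = cj a (cj s S)" using as cj_mult sgD(5)[OF A(1)] sgD(1,5)[OF d(5)] by simp
    also have "\<dots> = S" using cj_self[OF d(5) as(2)] coact_nrm[OF c] A(2) as by (auto simp: nrm_def)
    finally show "cj y S = S" .
  qed
qed

text \<open>For a subgroup A of the centralizer of S, the fibre contains the P-conjugates of AS.
Such a conjugate determines the conjugate T of S as its only Sylow q-subgroup, and then A as the
intersection with P after conjugating back to S. If S acts nontrivially, PS itself is not among
them.\<close>

lemma fibre_lower:
  assumes c: "coact p P q S" and P: "nml P"
  shows "card (subs (cen P S)) * card (cjs P S) + (if cen P S = P then 0 else 1) \<le> card (fibre P (P <#> S))"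
proof -
  note d = coactD[OF c]
  let ?C = "cen P S"
  define X where "X T = (SOME x. x \<in> P \<and> cj x S = T)" for T
  have X: "X T \<in> P" "cj (X T) S = T" if T: "T \<in> cjs P S" for T
    using someI_ex[of "\<lambda>x. x \<in> P \<and> cj x S = T"] T unfolding X_def cjs_def by auto
  define g where "g = (\<lambda>(A, T). cj (X T) (A <#> S))"
  have Sc: "S \<subseteq> carrier G" by (rule sgD(1)[OF d(5)])
  have Asub: "subgroup A G" "A \<subseteq> P" "A \<subseteq> ?C" if "A \<in> subs ?C" for A
    using that cen_sub by (auto simp: subs_def)
  have Ainv: "cj s A = A" if "A \<in> subs ?C" "s \<in> S" for A s
    using cen_inv[OF d(4,5) Asub(3)[OF that(1)] that(2)] .
  have AS: "subgroup (A <#> S) G" if "A \<in> subs ?C" for A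
    using prod_sg[OF Asub(1)[OF that] d(5) Ainv[OF that]] .
  have Xc: "X T \<in> carrier G" if "T \<in> cjs P S" for T using X(1)[OF that] sgD(5)[OF d(4)] by simp
  have inT: "T \<subseteq> g (A, T)" if "A \<in> subs ?C" "T \<in> cjs P S" for A T
    using X(2)[OF that(2)] cj_mono[OF prod_sub2[OF Asub(1)[OF that(1)] Sc], of "X T"] by (simp add: g_def)
  have only: "U \<subseteq> T" if A: "A \<in> subs ?C" and T: "T \<in> cjs P S" and U: "U \<in> cjs P S" "U \<subseteq> g (A, T)" for A T U
  proof -
    note x = Xc[OF T]
    have Us: "subgroup U G" "card U = card S" using U(1) sgD(5)[OF d(4)] cj_sg[OF _ d(5)] cj_card[OF _ Sc] by (auto simp: cjs_def)
    obtain k where k: "card S = q ^ k" using d(7) by blast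
    have "cj (inv (X T)) U \<subseteq> cj (inv (X T)) (cj (X T) (A <#> S))" using U(2) cj_mono by (simp add: g_def)
    then have "cj (inv (X T)) U \<subseteq> A <#> S" using cj_inv[OF x sgD(1)[OF AS[OF A]]] by simp
    then have "cj (inv (X T)) U \<subseteq> S"
      using cen_syl[OF c Asub(1,3)[OF A] cj_sg[OF inv_closed[OF x] Us(1)]] cj_card[OF inv_closed[OF x] sgD(1)[OF Us(1)]] Us(2) k by simp
    then have "cj (X T) (cj (inv (X T)) U) \<subseteq> cj (X T) S" by (rule cj_mono)
    then show ?thesis using cj_inv'[OF x sgD(1)[OF Us(1)]] X(2)[OF T] by simp
  qed
  have inj: "inj_on g (subs ?C \<times> cjs P S)"
  proof (rule inj_onI, clarify)
    fix A T B U
    assume a: "A \<in> subs ?C" "T \<in> cjs P S" "B \<in> subs ?C" "U \<in> cjs P S" "g (A, T) = g (B, U)"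
    have "U \<subseteq> T" using only[OF a(1,2,4)] inT[OF a(3,4)] a(5) by simp
    moreover have "T \<subseteq> U" using only[OF a(3,4,2)] inT[OF a(1,2)] a(5) by simp
    ultimately have TU: "T = U" by simp
    then have "A <#> S = B <#> S"
      using a(5) cj_eq_iff[OF Xc[OF a(2)] sgD(1)[OF AS[OF a(1)]] sgD(1)[OF AS[OF a(3)]]] by (simp add: g_def)
    then have "A = B" using prod_Int[OF d(4,5,9) Asub(2)[OF a(1)]] prod_Int[OF d(4,5,9) Asub(2)[OF a(3)]] by metis
    then show "A = B \<and> T = U" using TU by simp
  qed
  have sub: "g ` (subs ?C \<times> cjs P S) \<subseteq> fibre P (P <#> S)"
  proof clarify
    fix A T assume a: "A \<in> subs ?C" "T \<in> cjs P S"
    have "A \<in> subs P" using Asub[OF a(1)] by (simp add: subs_def)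
    then show "g (A, T) \<in> fibre P (P <#> S)" using fibre_mem[OF c P _ Ainv[OF a(1)] X(1)[OF a(2)]] by (simp add: g_def)
  qed
  have fin': "finite (cjs P S)" using sgD(2)[OF d(4)] by (simp add: cjs_def)
  have cg: "card (g ` (subs ?C \<times> cjs P S)) = card (subs ?C) * card (cjs P S)"
    using card_image[OF inj] by (simp add: card_cartesian_product)
  show ?thesis
  proof (cases "?C = P")
    case True
    then show ?thesis using card_mono[OF fibre_finite sub] cg by simp
  next
    case False
    have "P <#> S \<notin> g ` (subs ?C \<times> cjs P S)"
    proof
      assume "P <#> S \<in> g ` (subs ?C \<times> cjs P S)"
      then obtain A T where a: "A \<in> subs ?C" "T \<in> cjs P S" "P <#> S = g (A, T)" by auto
      have "card (P <#> S) = card (A <#> S)"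
        using a cj_card[OF Xc[OF a(2)] sgD(1)[OF AS[OF a(1)]]] by (simp add: g_def)
      moreover have "A <#> S \<subseteq> P <#> S" by (rule prod_mono[OF Asub(2)[OF a(1)] subset_refl])
      ultimately have "A <#> S = P <#> S" using sg_eqI[OF AS[OF a(1)] d(12)] by simp
      then have "A = P" using prod_Int[OF d(4,5,9) Asub(2)[OF a(1)]] prod_Int[OF d(4,5,9) subset_refl] by metis
      then show False using False Asub(3)[OF a(1)] cen_sub by blast
    qed
    moreover have "P <#> S \<in> fibre P (P <#> S)"
      using fibre_mem[OF c P _ d(8) sgD(3)[OF d(4)]] d(4) cj_one[OF sgD(1)[OF d(12)]] by (simp add: subs_def)
    moreover have "finite (g ` (subs ?C \<times> cjs P S))" using finite_subset[OF sub fibre_finite] .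
    ultimately have "card (insert (P <#> S) (g ` (subs ?C \<times> cjs P S))) = Suc (card (g ` (subs ?C \<times> cjs P S)))"
      and "insert (P <#> S) (g ` (subs ?C \<times> cjs P S)) \<subseteq> fibre P (P <#> S)"
      using sub by (simp_all only: card_insert_disjoint insert_subset simp_thms)
    with card_mono[OF fibre_finite, of "insert (P <#> S) (g ` (subs ?C \<times> cjs P S))" P "P <#> S"]
    have "Suc (card (subs ?C) * card (cjs P S)) \<le> card (fibre P (P <#> S))" by (simp only: cg)
    then show ?thesis using False by simp
  qed
qed

lemma coact_ne: assumes "coact p P q S" "cen P S \<noteq> P" shows "P <#> S \<noteq> P"
proof
  note d = coactD[OF assms(1)]
  assume "P <#> S = P"
  then have "S \<subseteq> P \<inter> S" using d(17) by auto
  then have "S = {\<one>}" using d(9) sgD(3)[OF d(5)] by auto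
  then have "cen P S = P" using sgD(5)[OF d(4)] by (auto simp: cen_def)
  then show False using assms(2) by simp
qed

lemma general_bound:
  assumes c: "coact p P q S" and P: "nml P" and nt: "cen P S \<noteq> P"
  shows "card (subs P) + card (subs (cen P S)) * card (cjs P S) + 1 \<le> num_subgroups G"
  using fibre_lower[OF c P] fibre_two[OF coact_ne[OF c nt], of P] fibre_self[OF coactD(4)[OF c]] nt by simp

lemma fibre_trivial:
  assumes c: "coact p P q S" and P: "nml P" and t: "cen P S = P"
  shows "card (fibre P (P <#> S)) = card (subs P)"
proof -
  note d = coactD[OF c]
  have i: "cj s A = A" if "A \<in> subs P" "s \<in> S" for A s
    using cen_inv[OF d(4,5), of A s] t that by (auto simp: subs_def)
  have "fibre P (P <#> S) = (\<lambda>A. A <#> S) ` subs P"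
  proof (intro equalityI subsetI)
    fix H assume H: "H \<in> fibre P (P <#> S)"
    obtain x where x: "x \<in> P" "H = (H \<inter> P) <#> cj x S" using fibre_form[OF c P H] by blast
    have "cj x S = S" using x(1) t coact_nrm[OF c] by (auto simp: nrm_def)
    moreover have "H \<inter> P \<in> subs P" using H sg_Int[OF _ d(4)] by (auto simp: fibre_def subs_def)
    ultimately show "H \<in> (\<lambda>A. A <#> S) ` subs P" using x(2) by auto
  next
    fix H assume "H \<in> (\<lambda>A. A <#> S) ` subs P"
    then obtain A where A: "A \<in> subs P" "H = A <#> S" by blast
    have "subgroup (A <#> S) G" using A prod_sg[OF _ d(5) i] by (auto simp: subs_def)
    then show "H \<in> fibre P (P <#> S)" using fibre_mem[OF c P A(1) i[OF A(1)] sgD(3)[OF d(4)]] A cj_one[OF sgD(1)] by simp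
  qed
  moreover have "inj_on (\<lambda>A. A <#> S) (subs P)"
    by (rule inj_onI) (metis prod_Int[OF d(4,5,9)] subs_def mem_Collect_eq)
  ultimately show ?thesis by (simp add: card_image)
qed

text \<open>S permutes the fibre. If it normalizes H, then S and the Sylow q-subgroups of H are
Sylow subgroups of the normalizer of H, so S lies in H, which is therefore AS for an S-invariant
subgroup A of P. The number of these A is s(P) modulo q.\<close>

lemma fibre_mod:
  assumes c: "coact p P q S" and P: "nml P"
  shows "card (fibre P (P <#> S)) mod q = card (subs P) mod q"
proof -
  note d = coactD[OF c]
  obtain k where k: "card S = q ^ k" using d(7) by blast
  have Pc: "P \<subseteq> carrier G" by (rule sgD(1)[OF d(4)])
  have sc: "s \<in> carrier G" if "s \<in> S" for s using sgD(5)[OF d(5) that] .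
  have ac: "acts S cj (fibre P (P <#> S))"
  proof (rule acts_cj[OF d(5)])
    show "X \<subseteq> carrier G" if "X \<in> fibre P (P <#> S)" for X using that sgD(1) by (auto simp: fibre_def)
    show "cj s X \<in> fibre P (P <#> S)" if s: "s \<in> S" and X: "X \<in> fibre P (P <#> S)" for s X
    proof -
      have Xs: "subgroup X G" "P <#> X = P <#> S" using X by (auto simp: fibre_def)
      have "P <#> cj s X = cj s (P <#> X)" using cj_prod[OF sc[OF s] Pc sgD(1)[OF Xs(1)]] d(8)[OF s] by simp
      also have "\<dots> = P <#> S" using Xs(2) cj_self[OF d(12)] s d(17) by auto
      finally show ?thesis using cj_sg[OF sc[OF s] Xs(1)] by (simp add: fibre_def)
    qed
  qed
  have "{H \<in> fibre P (P <#> S). \<forall>s\<in>S. cj s H = H} = (\<lambda>A. A <#> S) ` {A \<in> subs P. \<forall>s\<in>S. cj s A = A}"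
  proof (intro equalityI subsetI)
    fix H assume "H \<in> {H \<in> fibre P (P <#> S). \<forall>s\<in>S. cj s H = H}"
    then have H: "H \<in> fibre P (P <#> S)" "\<And>s. s \<in> S \<Longrightarrow> cj s H = H" by auto
    then have Hs: "subgroup H G" "P <#> H = P <#> S" by (auto simp: fibre_def)
    have HM: "H \<subseteq> P <#> S" using prod_sub2[OF d(4) sgD(1)[OF Hs(1)]] Hs(2) by simp
    obtain x where x: "x \<in> P" "cj x S \<subseteq> H" using fibre_form[OF c P H(1)] by blast
    let ?N = "nrm (P <#> S) H"
    have N: "subgroup ?N G" by (rule nrm_sg[OF d(12) sgD(1)[OF Hs(1)]])
    have HN: "H \<subseteq> ?N" by (rule sub_nrm[OF Hs(1) HM])
    have xM: "x \<in> P <#> S" using x d(16) by auto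
    have "is_syl q ?N (cj x S)"
      by (rule syl_mono[OF syl_cj[OF d(14,12) xM] d(12) N]) (use x HN nrm_sub in auto)
    moreover have "S \<subseteq> ?N" using H(2) d(17) by (auto simp: nrm_def)
    ultimately obtain y where y: "y \<in> ?N" "S \<subseteq> cj y (cj x S)" using syl_contains[OF N _ d(5) _ k] by blast
    have "cj y (cj x S) \<subseteq> cj y H" by (rule cj_mono[OF x(2)])
    then have SH: "S \<subseteq> H" using y by (auto simp: nrm_def)
    have "H = (H \<inter> P) <#> S" by (rule dedekind[OF Hs(1) d(4,5) SH HM])
    moreover have "H \<inter> P \<in> {A \<in> subs P. \<forall>s\<in>S. cj s A = A}"
      using H(2) d(8) cj_Int[OF sc sgD(1)[OF Hs(1)] Pc] sg_Int[OF Hs(1) d(4)] by (auto simp: subs_def)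
    ultimately show "H \<in> (\<lambda>A. A <#> S) ` {A \<in> subs P. \<forall>s\<in>S. cj s A = A}" by blast
  next
    fix H assume "H \<in> (\<lambda>A. A <#> S) ` {A \<in> subs P. \<forall>s\<in>S. cj s A = A}"
    then obtain A where A: "A \<in> subs P" "\<And>s. s \<in> S \<Longrightarrow> cj s A = A" "H = A <#> S" by blast
    have As: "subgroup A G" using A by (simp add: subs_def)
    have AS: "subgroup (A <#> S) G" using prod_sg[OF As d(5) A(2)] .
    have "cj s H = H" if "s \<in> S" for s
      using A(3) cj_self[OF AS] prod_sub2[OF As sgD(1)[OF d(5)]] that by auto
    then show "H \<in> {H \<in> fibre P (P <#> S). \<forall>s\<in>S. cj s H = H}"
      using fibre_mem[OF c P A(1,2) sgD(3)[OF d(4)]] A(3) cj_one[OF sgD(1)[OF AS]] by simp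
  qed
  moreover have "inj_on (\<lambda>A. A <#> S) {A \<in> subs P. \<forall>s\<in>S. cj s A = A}"
    by (rule inj_onI) (metis (no_types, lifting) prod_Int[OF d(4,5,9)] subs_def mem_Collect_eq)
  ultimately have "card {H \<in> fibre P (P <#> S). \<forall>s\<in>S. cj s H = H} = card {A \<in> subs P. \<forall>s\<in>S. cj s A = A}"
    by (simp add: card_image)
  then show ?thesis
    using fixed_points_mod[OF d(5) k d(2) ac fibre_finite] subs_inv_mod[OF d(5) k d(2,4,8)] by simp
qed

lemma over_normal_form:
  assumes P: "subgroup P G" and Q: "subgroup Q G" "P <#> Q = carrier G" and M: "subgroup M G" "P \<subseteq> M"
  shows "M = P <#> (M \<inter> Q)"
  using dedekind_left[OF P Q(1) M] sgD(1)[OF M(1)] Q(2) by simp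

lemma fibre_dvd_num:
  assumes P: "nml P" and Q: "subgroup Q G" "P <#> Q = carrier G"
    and f: "\<And>S. subgroup S G \<Longrightarrow> S \<subseteq> Q \<Longrightarrow> n dvd card (fibre P (P <#> S))"
  shows "n dvd num_subgroups G"
  unfolding num_eq_sum_fibre[OF P]
proof (rule dvd_sum)
  fix M assume "M \<in> {M. subgroup M G \<and> P \<subseteq> M}"
  then have M: "subgroup M G" "P \<subseteq> M" by auto
  note P' = nmlD[OF P]
  have "M = P <#> (M \<inter> Q)" by (rule over_normal_form[OF P'(1) Q M])
  then show "n dvd card (fibre P M)" using f[OF sg_Int[OF M(1) Q(1)]] by simp
qed

text \<open>Every fibre over P is a fibre over PS for some S in Q, and so has s(P) elements modulo
q.\<close>

lemma dvd_subs_imp_dvd_num: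
  assumes c: "coact p P q Q" and P: "nml P" and G: "P <#> Q = carrier G" and dv: "q dvd card (subs P)"
  shows "q dvd num_subgroups G"
proof (rule fibre_dvd_num[OF P coactD(5)[OF c] G])
  note d = coactD[OF c]
  fix S assume S: "subgroup S G" "S \<subseteq> Q"
  obtain k where "card Q = q ^ k" using d(7) by blast
  then have "card S dvd q ^ k" using sg_dvd[OF S(1) d(5) S(2)] by simp
  then obtain j where "card S = q ^ j" using d(2) by (auto simp: divides_primepow_nat)
  then have "coact p P q S" using c S by (auto simp: coact_def)
  then show "q dvd card (fibre P (P <#> S))" using fibre_mod[OF _ P] dv by (metis dvd_eq_mod_eq_0)
qed

section \<open>Complements of abelian normal subgroups\<close>

lemma conj_finprod:
  assumes P: "subgroup P G" "\<And>x y. x \<in> P \<Longrightarrow> y \<in> P \<Longrightarrow> x \<otimes> y = y \<otimes> x" and g: "g \<in> carrier G" "cj g P = P"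
  shows "finite A \<Longrightarrow> f \<in> A \<rightarrow> P \<Longrightarrow> finprod (G\<lparr>carrier := P\<rparr>) f A \<in> P \<and>
    finprod (G\<lparr>carrier := P\<rparr>) (\<lambda>c. g \<otimes> f c \<otimes> inv g) A = g \<otimes> finprod (G\<lparr>carrier := P\<rparr>) f A \<otimes> inv g"
proof (induction A rule: finite_induct)
  case empty
  interpret H: group "G\<lparr>carrier := P\<rparr>" by (rule subgroup_imp_group[OF P(1)])
  interpret H: comm_group "G\<lparr>carrier := P\<rparr>" by (rule H.group_comm_groupI) (simp add: P(2))
  show ?case using g sgD(3)[OF P(1)] by simp
next
  case (insert a A)
  interpret H: group "G\<lparr>carrier := P\<rparr>" by (rule subgroup_imp_group[OF P(1)])
  interpret H: comm_group "G\<lparr>carrier := P\<rparr>" by (rule H.group_comm_groupI) (simp add: P(2))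
  have gP: "g \<otimes> x \<otimes> inv g \<in> P" if "x \<in> P" for x using g(2) that by (auto simp: cj_def)
  have f: "f \<in> A \<rightarrow> P" "f a \<in> P" using insert by auto
  let ?F = "finprod (G\<lparr>carrier := P\<rparr>) f A"
  have F: "?F \<in> P" using insert f by blast
  have "finprod (G\<lparr>carrier := P\<rparr>) (\<lambda>c. g \<otimes> f c \<otimes> inv g) (insert a A)
      = (g \<otimes> f a \<otimes> inv g) \<otimes> (g \<otimes> ?F \<otimes> inv g)"
    using insert f gP by (subst H.finprod_insert) (auto simp: Pi_def)
  also have "\<dots> = g \<otimes> (f a \<otimes> ?F) \<otimes> inv g"
    using g f F sgD(5)[OF P(1)] by (simp add: m_assoc) (metis inv_closed l_inv l_one m_assoc m_closed)
  also have "f a \<otimes> ?F = finprod (G\<lparr>carrier := P\<rparr>) f (insert a A)"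
    using insert f by (subst H.finprod_insert) (auto simp: Pi_def)
  finally show ?case using H.finprod_closed[of f "insert a A"] insert.prems by simp
qed

lemma pow_inj_coprime:
  assumes P: "subgroup P G" and "coprime (card P) n" "u \<in> P" "u [^] (n::nat) = \<one>" shows "u = \<one>"
proof -
  have u: "u \<in> carrier G" using assms(3) sgD(5)[OF P] by simp
  have "ord u dvd n" "ord u dvd card P" using pow_eq_id[OF u] assms(4) pow_card_one[OF P assms(3)] by auto
  then have "ord u = 1" using assms(2) by (metis coprime_common_divisor_nat)
  then show ?thesis using ord_eq_1[OF u] by simp
qed

text \<open>This is the Schur-Zassenhaus theorem for an abelian normal subgroup. Let \<tau> choose
a representative of each coset of P in M. The product h(g) over all cosets c of the elements
\<open>g \<otimes> \<tau> (g\<inverse> c) \<otimes> (\<tau> c)\<inverse>\<close> of P is a crossed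
homomorphism from M to P, and h(u) is the n-th power of u for u in P, where n is the index of P in
M. As n is prime to the order of P, this is a bijection of P, and the elements with trivial h form
a complement.\<close>

lemma abelian_complement:
  assumes M: "subgroup M G" and P: "subgroup P G" "P \<subseteq> M" "\<And>x. x \<in> M \<Longrightarrow> cj x P = P"
    and ab: "\<And>x y. x \<in> P \<Longrightarrow> y \<in> P \<Longrightarrow> x \<otimes> y = y \<otimes> x" and cop: "coprime (card P) (card M div card P)"
  shows "\<exists>T. subgroup T G \<and> T \<subseteq> M \<and> P \<inter> T = {\<one>} \<and> P <#> T = M"
proof -
  let ?P = "G\<lparr>carrier := P\<rparr>"
  interpret H: group ?P by (rule subgroup_imp_group[OF P(1)])
  interpret H: comm_group ?P by (rule H.group_comm_groupI) (simp add: ab)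
  have Pc: "P \<subseteq> carrier G" by (rule sgD(1)[OF P(1)])
  have Mc: "x \<in> carrier G" if "x \<in> M" for x using sgD(5)[OF M that] .
  define R where "R = (\<lambda>x. lc x P) ` M"
  define n where "n = card R"
  define \<tau> where "\<tau> c = (SOME y. y \<in> c)" for c :: "'a set"
  define k where "k g c = g \<otimes> \<tau> (lc (inv g) c) \<otimes> inv (\<tau> c)" for g c
  define h where "h g = finprod ?P (k g) R" for g
  have fR: "finite R" unfolding R_def using sgD(2)[OF M] by simp
  have Rn: "c \<noteq> {}" if "c \<in> R" for c using that sgD(3)[OF P(1)] by (auto simp: R_def l_coset_def)
  have RM: "c \<subseteq> M" if "c \<in> R" for c using that P(2) sgD(7)[OF M] by (auto simp: R_def l_coset_def)
  have \<tau>: "\<tau> c \<in> c" if "c \<in> R" for c unfolding \<tau>_def using Rn[OF that] by (simp add: some_in_eq)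
  have \<tau>c: "\<tau> c \<in> M" "\<tau> c \<in> carrier G" if "c \<in> R" for c using \<tau>[OF that] RM[OF that] Mc by auto
  have Rl: "lc g c \<in> R" if "g \<in> M" "c \<in> R" for g c
    using that Mc Pc sgD(7)[OF M] by (auto simp: R_def lcos_m_assoc)
  have Rll: "lc g (lc g' c) = lc (g \<otimes> g') c" if "g \<in> M" "g' \<in> M" "c \<in> R" for g g' c
    using that RM[OF that(3)] Mc by (intro lcos_m_assoc) auto
  have R1: "lc \<one> c = c" if "c \<in> R" for c using that RM[OF that] Mc by (intro lcos_mult_one) auto
  have quot: "a \<otimes> inv b \<in> P" if c: "c \<in> R" and ab': "a \<in> c" "b \<in> c" for a b c
  proof -
    obtain x where x: "x \<in> M" "c = lc x P" using c by (auto simp: R_def)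
    obtain u v where uv: "u \<in> P" "v \<in> P" "a = x \<otimes> u" "b = x \<otimes> v" using ab' x by (auto simp: l_coset_def)
    have "a \<otimes> inv b = x \<otimes> (u \<otimes> inv v) \<otimes> inv x" using uv Mc[OF x(1)] sgD(5)[OF P(1)] by (simp add: inv_mult_group m_assoc)
    moreover have "u \<otimes> inv v \<in> P" using uv sgD(6,7)[OF P(1)] by auto
    ultimately have "a \<otimes> inv b \<in> cj x P" by (auto simp: cj_def)
    then show ?thesis using P(3)[OF x(1)] by simp
  qed
  have kP: "k g c \<in> P" if g: "g \<in> M" and c: "c \<in> R" for g c
  proof -
    have d: "lc (inv g) c \<in> R" using Rl[OF sgD(6)[OF M g] c] .
    have "g \<otimes> \<tau> (lc (inv g) c) \<in> lc g (lc (inv g) c)" using \<tau>[OF d] by (auto simp: l_coset_def)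
    also have "lc g (lc (inv g) c) = c" using Rll[OF g sgD(6)[OF M g] c] R1[OF c] Mc[OF g] by simp
    finally show ?thesis using quot[OF c _ \<tau>[OF c]] by (simp add: k_def)
  qed
  have hP: "h g \<in> P" if "g \<in> M" for g
    using H.finprod_closed[of "k g" R] kP[OF that] by (simp add: h_def Pi_def)
  \<comment> \<open>The factors of the left hand side match those of the right hand side up to the
    permutation of the cosets by g.\<close>
  have cross: "h (g \<otimes> g') = (g \<otimes> h g' \<otimes> inv g) \<otimes> h g" if g: "g \<in> M" "g' \<in> M" for g g'
  proof -
    have gc: "g \<in> carrier G" "g' \<in> carrier G" using g Mc by auto
    have gi: "inv g \<in> M" using sgD(6)[OF M g(1)] .
    have inj: "inj_on (lc (inv g)) R"
    proof (rule inj_onI)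
      fix c d assume "c \<in> R" "d \<in> R" "lc (inv g) c = lc (inv g) d"
      then have "lc g (lc (inv g) c) = lc g (lc (inv g) d)" by simp
      then show "c = d" using Rll[OF g(1) gi] R1 gc \<open>c \<in> R\<close> \<open>d \<in> R\<close> by simp
    qed
    have im: "lc (inv g) ` R = R"
      by (rule endo_inj_surj[OF fR _ inj]) (use Rl[OF gi] in auto)
    have 1: "k (g \<otimes> g') c = (g \<otimes> k g' (lc (inv g) c) \<otimes> inv g) \<otimes> k g c" if c: "c \<in> R" for c
    proof -
      have d: "lc (inv g) c \<in> R" using Rl[OF gi c] .
      have e: "lc (inv g') (lc (inv g) c) \<in> R" using Rl[OF sgD(6)[OF M g(2)] d] .
      have "lc (inv (g \<otimes> g')) c = lc (inv g') (lc (inv g) c)"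
        using Rll[OF sgD(6)[OF M g(2)] gi c] gc by (simp add: inv_mult_group)
      then have "k (g \<otimes> g') c = g \<otimes> g' \<otimes> \<tau> (lc (inv g') (lc (inv g) c)) \<otimes> inv (\<tau> c)" by (simp add: k_def)
      also have "\<dots> = (g \<otimes> k g' (lc (inv g) c) \<otimes> inv g) \<otimes> k g c"
      proof -
        let ?a = "\<tau> (lc (inv g') (lc (inv g) c))" and ?b = "\<tau> (lc (inv g) c)"
        have ab'': "?a \<in> carrier G" "?b \<in> carrier G" "\<tau> c \<in> carrier G" using \<tau>c e d c by auto
        have "(g \<otimes> (g' \<otimes> ?a \<otimes> inv ?b) \<otimes> inv g) \<otimes> (g \<otimes> ?b \<otimes> inv (\<tau> c))
          = g \<otimes> g' \<otimes> ?a \<otimes> (inv ?b \<otimes> ((inv g \<otimes> g) \<otimes> ?b)) \<otimes> inv (\<tau> c)"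
          using gc ab'' by (simp only: m_assoc m_closed inv_closed)
        then show ?thesis using gc ab'' by (simp add: k_def)
      qed
      finally show ?thesis .
    qed
    let ?f = "\<lambda>c. k g' (lc (inv g) c)"
    have fP: "?f \<in> R \<rightarrow> P" using kP[OF g(2)] Rl[OF gi] by auto
    have gP: "g \<otimes> x \<otimes> inv g \<in> P" if "x \<in> P" for x using P(3)[OF g(1)] that by (auto simp: cj_def)
    have "h (g \<otimes> g') = finprod ?P (\<lambda>c. (g \<otimes> ?f c \<otimes> inv g) \<otimes>\<^bsub>?P\<^esub> k g c) R"
      unfolding h_def by (rule H.finprod_cong') (use 1 gP fP kP[OF g(1)] sgD(7)[OF P(1)] in \<open>auto simp: Pi_def\<close>)
    also have "\<dots> = finprod ?P (\<lambda>c. g \<otimes> ?f c \<otimes> inv g) R \<otimes> finprod ?P (k g) R"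
      by (subst H.finprod_multf) (use gP fP kP[OF g(1)] in \<open>auto simp: Pi_def\<close>)
    also have "finprod ?P (\<lambda>c. g \<otimes> ?f c \<otimes> inv g) R = g \<otimes> finprod ?P ?f R \<otimes> inv g"
      using conj_finprod[OF P(1) ab gc(1) P(3)[OF g(1)] fR fP] by blast
    also have "finprod ?P ?f R = finprod ?P (k g') R"
      using H.finprod_reindex[of "k g'" "lc (inv g)" R] im inj kP[OF g(2)] by (simp add: Pi_def)
    finally show ?thesis by (simp add: h_def)
  qed
  have hu: "h u = u [^] n" if u: "u \<in> P" for u
  proof -
    have uM: "u \<in> M" using u P(2) by auto
    have "k u c = u" if c: "c \<in> R" for c
    proof -
      obtain x where x: "x \<in> M" "c = lc x P" using c by (auto simp: R_def)
      have xc: "x \<in> carrier G" "u \<in> carrier G" using x uM Mc by auto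
      have "inv x \<otimes> inv u \<otimes> inv (inv x) \<in> P"
        using P(3)[OF sgD(6)[OF M x(1)]] sgD(6)[OF P(1) u] by (auto simp: cj_def)
      then have b: "inv x \<otimes> inv u \<otimes> x \<in> P" using xc by simp
      have "inv u \<otimes> x = x \<otimes> (inv x \<otimes> inv u \<otimes> x)" using xc by (simp add: m_assoc[symmetric])
      then have "lc (inv u) c = lc x (lc (inv x \<otimes> inv u \<otimes> x) P)" using x(2) xc Pc by (simp add: lcos_m_assoc)
      also have "lc (inv x \<otimes> inv u \<otimes> x) P = P" using lc_eq_iff[OF P(1), of "inv x \<otimes> inv u \<otimes> x"] b xc by simp
      finally show ?thesis using x \<tau>c(2)[OF c] xc by (simp add: k_def m_assoc)
    qed
    then have "h u = finprod ?P (\<lambda>_. u) R" unfolding h_def by (intro H.finprod_cong') (use u in auto)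
    also have "\<dots> = u [^]\<^bsub>?P\<^esub> n" using H.finprod_const[of u R] u by (simp add: n_def)
    finally show ?thesis by (simp add: nat_pow_consistent[symmetric])
  qed
  have nM: "n * card P = card M"
    using coset_fixed(1)[OF M P(1,2) sg_one, of 2 0] sgD(3)[OF M] by (simp add: n_def R_def)
  then have cn: "coprime (card P) n" using cop sgD(4)[OF P(1)] by (metis nonzero_mult_div_cancel_right not_gr_zero)
  define T where "T = {g \<in> M. h g = \<one>}"
  have h1: "h \<one> = \<one>" using hu[OF sgD(3)[OF P(1)]] by simp
  have T: "subgroup T G"
  proof (rule subgroupI)
    show "T \<subseteq> carrier G" using Mc by (auto simp: T_def)
    show "T \<noteq> {}" using h1 sgD(3)[OF M] by (auto simp: T_def)
    show "a \<otimes> b \<in> T" if "a \<in> T" "b \<in> T" for a b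
      using that cross[of a b] sgD(7)[OF M] Mc by (auto simp: T_def)
    show "inv a \<in> T" if a: "a \<in> T" for a
    proof -
      have aM: "a \<in> M" "h a = \<one>" "inv a \<in> M" using a sgD(6)[OF M] by (auto simp: T_def)
      have "h (inv a \<otimes> a) = h (inv a)" using cross[OF aM(3,1)] aM(2) hP[OF aM(3)] Mc[OF aM(1)] sgD(5)[OF P(1)] by simp
      then show ?thesis using aM h1 Mc by (simp add: T_def)
    qed
  qed
  have "P \<inter> T = {\<one>}"
  proof -
    have "u = \<one>" if "u \<in> P \<inter> T" for u
    proof (rule pow_inj_coprime[OF P(1) cn])
      show "u \<in> P" using that by simp
      then show "u [^] n = \<one>" using hu that by (simp add: T_def)
    qed
    moreover have "\<one> \<in> P \<inter> T" using sgD(3)[OF P(1)] sgD(3)[OF T] by simp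
    ultimately show ?thesis by blast
  qed
  moreover have "P <#> T = M"
  proof
    show "P <#> T \<subseteq> M" by (rule prod_least[OF M P(2)]) (auto simp: T_def)
    show "M \<subseteq> P <#> T"
    proof
      fix g assume g: "g \<in> M"
      have inj: "inj_on (\<lambda>u. u [^] n) P"
      proof (rule inj_onI)
        fix u v assume uv: "u \<in> P" "v \<in> P" "u [^] n = v [^] n"
        have c: "u \<in> carrier G" "v \<in> carrier G" using uv Pc by auto
        have "(u \<otimes> inv v) [^] n = u [^] n \<otimes> inv v [^] n"
          by (rule pow_mult_distrib) (use uv c ab sgD(6)[OF P(1)] in auto)
        then have "(u \<otimes> inv v) [^] n = \<one>" using uv(3) c by (simp add: nat_pow_inv)
        then have "u \<otimes> inv v = \<one>" using pow_inj_coprime[OF P(1) cn] uv sgD(6,7)[OF P(1)] by auto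
        then show "u = v" using c by (metis inv_closed inv_equality inv_inv)
      qed
      have "(\<lambda>u. u [^] n) ` P = P"
        by (rule endo_inj_surj[OF sgD(2)[OF P(1)] _ inj]) (use sg_pow[OF P(1)] in auto)
      then obtain u where u: "u \<in> P" "inv (h g) = u [^] n" using sgD(6)[OF P(1) hP[OF g]] by blast
      have uM: "u \<in> M" using u P(2) by auto
      have c: "u \<in> carrier G" "g \<in> carrier G" "h g \<in> carrier G" using u Pc Mc[OF g] hP[OF g] by auto
      have "h (u \<otimes> g) = (u \<otimes> h g \<otimes> inv u) \<otimes> inv (h g)" using cross[OF uM g] hu[OF u(1)] u(2) by simp
      also have "u \<otimes> h g \<otimes> inv u = h g" using ab[OF u(1) hP[OF g]] c by (simp add: m_assoc)
      finally have "u \<otimes> g \<in> T" using c sgD(7)[OF M uM g] by (simp add: T_def)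
      moreover have "g = inv u \<otimes> (u \<otimes> g)" using c by (simp add: m_assoc[symmetric])
      ultimately show "g \<in> P <#> T" using sgD(6)[OF P(1) u(1)] by (metis set_multI)
    qed
  qed
  moreover have "T \<subseteq> M" by (auto simp: T_def)
  ultimately show ?thesis using T by blast
qed

section \<open>Direct products and the existence of a nontrivial action\<close>

lemma prod_Int2:
  assumes P: "subgroup P G" and S: "subgroup S G" and "P \<inter> S = {\<one>}" "E \<subseteq> S"
  shows "(P <#> E) \<inter> S = E"
proof
  show "E \<subseteq> (P <#> E) \<inter> S" using prod_sub2[OF P, of E] assms sgD(1)[OF S] by auto
  show "(P <#> E) \<inter> S \<subseteq> E"
  proof
    fix x assume x: "x \<in> (P <#> E) \<inter> S"
    then obtain a s where as: "a \<in> P" "s \<in> E" "x = a \<otimes> s" by (meson set_multE IntD1)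
    have sS: "s \<in> S" using as assms(4) by auto
    have xc: "x \<in> carrier G" using x sgD(5)[OF S] by simp
    then have "\<one> \<otimes> x = a \<otimes> s" using as by simp
    then have "x = s" using prod_unique[OF P S assms(3), of \<one> a x s] x as sS sgD(3)[OF P] by auto
    then show "x \<in> E" using as by simp
  qed
qed

lemma card_subs_ge2: assumes "subgroup P G" "P \<noteq> {\<one>}" shows "card (subs P) \<ge> 2"
proof -
  have "{P, {\<one>}} \<subseteq> subs P" using assms sg_one sgD(3) by (auto simp: subs_def)
  then have "card {P, {\<one>}} \<le> card (subs P)" by (rule card_mono[OF subs_finite])
  then show ?thesis using assms(2) by simp
qed

text \<open>By Bezout's identity both components of an element of the product are powers of it, so
that every subgroup is the product of its intersections with the factors.\<close>

lemma coprime_direct_product_count: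
  assumes P: "subgroup P G" and T: "subgroup T G" and cop: "coprime (card P) (card T)"
    and com: "\<And>x t. x \<in> P \<Longrightarrow> t \<in> T \<Longrightarrow> x \<otimes> t = t \<otimes> x" and G: "P <#> T = carrier G"
  shows "num_subgroups G = card (subs P) * card (subs T)"
proof -
  have i: "P \<inter> T = {\<one>}" by (rule sg_coprime_Int[OF P T cop])
  have inv: "cj t A = A" if "A \<subseteq> P" "t \<in> T" for A t
  proof -
    have "t \<otimes> a \<otimes> inv t = a" if "a \<in> A" for a
      using that \<open>A \<subseteq> P\<close> com[of a t] \<open>t \<in> T\<close> fixed_iff[of t a] sgD(5)[OF P] sgD(5)[OF T] by auto
    then show ?thesis by (auto simp: cj_def)
  qed
  have "bij_betw (\<lambda>(A, E). A <#> E) (subs P \<times> subs T) (subs (carrier G))"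
  proof (rule bij_betw_byWitness[where f' = "\<lambda>H. (H \<inter> P, H \<inter> T)"])
    show "\<forall>x\<in>subs P \<times> subs T. (\<lambda>H. (H \<inter> P, H \<inter> T)) (case x of (A, E) \<Rightarrow> A <#> E) = x"
    proof
      fix x assume "x \<in> subs P \<times> subs T"
      then obtain A E where x: "x = (A, E)" "A \<in> subs P" "E \<in> subs T" by blast
      then have a: "subgroup A G" "A \<subseteq> P" "subgroup E G" "E \<subseteq> T" by (auto simp: subs_def)
      have "P \<inter> E = {\<one>}" "A \<inter> T = {\<one>}" using a i sgD(3)[OF a(1)] sgD(3)[OF a(3)] by auto
      then show "(\<lambda>H. (H \<inter> P, H \<inter> T)) (case x of (A, E) \<Rightarrow> A <#> E) = x"
        unfolding x(1) using prod_Int[OF P a(3) _ a(2)] prod_Int2[OF a(1) T _ a(4)] by simp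
    qed
    show "\<forall>H\<in>subs (carrier G). (case (H \<inter> P, H \<inter> T) of (A, E) \<Rightarrow> A <#> E) = H"
    proof
      fix H assume "H \<in> subs (carrier G)"
      then have H: "subgroup H G" by (simp add: subs_def)
      have "H \<subseteq> (H \<inter> P) <#> (H \<inter> T)"
      proof
        fix h assume h: "h \<in> H"
        then have "h \<in> P <#> T" using G sgD(5)[OF H] by simp
        then obtain x t where xt: "x \<in> P" "t \<in> T" "h = x \<otimes> t" by (rule set_multE)
        have c: "x \<in> carrier G" "t \<in> carrier G" using xt sgD(5)[OF P] sgD(5)[OF T] by auto
        obtain u v where uv: "card T * u = card P * v + 1"
          using bezout_nat[of "card T" "card P"] cop sgD(4)[OF T] by (auto simp: coprime_iff_gcd_eq_1 gcd.commute)
        have "h [^] (card T * u) = x [^] (card T * u) \<otimes> t [^] (card T * u)"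
          using pow_mult_distrib[OF com[OF xt(1,2)] c] xt(3) by simp
        also have "t [^] (card T * u) = \<one>"
          using c pow_card_one[OF T xt(2)] by (simp add: nat_pow_pow[symmetric])
        also have "x [^] (card T * u) = x [^] (card P * v) \<otimes> x" using uv c by simp
        also have "x [^] (card P * v) = \<one>"
          using c pow_card_one[OF P xt(1)] by (simp add: nat_pow_pow[symmetric])
        finally have "x = h [^] (card T * u)" using c by simp
        then have xH: "x \<in> H" using sg_pow[OF H h] by simp
        have "t = inv x \<otimes> h" using xt c by (simp add: m_assoc[symmetric])
        then have "t \<in> H" using xH h sgD(6,7)[OF H] by simp
        then show "h \<in> (H \<inter> P) <#> (H \<inter> T)" using xt xH by (auto intro: set_multI)
      qed
      moreover have "(H \<inter> P) <#> (H \<inter> T) \<subseteq> H" by (rule prod_least[OF H]) auto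
      ultimately show "(case (H \<inter> P, H \<inter> T) of (A, E) \<Rightarrow> A <#> E) = H" by simp
    qed
    show "(\<lambda>(A, E). A <#> E) ` (subs P \<times> subs T) \<subseteq> subs (carrier G)"
    proof clarify
      fix A E assume "A \<in> subs P" "E \<in> subs T"
      then have a: "subgroup A G" "A \<subseteq> P" "subgroup E G" "E \<subseteq> T" by (auto simp: subs_def)
      have "subgroup (A <#> E) G" by (rule prod_sg[OF a(1,3)]) (use inv[OF a(2)] a(4) in auto)
      then show "A <#> E \<in> subs (carrier G)" using sgD(1) by (simp add: subs_def)
    qed
    show "(\<lambda>H. (H \<inter> P, H \<inter> T)) ` subs (carrier G) \<subseteq> subs P \<times> subs T"
      using sg_Int[OF _ P] sg_Int[OF _ T] by (auto simp: subs_def)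
  qed
  from bij_betw_same_card[OF this] show ?thesis by (simp add: card_cartesian_product subs_carrier)
qed

lemma cen_nml: assumes "nml P" shows "nml (cen (carrier G) P)"
proof (rule nmlI)
  note P = nmlD[OF assms]
  show "subgroup (cen (carrier G) P) G" by (rule cen_sg[OF sg_carrier sgD(1)[OF P(1)]])
  fix x assume x: "x \<in> carrier G"
  show "cj x (cen (carrier G) P) \<subseteq> cen (carrier G) P"
  proof
    fix y assume "y \<in> cj x (cen (carrier G) P)"
    then obtain d where d: "d \<in> carrier G" "\<And>h. h \<in> P \<Longrightarrow> d \<otimes> h = h \<otimes> d" "y = x \<otimes> d \<otimes> inv x"
      by (auto simp: cj_def cen_def)
    have "y \<otimes> h = h \<otimes> y" if h: "h \<in> P" for h
    proof -
      have hc: "h \<in> carrier G" using h sgD(5)[OF P(1)] by simp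
      have "inv x \<otimes> h \<otimes> inv (inv x) \<in> P" using P(2)[of "inv x"] x h by (auto simp: cj_def)
      then have b: "d \<otimes> (inv x \<otimes> h \<otimes> x) = (inv x \<otimes> h \<otimes> x) \<otimes> d" using d(2) x by simp
      have "y \<otimes> h = x \<otimes> (d \<otimes> (inv x \<otimes> h \<otimes> x)) \<otimes> inv x"
        using d x hc by (simp add: m_assoc)
      also have "\<dots> = h \<otimes> y" unfolding b using d x hc by (simp add: m_assoc[symmetric])
      finally show ?thesis .
    qed
    then show "y \<in> cen (carrier G) P" using d x by (simp add: cen_def)
  qed
qed

text \<open>Otherwise the product of P with its centralizer contains a Sylow subgroup for every
prime, and is G. The center of P is then a normal Sylow subgroup of the centralizer and has a
complement T there. So G is the direct product of P and T, and the number of subgroups is a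
product of two factors greater than 1.\<close>

lemma prime_count_nontrivial_action:
  assumes num: "prime (num_subgroups G)" and P: "nml P" "is_syl p (carrier G) P" and ne: "P \<noteq> {\<one>}" "P \<noteq> carrier G"
  shows "\<exists>q S. prime q \<and> q \<noteq> p \<and> is_syl q (carrier G) S \<and> cen P S \<noteq> P"
proof (rule ccontr)
  assume "\<not> ?thesis"
  then have tr: "cen P S = P" if "prime q" "q \<noteq> p" "is_syl q (carrier G) S" for q S using that by blast
  note P' = nmlD[OF P(1)]
  have Pc: "P \<subseteq> carrier G" by (rule sgD(1)[OF P'(1)])
  let ?D = "cen (carrier G) P"
  note D = nmlD[OF cen_nml[OF P(1)]]
  have p: "prime p" using sylD[OF P(2)] by simp
  obtain m where m: "card P = p ^ m" using sylD(5)[OF P(2)] by blast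
  have PD: "subgroup (P <#> ?D) G" by (rule nml_prod[OF P(1) D(1)])
  have G: "P <#> ?D = carrier G"
  proof (rule sg_eqI[OF PD sg_carrier sgD(1)[OF PD]], rule ccontr)
    assume "\<not> card (carrier G) \<le> card (P <#> ?D)"
    moreover have dv: "card (P <#> ?D) dvd card (carrier G)" by (rule sg_dvd_carrier[OF PD])
    ultimately have "card (carrier G) div card (P <#> ?D) \<noteq> 1" using dvd_div_mult_self[OF dv] by auto
    then obtain r where r: "prime r" "r dvd card (carrier G) div card (P <#> ?D)" using prime_factor_nat by blast
    obtain S where S: "is_syl r (carrier G) S" using syl_ex[OF sg_carrier r(1)] by blast
    have SD: "S \<subseteq> P <#> ?D"
    proof (cases "r = p")
      case True
      then obtain x where "x \<in> carrier G" "S = cj x P" using syl_conj[OF sg_carrier P(2)] S by blast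
      then have "S = P" using P'(2) by simp
      then show ?thesis using prod_sub1[OF D(1) Pc] by simp
    next
      case False
      have "x \<otimes> s = s \<otimes> x" if "x \<in> P" "s \<in> S" for x s
        using tr[OF r(1) False S] that unfolding cen_def by blast
      then have "S \<subseteq> ?D" using sylD(2)[OF S] by (auto simp: cen_def)
      then show ?thesis using prod_sub2[OF P'(1) sgD(1)[OF D(1)]] by auto
    qed
    have "card (carrier G) div card (P <#> ?D) dvd card (carrier G) div card S"
    proof -
      obtain a where a: "card (P <#> ?D) = card S * a" using sg_dvd[OF sylD(1)[OF S] PD SD] by blast
      obtain b where b: "card (carrier G) = card (P <#> ?D) * b" using dv by blast
      have "card (carrier G) div card (P <#> ?D) = b" using b sgD(4)[OF PD] by simp
      moreover have "card (carrier G) div card S = a * b" using a b sgD(4)[OF sylD(1)[OF S]] by (simp add: mult.assoc)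
      ultimately show ?thesis by simp
    qed
    then show False using r(2) sylD(4)[OF S] by (meson dvd_trans)
  qed
  \<comment> \<open>Z is the center of P, and its index in the centralizer of P is the index of P
    in G.\<close>
  define Z where "Z = ?D \<inter> P"
  have Z: "subgroup Z G" unfolding Z_def by (rule sg_Int[OF D(1) P'(1)])
  have cZ: "card (carrier G) * card Z = card P * card ?D"
    using nml_prod_card[OF P(1) D(1)] G by (simp add: Z_def)
  have "card P dvd card (carrier G)" by (rule sg_dvd_carrier[OF P'(1)])
  then have cG: "card (carrier G) = card P * (card (carrier G) div card P)" by (rule dvd_mult_div_cancel[symmetric])
  have cD: "card ?D = (card (carrier G) div card P) * card Z"
  proof -
    have "card P * card ?D = card P * ((card (carrier G) div card P) * card Z)"
      using cZ cG by (metis mult.assoc)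
    then show ?thesis using sgD(4)[OF P'(1)] by (simp only: mult_cancel1) simp
  qed
  have nd: "\<not> p dvd card (carrier G) div card P" using sylD(4)[OF P(2)] .
  have cp: "coprime (p ^ j) (card (carrier G) div card P)" for j
    using nd p by (simp add: prime_imp_coprime)
  have "card Z dvd p ^ m" using sg_dvd[OF Z P'(1)] m by (auto simp: Z_def)
  then obtain j where j: "card Z = p ^ j" using p by (auto simp: divides_primepow_nat)
  have "\<exists>T. subgroup T G \<and> T \<subseteq> ?D \<and> Z \<inter> T = {\<one>} \<and> Z <#> T = ?D"
  proof (rule abelian_complement[OF D(1) Z])
    show "Z \<subseteq> ?D" by (auto simp: Z_def)
    show "cj x Z = Z" if "x \<in> ?D" for x
    proof -
      have xc: "x \<in> carrier G" using that by (simp add: cen_def)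
      show ?thesis unfolding Z_def cj_Int[OF xc sgD(1)[OF D(1)] Pc] D(2)[OF xc] P'(2)[OF xc] by (rule refl)
    qed
    show "x \<otimes> y = y \<otimes> x" if "x \<in> Z" "y \<in> Z" for x y using that unfolding Z_def cen_def by blast
    have "card ?D div card Z = card (carrier G) div card P" using cD sgD(4)[OF Z] by simp
    then show "coprime (card Z) (card ?D div card Z)" using cp[of j] j by simp
  qed
  then obtain T where T: "subgroup T G" "T \<subseteq> ?D" "Z \<inter> T = {\<one>}" "Z <#> T = ?D" by blast
  have Tn: "card Z * card T = card ?D" using prod_card[OF Z T(1,3)] T(4) by simp
  then have "card Z * card T = card Z * (card (carrier G) div card P)" using cD by (simp only: mult.commute)
  then have "card T = card (carrier G) div card P" using sgD(4)[OF Z] by (simp only: mult_cancel1) simp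
  then have cop: "coprime (card P) (card T)" using cp[of m] m by simp
  have com: "x \<otimes> t = t \<otimes> x" if "x \<in> P" "t \<in> T" for x t
  proof -
    have "t \<in> ?D" using that T(2) by blast
    then show ?thesis using that(1) unfolding cen_def by simp
  qed
  have "carrier G \<subseteq> P <#> T"
  proof
    fix g assume "g \<in> carrier G"
    then obtain x d where xd: "x \<in> P" "d \<in> ?D" "g = x \<otimes> d" using G by (metis set_multE)
    then obtain z t where zt: "z \<in> Z" "t \<in> T" "d = z \<otimes> t" using T(4) by (metis set_multE)
    have "g = (x \<otimes> z) \<otimes> t" using xd zt sgD(5)[OF P'(1)] sgD(5)[OF Z] sgD(5)[OF T(1)] by (simp add: m_assoc)
    moreover have "x \<otimes> z \<in> P" using xd zt sgD(7)[OF P'(1)] by (auto simp: Z_def)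
    ultimately show "g \<in> P <#> T" using zt set_multI by metis
  qed
  then have PT: "P <#> T = carrier G" using prod_least[OF sg_carrier Pc sgD(1)[OF T(1)]] by auto
  have "T \<noteq> {\<one>}"
  proof
    assume "T = {\<one>}"
    then have "P <#> T \<subseteq> P" using prod_least[OF P'(1) subset_refl, of T] sgD(3)[OF P'(1)] by simp
    then show False using PT ne(2) Pc by auto
  qed
  then have "card (subs T) \<ge> 2" by (rule card_subs_ge2[OF T(1)])
  moreover have "card (subs P) \<ge> 2" by (rule card_subs_ge2[OF P'(1) ne(1)])
  ultimately show False
    using num coprime_direct_product_count[OF P'(1) T(1) cop com PT] by (auto simp: prime_product dest: prime_product)
qed

text \<open>Let D be a complement of P. As P is abelian, \<theta> sending bd to the product of the
inverse of b with d is an automorphism of order two. It fixes exactly the subgroups of D and the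
subgroups containing P, and both kinds are equally many. The other subgroups are permuted in
pairs.\<close>

lemma even_subs_normal_sylow_prime_order:
  assumes P: "nml P" "is_syl p (carrier G) P" "card P = p" and odd: "odd p"
  shows "even (num_subgroups G)"
proof -
  note P' = nmlD[OF P(1)]
  have p: "prime p" using sylD[OF P(2)] by simp
  have Pc: "P \<subseteq> carrier G" by (rule sgD(1)[OF P'(1)])
  have ex: "\<exists>x\<in>P. x \<noteq> \<one>"
  proof (rule ccontr)
    assume "\<not> ?thesis"
    then have "P \<subseteq> {\<one>}" by blast
    then have "card P \<le> 1" using card_mono[of "{\<one>}" P] by simp
    then show False using P(3) prime_ge_2_nat[OF p] by simp
  qed
  have sub_dich: "H \<inter> P = {\<one>} \<or> P \<subseteq> H" if H: "subgroup H G" for H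
  proof -
    have HP: "subgroup (H \<inter> P) G" by (rule sg_Int[OF H P'(1)])
    have "card (H \<inter> P) dvd p" using sg_dvd[OF HP P'(1)] P(3) by simp
    then have "card (H \<inter> P) = 1 \<or> card (H \<inter> P) = p" using p by (simp add: prime_nat_iff)
    then show ?thesis using sg_card1[OF HP] sg_eqI[OF HP P'(1)] P(3) by auto
  qed
  have ab: "x \<otimes> y = y \<otimes> x" if "x \<in> P" "y \<in> P" for x y
  proof -
    obtain z where z: "z \<in> P" "z \<noteq> \<one>" using ex by blast
    have zc: "z \<in> carrier G" using z Pc by auto
    have "P \<subseteq> cyc z" using sub_dich[OF cyc_sg[OF zc]] cyc_self[of z] z by blast
    then show ?thesis using cyc_comm[OF zc] that by blast
  qed
  have "coprime (card P) (card (carrier G) div card P)"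
    using P(3) sylD(4)[OF P(2)] p by (simp add: prime_imp_coprime)
  then obtain D where D: "subgroup D G" "P \<inter> D = {\<one>}" "P <#> D = carrier G"
    using abelian_complement[OF sg_carrier P'(1) Pc P'(2) ab] by blast
  define \<theta> where "\<theta> g = (THE y. \<exists>b\<in>P. \<exists>d\<in>D. g = b \<otimes> d \<and> y = inv b \<otimes> d)" for g
  have \<theta>: "\<theta> (b \<otimes> d) = inv b \<otimes> d" if "b \<in> P" "d \<in> D" for b d
    unfolding \<theta>_def using that prod_unique[OF P'(1) D(1,2)] by (intro the_equality) blast+
  have decomp: "\<exists>b\<in>P. \<exists>d\<in>D. g = b \<otimes> d" if "g \<in> carrier G" for g
    using that D(3) by (metis set_multE)
  have cs: "b \<in> P \<Longrightarrow> b \<in> carrier G" "d \<in> D \<Longrightarrow> d \<in> carrier G" for b d using Pc sgD(5)[OF D(1)] by auto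
  have \<theta>c: "\<theta> g \<in> carrier G" "\<theta> (\<theta> g) = g" if g: "g \<in> carrier G" for g
  proof -
    obtain b d where bd: "b \<in> P" "d \<in> D" "g = b \<otimes> d" using decomp[OF g] by blast
    show "\<theta> g \<in> carrier G" using bd \<theta> cs by simp
    show "\<theta> (\<theta> g) = g" using bd \<theta>[OF bd(1,2)] \<theta>[OF sgD(6)[OF P'(1) bd(1)] bd(2)] cs by simp
  qed
  have \<theta>hom: "\<theta> (g \<otimes> g') = \<theta> g \<otimes> \<theta> g'" if g: "g \<in> carrier G" "g' \<in> carrier G" for g g'
  proof -
    obtain b d where bd: "b \<in> P" "d \<in> D" "g = b \<otimes> d" using decomp[OF g(1)] by blast
    obtain b' d' where bd': "b' \<in> P" "d' \<in> D" "g' = b' \<otimes> d'" using decomp[OF g(2)] by blast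
    have c: "b \<in> carrier G" "d \<in> carrier G" "b' \<in> carrier G" "d' \<in> carrier G" using bd bd' cs by auto
    let ?u = "d \<otimes> b' \<otimes> inv d"
    have u: "?u \<in> P" using P'(2)[OF c(2)] bd' by (auto simp: cj_def)
    have uc: "?u \<in> carrier G" using u cs by simp
    have "g \<otimes> g' = (b \<otimes> ?u) \<otimes> (d \<otimes> d')"
      using c bd bd' by (simp add: m_assoc) (metis inv_closed l_inv l_one m_assoc m_closed)
    then have "\<theta> (g \<otimes> g') = inv (b \<otimes> ?u) \<otimes> (d \<otimes> d')"
      using \<theta> bd bd' u sgD(7)[OF P'(1)] sgD(7)[OF D(1)] by simp
    also have "inv (b \<otimes> ?u) = inv b \<otimes> inv ?u"
      using ab[OF bd(1) u] c uc by (metis inv_mult_group)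
    also have "inv ?u = d \<otimes> inv b' \<otimes> inv d" using c by (simp add: inv_mult_group m_assoc)
    also have "inv b \<otimes> (d \<otimes> inv b' \<otimes> inv d) \<otimes> (d \<otimes> d') = (inv b \<otimes> d) \<otimes> (inv b' \<otimes> d')"
      using c by (simp add: m_assoc) (metis inv_closed l_inv l_one m_assoc m_closed)
    finally show ?thesis using bd bd' \<theta> by simp
  qed
  have img: "subgroup (\<theta> ` H) G" if H: "subgroup H G" for H
  proof -
    interpret h: group_hom G G \<theta>
      by unfold_locales (use \<theta>c \<theta>hom in \<open>auto simp: hom_def\<close>)
    show ?thesis by (rule h.subgroup_img_is_subgroup[OF H])
  qed
  have 1: "card (subs (carrier G)) mod 2 = card {H \<in> subs (carrier G). \<theta> ` H = H} mod 2"
  proof (rule involution_parity[OF subs_finite])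
    show "\<theta> ` H \<in> subs (carrier G)" if "H \<in> subs (carrier G)" for H
      using that img sgD(1) by (simp add: subs_def)
    show "\<theta> ` \<theta> ` H = H" if "H \<in> subs (carrier G)" for H
    proof -
      have "\<theta> (\<theta> h) = h" if "h \<in> H" for h
        using \<theta>c(2) sgD(5)[of H h] that \<open>H \<in> subs (carrier G)\<close> by (simp add: subs_def)
      then show ?thesis by (simp add: image_image)
    qed
  qed
  have fx: "\<theta> ` H = H \<longleftrightarrow> H \<subseteq> D \<or> P \<subseteq> H" if H: "subgroup H G" for H
  proof
    assume e: "\<theta> ` H = H"
    show "H \<subseteq> D \<or> P \<subseteq> H"
    proof (cases "P \<subseteq> H")
      case False
      then have i: "H \<inter> P = {\<one>}" using sub_dich[OF H] by simp
      have "h \<in> D" if h: "h \<in> H" for h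
      proof -
        obtain b d where bd: "b \<in> P" "d \<in> D" "h = b \<otimes> d" using decomp sgD(5)[OF H h] by blast
        have bc: "b \<in> carrier G" "d \<in> carrier G" using bd cs by auto
        \<comment> \<open>If H contains bd and its image, it contains the square of b, which
          generates the same subgroup as b.\<close>
        have "inv b \<otimes> d \<in> H" using e h bd \<theta> by force
        then have "h \<otimes> inv (inv b \<otimes> d) \<in> H" using h sgD(6,7)[OF H] by simp
        moreover have "h \<otimes> inv (inv b \<otimes> d) = b [^] (2::nat)"
          using bd bc by (simp add: inv_mult_group m_assoc numeral_2_eq_2) (simp add: m_assoc[symmetric])
        ultimately have b2: "b [^] (2::nat) \<in> H \<inter> P" using sg_pow[OF P'(1) bd(1)] by simp
        have "coprime (card P) 2" using odd P(3) by (simp only: coprime_right_2_iff_odd simp_thms)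
        moreover have "b [^] (2::nat) = \<one>" using b2 i by (metis singletonD)
        ultimately have "b = \<one>" by (rule pow_inj_coprime[OF P'(1) _ bd(1)])
        then show ?thesis using bd bc by simp
      qed
      then show ?thesis by blast
    qed simp
  next
    assume "H \<subseteq> D \<or> P \<subseteq> H"
    then have "\<theta> h \<in> H" if h: "h \<in> H" for h
    proof
      assume HD: "H \<subseteq> D"
      then have "\<theta> (\<one> \<otimes> h) = inv \<one> \<otimes> h" using h by (intro \<theta>[OF sgD(3)[OF P'(1)]]) auto
      then show ?thesis using h sgD(5)[OF H] by simp
    next
      assume PH: "P \<subseteq> H"
      obtain b d where bd: "b \<in> P" "d \<in> D" "h = b \<otimes> d" using decomp sgD(5)[OF H h] by blast
      have "d = inv b \<otimes> h" using bd cs by (simp add: m_assoc[symmetric])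
      then have "d \<in> H" "b \<in> H" using bd(1) PH h sgD(6,7)[OF H] by (metis subsetD)+
      then show ?thesis using bd \<theta> sgD(6,7)[OF H] by simp
    qed
    then have "\<theta> ` H \<subseteq> H" by blast
    moreover have "H \<subseteq> \<theta> ` H"
    proof
      fix h assume "h \<in> H"
      then have "\<theta> h \<in> H" "h = \<theta> (\<theta> h)" using \<open>\<theta> ` H \<subseteq> H\<close> \<theta>c(2) sgD(5)[OF H] by auto
      then show "h \<in> \<theta> ` H" by blast
    qed
    ultimately show "\<theta> ` H = H" by simp
  qed
  let ?U = "{H. subgroup H G \<and> P \<subseteq> H}"
  have fe: "{H \<in> subs (carrier G). \<theta> ` H = H} = subs D \<union> ?U"
    unfolding subs_def using fx sgD(1) by blast
  have fU: "finite ?U" by (rule finite_subset[OF _ subs_finite[of "carrier G"]]) (auto simp: subs_def dest: sgD(1))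
  have dj: "subs D \<inter> ?U = {}"
  proof (rule ccontr)
    assume "subs D \<inter> ?U \<noteq> {}"
    then have "P \<subseteq> D" by (auto simp: subs_def)
    then show False using D(2) ex by blast
  qed
  have "bij_betw (\<lambda>H. H \<inter> D) ?U (subs D)"
  proof (rule bij_betw_byWitness[where f' = "\<lambda>E. P <#> E"])
    show "\<forall>H\<in>?U. P <#> (H \<inter> D) = H" using over_normal_form[OF P'(1) D(1,3)] by blast
    show "\<forall>E\<in>subs D. (P <#> E) \<inter> D = E" using prod_Int2[OF P'(1) D(1,2)] by (auto simp: subs_def)
    show "(\<lambda>H. H \<inter> D) ` ?U \<subseteq> subs D" using sg_Int[OF _ D(1)] by (auto simp: subs_def)
    show "(\<lambda>E. P <#> E) ` subs D \<subseteq> ?U"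
      using nml_prod[OF P(1)] prod_sub1[OF _ Pc] by (auto simp: subs_def)
  qed
  then have "card ?U = card (subs D)" by (rule bij_betw_same_card)
  then have "card {H \<in> subs (carrier G). \<theta> ` H = H} = 2 * card (subs D)"
    unfolding fe using card_Un_disjoint[OF subs_finite fU dj] by simp
  then show ?thesis using 1 by (simp add: subs_carrier even_iff_mod_2_eq_zero)
qed

section \<open>Normal Sylow subgroups for primes above 3\<close>

lemma Syl_finite [simp]: "finite (Syl q M)"
  by (rule finite_subset[OF _ subs_finite[of M]]) (auto simp: Syl_def subs_def is_syl_def)

lemma Syl_ge: assumes "is_syl r (carrier G) R" "\<not> nml R" shows "card (Syl r (carrier G)) \<ge> r + 1"
proof -
  note s = sylD[OF assms(1)]
  have m: "card (Syl r (carrier G)) mod r = 1" by (rule Syl_count_mod[OF sg_carrier assms(1)])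
  have "card (Syl r (carrier G)) \<noteq> 1"
  proof
    assume "card (Syl r (carrier G)) = 1"
    then obtain T where T: "Syl r (carrier G) = {T}" by (rule card_1_singletonE)
    have "cj x R = R" if "x \<in> carrier G" for x
      using T syl_cj[OF assms(1) sg_carrier that] assms(1) unfolding Syl_def by blast
    then show False using assms(2) s(1) by (simp add: nml_def)
  qed
  moreover have "card (Syl r (carrier G)) \<noteq> 0" using m prime_gt_1_nat[OF s(3)] by (intro notI) simp
  ultimately show ?thesis using m prime_gt_1_nat[OF s(3)]
    by (metis One_nat_def Suc_eq_plus1 Suc_leI less_one linorder_neqE_nat mod_less not_less_eq mod_self neq0_conv)
qed

lemma syl_coact: assumes "nml P" "is_syl p (carrier G) P" "is_syl q (carrier G) S" "q \<noteq> p" shows "coact p P q S"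
  using coactI[OF assms(1) sylD(3)[OF assms(2)] sylD(3)[OF assms(3)] _ _ sylD(1)[OF assms(3)]]
    assms(4) sylD(5)[OF assms(2)] sylD(5)[OF assms(3)] by blast

lemma syl_nontrivial: assumes "is_syl r (carrier G) R" "r dvd card (carrier G)" shows "R \<noteq> {\<one>}"
proof
  assume "R = {\<one>}"
  then have "\<not> r dvd card (carrier G)" using sylD(4)[OF assms(1)] by simp
  then show False using assms(2) by simp
qed

lemma prod_neq:
  assumes c: "coact p P q S" and c': "coact p P r R" and ne: "q \<noteq> r" "S \<noteq> {\<one>}"
  shows "P <#> S \<noteq> P <#> R"
proof
  assume "P <#> S = P <#> R"
  then have e: "card S = card R" using coactD(13)[OF c] coactD(13)[OF c'] sgD(4)[OF coactD(4)[OF c]] by simp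
  obtain k j where kj: "card S = q ^ k" "card R = r ^ j" using coactD(7)[OF c] coactD(7)[OF c'] by blast
  have "coprime (q ^ k) (r ^ j)" using primes_coprime[OF coactD(2)[OF c] coactD(2)[OF c'] ne(1)] by simp
  then have "coprime (card S) (card S)" using e kj by metis
  then have "card S = 1" by simp
  then show False using ne(2) sg_card1[OF coactD(5)[OF c]] by simp
qed

lemma two_prime_product:
  assumes P: "nml P" "is_syl p (carrier G) P" and S: "is_syl q (carrier G) S" and "q \<noteq> p"
    and pr: "\<And>r. prime r \<Longrightarrow> r dvd card (carrier G) \<Longrightarrow> r = p \<or> r = q"
  shows "P <#> S = carrier G"
proof -
  note c = coactD[OF syl_coact[OF P S assms(4)]]
  show ?thesis
  proof (rule sg_eqI[OF c(12) sg_carrier sgD(1)[OF c(12)]], rule ccontr)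
    assume "\<not> card (carrier G) \<le> card (P <#> S)"
    moreover obtain b where b: "card (carrier G) = card (P <#> S) * b" using sg_dvd_carrier[OF c(12)] by blast
    ultimately have "b \<noteq> 1" by auto
    then obtain r where r: "prime r" "r dvd b" using prime_factor_nat by blast
    have "r = p \<or> r = q" using pr[OF r(1)] r(2) b by simp
    moreover have "card (carrier G) div card P = card S * b" "card (carrier G) div card S = card P * b"
      using b c(13) sgD(4)[OF c(4)] sgD(4)[OF c(5)] by simp_all
    then have "\<not> p dvd card S * b" "\<not> q dvd card P * b" using sylD(4)[OF P(2)] sylD(4)[OF S] by simp_all
    ultimately show False using r(2) by auto
  qed
qed

text \<open>There are at least r + 1 Sylow r-subgroups; each of them centralizes P, so that its
products with the subgroups of P are subgroups, all different and in fibres other than the one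
over M.\<close>

lemma centralized_sylow_count:
  assumes P: "nml P" "is_syl p (carrier G) P" and R: "is_syl r (carrier G) R" "r \<noteq> p" "cen P R = P" "\<not> nml R"
    and M: "\<And>R'. R' \<in> Syl r (carrier G) \<Longrightarrow> P <#> R' \<noteq> M"
  shows "(r + 1) * card (subs P) + card (fibre P M) \<le> num_subgroups G"
proof -
  note P' = nmlD[OF P(1)]
  have tr: "is_syl r (carrier G) R'" "coact p P r R'" "cen P R' = P" if R': "R' \<in> Syl r (carrier G)" for R'
  proof -
    show 1: "is_syl r (carrier G) R'" using R' by (simp add: Syl_def)
    show c: "coact p P r R'" by (rule syl_coact[OF P 1 R(2)])
    obtain g where g: "g \<in> carrier G" "R' = cj g R" using syl_conj[OF sg_carrier R(1) 1] by blast
    have "x \<otimes> h = h \<otimes> x" if x: "x \<in> P" and h: "h \<in> R'" for x h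
    proof -
      obtain t where t: "t \<in> R" "h = g \<otimes> t \<otimes> inv g" using h g(2) by (auto simp: cj_def)
      have xc: "x \<in> carrier G" "t \<in> carrier G" using x t sgD(5)[OF P'(1)] sgD(5)[OF sylD(1)[OF R(1)]] by auto
      have "inv g \<otimes> x \<otimes> inv (inv g) \<in> P" using P'(2)[of "inv g"] g(1) x by (auto simp: cj_def)
      then have "inv g \<otimes> x \<otimes> g \<in> cen P R" using R(3) g(1) by simp
      then have e: "(inv g \<otimes> x \<otimes> g) \<otimes> t = t \<otimes> (inv g \<otimes> x \<otimes> g)" using t(1) unfolding cen_def by blast
      have "x \<otimes> h = g \<otimes> ((inv g \<otimes> x \<otimes> g) \<otimes> t) \<otimes> inv g" using t xc g(1) by (simp add: m_assoc[symmetric])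
      also have "\<dots> = h \<otimes> x" unfolding e using t xc g(1) by (simp add: m_assoc)
      finally show ?thesis .
    qed
    then show "cen P R' = P" unfolding cen_def by blast
  qed
  let ?g = "\<lambda>(A, R'). A <#> R'"
  have AR: "subgroup (A <#> R') G" "R' \<subseteq> A <#> R'" "(A <#> R') \<inter> P = A" "P <#> (A <#> R') = P <#> R'"
    if a: "A \<in> subs P" "R' \<in> Syl r (carrier G)" for A R'
  proof -
    note c = coactD[OF tr(2)[OF a(2)]]
    have A: "subgroup A G" "A \<subseteq> P" using a by (auto simp: subs_def)
    have i: "cj s A = A" if "s \<in> R'" for s using cen_inv[OF c(4,5) _ that] A(2) tr(3)[OF a(2)] by simp
    show 1: "subgroup (A <#> R') G" by (rule prod_sg[OF A(1) c(5) i])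
    show "R' \<subseteq> A <#> R'" by (rule prod_sub2[OF A(1) sgD(1)[OF c(5)]])
    show "(A <#> R') \<inter> P = A" by (rule prod_Int[OF c(4,5,9) A(2)])
    show "P <#> (A <#> R') = P <#> R'"
      using fibre_mem[OF tr(2)[OF a(2)] P(1) a(1) i sgD(3)[OF c(4)]] cj_one[OF sgD(1)[OF 1]] by (simp add: fibre_def)
  qed
  have inj: "inj_on ?g (subs P \<times> Syl r (carrier G))"
  proof (rule inj_onI, clarify)
    fix A T B U assume a: "A \<in> subs P" "T \<in> Syl r (carrier G)" "B \<in> subs P" "U \<in> Syl r (carrier G)" "A <#> T = B <#> U"
    have AB: "A = B" using AR(3)[OF a(1,2)] AR(3)[OF a(3,4)] a(5) by metis
    obtain k where k: "card U = r ^ k" using coactD(7)[OF tr(2)[OF a(4)]] by blast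
    have "U \<subseteq> T"
    proof (rule cen_syl[OF tr(2)[OF a(2)] _ _ coactD(5)[OF tr(2)[OF a(4)]] _ k])
      show "subgroup A G" "A \<subseteq> cen P T" using a(1) tr(3)[OF a(2)] by (auto simp: subs_def)
      show "U \<subseteq> A <#> T" using AR(2)[OF a(3,4)] a(5) by simp
    qed
    then have "U = T" using sg_eqI[OF sylD(1)[OF tr(1)[OF a(4)]] sylD(1)[OF tr(1)[OF a(2)]]]
        syl_card_eq[OF tr(1)[OF a(2)] tr(1)[OF a(4)] sg_carrier] by simp
    then show "A = B \<and> T = U" using AB by simp
  qed
  have im: "?g ` (subs P \<times> Syl r (carrier G)) \<subseteq> subs (carrier G)"
    using AR(1) sgD(1) by (auto simp: subs_def)
  have dj: "?g ` (subs P \<times> Syl r (carrier G)) \<inter> fibre P M = {}"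
  proof (rule equals0I)
    fix H assume "H \<in> ?g ` (subs P \<times> Syl r (carrier G)) \<inter> fibre P M"
    then obtain A T where a: "A \<in> subs P" "T \<in> Syl r (carrier G)" "P <#> (A <#> T) = M" by (auto simp: fibre_def)
    then show False using AR(4)[OF a(1,2)] M[OF a(2)] by simp
  qed
  have "card (subs P) * card (Syl r (carrier G)) + card (fibre P M) = card (?g ` (subs P \<times> Syl r (carrier G)) \<union> fibre P M)"
    using card_image[OF inj] dj by (subst card_Un_disjoint) (auto simp: card_cartesian_product)
  also have "\<dots> \<le> num_subgroups G" unfolding subs_carrier using im fibre_subs by (intro card_mono) auto
  finally have "card (subs P) * card (Syl r (carrier G)) + card (fibre P M) \<le> num_subgroups G" .
  moreover have "card (subs P) * (r + 1) \<le> card (subs P) * card (Syl r (carrier G))"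
    using Syl_ge[OF R(1,4)] by (rule mult_le_mono2)
  ultimately show ?thesis by (simp add: mult.commute)
qed

text \<open>A nontrivial centralizer would contain the only subgroup of order p of the cyclic
group P, and S would centralize P by \<open>cyc_centralized\<close>.\<close>

lemma cyclic_cen_trivial:
  assumes c: "coact p P q S" and P: "x \<in> P" "P = cyc x" and nt: "cen P S \<noteq> P"
  shows "cen P S = {\<one>}"
proof (rule ccontr)
  assume n1: "cen P S \<noteq> {\<one>}"
  note d = coactD[OF c]
  have xc: "x \<in> carrier G" using P sgD(5)[OF d(4)] by simp
  obtain m where m: "card P = p ^ m" using d(6) by blast
  obtain k where k: "card S = q ^ k" using d(7) by blast
  have "card (cen P S) dvd p ^ m" using sg_dvd[OF d(15,4) cen_sub] m by simp
  then obtain j where j: "card (cen P S) = p ^ j" using d(1) by (auto simp: divides_primepow_nat)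
  have "j \<noteq> 0" using j n1 sg_card1[OF d(15)] by (intro notI) simp
  then have "p ^ 1 dvd card (cen P S)" using j by (simp add: dvd_power)
  then obtain A where A: "subgroup A G" "A \<subseteq> cen P S" "card A = p"
    using sg_exists_prime_power[OF d(15,1), of 1] by auto
  have AP: "A \<subseteq> cyc x" using A(2) cen_sub[of P S] P(2) by auto
  have fx: "s \<otimes> z \<otimes> inv s = z" if "z \<in> cen P S" "s \<in> S" for s z
  proof -
    have "z \<otimes> s = s \<otimes> z" "z \<in> P" using that unfolding cen_def by blast+
    then show ?thesis using fixed_iff[of s z] that sgD(5)[OF d(4)] sgD(5)[OF d(5)] by simp
  qed
  have "\<forall>s\<in>S. s \<otimes> x \<otimes> inv s = x"
  proof (rule cyc_centralized[OF d(1,2,3,5) k xc])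
    show "x [^] (p ^ m) = \<one>" using pow_card_one[OF d(4) P(1)] m by simp
    show "\<forall>s\<in>S. s \<otimes> x \<otimes> inv s \<in> cyc x" using d(8) P by (auto simp: cj_def)
    show "\<forall>z\<in>cyc x. z [^] p = \<one> \<longrightarrow> (\<forall>s\<in>S. s \<otimes> z \<otimes> inv s = z)"
    proof (intro ballI impI)
      fix z s assume z: "z \<in> cyc x" "z [^] p = \<one>" and s: "s \<in> S"
      have zc: "z \<in> carrier G" using z(1) sgD(5)[OF cyc_sg[OF xc]] by simp
      show "s \<otimes> z \<otimes> inv s = z"
      proof (cases "z = \<one>")
        case True
        then show ?thesis using s sgD(5)[OF d(5)] by simp
      next
        case False
        have "ord z dvd p" using pow_eq_id[OF zc] z(2) by simp
        then have "ord z = 1 \<or> ord z = p" using d(1) by (metis prime_nat_iff)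
        then have "ord z = p" using False ord_eq_1[OF zc] by blast
        then have "card (cyc z) = p" using generate_pow_card[OF zc] by simp
        then have "cyc z = A"
          using cyc_prime_subgroup_unique[OF xc _ d(1) cyc_sg[OF zc] _ _ A(1) AP A(3), of m] m P(2)
            cyc_least[OF cyc_sg[OF xc] z(1)] by simp
        then show ?thesis using fx[OF _ s] A(2) cyc_self[of z] by auto
      qed
    qed
  qed
  then have "x \<in> cen P S" using P(1) fixed_iff[OF _ xc] sgD(5)[OF d(5)] by (auto simp: cen_def)
  then have "P \<subseteq> cen P S" using cyc_least[OF d(15)] P(2) by simp
  then show False using nt cen_sub[of P S] by auto
qed

text \<open>The subgroups of order p meet trivially, so there are at most p + 1 of them.\<close>

lemma card_subs_prime_square:
  assumes P: "subgroup P G" "card P = p ^ 2" "prime p" and nc: "\<And>x. x \<in> P \<Longrightarrow> P \<noteq> cyc x"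
  shows "card (subs P) = p + 3"
proof (rule antisym)
  have p2: "p \<ge> 2" using prime_ge_2_nat[OF P(3)] .
  let ?O = "{A \<in> subs P. card A = p}"
  have O: "subgroup A G" "A \<subseteq> P" "card A = p" if "A \<in> ?O" for A using that by (auto simp: subs_def)
  have int: "(A - {\<one>}) \<inter> (B - {\<one>}) = {}" if "A \<in> ?O" "B \<in> ?O" "A \<noteq> B" for A B
  proof -
    have i: "subgroup (A \<inter> B) G" by (rule sg_Int[OF O(1)[OF that(1)] O(1)[OF that(2)]])
    have "card (A \<inter> B) dvd p" using sg_dvd[OF i O(1)[OF that(1)]] O(3)[OF that(1)] by simp
    then have "card (A \<inter> B) = 1 \<or> card (A \<inter> B) = p" using P(3) by (simp add: prime_nat_iff)
    moreover have "card (A \<inter> B) \<noteq> p"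
    proof
      assume e: "card (A \<inter> B) = p"
      have "A \<inter> B = A" by (rule sg_eqI[OF i O(1)[OF that(1)]]) (use e O(3)[OF that(1)] in auto)
      moreover have "A \<inter> B = B" by (rule sg_eqI[OF i O(1)[OF that(2)]]) (use e O(3)[OF that(2)] in auto)
      ultimately show False using that(3) by simp
    qed
    ultimately show ?thesis using sg_card1[OF i] by auto
  qed
  have "card ?O * (p - 1) = (\<Sum>A\<in>?O. card (A - {\<one>}))"
    using O(3) sgD(3)[OF O(1)] by (simp add: card_Diff_singleton)
  also have "\<dots> = card (\<Union>A\<in>?O. A - {\<one>})"
  proof (rule card_UN_disjoint[symmetric])
    show "finite ?O" by simp
    show "\<forall>A\<in>?O. finite (A - {\<one>})" using sgD(2)[OF O(1)] by blast
    show "\<forall>A\<in>?O. \<forall>B\<in>?O. A \<noteq> B \<longrightarrow> (A - {\<one>}) \<inter> (B - {\<one>}) = {}" using int by blast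
  qed
  also have "\<dots> \<le> card (P - {\<one>})"
  proof (rule card_mono)
    show "finite (P - {\<one>})" using sgD(2)[OF P(1)] by simp
    show "(\<Union>A\<in>?O. A - {\<one>}) \<subseteq> P - {\<one>}" using O(2) by blast
  qed
  also have "\<dots> = p ^ 2 - 1" using P(2) sgD(3)[OF P(1)] by (simp add: card_Diff_singleton)
  also have "\<dots> = (p + 1) * (p - 1)" by (simp add: power2_eq_square algebra_simps)
  finally have "card ?O * (p - 1) \<le> (p + 1) * (p - 1)" .
  then have "0 < p - 1 \<longrightarrow> card ?O \<le> p + 1" by (simp only: mult_le_cancel2)
  then have "card ?O \<le> p + 1" using p2 by simp
  moreover have "subs P \<subseteq> insert {\<one>} (insert P ?O)"
  proof
    fix A assume A: "A \<in> subs P"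
    then have As: "subgroup A G" "A \<subseteq> P" by (auto simp: subs_def)
    have "card A dvd p ^ 2" using sg_dvd[OF As(1) P(1) As(2)] P(2) by simp
    then obtain i where i: "card A = p ^ i" "i \<le> 2" using P(3) by (auto simp: divides_primepow_nat)
    then consider "i = 0" | "i = 1" | "i = 2" by linarith
    then show "A \<in> insert {\<one>} (insert P ?O)"
    proof cases
      case 1 then show ?thesis using i sg_card1[OF As(1)] by simp
    next
      case 2 then show ?thesis using i A by simp
    next
      case 3 then show ?thesis using i P(2) sg_eqI[OF As(1) P(1) As(2)] by simp
    qed
  qed
  then have "card (subs P) \<le> card (insert {\<one>} (insert P ?O))" by (intro card_mono) auto
  moreover have "card (insert {\<one>} (insert P ?O)) \<le> card ?O + 2"
  proof -
    have "card (insert {\<one>} (insert P ?O)) \<le> Suc (card (insert P ?O))" by (rule card_insert_le_m1) simp_all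
    moreover have "card (insert P ?O) \<le> Suc (card ?O)" by (rule card_insert_le_m1) simp_all
    ultimately show ?thesis by linarith
  qed
  ultimately show "card (subs P) \<le> p + 3" by linarith
  show "p + 3 \<le> card (subs P)" by (rule noncyclic_card_subs[OF P(1,2,3) nc])
qed

lemma card_subs_pos: "subgroup P G \<Longrightarrow> card (subs P) \<ge> 1"
proof -
  assume "subgroup P G"
  then have "subs P \<noteq> {}" by (auto simp: subs_def)
  then show ?thesis using card_gt_0_iff[of "subs P"] by simp
qed

lemma card_subs_ge3:
  assumes C: "subgroup C G" "card C = p ^ j" "prime p" "j \<ge> 2" shows "card (subs C) \<ge> 3"
proof -
  have "p ^ 1 dvd card C" unfolding C(2) using C(4) by (intro le_imp_power_dvd) simp
  then obtain A where A: "subgroup A G" "A \<subseteq> C" "card A = p ^ 1" using sg_exists_prime_power[OF C(1,3)] by blast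
  have p: "p \<ge> 2" using prime_ge_2_nat[OF C(3)] .
  have "p ^ 1 < p ^ j" using p C(4) by (intro power_strict_increasing) auto
  then have "A \<noteq> C" "A \<noteq> {\<one>}" "C \<noteq> {\<one>}" using A C p by auto
  then have "card {A, C, {\<one>}} = 3" by simp
  moreover have "{A, C, {\<one>}} \<subseteq> subs C" using A C sg_one sgD(3) by (auto simp: subs_def)
  ultimately show ?thesis using card_mono[OF subs_finite] by metis
qed

text \<open>Let n be the index of the centralizer of S in P. The order of P is not p by parity,
and n \<le> 21 gives n = p. If P were cyclic, the centralizer would be trivial and n the order of
P; so s(P) \<ge> p + 3, and p + 3 + 2p + 1 \<le> 23 gives p = 5. This forces q = 2, the order 25
for P, and s(P) = 8. A third prime would yield one more large fibre, so G = PS, and s(G) is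
even.\<close>

theorem no_normal_sylow_ge5:
  assumes num: "num_subgroups G = 23" and P: "nml P" "is_syl p (carrier G) P" "p \<ge> 5" and ne: "P \<noteq> {\<one>}" "P \<noteq> carrier G"
  shows False
proof -
  have p23: "prime (num_subgroups G)" unfolding num by simp
  obtain q S where S: "prime q" "q \<noteq> p" "is_syl q (carrier G) S" "cen P S \<noteq> P"
    using prime_count_nontrivial_action[OF p23 P(1,2) ne] by blast
  note c = syl_coact[OF P(1,2) S(3,2)]
  note d = coactD[OF c]
  obtain m where m: "card P = p ^ m" using d(6) by blast
  have m0: "m \<noteq> 0" using m ne(1) sg_card1[OF d(4)] by (intro notI) simp
  have m1: "m \<noteq> 1"
  proof
    assume "m = 1"
    then have "even (num_subgroups G)"
      using even_subs_normal_sylow_prime_order[OF P(1,2)] m P(3) prime_odd_nat[OF d(1)] by simp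
    then show False using num by simp
  qed
  have m2: "m \<ge> 2" using m0 m1 by linarith
  define n where "n = card (cjs P S)"
  define s where "s = card (subs P)"
  define t where "t = card (subs (cen P S))"
  have bd: "s + t * n + 1 \<le> 23" using general_bound[OF c P(1) S(4)] num by (simp add: n_def s_def t_def)
  have t1: "t \<ge> 1" unfolding t_def by (rule card_subs_pos[OF d(15)])
  have s1: "s \<ge> 1" unfolding s_def by (rule card_subs_pos[OF d(4)])
  have big: "p ^ a \<ge> 25" if "a \<ge> 2" for a
  proof -
    have "(5::nat) ^ 2 \<le> p ^ 2" using P(3) by (intro power_mono) auto
    also have "\<dots> \<le> p ^ a" using that P(3) by (intro power_increasing) auto
    finally show ?thesis by simp
  qed
  have nle: "n \<le> 21"
  proof -
    have "1 * n \<le> t * n" using t1 by (intro mult_right_mono) auto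
    then show ?thesis using bd s1 by linarith
  qed
  obtain a where a: "a > 0" "n = p ^ a" using coact_index(1)[OF c S(4)] by (auto simp: n_def)
  have a1: "a = 1"
  proof (rule ccontr)
    assume "a \<noteq> 1"
    then have "p ^ a \<ge> 25" using a(1) by (intro big) simp
    then show False using nle a(2) by simp
  qed
  have np: "n = p" using a a1 by simp
  have nc: "n * card (cen P S) = p ^ m" using coact_card[OF c] m by (simp add: n_def)
  have noncyc: "P \<noteq> cyc x" if "x \<in> P" for x
  proof
    assume "P = cyc x"
    then have "cen P S = {\<one>}" using cyclic_cen_trivial[OF c that _ S(4)] by simp
    then have "n = p ^ m" using nc by simp
    then show False using big[OF m2] nle by simp
  qed
  have sp: "s \<ge> p + 3" unfolding s_def by (rule noncyclic_card_subs[OF d(4) m d(1) noncyc])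
  have cC: "card (cen P S) = p ^ (m - 1)"
  proof -
    have "p ^ m = p * p ^ (m - 1)" using m2 by (simp add: power_eq_if)
    then show ?thesis using nc np P(3) by simp
  qed
  have "cen P S \<noteq> {\<one>}"
  proof
    assume "cen P S = {\<one>}"
    then have "n = p ^ m" using nc by simp
    then show False using big[OF m2] nle by simp
  qed
  then have t2: "t \<ge> 2" unfolding t_def by (rule card_subs_ge2[OF d(15)])
  have "2 * n \<le> t * n" using t2 by (intro mult_right_mono) auto
  then have "p \<le> 6" using bd sp np by linarith
  moreover have "p \<noteq> 6" using d(1) by (intro notI) simp
  ultimately have p5: "p = 5" using P(3) by linarith
  have q2: "q = 2"
  proof -
    have "5 mod q = 1" using coact_mod[OF c] np p5 by (simp add: n_def)
    moreover have "q + 1 \<le> 5" using coact_index(2)[OF c S(4)] np p5 by (simp add: n_def)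
    then have "q = 0 \<or> q = 1 \<or> q = 2 \<or> q = 3 \<or> q = 4" by linarith
    ultimately show ?thesis using S(1) by auto
  qed
  have "m = 2"
  proof (rule ccontr)
    assume "m \<noteq> 2"
    then have "t \<ge> 3" unfolding t_def using m2 by (intro card_subs_ge3[OF d(15) cC d(1)]) simp
    then have "3 * n \<le> t * n" by (intro mult_right_mono) auto
    then show False using bd sp np p5 by linarith
  qed
  then have "s = 8" using card_subs_prime_square[OF d(4) _ d(1) noncyc] m p5 by (simp add: s_def)
  have "P <#> S = carrier G"
  proof (rule two_prime_product[OF P(1,2) S(3,2)])
    fix r assume r: "prime r" "r dvd card (carrier G)"
    show "r = p \<or> r = q"
    proof (rule ccontr)
      assume nr: "\<not> (r = p \<or> r = q)"
      obtain R where R: "is_syl r (carrier G) R" using syl_ex[OF sg_carrier r(1)] by blast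
      have "r \<noteq> p" "r \<noteq> q" using nr by auto
      note c' = syl_coact[OF P(1,2) R \<open>r \<noteq> p\<close>]
      note d' = coactD[OF c']
      have Rn: "R \<noteq> {\<one>}" by (rule syl_nontrivial[OF R r(2)])
      have Sn: "S \<noteq> {\<one>}" using coact_ne[OF c S(4)] prod_least[OF d(4) subset_refl, of S] d(16) sgD(3)[OF d(4)] by auto
      have r3: "r \<ge> 3" using r(1) nr q2 prime_ge_2_nat[OF r(1)] by linarith
      have "card (fibre P (P <#> R)) \<ge> 5"
      proof (cases "cen P R = P")
        case True
        then show ?thesis using fibre_trivial[OF c' P(1)] \<open>s = 8\<close> by (simp add: s_def)
      next
        case False
        have "1 * card (cjs P R) \<le> card (subs (cen P R)) * card (cjs P R)"
          using card_subs_pos[OF d'(15)] by (intro mult_right_mono) auto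
        moreover have "card (subs (cen P R)) * card (cjs P R) + 1 \<le> card (fibre P (P <#> R))"
          using fibre_lower[OF c' P(1)] False by simp
        ultimately show ?thesis using coact_index(2)[OF c' False] r3 by linarith
      qed
      \<comment> \<open>The fibres over P, PS and PR have at least 8 + 11 + 5 elements.\<close>
      moreover have "card (fibre P (P <#> S)) \<ge> 11"
        using fibre_lower[OF c P(1)] S(4) \<open>2 * n \<le> t * n\<close> np p5 by (simp add: n_def t_def)
      moreover have "P <#> R \<noteq> P"
      proof
        assume "P <#> R = P"
        then have "R \<subseteq> P \<inter> R" using d'(17) by auto
        then show False using d'(9) Rn sgD(3)[OF d'(5)] by auto
      qed
      moreover have "P <#> S \<noteq> P <#> R" using prod_neq[OF c c' _ Sn] \<open>r \<noteq> q\<close> by auto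
      ultimately show False
        using fibre_three[of P "P <#> S" "P <#> R" P] coact_ne[OF c S(4)] fibre_self[OF d(4)] \<open>s = 8\<close> num
        by (simp add: s_def)
    qed
  qed
  then have "q dvd num_subgroups G"
    by (rule dvd_subs_imp_dvd_num[OF c P(1)]) (use \<open>s = 8\<close> q2 in \<open>simp add: s_def\<close>)
  then show False using num q2 by simp
qed

section \<open>Normal Sylow 3-subgroups\<close>

text \<open>Some y in S acts on P as an automorphism of order two. Its centralizer C in P has
index 3, and the commutators of y with P form a subgroup J of order 3 on which y acts by
inversion; P is the product of J and C. An invariant subgroup that is not contained in C contains
a nontrivial commutator and hence J, so it is JE for a subgroup E of C. There are thus 2 s(C)
invariant subgroups, and the others lie in orbits of even length.\<close>

lemma even_subs_reflection:
  assumes c: "coact 3 P 2 S" and n: "card (cjs P S) = 3"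
  shows "even (card (subs P))"
proof -
  note d = coactD[OF c]
  have Pc: "x \<in> carrier G" if "x \<in> P" for x using sgD(5)[OF d(4) that] .
  have Sc: "x \<in> carrier G" if "x \<in> S" for x using sgD(5)[OF d(5) that] .
  define Z where "Z = cen S P"
  have nt: "cen P S \<noteq> P"
  proof
    assume "cen P S = P"
    then have "card (cjs P S) * card P = card P" using coact_card[OF c] by simp
    then show False using n sgD(4)[OF d(4)] by simp
  qed
  have "\<exists>z\<in>S. z \<notin> Z"
  proof (rule ccontr)
    assume "\<not> ?thesis"
    then have "z \<otimes> x = x \<otimes> z" if "z \<in> S" "x \<in> P" for z x using that by (auto simp: Z_def cen_def)
    then have "cen P S = P" unfolding cen_def by force
    then show False using nt by simp
  qed
  then obtain z where z: "z \<in> S" "z \<notin> Z" by blast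
  obtain k where k: "card S = 2 ^ k" using d(7) by blast
  \<comment> \<open>The last of the elements z, z^2, z^4, ... that does not centralize P is the
    required y.\<close>
  define i where "i = (LEAST i. z [^] (2 ^ i :: nat) \<in> Z)"
  have Zs: "subgroup Z G" unfolding Z_def by (rule cen_sg[OF d(5) sgD(1)[OF d(4)]])
  have "z [^] (2 ^ k :: nat) \<in> Z" using pow_card_one[OF d(5) z(1)] k sgD(3)[OF Zs] by simp
  then have i1: "z [^] (2 ^ i :: nat) \<in> Z" unfolding i_def by (rule LeastI)
  have i0: "i \<noteq> 0" using i1 z Sc by (intro notI) simp
  define y where "y = z [^] (2 ^ (i - 1) :: nat)"
  have yZ: "y \<notin> Z" unfolding y_def using not_less_Least[of "i - 1" "\<lambda>i. z [^] (2 ^ i :: nat) \<in> Z"] i0 by (simp add: i_def)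
  have yS: "y \<in> S" unfolding y_def by (rule sg_pow[OF d(5) z(1)])
  have yc: "y \<in> carrier G" using Sc[OF yS] .
  have "(2::nat) ^ i = 2 ^ (i - 1) * 2" using i0 by (cases i) auto
  then have "y [^] (2::nat) = z [^] (2 ^ i :: nat)" unfolding y_def using Sc[OF z(1)] by (simp add: nat_pow_pow)
  then have y2: "y \<otimes> y \<in> Z" using i1 yc by (simp add: numeral_2_eq_2)
  define C where "C = cen P {y}"
  have C: "subgroup C G" unfolding C_def by (rule cen_sg[OF d(4)]) (use yc in simp)
  have CP: "C \<subseteq> P" by (auto simp: C_def cen_def)
  have CP': "C \<noteq> P"
  proof
    assume e: "C = P"
    have "y \<otimes> x = x \<otimes> y" if "x \<in> P" for x
    proof -
      have "x \<in> C" using that e by simp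
      then show ?thesis by (simp add: C_def cen_def)
    qed
    then show False using yZ yS by (simp add: Z_def cen_def)
  qed
  have sub: "cen P S \<subseteq> C" using yS by (auto simp: C_def cen_def)
  have PC: "card P = 3 * card C"
  proof -
    have e: "card P = 3 * card (cen P S)" using coact_card[OF c] n by simp
    obtain u where u: "card C = card (cen P S) * u" using sg_dvd[OF d(15) C sub] by blast
    obtain v where v: "card P = card C * v" using sg_dvd[OF C d(4) CP] by blast
    have "u * v = 3" using e u v sgD(4)[OF d(15)] by (simp add: mult.assoc)
    moreover have "v \<noteq> 1" using v CP' sg_eqI[OF C d(4) CP] by auto
    moreover have "u dvd 3" using calculation(1) by (metis dvd_triv_left)
    then have "u \<le> 3" by (rule dvd_imp_le) simp
    then have "u = 0 \<or> u = 1 \<or> u = 2 \<or> u = 3" by linarith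
    ultimately have "u = 1" by (elim disjE) (simp_all, presburger?)
    then show ?thesis using e u by simp
  qed
  define f where "f u = y \<otimes> u \<otimes> inv y \<otimes> inv u" for u
  have yP: "y \<otimes> u \<otimes> inv y \<in> P" if "u \<in> P" for u using d(8)[OF yS] that by (auto simp: cj_def)
  have fP: "f u \<in> P" if "u \<in> P" for u unfolding f_def using yP[OF that] that sgD(6,7)[OF d(4)] by simp
  define J where "J = f ` P"
  \<comment> \<open>The commutators of y correspond to the conjugates of y under P.\<close>
  have cJ: "card J = 3"
  proof -
    have nC: "nrm P {y} = C"
    proof -
      have "x \<otimes> y \<otimes> inv x = y \<longleftrightarrow> x \<otimes> y = y \<otimes> x" if "x \<in> P" for x
        using fixed_iff[OF Pc[OF that] yc] by auto
      then show ?thesis unfolding nrm_def C_def cen_def cj_def by auto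
    qed
    have "card (cjs P {y}) * card C = card P" using card_cjs[OF d(4), of "{y}"] yc nC by simp
    then have "card (cjs P {y}) = 3" using PC sgD(4)[OF C] by simp
    moreover have "J = (\<lambda>X. y \<otimes> inv (the_elem X)) ` cjs P {y}"
      unfolding J_def cjs_def cj_def image_image
      by (rule image_cong) (use Pc yc in \<open>auto simp: f_def inv_mult_group m_assoc\<close>)
    moreover have "inj_on (\<lambda>X. y \<otimes> inv (the_elem X)) (cjs P {y})"
      by (rule inj_onI) (use Pc yc in \<open>auto simp: cjs_def cj_def\<close>)
    ultimately show ?thesis by (simp add: card_image)
  qed
  have finJ: "finite J" using cJ by (intro card_ge_0_finite) simp
  have f1: "\<one> \<in> J" unfolding J_def using yc sgD(3)[OF d(4)] by (intro image_eqI[of _ _ \<one>]) (auto simp: f_def)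
  have JP: "J \<subseteq> P" using fP by (auto simp: J_def)
  have inv_y: "y \<otimes> f u \<otimes> inv y = inv (f u)" if u: "u \<in> P" for u
  proof -
    have uc: "u \<in> carrier G" using Pc[OF u] .
    have "(y \<otimes> y) \<otimes> u = u \<otimes> (y \<otimes> y)" using y2 u by (auto simp: Z_def cen_def)
    then have e: "y \<otimes> (y \<otimes> u) = u \<otimes> (y \<otimes> y)" using yc uc by (simp add: m_assoc)
    have "y \<otimes> f u \<otimes> inv y = (y \<otimes> (y \<otimes> u)) \<otimes> inv y \<otimes> inv u \<otimes> inv y"
      using yc uc by (simp add: f_def m_assoc)
    also have "\<dots> = u \<otimes> y \<otimes> inv u \<otimes> inv y" unfolding e using yc uc by (simp add: m_assoc)
    also have "\<dots> = inv (f u)" using yc uc by (simp add: f_def inv_mult_group m_assoc)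
    finally show ?thesis .
  qed
  have Jinv: "inv j \<in> J" if j: "j \<in> J" for j
  proof -
    obtain u where u: "u \<in> P" "j = f u" using j by (auto simp: J_def)
    have uc: "u \<in> carrier G" using Pc[OF u(1)] .
    have "(y \<otimes> y) \<otimes> u = u \<otimes> (y \<otimes> y)" using y2 u by (auto simp: Z_def cen_def)
    then have e: "y \<otimes> (y \<otimes> u) = u \<otimes> (y \<otimes> y)" using yc uc by (simp add: m_assoc)
    have "f (y \<otimes> u \<otimes> inv y) = (y \<otimes> (y \<otimes> u)) \<otimes> inv y \<otimes> inv y \<otimes> inv (y \<otimes> u \<otimes> inv y)"
      using yc uc by (simp add: f_def m_assoc)
    also have "\<dots> = u \<otimes> inv (y \<otimes> u \<otimes> inv y)" unfolding e using yc uc by (simp add: m_assoc)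
    also have "\<dots> = inv j" using yc uc u by (simp add: f_def inv_mult_group m_assoc)
    finally show ?thesis using yP[OF u(1)] by (metis J_def imageI)
  qed
  obtain j where j: "j \<in> J" "j \<noteq> \<one>"
  proof -
    have "\<not> J \<subseteq> {\<one>}" using cJ card_mono[of "{\<one>}" J] by auto
    then show ?thesis using that by blast
  qed
  have jc: "j \<in> carrier G" "j \<in> P" using j JP Pc by auto
  have jj: "j \<noteq> inv j"
  proof
    assume "j = inv j"
    then have "j [^] (2::nat) = \<one>" using jc by (simp add: numeral_2_eq_2) (metis r_inv)
    moreover have "coprime (card P) 2" using d(10) by simp
    ultimately show False using pow_inj_coprime[OF d(4) _ jc(2)] j(2) by blast
  qed
  have Jeq: "J = {\<one>, j, inv j}"
  proof -
    have "inv j \<noteq> \<one>" using j(2) jc by (metis inv_inv inv_one)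
    then have "card {\<one>, j, inv j} = 3" using j(2) jj by auto
    moreover have "{\<one>, j, inv j} \<subseteq> J" using f1 j Jinv by auto
    ultimately show ?thesis using cJ card_subset_eq[OF finJ] by metis
  qed
  have yj: "y \<otimes> j \<otimes> inv y = inv j" using inv_y j(1) by (auto simp: J_def)
  have j2: "inv j \<otimes> inv j = j"
  proof -
    have "f j = inv j \<otimes> inv j" using yj by (simp add: f_def)
    then have "inv j \<otimes> inv j \<in> {\<one>, j, inv j}" using Jeq jc by (metis J_def imageI)
    moreover have "inv j \<otimes> inv j \<noteq> \<one>" using jj jc by (metis inv_closed inv_equality inv_inv)
    moreover have "inv j \<otimes> inv j \<noteq> inv j" using j(2) jc by (metis inv_closed inv_inv inv_one r_cancel_one')
    ultimately show ?thesis by auto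
  qed
  have j3: "j \<otimes> j = inv j" using j2 jc by (metis inv_mult_group inv_inv inv_closed)
  have J: "subgroup J G"
  proof (rule subgroupI)
    show "J \<subseteq> carrier G" "J \<noteq> {}" using JP Pc j by auto
    show "inv a \<in> J" if "a \<in> J" for a by (rule Jinv[OF that])
    show "a \<otimes> b \<in> J" if "a \<in> J" "b \<in> J" for a b using that j2 j3 jc unfolding Jeq by auto
  qed
  have JC: "J \<inter> C = {\<one>}"
  proof -
    have "x = \<one>" if x: "x \<in> J" "x \<in> C" for x
    proof -
      have xc: "x \<in> carrier G" "x \<in> P" using x JP Pc by auto
      have "y \<otimes> x \<otimes> inv y = x" using x(2) fixed_iff[OF yc xc(1)] by (auto simp: C_def cen_def)
      moreover have "y \<otimes> x \<otimes> inv y = inv x" using inv_y x(1) by (auto simp: J_def)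
      ultimately have "x [^] (2::nat) = \<one>" using xc by (simp add: numeral_2_eq_2) (metis r_inv)
      moreover have "coprime (card P) 2" using d(10) by simp
      ultimately show ?thesis using pow_inj_coprime[OF d(4) _ xc(2)] by blast
    qed
    moreover have "\<one> \<in> J" "\<one> \<in> C" using sgD(3)[OF J] sgD(3)[OF C] by simp_all
    ultimately show ?thesis by blast
  qed
  have CJ: "cj e J = J" if e: "e \<in> C" for e
  proof -
    have eP: "e \<in> P" "e \<in> carrier G" using e CP Pc by auto
    have ey': "e \<otimes> y = y \<otimes> e" using e by (simp add: C_def cen_def)
    have "cj e J \<subseteq> J"
    proof
      fix x assume "x \<in> cj e J"
      then obtain u where u: "u \<in> P" "x = e \<otimes> f u \<otimes> inv e" by (auto simp: J_def cj_def)
      have uc: "u \<in> carrier G" using Pc[OF u(1)] .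
      have ey: "inv e \<otimes> inv y = inv y \<otimes> inv e"
        using inv_mult_group[OF eP(2) yc] inv_mult_group[OF yc eP(2)] ey' by simp
      have "f (e \<otimes> u \<otimes> inv e) = (y \<otimes> e) \<otimes> u \<otimes> (inv e \<otimes> inv y) \<otimes> e \<otimes> inv u \<otimes> inv e"
        using eP yc uc by (simp add: f_def inv_mult_group m_assoc)
      also have "\<dots> = x" unfolding ey ey'[symmetric] using eP(2) yc uc u(2) by (simp add: f_def m_assoc)
      finally show "x \<in> J" unfolding J_def using u eP sgD(6,7)[OF d(4)] by (metis imageI)
    qed
    then show ?thesis using sg_eqI[OF cj_sg[OF eP(2) J] J] cj_card[OF eP(2) sgD(1)[OF J]] by simp
  qed
  have JCP: "J <#> C = P"
  proof -
    have s: "subgroup (J <#> C) G" by (rule prod_sg[OF J C CJ])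
    have "J <#> C \<subseteq> P" by (rule prod_least[OF d(4) JP CP])
    then show ?thesis using sg_eqI[OF s d(4)] prod_card[OF J C JC] cJ PC by simp
  qed
  \<comment> \<open>The reduction modulo 2 uses the 2-group generated by y, which has the same invariant subgroups as y.\<close>
  let ?Y = "cyc y"
  have Y: "subgroup ?Y G" "?Y \<subseteq> S" using cyc_sg[OF yc] cyc_least[OF d(5) yS] by auto
  have "card ?Y dvd 2 ^ k" using sg_dvd[OF Y(1) d(5) Y(2)] k by simp
  then obtain l where l: "card ?Y = 2 ^ l" by (metis divides_primepow_nat two_is_prime_nat)
  have inv_iff: "(\<forall>s\<in>?Y. cj s A = A) \<longleftrightarrow> cj y A = A" if A: "A \<subseteq> carrier G" for A
  proof
    assume "\<forall>s\<in>?Y. cj s A = A" then show "cj y A = A" using cyc_self[of y] by blast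
  next
    assume "cj y A = A"
    then have "y \<in> nrm (carrier G) A" using yc by (simp add: nrm_def)
    then have "?Y \<subseteq> nrm (carrier G) A" by (rule cyc_least[OF nrm_sg[OF sg_carrier A]])
    then show "\<forall>s\<in>?Y. cj s A = A" by (auto simp: nrm_def)
  qed
  let ?I = "{A \<in> subs P. \<forall>s\<in>?Y. cj s A = A}"
  let ?U = "{A \<in> subs P. J \<subseteq> A \<and> cj y A = A}"
  have Isplit: "?I = subs C \<union> ?U"
  proof (intro equalityI subsetI)
    fix A assume A: "A \<in> ?I"
    then have As: "subgroup A G" "A \<subseteq> P" "cj y A = A" using inv_iff[of A] sgD(1) by (auto simp: subs_def)
    show "A \<in> subs C \<union> ?U"
    proof (cases "A \<subseteq> C")
      case True then show ?thesis using As by (simp add: subs_def)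
    next
      case False
      then obtain u where u: "u \<in> A" "u \<notin> C" by blast
      have uP: "u \<in> P" "u \<in> carrier G" using u As Pc by auto
      have "y \<otimes> u \<otimes> inv y \<in> A" using As(3) u(1) by (auto simp: cj_def)
      then have fA: "f u \<in> A" unfolding f_def using u(1) sgD(6,7)[OF As(1)] by simp
      have "f u \<noteq> \<one>"
      proof
        assume "f u = \<one>"
        then have "y \<otimes> u \<otimes> inv y = u" using uP yc unfolding f_def by (metis inv_equality inv_inv m_closed inv_closed)
        then have "u \<in> C" using fixed_iff[OF yc uP(2)] uP by (simp add: C_def cen_def)
        then show False using u by simp
      qed
      moreover have "f u \<in> J" using uP by (simp add: J_def)
      ultimately have "f u = j \<or> f u = inv j" using Jeq by auto
      then have "j \<in> A" using fA sgD(6)[OF As(1)] jc by force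
      then have "J \<subseteq> A" unfolding Jeq using sgD(3,6)[OF As(1)] by simp
      then show ?thesis using As by (simp add: subs_def)
    qed
  next
    fix A assume "A \<in> subs C \<union> ?U"
    then show "A \<in> ?I"
    proof
      assume "A \<in> subs C"
      then have A: "subgroup A G" "A \<subseteq> C" by (auto simp: subs_def)
      have "y \<otimes> x \<otimes> inv y = x" if "x \<in> A" for x
        using that A(2) CP Pc fixed_iff[OF yc, of x] by (auto simp: C_def cen_def)
      then have "cj y A = A" by (auto simp: cj_def)
      then show ?thesis using A CP inv_iff[OF sgD(1)[OF A(1)]] by (auto simp: subs_def)
    next
      assume "A \<in> ?U"
      then show ?thesis using inv_iff[of A] sgD(1) by (auto simp: subs_def)
    qed
  qed
  have dj: "subs C \<inter> ?U = {}"
  proof (rule equals0I)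
    fix A assume "A \<in> subs C \<inter> ?U"
    then have "J \<subseteq> C" by (auto simp: subs_def)
    then show False using JC j by blast
  qed
  have "bij_betw (\<lambda>A. A \<inter> C) ?U (subs C)"
  proof (rule bij_betw_byWitness[where f' = "\<lambda>E. J <#> E"])
    show "\<forall>A\<in>?U. J <#> (A \<inter> C) = A"
    proof
      fix A assume "A \<in> ?U"
      then have "subgroup A G" "J \<subseteq> A" "A \<subseteq> J <#> C" using JCP by (auto simp: subs_def)
      then show "J <#> (A \<inter> C) = A" using dedekind_left[OF J C] by simp
    qed
    show "\<forall>E\<in>subs C. (J <#> E) \<inter> C = E" using prod_Int2[OF J C JC] by (auto simp: subs_def)
    show "(\<lambda>A. A \<inter> C) ` ?U \<subseteq> subs C" using sg_Int[OF _ C] by (auto simp: subs_def)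
    show "(\<lambda>E. J <#> E) ` subs C \<subseteq> ?U"
    proof
      fix A assume "A \<in> (\<lambda>E. J <#> E) ` subs C"
      then obtain E where E: "subgroup E G" "E \<subseteq> C" "A = J <#> E" by (auto simp: subs_def)
      have As: "subgroup A G" unfolding E(3) by (rule prod_sg[OF J E(1) CJ]) (use E(2) in auto)
      have "y \<otimes> x \<otimes> inv y = x" if "x \<in> E" for x
        using that E(2) CP Pc fixed_iff[OF yc, of x] by (auto simp: C_def cen_def)
      then have yE: "cj y E = E" by (auto simp: cj_def)
      have "cj y J \<subseteq> J" using inv_y Jinv by (auto simp: cj_def J_def)
      then have yJ: "cj y J = J" using sg_eqI[OF cj_sg[OF yc J] J] cj_card[OF yc sgD(1)[OF J]] by simp
      have "cj y A = A" unfolding E(3) cj_prod[OF yc sgD(1)[OF J] sgD(1)[OF E(1)]] yE yJ by (rule refl)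
      moreover have "A \<subseteq> P" unfolding E(3) using prod_least[OF d(4) JP, of E] E(2) CP by auto
      moreover have "J \<subseteq> A" unfolding E(3) by (rule prod_sub1[OF E(1) sgD(1)[OF J]])
      ultimately show "A \<in> ?U" using As by (simp add: subs_def)
    qed
  qed
  then have "card ?U = card (subs C)" by (rule bij_betw_same_card)
  then have "card ?I = 2 * card (subs C)"
    unfolding Isplit using card_Un_disjoint[OF subs_finite _ dj] by simp
  moreover have "card (subs P) mod 2 = card ?I mod 2"
    by (rule subs_inv_mod[OF Y(1) l two_is_prime_nat d(4)]) (use d(8) Y(2) in auto)
  ultimately show ?thesis by (simp add: even_iff_mod_2_eq_zero)
qed

lemma bound23:
  assumes num: "num_subgroups G = 23" and c: "coact p P q S" "nml P" "cen P S \<noteq> P"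
  shows "card (subs P) + card (subs (cen P S)) * card (cjs P S) + 1 \<le> 23" "card (cjs P S) \<le> 21"
    "card (cjs P S) + 1 \<le> card (fibre P (P <#> S))"
proof -
  note d = coactD[OF c(1)]
  show b: "card (subs P) + card (subs (cen P S)) * card (cjs P S) + 1 \<le> 23"
    using general_bound[OF c] num by simp
  have t: "1 * card (cjs P S) \<le> card (subs (cen P S)) * card (cjs P S)"
    using card_subs_pos[OF d(15)] by (intro mult_right_mono) auto
  show "card (cjs P S) \<le> 21" using b t card_subs_pos[OF d(4)] by linarith
  have "card (subs (cen P S)) * card (cjs P S) + 1 \<le> card (fibre P (P <#> S))"
    using fibre_lower[OF c(1,2)] c(3) by simp
  then show "card (cjs P S) + 1 \<le> card (fibre P (P <#> S))" using t by linarith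
qed

text \<open>R is not normal, because this was excluded for primes from 5 on;
\<open>centralized_sylow_count\<close> applies to its at least 6 conjugates.\<close>

lemma other_prime_bound:
  assumes num: "num_subgroups G = 23" and P: "nml P" "is_syl p (carrier G) P" "P \<noteq> {\<one>}"
    and S: "is_syl q (carrier G) S" "q \<noteq> p" "cen P S \<noteq> P"
    and R: "is_syl r (carrier G) R" "r dvd card (carrier G)" "r \<noteq> p" "r \<noteq> q" "r \<ge> 5" "cen P R = P"
  shows "6 * card (subs P) + card (fibre P (P <#> S)) \<le> 23"
proof -
  note c = syl_coact[OF P(1,2) S(1,2)]
  note c' = syl_coact[OF P(1,2) R(1,3)]
  note d = coactD[OF c]
  note d' = coactD[OF c']
  have Sn: "S \<noteq> {\<one>}" using coact_ne[OF c S(3)] prod_least[OF d(4) subset_refl, of S] d(16) sgD(3)[OF d(4)] by auto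
  have nR: "\<not> nml R"
  proof
    assume "nml R"
    moreover have "R \<noteq> carrier G" using d'(9) P(3) sgD(1)[OF d(4)] by auto
    ultimately show False using no_normal_sylow_ge5[OF num _ R(1,5) syl_nontrivial[OF R(1,2)]] by blast
  qed
  have "(r + 1) * card (subs P) + card (fibre P (P <#> S)) \<le> num_subgroups G"
  proof (rule centralized_sylow_count[OF P(1,2) R(1,3,6) nR])
    fix R' assume "R' \<in> Syl r (carrier G)"
    then have "coact p P r R'" using syl_coact[OF P(1,2) _ R(3)] by (simp add: Syl_def)
    then show "P <#> R' \<noteq> P <#> S" using prod_neq[OF c _ _ Sn, of r R'] R(4) by auto
  qed
  moreover have "6 * card (subs P) \<le> (r + 1) * card (subs P)" using R(5) by (intro mult_right_mono) auto
  ultimately show ?thesis using num by linarith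
qed

text \<open>P permutes the fibre. If it normalizes H, then all P-conjugates of S lie in H and are
conjugate there, already by elements of \<open>H \<inter> P\<close>. As P contains no nontrivial
element normalizing S, it lies in H, and H = PS.\<close>

lemma fibre_mod_self:
  assumes c: "coact p P q S" and P: "nml P" and t: "cen P S = {\<one>}"
  shows "card (fibre P (P <#> S)) mod p = 1"
proof -
  note d = coactD[OF c]
  obtain m where m: "card P = p ^ m" using d(6) by blast
  have Pc: "P \<subseteq> carrier G" by (rule sgD(1)[OF d(4)])
  have xc: "x \<in> carrier G" if "x \<in> P" for x using that Pc by auto
  have PS: "P <#> S \<in> fibre P (P <#> S)"
    using fibre_mem[OF c P _ d(8) sgD(3)[OF d(4)]] d(4) cj_one[OF sgD(1)[OF d(12)]] by (simp add: subs_def)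
  have ac: "acts P cj (fibre P (P <#> S))"
  proof (rule acts_cj[OF d(4)])
    show "X \<subseteq> carrier G" if "X \<in> fibre P (P <#> S)" for X using that sgD(1) by (auto simp: fibre_def)
    show "cj x X \<in> fibre P (P <#> S)" if x: "x \<in> P" and X: "X \<in> fibre P (P <#> S)" for x X
    proof -
      have Xs: "subgroup X G" "P <#> X = P <#> S" using X by (auto simp: fibre_def)
      have "P <#> cj x X = cj x (P <#> X)" using cj_prod[OF xc[OF x] Pc sgD(1)[OF Xs(1)]] cj_self[OF d(4) x] by simp
      also have "\<dots> = P <#> S" using Xs(2) cj_self[OF d(12)] x d(16) by auto
      finally show ?thesis using cj_sg[OF xc[OF x] Xs(1)] by (simp add: fibre_def)
    qed
  qed
  have "{H \<in> fibre P (P <#> S). \<forall>x\<in>P. cj x H = H} = {P <#> S}"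
  proof (intro equalityI subsetI)
    fix H assume "H \<in> {P <#> S}"
    then show "H \<in> {H \<in> fibre P (P <#> S). \<forall>x\<in>P. cj x H = H}"
      using PS cj_self[OF d(12)] d(16) by auto
  next
    fix H assume "H \<in> {H \<in> fibre P (P <#> S). \<forall>x\<in>P. cj x H = H}"
    then have H: "H \<in> fibre P (P <#> S)" "\<And>x. x \<in> P \<Longrightarrow> cj x H = H" by auto
    then have Hs: "subgroup H G" "P <#> H = P <#> S" by (auto simp: fibre_def)
    obtain x where x: "x \<in> P" "cj x S \<subseteq> H" "H = (H \<inter> P) <#> cj x S" using fibre_form[OF c P H(1)] by blast
    have "cj (inv x) (cj x S) \<subseteq> cj (inv x) H" by (rule cj_mono[OF x(2)])
    then have SH: "S \<subseteq> H" using cj_inv[OF xc[OF x(1)] sgD(1)[OF d(5)]] H(2)[OF sgD(6)[OF d(4) x(1)]] by simp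
    have HM: "H \<subseteq> P <#> S" using prod_sub2[OF d(4) sgD(1)[OF Hs(1)]] Hs(2) by simp
    have Hd: "H = (H \<inter> P) <#> S" by (rule dedekind[OF Hs(1) d(4,5) SH HM])
    have sy: "is_syl q H S" by (rule syl_mono[OF d(14,12) Hs(1) SH HM])
    have "y \<in> H" if y: "y \<in> P" for y
    proof -
      have "cj y S \<subseteq> cj y H" by (rule cj_mono[OF SH])
      then have yH: "cj y S \<subseteq> H" using H(2)[OF y] by simp
      have yM: "y \<in> P <#> S" using y d(16) by auto
      have "is_syl q H (cj y S)" by (rule syl_mono[OF syl_cj[OF d(14,12) yM] d(12) Hs(1) yH HM])
      then obtain h where h: "h \<in> H" "cj y S = cj h S" using syl_conj[OF Hs(1) sy] by blast
      then obtain a s where as: "a \<in> H \<inter> P" "s \<in> S" "h = a \<otimes> s" using Hd by (metis set_multE)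
      have ac: "a \<in> carrier G" "s \<in> carrier G" using as xc sgD(5)[OF d(5)] by auto
      have "cj h S = cj a S" using as ac cj_mult[OF ac sgD(1)[OF d(5)]] cj_self[OF d(5) as(2)] by simp
      then have "cj (inv a) (cj y S) = S" using h(2) cj_inv[OF ac(1) sgD(1)[OF d(5)]] by simp
      then have "cj (inv a \<otimes> y) S = S" using cj_mult[of "inv a" y S] ac xc[OF y] sgD(1)[OF d(5)] by simp
      moreover have "inv a \<otimes> y \<in> P" using as y sgD(6,7)[OF d(4)] by auto
      ultimately have "inv a \<otimes> y \<in> nrm P S" by (simp add: nrm_def)
      then have "inv a \<otimes> y = \<one>" using coact_nrm[OF c] t by simp
      then have "y = a" using ac xc[OF y] by (metis inv_equality inv_inv inv_closed)
      then show ?thesis using as by simp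
    qed
    then have "P <#> S \<subseteq> H" using prod_least[OF Hs(1) _ SH] by blast
    then show "H \<in> {P <#> S}" using HM by simp
  qed
  then show ?thesis using fixed_points_mod[OF d(4) m d(1) ac fibre_finite] prime_gt_1_nat[OF d(1)] by simp
qed

text \<open>If a subgroup T of S acts nontrivially, then the fibre over PT contains the 9
conjugates of T, the product AT with the subgroup A of order 3, and PT. There is room for only one
such fibre, the one over G = PS, whose size is 1 modulo 3. The other fibres have s(P) = 3
elements. But 23 is 2 modulo 3.\<close>

lemma cyclic9_contra:
  assumes num: "num_subgroups G = 23" and c: "coact 3 P 2 S" and P: "nml P" "card P = 9" "x \<in> P" "P = cyc x"
    and nt: "cen P S \<noteq> P" and G: "P <#> S = carrier G"
  shows False
proof -
  note d = coactD[OF c]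
  have xc: "x \<in> carrier G" using P(3) sgD(5)[OF d(4)] by simp
  have p3: "prime (3::nat)" by simp
  obtain A where A: "subgroup A G" "A \<subseteq> P" "card A = 3 ^ 1" using sg_exists_prime_power[OF d(4) p3, of 1] P(2) by auto
  have uniq: "B = A" if "subgroup B G" "B \<subseteq> P" "card B = 3" for B
    using cyc_prime_subgroup_unique[OF xc _ p3 that(1) _ that(3) A(1), of 2] that(2) A P(2,4) by simp
  have sP: "card (subs P) = 3"
  proof -
    have "subs P = {{\<one>}, A, P}"
    proof (intro equalityI subsetI)
      fix B assume "B \<in> subs P"
      then have B: "subgroup B G" "B \<subseteq> P" by (auto simp: subs_def)
      have "card B dvd 3 ^ 2" using sg_dvd[OF B(1) d(4) B(2)] P(2) by simp
      then obtain i where i: "card B = 3 ^ i" "i \<le> 2" using p3 by (metis divides_primepow_nat)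
      then consider "i = 0" | "i = 1" | "i = 2" by linarith
      then show "B \<in> {{\<one>}, A, P}"
      proof cases
        case 1 then show ?thesis using i sg_card1[OF B(1)] by simp
      next
        case 2 then show ?thesis using i uniq[OF B] by simp
      next
        case 3 then show ?thesis using i P(2) sg_eqI[OF B(1) d(4) B(2)] by simp
      qed
    qed (use A d(4) sg_one sgD(3)[OF d(4)] in \<open>auto simp: subs_def\<close>)
    moreover have "A \<noteq> P" "A \<noteq> {\<one>}" "P \<noteq> {\<one>}" using A P(2) by auto
    ultimately show ?thesis by simp
  qed
  have co: "coact 3 P 2 T" if T: "subgroup T G" "T \<subseteq> S" for T
  proof -
    obtain k where "card S = 2 ^ k" using d(7) by blast
    then have "card T dvd 2 ^ k" using sg_dvd[OF T(1) d(5) T(2)] by simp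
    then obtain j where "card T = 2 ^ j" by (metis divides_primepow_nat two_is_prime_nat)
    then show ?thesis using c T by (auto simp: coact_def)
  qed
  have big: "card (fibre P (P <#> T)) \<ge> 11" if c: "coact 3 P 2 T" and nt: "cen P T \<noteq> P" for T
  proof -
    note e = coactD[OF c]
    have "cen P T = {\<one>}" by (rule cyclic_cen_trivial[OF c P(3,4) nt])
    then have n: "card (cjs P T) = 9" using coact_card[OF c] P(2) by simp
    have inv: "cj s A = A" if s: "s \<in> T" for s
    proof (rule uniq)
      have sc: "s \<in> carrier G" using s sgD(5)[OF e(5)] by simp
      show "subgroup (cj s A) G" by (rule cj_sg[OF sc A(1)])
      show "cj s A \<subseteq> P" using cj_mono[OF A(2), of s] e(8)[OF s] by simp
      show "card (cj s A) = 3" using cj_card[OF sc sgD(1)[OF A(1)]] A(3) by simp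
    qed
    have one: "\<one> \<in> P" by (rule sgD(3)[OF d(4)])
    have "A \<in> subs P" "P \<in> subs P" "{\<one>} \<in> subs P" using A d(4) sg_one one by (auto simp: subs_def)
    have AT: "subgroup (A <#> T) G" by (rule prod_sg[OF A(1) e(5) inv])
    have 1: "A <#> T \<in> fibre P (P <#> T)"
      using fibre_mem[OF c P(1) \<open>A \<in> subs P\<close> inv one] cj_one[OF sgD(1)[OF AT]] by simp
    have 2: "P <#> T \<in> fibre P (P <#> T)"
      using fibre_mem[OF c P(1) \<open>P \<in> subs P\<close> e(8) one] cj_one[OF sgD(1)[OF e(12)]] by simp
    have oT: "{\<one>} <#> T = T" using sgD(5)[OF e(5)] by (force simp: set_mult_def)
    have 3: "cjs P T \<subseteq> fibre P (P <#> T)"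
    proof
      fix X assume "X \<in> cjs P T"
      then obtain y where y: "y \<in> P" "X = cj y T" by (auto simp: cjs_def)
      have "cj s {\<one>} = {\<one>}" if "s \<in> T" for s using sgD(5)[OF e(5) that] by (simp add: cj_def)
      then show "X \<in> fibre P (P <#> T)" using fibre_mem[OF c P(1) \<open>{\<one>} \<in> subs P\<close> _ y(1)] oT y(2) by simp
    qed
    have AT1: "A \<inter> T = {\<one>}" using A(2) e(9) sgD(3)[OF A(1)] sgD(3)[OF e(5)] by blast
    have cAT: "card (A <#> T) = 3 * card T" using prod_card[OF A(1) e(5) AT1] A(3) by simp
    have cPT: "card (P <#> T) = 9 * card T" using e(13) P(2) by simp
    have ccj: "card X = card T" if "X \<in> cjs P T" for X
      using that cj_card[OF _ sgD(1)[OF e(5)]] sgD(5)[OF d(4)] by (auto simp: cjs_def)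
    have T0: "card T > 0" by (rule sgD(4)[OF e(5)])
    have fc: "finite (cjs P T)" using n by (intro card_ge_0_finite) simp
    have "A <#> T \<notin> cjs P T" using ccj[of "A <#> T"] cAT T0 by auto
    moreover have "P <#> T \<notin> insert (A <#> T) (cjs P T)"
    proof
      assume "P <#> T \<in> insert (A <#> T) (cjs P T)"
      then have "card (P <#> T) = 3 * card T \<or> card (P <#> T) = card T" using ccj cAT by auto
      then show False using cPT T0 by simp
    qed
    ultimately have "card (insert (P <#> T) (insert (A <#> T) (cjs P T))) = 11" using fc n by simp
    moreover have "card (insert (P <#> T) (insert (A <#> T) (cjs P T))) \<le> card (fibre P (P <#> T))"
      using 1 2 3 by (intro card_mono) auto
    ultimately show ?thesis by simp
  qed
  let ?\<M> = "{M. subgroup M G \<and> P \<subseteq> M}"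
  have f: "finite ?\<M>" by (rule finite_subset[OF _ subs_finite[of "carrier G"]]) (auto simp: subs_def dest: sgD(1))
  have mem: "P <#> S \<in> ?\<M>" using d(12,16) by simp
  have dv: "3 dvd card (fibre P M)" if M: "M \<in> ?\<M> - {P <#> S}" for M
  proof -
    have Ms: "subgroup M G" "P \<subseteq> M" "M \<noteq> P <#> S" using M by auto
    have T: "subgroup (M \<inter> S) G" by (rule sg_Int[OF Ms(1) d(5)])
    have e: "M = P <#> (M \<inter> S)" by (rule over_normal_form[OF d(4,5) G Ms(1,2)])
    have c': "coact 3 P 2 (M \<inter> S)" by (rule co[OF T]) simp
    have "cen P (M \<inter> S) = P"
    proof (rule ccontr)
      assume n: "cen P (M \<inter> S) \<noteq> P"
      have "card (fibre P M) \<ge> 11" using big[OF c' n] e by simp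
      moreover have "card (fibre P (P <#> S)) \<ge> 11" by (rule big[OF c nt])
      \<comment> \<open>Together with the fibre over P this would give 11 + 11 + 3
        subgroups.\<close>
      moreover have "M \<noteq> P" using coact_ne[OF c' n] e by simp
      ultimately show False
        using fibre_three[of P M "P <#> S" P] coact_ne[OF c nt] Ms(3) fibre_self[OF d(4)] sP num by auto
    qed
    then show ?thesis using fibre_trivial[OF c' P(1)] sP e by simp
  qed
  have "num_subgroups G = card (fibre P (P <#> S)) + (\<Sum>M\<in>?\<M> - {P <#> S}. card (fibre P M))"
    unfolding num_eq_sum_fibre[OF P(1)] by (rule sum.remove[OF f mem])
  moreover have "3 dvd (\<Sum>M\<in>?\<M> - {P <#> S}. card (fibre P M))" using dv by (intro dvd_sum) blast
  then obtain w where "(\<Sum>M\<in>?\<M> - {P <#> S}. card (fibre P M)) = 3 * w" by (rule dvdE)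
  ultimately have "23 = card (fibre P (P <#> S)) + 3 * w" using num by (simp only:)
  moreover have "card (fibre P (P <#> S)) mod 3 = 1"
    by (rule fibre_mod_self[OF c P(1) cyclic_cen_trivial[OF c P(3,4) nt]])
  ultimately show False by presburger
qed

text \<open>Here q = 2, the index n of the centralizer of S is 3 or 9, and G = PS because a
further prime would yield too many subgroups. A cyclic P has order 9. Otherwise s(P) is even, by
\<open>even_subs_reflection\<close> if n = 3 and because the order of P is 9 and s(P) = 6 if n =
9, and then s(G) is even as well.\<close>

theorem no_normal_sylow_3:
  assumes num: "num_subgroups G = 23" and P: "nml P" "is_syl 3 (carrier G) P" and ne: "P \<noteq> {\<one>}" "P \<noteq> carrier G"
  shows False
proof -
  have p23: "prime (num_subgroups G)" unfolding num by simp
  obtain q S where S: "prime q" "q \<noteq> 3" "is_syl q (carrier G) S" "cen P S \<noteq> P"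
    using prime_count_nontrivial_action[OF p23 P(1,2) ne] by blast
  have forced: "q = 2 \<and> (card (cjs P T) = 3 \<or> card (cjs P T) = 9)"
    if c: "coact 3 P q T" and nt: "cen P T \<noteq> P" for q T
  proof -
    obtain a where a: "a > 0" "card (cjs P T) = 3 ^ a" using coact_index(1)[OF c nt] by blast
    have "a < 3"
    proof (rule ccontr)
      assume "\<not> a < 3"
      then have "(3::nat) ^ 3 \<le> 3 ^ a" by (intro power_increasing) auto
      then show False using bound23(2)[OF num c P(1) nt] a(2) by simp
    qed
    then have "a = 1 \<or> a = 2" using a(1) by linarith
    then have n: "card (cjs P T) = 3 \<or> card (cjs P T) = 9" using a(2) by auto
    have m: "card (cjs P T) mod q = 1" by (rule coact_mod[OF c])
    have qle: "q + 1 \<le> card (cjs P T)" by (rule coact_index(2)[OF c nt])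
    have pq: "prime q" "q \<noteq> 3" using coactD(2,3)[OF c] by auto
    from n have "q = 2"
    proof
      assume "card (cjs P T) = 3"
      then show ?thesis using qle prime_ge_2_nat[OF pq(1)] by linarith
    next
      assume n9: "card (cjs P T) = 9"
      then have "q \<le> 8" using qle by simp
      then have "q \<in> {0,1,2,3,4,5,6,7,8}" by auto
      then show ?thesis using m n9 pq by auto
    qed
    then show ?thesis using n by blast
  qed
  note c = syl_coact[OF P(1,2) S(3,2)]
  note d = coactD[OF c]
  have q2: "q = 2" using forced[OF c S(4)] by blast
  define n where "n = card (cjs P S)"
  have n: "n = 3 \<or> n = 9" using forced[OF c S(4)] by (simp add: n_def)
  obtain m where m: "card P = 3 ^ m" using d(6) by blast
  have m0: "m \<noteq> 0" using m ne(1) sg_card1[OF d(4)] by (intro notI) simp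
  have m1: "m \<noteq> 1"
  proof
    assume "m = 1"
    then have "even (num_subgroups G)"
      using even_subs_normal_sylow_prime_order[OF P(1,2)] m by simp
    then show False using num by simp
  qed
  have m2: "m \<ge> 2" using m0 m1 by linarith
  have nc: "n * card (cen P S) = 3 ^ m" using coact_card[OF c] m by (simp add: n_def)
  define t where "t = card (subs (cen P S))"
  define s where "s = card (subs P)"
  have bd: "s + t * n + 1 \<le> 23" using bound23(1)[OF num c P(1) S(4)] by (simp add: n_def s_def t_def)
  have t2: "t \<ge> 2" if "n = 3"
  proof -
    have "cen P S \<noteq> {\<one>}"
    proof
      assume "cen P S = {\<one>}"
      then have "(3::nat) ^ m = 3 ^ 1" using nc that by simp
      then have "m = 1" by (rule power_inject_exp[THEN iffD1, rotated]) simp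
      then show False using m2 by simp
    qed
    then show ?thesis unfolding t_def by (rule card_subs_ge2[OF d(15)])
  qed
  have G: "P <#> S = carrier G"
  proof (rule two_prime_product[OF P(1,2) S(3,2)])
    fix r assume r: "prime r" "r dvd card (carrier G)"
    show "r = 3 \<or> r = q"
    proof (rule ccontr)
      assume nr: "\<not> (r = 3 \<or> r = q)"
      obtain R where R: "is_syl r (carrier G) R" using syl_ex[OF sg_carrier r(1)] by blast
      have "r \<noteq> 4" using r(1) by (intro notI) simp
      then have r5: "r \<noteq> 3" "r \<noteq> q" "r \<ge> 5" using nr q2 prime_ge_2_nat[OF r(1)] by auto
      note c' = syl_coact[OF P(1,2) R r5(1)]
      have "cen P R = P" using forced[OF c'] r5 by auto
      then have "6 * s + card (fibre P (P <#> S)) \<le> 23"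
        using other_prime_bound[OF num P(1,2) ne(1) S(3,2,4) R r(2) r5] by (simp add: s_def)
      moreover have "s \<ge> 3" unfolding s_def by (rule card_subs_ge3[OF d(4) m d(1) m2])
      moreover have "card (fibre P (P <#> S)) \<ge> 7"
      proof (cases "n = 3")
        case True
        have "t * n + 1 \<le> card (fibre P (P <#> S))" using fibre_lower[OF c P(1)] S(4) by (simp add: n_def t_def)
        moreover have "2 * n \<le> t * n" using t2[OF True] by (intro mult_right_mono) auto
        ultimately show ?thesis using True by linarith
      next
        case False
        then show ?thesis using bound23(3)[OF num c P(1) S(4)] n by (simp add: n_def)
      qed
      ultimately show False by linarith
    qed
  qed
  show False
  proof (cases "\<exists>x\<in>P. P = cyc x")
    case True
    then obtain x where x: "x \<in> P" "P = cyc x" by blast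
    have "cen P S = {\<one>}" by (rule cyclic_cen_trivial[OF c x S(4)])
    then have e: "n = 3 ^ m" using nc by simp
    have "(3::nat) ^ 2 \<le> 3 ^ m" using m2 by (intro power_increasing) auto
    then have "card P = 9" using e n m by auto
    then show False using cyclic9_contra[OF num _ P(1) _ x S(4) G] c q2 by simp
  next
    case False
    then have nc': "\<And>x. x \<in> P \<Longrightarrow> P \<noteq> cyc x" by blast
    have s6: "s \<ge> 6" using noncyclic_card_subs[OF d(4) m d(1) nc'] by (simp add: s_def)
    have "even s"
    proof (cases "n = 3")
      case True
      then show ?thesis using even_subs_reflection[of P S] c q2 by (simp add: s_def n_def)
    next
      case False
      then have n9: "n = 9" using n by simp
      have "cen P S = {\<one>}"
      proof (rule ccontr)
        assume "cen P S \<noteq> {\<one>}"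
        then have "t \<ge> 2" unfolding t_def by (rule card_subs_ge2[OF d(15)])
        then have "2 * n \<le> t * n" by (intro mult_right_mono) auto
        then show False using bd s6 n9 by linarith
      qed
      then have "card P = 3 ^ 2" using nc n9 m by simp
      then have "s = 3 + 3" using card_subs_prime_square[OF d(4) _ d(1) nc'] by (simp add: s_def)
      then show ?thesis by simp
    qed
    then have "q dvd num_subgroups G"
      by (intro dvd_subs_imp_dvd_num[OF c P(1) G]) (simp add: s_def q2)
    then show False using num q2 by simp
  qed
qed

section \<open>Normal Sylow 2-subgroups\<close>

definition moved :: "'a set \<Rightarrow> 'a set \<Rightarrow> bool" where
  "moved S X \<longleftrightarrow> (\<exists>s\<in>S. cj s X \<noteq> X)"

lemma cjs_subs:
  assumes "subgroup S G" "subgroup P G" "\<And>s. s \<in> S \<Longrightarrow> cj s P = P" "X \<in> subs P"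
  shows "cjs S X \<subseteq> subs P"
proof
  fix Y assume "Y \<in> cjs S X"
  then obtain s where s: "s \<in> S" "Y = cj s X" by (auto simp: cjs_def)
  then show "Y \<in> subs P" using assms(3)[OF s(1)] assms(4) cj_mono[of X P s] cj_sg[of s X] sgD(5)[OF assms(1)] by (auto simp: subs_def)
qed

text \<open>Conjugation by S preserves each component of the label, since A and C are
invariant.\<close>

lemma orbit_bound:
  assumes c: "coact p P q S" and Y: "Y \<in> subs P" "moved S Y"
    and A: "A \<subseteq> carrier G" "\<not> moved S A" and C: "C \<subseteq> carrier G" "\<not> moved S C"
  shows "q \<le> card {Z \<in> subs P. (card Z, Z \<subseteq> A, C \<subseteq> Z, moved S Z) = (card Y, Y \<subseteq> A, C \<subseteq> Y, True)}"
proof -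
  note d = coactD[OF c]
  have Ys: "subgroup Y G" "Y \<subseteq> carrier G" using Y sgD(1) by (auto simp: subs_def)
  obtain k where k: "card S = q ^ k" using d(7) by blast
  have "q \<le> card (cjs S Y)" by (rule cjs_ge[OF d(5) k d(2) Ys(1)]) (use Y(2) in \<open>simp add: moved_def\<close>)
  also have "\<dots> \<le> card {Z \<in> subs P. (card Z, Z \<subseteq> A, C \<subseteq> Z, moved S Z) = (card Y, Y \<subseteq> A, C \<subseteq> Y, True)}"
  proof (rule card_mono)
    show "cjs S Y \<subseteq> {Z \<in> subs P. (card Z, Z \<subseteq> A, C \<subseteq> Z, moved S Z) = (card Y, Y \<subseteq> A, C \<subseteq> Y, True)}"
    proof
      fix Z assume Z: "Z \<in> cjs S Y"
      then obtain s where s: "s \<in> S" "Z = cj s Y" by (auto simp: cjs_def)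
      have sc: "s \<in> carrier G" using s sgD(5)[OF d(5)] by simp
      have "card Z = card Y" using cj_card[OF sc Ys(2)] s by simp
      moreover have "Z \<subseteq> A \<longleftrightarrow> Y \<subseteq> A" using cj_subset_iff[OF sc Ys(2) A(1)] A(2) s by (auto simp: moved_def)
      moreover have "C \<subseteq> Z \<longleftrightarrow> C \<subseteq> Y" using cj_subset_iff[OF sc C(1) Ys(2)] C(2) s by (auto simp: moved_def)
      moreover have "moved S Z"
      proof (rule ccontr)
        assume "\<not> moved S Z"
        then have m: "cj u Z = Z" if "u \<in> S" for u using that by (auto simp: moved_def)
        have "Y = Z" using m[OF sgD(6)[OF d(5) s(1)]] cj_inv[OF sc Ys(2)] s(2) by simp
        then show False using Y(2) \<open>\<not> moved S Z\<close> by simp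
      qed
      moreover have "Z \<in> subs P" using cjs_subs[OF d(5,4,8) Y(1)] Z by auto
      ultimately show "Z \<in> {Z \<in> subs P. (card Z, Z \<subseteq> A, C \<subseteq> Z, moved S Z) = (card Y, Y \<subseteq> A, C \<subseteq> Y, True)}" by simp
    qed
  qed simp
  finally show ?thesis .
qed

lemma one_bound: assumes "Y \<in> subs P" shows "1 \<le> card {Z \<in> subs P. \<kappa> Z = \<kappa> Y}"
proof -
  have "{Y} \<subseteq> {Z \<in> subs P. \<kappa> Z = \<kappa> Y}" using assms by simp
  then have "card {Y} \<le> card {Z \<in> subs P. \<kappa> Z = \<kappa> Y}" by (rule card_mono[rotated]) simp
  then show ?thesis by simp
qed

lemma orbit_card_bound:
  assumes c: "coact p P q S" and Y: "Y \<in> subs P" "moved S Y"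
  shows "q \<le> card {Z \<in> subs P. card Z = card Y}"
proof -
  have "q \<le> card {Z \<in> subs P. (card Z, Z \<subseteq> {}, {} \<subseteq> Z, moved S Z) = (card Y, Y \<subseteq> {}, {} \<subseteq> Y, True)}"
    by (rule orbit_bound[OF c Y]) (auto simp: moved_def cj_def)
  also have "\<dots> \<le> card {Z \<in> subs P. card Z = card Y}" by (rule card_mono) auto
  finally show ?thesis .
qed

lemma invariant_card_mod:
  assumes c: "coact p P q S" and A: "A \<in> subs P" "\<not> moved S A"
  shows "card A mod q = card (A \<inter> cen P S) mod q"
proof -
  note d = coactD[OF c]
  obtain k where k: "card S = q ^ k" using d(7) by blast
  have As: "subgroup A G" "A \<subseteq> P" using A by (auto simp: subs_def)
  have "cen A S = A \<inter> cen P S" using As(2) by (auto simp: cen_def)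
  then show ?thesis using elem_inv_mod[OF d(5) k d(2) As(1)] A(2) by (auto simp: moved_def)
qed

lemma moved_exists:
  assumes c: "coact 2 P q S" and nt: "cen P S \<noteq> P" shows "\<exists>X\<in>subs P. moved S X"
proof -
  note d = coactD[OF c]
  obtain k m where k: "card S = q ^ k" "card P = 2 ^ m" using d(6,7) by blast
  have "q \<noteq> 2" using d(3) by simp
  from moved_cyclic[OF d(5) k(1) d(2) this d(4) k(2) d(8) nt]
  obtain x s where "x \<in> P" "s \<in> S" "cj s (cyc x) \<noteq> cyc x" by blast
  then show ?thesis using cyc_sg[of x] sgD(5)[OF d(4)] cyc_least[OF d(4)]
    by (intro bexI[of _ "cyc x"]) (auto simp: moved_def subs_def)
qed

lemma not_moved_simps:
  assumes c: "coact p P q S"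
  shows "\<not> moved S P" "\<not> moved S {\<one>}" "A \<subseteq> cen P S \<Longrightarrow> \<not> moved S A"
  using coactD(8)[OF c] cen_inv[OF coactD(4,5)[OF c], of A] sgD(5)[OF coactD(5)[OF c]] by (auto simp: moved_def cj_def)

text \<open>The index n is a power of 2 and at most 16. If n = 16, then P has at least 7
subgroups: one of every order 1, 2, 4, 8, 16 and, for some order, an orbit of at least three. If n
= 8, then q = 7, and an orbit of seven makes the centralizer trivial, so P has order 8, and its
subgroups of order 2 and of order 4 all lie in orbits of seven. In both cases the general bound
fails.\<close>

lemma moved_index_two_group:
  assumes num: "num_subgroups G = 23" and c: "coact 2 P q S" and P: "nml P" and nt: "cen P S \<noteq> P"
  shows "q = 3 \<and> card (cjs P S) = 4"
proof -
  note d = coactD[OF c]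
  define n where "n = card (cjs P S)"
  define s where "s = card (subs P)"
  define t where "t = card (subs (cen P S))"
  have bd: "s + t * n + 1 \<le> 23" using bound23(1)[OF num c P nt] by (simp add: n_def s_def t_def)
  have n21: "n \<le> 21" using bound23(2)[OF num c P nt] by (simp add: n_def)
  obtain m where m: "card P = 2 ^ m" using d(6) by blast
  obtain a where a: "a > 0" "n = 2 ^ a" using coact_index(1)[OF c nt] by (auto simp: n_def)
  have q3: "q \<ge> 3" using d(2,3) prime_ge_2_nat[OF d(2)] by linarith
  have qn: "q + 1 \<le> n" using coact_index(2)[OF c nt] by (simp add: n_def)
  have mq: "n mod q = 1" using coact_mod[OF c] by (simp add: n_def)
  have a5: "a < 5"
  proof (rule ccontr)
    assume "\<not> a < 5"
    then have "(2::nat) ^ 5 \<le> 2 ^ a" by (intro power_increasing) auto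
    then show False using n21 a(2) by simp
  qed
  have nC: "n * card (cen P S) = card P" using coact_card[OF c] by (simp add: n_def)
  have am: "a \<le> m"
  proof -
    have "(2::nat) ^ a dvd 2 ^ m" using nC a(2) m by (metis dvd_triv_left)
    then show ?thesis by (rule power_dvd_imp_le) simp
  qed
  have t1: "t \<ge> 1" unfolding t_def by (rule card_subs_pos[OF d(15)])
  have tn: "n \<le> t * n" using t1 by simp
  obtain X where X: "X \<in> subs P" "moved S X" using moved_exists[OF c nt] by blast
  have Xs: "subgroup X G" "X \<subseteq> P" using X by (auto simp: subs_def)
  have "card X dvd 2 ^ m" using sg_dvd[OF Xs(1) d(4) Xs(2)] m by simp
  then obtain i where i: "card X = 2 ^ i" by (metis divides_primepow_nat two_is_prime_nat)
  have X1: "card X \<noteq> 1" using X(2) not_moved_simps(2)[OF c] sg_card1[OF Xs(1)] by auto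
  have XP: "card X \<noteq> card P" using X(2) not_moved_simps(1)[OF c] sg_eqI[OF Xs(1) d(4) Xs(2)] by auto
  have b1: "1 \<le> card {Z \<in> subs P. card Z = 1}" using one_bound[of "{\<one>}" P card] sg_one sgD(3)[OF d(4)] by (simp add: subs_def)
  have bP: "1 \<le> card {Z \<in> subs P. card Z = card P}" using one_bound[of P P card] d(4) by (simp add: subs_def)
  have bX: "q \<le> card {Z \<in> subs P. card Z = card X}" by (rule orbit_card_bound[OF c X])
  have bk: "1 \<le> card {Z \<in> subs P. card Z = 2 ^ j}" if "j \<le> m" for j
  proof -
    have "(2::nat) ^ j dvd card P" using that m by (simp add: le_imp_power_dvd)
    then obtain Y where "subgroup Y G" "Y \<subseteq> P" "card Y = 2 ^ j" using sg_exists_prime_power[OF d(4) two_is_prime_nat] by blast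
    then show ?thesis using one_bound[of Y P card] by (simp add: subs_def)
  qed
  have a4: "a \<noteq> 4"
  proof
    assume a4: "a = 4"
    have m4: "m \<ge> 4" using am a4 by simp
    have P16: "card P \<ge> 16"
    proof -
      have "(2::nat) ^ 4 \<le> 2 ^ m" using m4 by (intro power_increasing) auto
      then show ?thesis using m by simp
    qed
    have k: "1 \<le> card {Z \<in> subs P. card Z = 2}" "1 \<le> card {Z \<in> subs P. card Z = 4}" "1 \<le> card {Z \<in> subs P. card Z = 8}"
      using bk[of 1] bk[of 2] bk[of 3] m4 by simp_all
    \<comment> \<open>Two further orders besides those of 1, P and the moved subgroup X.\<close>
    obtain u v :: nat where uv: "u \<in> {2,4,8}" "v \<in> {2,4,8}" "u \<noteq> v" "u \<noteq> card X" "v \<noteq> card X"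
    proof (cases "card X = 2")
      case True
      then show ?thesis using that[of 4 8] by simp
    next
      case False
      then show ?thesis using that[of 2 4] that[of 2 8] by (cases "card X = 4") simp_all
    qed
    have "sum_list (map snd [(1, 1), (card P, 1), (card X, q), (u, 1), (v, 1)]) \<le> card (subs P)"
    proof (rule tagged_card_bound[OF subs_finite, where \<kappa> = card])
      show "distinct (map fst [(1, 1), (card P, 1), (card X, q), (u, 1), (v, 1)])"
        using uv X1 XP P16 by auto
      fix i l assume "(i, l) \<in> set [(1, 1), (card P, 1), (card X, q), (u, 1), (v, 1)]"
      then show "l \<le> card {x \<in> subs P. card x = i}" using b1 bP bX k uv(1,2) by auto
    qed
    then have "s \<ge> 7" using q3 by (simp add: s_def)
    then show False using bd tn a(2) a4 by simp
  qed
  have a3: "a \<noteq> 3"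
  proof
    assume a3: "a = 3"
    have "q \<le> 7" using qn a(2) a3 by simp
    then have "q \<in> {0,1,2,3,4,5,6,7}" by auto
    then have q7: "q = 7" using mq a(2) a3 q3 by auto
    have "card P \<noteq> 1" using m am a3 by simp
    then have "sum_list (map snd [(1, 1), (card P, 1), (card X, q)]) \<le> card (subs P)"
      by (intro tagged_card_bound[OF subs_finite, where \<kappa> = card]) (use X1 XP b1 bP bX in auto)
    then have s9: "s \<ge> 9" using q7 by (simp add: s_def)
    have C1: "cen P S = {\<one>}"
    proof (rule ccontr)
      assume "cen P S \<noteq> {\<one>}"
      then have "t \<ge> 2" unfolding t_def by (rule card_subs_ge2[OF d(15)])
      then have "2 * n \<le> t * n" by (intro mult_right_mono) auto
      then show False using bd s9 a(2) a3 by simp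
    qed
    then have P8: "card P = 8" using nC a(2) a3 by simp
    have mv: "moved S Y" if Y: "Y \<in> subs P" "card Y = 2 \<or> card Y = 4" for Y
    proof (rule ccontr)
      assume "\<not> moved S Y"
      then have "card Y mod 7 = card (Y \<inter> {\<one>}) mod 7" using invariant_card_mod[OF c Y(1)] C1 q7 by simp
      moreover have "Y \<inter> {\<one>} = {\<one>}" using Y(1) sgD(3) by (auto simp: subs_def)
      ultimately show False using Y(2) by auto
    qed
    obtain Y2 where Y2: "subgroup Y2 G" "Y2 \<subseteq> P" "card Y2 = 2 ^ 1" using sg_exists_prime_power[OF d(4) two_is_prime_nat, of 1] P8 by auto
    obtain Y4 where Y4: "subgroup Y4 G" "Y4 \<subseteq> P" "card Y4 = 2 ^ 2" using sg_exists_prime_power[OF d(4) two_is_prime_nat, of 2] P8 by auto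
    have "7 \<le> card {Z \<in> subs P. card Z = 2}" using orbit_card_bound[OF c _ mv, of Y2] Y2 q7 by (simp add: subs_def)
    moreover have "7 \<le> card {Z \<in> subs P. card Z = 4}" using orbit_card_bound[OF c _ mv, of Y4] Y4 q7 by (simp add: subs_def)
    ultimately have "sum_list (map snd [(1, 1), (8::nat, 1), (2, 7), (4, 7)]) \<le> card (subs P)"
      by (intro tagged_card_bound[OF subs_finite, where \<kappa> = card]) (use b1 bP P8 in auto)
    then show False using bd tn a(2) a3 by (simp add: s_def)
  qed
  have a1: "a \<noteq> 1" using qn q3 a(2) by auto
  have "a = 2" using a(1) a1 a3 a4 a5 by linarith
  then have "n = 4" using a(2) by simp
  moreover have "q = 3" using qn q3 \<open>n = 4\<close> by linarith
  ultimately show ?thesis by (simp add: n_def)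
qed

lemma klein_sg:
  assumes P: "subgroup P G" and sq: "\<And>x. x \<in> P \<Longrightarrow> x \<otimes> x = \<one>" and u: "u \<in> P" "v \<in> P"
  shows "subgroup {\<one>, u} G" "subgroup {\<one>, u, v, u \<otimes> v} G"
proof -
  have c: "x \<in> carrier G" if "x \<in> P" for x using sgD(5)[OF P that] .
  have iv: "inv x = x" if "x \<in> P" for x using sq[OF that] c[OF that] by (simp add: inv_equality)
  have com: "x \<otimes> y = y \<otimes> x" if xy: "x \<in> P" "y \<in> P" for x y
  proof -
    have "inv (x \<otimes> y) = x \<otimes> y" using iv sgD(7)[OF P xy] by simp
    then show ?thesis using inv_mult_group[OF c[OF xy(1)] c[OF xy(2)]] iv xy by simp
  qed
  show "subgroup {\<one>, u} G" by (rule subgroupI) (use c iv sq u in auto)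
  have uv: "u \<otimes> v \<in> P" using sgD(7)[OF P u] .
  have e: "v \<otimes> u = u \<otimes> v" using com u by simp
  have 1: "u \<otimes> (u \<otimes> v) = v" using sq[OF u(1)] c u by (simp add: m_assoc[symmetric])
  have 2: "(u \<otimes> v) \<otimes> u = v" using com[OF uv u(1)] 1 by simp
  have 3: "(u \<otimes> v) \<otimes> v = u" using sq[OF u(2)] c u by (simp add: m_assoc)
  have 4: "v \<otimes> (u \<otimes> v) = u" using com[OF u(2) uv] 3 by simp
  show "subgroup {\<one>, u, v, u \<otimes> v} G"
  proof (rule subgroupI)
    show "{\<one>, u, v, u \<otimes> v} \<subseteq> carrier G" using c u by auto
    show "{\<one>, u, v, u \<otimes> v} \<noteq> {}" by simp
    show "inv x \<in> {\<one>, u, v, u \<otimes> v}" if "x \<in> {\<one>, u, v, u \<otimes> v}" for x using that iv u uv by auto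
    show "x \<otimes> y \<in> {\<one>, u, v, u \<otimes> v}" if "x \<in> {\<one>, u, v, u \<otimes> v}" "y \<in> {\<one>, u, v, u \<otimes> v}" for x y
      using that c u sq uv e 1 2 3 4 by (elim insertE emptyE) simp_all
  qed
qed

text \<open>S permutes the three nontrivial elements of A transitively, so A is elementary abelian
and is centralized by the generator z of \<open>cen P S\<close>. Hence P is elementary abelian of
order 8, which has 16 subgroups.\<close>

lemma order8_card_subs:
  assumes c: "coact 2 P 3 S" and P8: "card P = 8" and C2: "card (cen P S) = 2"
    and A: "A \<in> subs P" "\<not> moved S A" "card A = 4"
  shows "16 \<le> card (subs P)"
proof -
  note d = coactD[OF c]
  let ?C = "cen P S"
  have As: "subgroup A G" "A \<subseteq> P" using A by (auto simp: subs_def)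
  have Pc: "x \<in> carrier G" if "x \<in> P" for x using sgD(5)[OF d(4) that] .
  have Sc: "x \<in> carrier G" if "x \<in> S" for x using sgD(5)[OF d(5) that] .
  obtain k where k: "card S = 3 ^ k" using d(7) by blast
  have AC: "A \<inter> ?C = {\<one>}"
  proof -
    have i: "subgroup (A \<inter> ?C) G" by (rule sg_Int[OF As(1) d(15)])
    have "card (A \<inter> ?C) dvd 2" using sg_dvd[OF i d(15)] C2 by simp
    then have "card (A \<inter> ?C) = 1 \<or> card (A \<inter> ?C) = 2" by (metis prime_nat_iff two_is_prime_nat)
    moreover have "card (A \<inter> ?C) mod 3 = 1" using invariant_card_mod[OF c A(1,2)] A(3) by simp
    ultimately show ?thesis using sg_card1[OF i] by auto
  qed
  obtain z where z: "?C = {\<one>, z}" "z \<noteq> \<one>"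
  proof -
    obtain x y where xy: "?C = {x, y}" "x \<noteq> y" using C2 by (auto simp: card_2_iff)
    have "\<one> \<in> ?C" by (rule sgD(3)[OF d(15)])
    then show ?thesis using xy that[of x] that[of y] by auto
  qed
  have zP: "z \<in> P" "z \<in> ?C" using z cen_sub[of P S] by auto
  have zc: "z \<in> carrier G" using Pc[OF zP(1)] .
  have zz: "z \<otimes> z = \<one>" using pow_card_one[OF d(15) zP(2)] C2 zc by (simp add: numeral_2_eq_2)
  have zA: "z \<notin> A" using AC zP z(2) by auto
  have zS: "s \<otimes> z = z \<otimes> s" if "s \<in> S" for s using zP(2) that by (auto simp: cen_def)
  have trans: "\<exists>s\<in>S. a = s \<otimes> b \<otimes> inv s" if ab: "a \<in> A - {\<one>}" "b \<in> A - {\<one>}" for a b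
  proof -
    have ac: "acts S (\<lambda>s x. s \<otimes> x \<otimes> inv s) A"
      by (rule acts_elem[OF d(5) sgD(1)[OF As(1)]]) (use A(2) in \<open>auto simp: moved_def\<close>)
    have bP: "b \<in> P" "b \<in> carrier G" "b \<in> A" "b \<noteq> \<one>" using ab As(2) Pc by auto
    have nf: "\<exists>s\<in>S. s \<otimes> b \<otimes> inv s \<noteq> b"
    proof (rule ccontr)
      assume "\<not> ?thesis"
      then have "b \<in> ?C" using fixed_iff[OF Sc bP(2)] bP(1) unfolding cen_def by auto
      then show False using AC bP by auto
    qed
    let ?O = "(\<lambda>s. s \<otimes> b \<otimes> inv s) ` S"
    obtain j where j: "j > 0" "card ?O = 3 ^ j" using orbit_prime_power[OF d(5) k d(2) ac bP(3) nf] by blast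
    have OA: "?O \<subseteq> A - {\<one>}"
    proof
      fix x assume "x \<in> ?O"
      then obtain s where s: "s \<in> S" "x = s \<otimes> b \<otimes> inv s" by blast
      have "x \<in> A" using ac s bP(3) by (auto simp: acts_def)
      moreover have "x \<noteq> \<one>" using s bP inj_onD[OF cj_inj[OF Sc[OF s(1)]], of b \<one>] Sc[OF s(1)] by auto
      ultimately show "x \<in> A - {\<one>}" by simp
    qed
    have "card (A - {\<one>}) = 3" using A(3) sgD(3)[OF As(1)] by (simp add: card_Diff_singleton)
    moreover have "(3::nat) ^ 1 \<le> 3 ^ j" using j(1) by (intro power_increasing) auto
    ultimately have "?O = A - {\<one>}" using card_seteq[OF _ OA] sgD(2)[OF As(1)] j(2) by simp
    then show ?thesis using ab(1) by blast
  qed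
  have sqA: "a \<otimes> a = \<one>" if a: "a \<in> A" for a
  proof (cases "a = \<one>")
    case False
    obtain Y where Y: "subgroup Y G" "Y \<subseteq> A" "card Y = 2 ^ 1" using sg_exists_prime_power[OF As(1) two_is_prime_nat, of 1] A(3) by auto
    have "\<not> Y \<subseteq> {\<one>}" using Y(3) card_mono[of "{\<one>}" Y] by auto
    then obtain y where y: "y \<in> Y" "y \<noteq> \<one>" by blast
    have yc: "y \<in> carrier G" using y sgD(5)[OF Y(1)] by simp
    have yy: "y [^] (2::nat) = \<one>" using pow_card_one[OF Y(1) y(1)] Y(3) by simp
    obtain s where s: "s \<in> S" "a = s \<otimes> y \<otimes> inv s" using trans[of a y] a False y Y(2) by auto
    have "a [^] (2::nat) = s \<otimes> y [^] (2::nat) \<otimes> inv s" using cj_pow[OF Sc[OF s(1)] yc, of 2] s(2) by simp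
    then have "a [^] (2::nat) = \<one>" using yy Sc[OF s(1)] by simp
    then show ?thesis using Pc a As(2) by (simp add: numeral_2_eq_2 subset_iff)
  qed simp
  have nA: "nrm P A = P"
  proof -
    have N: "subgroup (nrm P A) G" by (rule nrm_sg[OF d(4) sgD(1)[OF As(1)]])
    have ps: "A \<subset> P" using As(2) A(3) P8 by auto
    obtain m where "card P = 2 ^ m" using d(6) by blast
    then obtain x where x: "x \<in> P - A" "cj x A = A" using normalizer_grows[OF d(4) _ two_is_prime_nat As(1) ps] by blast
    have "insert x A \<subseteq> nrm P A" using x sub_nrm[OF As] by (auto simp: nrm_def)
    then have "card (insert x A) \<le> card (nrm P A)" by (rule card_mono[OF sgD(2)[OF N]])
    then have "card (nrm P A) \<ge> 5" using x A(3) sgD(2)[OF As(1)] by simp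
    moreover obtain w where w: "8 = card (nrm P A) * w" using sg_dvd[OF N d(4) nrm_sub] P8 by (metis dvdE)
    ultimately have "card (nrm P A) = 8"
    proof -
      have "card (nrm P A) \<le> 8" using w by (cases w) auto
      moreover have "card (nrm P A) \<in> {5,6,7,8}" using calculation \<open>card (nrm P A) \<ge> 5\<close> by auto
      ultimately show ?thesis using w by auto presburger+
    qed
    then show ?thesis using sg_eqI[OF N d(4) nrm_sub] P8 by simp
  qed
  have zA': "a \<otimes> z = z \<otimes> a" if a: "a \<in> A" for a
  proof (cases "a = \<one>")
    case False
    have Cn: "cj s A = A" if "s \<in> ?C" for s using that nA cen_sub[of P S] by (auto simp: nrm_def)
    have "card A mod 2 = card (cen A ?C) mod 2"
      by (rule elem_inv_mod[OF d(15) _ two_is_prime_nat As(1) Cn, of 1]) (use C2 in auto)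
    then have ev: "even (card (cen A ?C))" using A(3) by presburger
    have B: "subgroup (cen A ?C) G" by (rule cen_sg[OF As(1) sgD(1)[OF d(15)]])
    have "\<not> cen A ?C \<subseteq> {\<one>}"
    proof
      assume "cen A ?C \<subseteq> {\<one>}"
      then have "cen A ?C = {\<one>}" using sgD(3)[OF B] by auto
      then show False using ev by simp
    qed
    then obtain b where b: "b \<in> cen A ?C" "b \<noteq> \<one>" by blast
    have bA: "b \<in> A" "b \<otimes> z = z \<otimes> b" using b zP(2) by (auto simp: cen_def)
    have bc: "b \<in> carrier G" using bA As(2) Pc by auto
    obtain s where s: "s \<in> S" "a = s \<otimes> b \<otimes> inv s" using trans[of a b] a False b bA by auto
    note sc = Sc[OF s(1)]
    have iz: "inv s \<otimes> z = z \<otimes> inv s" using zS[OF sgD(6)[OF d(5) s(1)]] .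
    have "a \<otimes> z = s \<otimes> (b \<otimes> (inv s \<otimes> z))" using s sc bc zc by (simp add: m_assoc)
    also have "\<dots> = s \<otimes> ((b \<otimes> z) \<otimes> inv s)" unfolding iz using sc bc zc by (simp add: m_assoc)
    also have "\<dots> = (s \<otimes> z) \<otimes> (b \<otimes> inv s)" unfolding bA(2) using sc bc zc by (simp add: m_assoc)
    also have "\<dots> = z \<otimes> a" unfolding zS[OF s(1)] using s sc bc zc by (simp add: m_assoc)
    finally show ?thesis .
  qed (use zc in simp)
  have PAC: "A <#> ?C = P"
  proof -
    have Cn: "cj s A = A" if "s \<in> ?C" for s using that nA cen_sub[of P S] by (auto simp: nrm_def)
    have p: "subgroup (A <#> ?C) G" by (rule prod_sg[OF As(1) d(15) Cn])
    have "A <#> ?C \<subseteq> P" by (rule prod_least[OF d(4) As(2) cen_sub])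
    then show ?thesis using sg_eqI[OF p d(4)] prod_card[OF As(1) d(15) AC] A(3) C2 P8 by simp
  qed
  have sq: "x \<otimes> x = \<one>" if x: "x \<in> P" for x
  proof -
    obtain a e where ae: "a \<in> A" "e \<in> ?C" "x = a \<otimes> e" using x PAC by (metis set_multE)
    have cc: "a \<in> carrier G" "e \<in> carrier G" using ae As(2) Pc cen_sub[of P S] by auto
    have "a \<otimes> e = e \<otimes> a" "e \<otimes> e = \<one>" using ae(2) z zA'[OF ae(1)] zz cc by auto
    then have "x \<otimes> x = a \<otimes> a \<otimes> (e \<otimes> e)" using cc ae(3) by (metis m_assoc m_closed)
    then show ?thesis using sqA[OF ae(1)] \<open>e \<otimes> e = \<one>\<close> by simp
  qed
  obtain a b where ab: "a \<in> A" "b \<in> A" "a \<noteq> \<one>" "b \<noteq> \<one>" "a \<noteq> b"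
  proof -
    have c3: "card (A - {\<one>}) = 3" using A(3) sgD(3)[OF As(1)] by (simp add: card_Diff_singleton)
    then have "A - {\<one>} \<noteq> {}" by (intro notI) simp
    then obtain a where a: "a \<in> A - {\<one>}" by blast
    then have "card (A - {\<one>} - {a}) = 2" using c3 sgD(2)[OF As(1)] by (subst card_Diff_singleton) auto
    then have "A - {\<one>} - {a} \<noteq> {}" by (intro notI) simp
    then obtain b where "b \<in> A - {\<one>} - {a}" by blast
    then show ?thesis using a that by blast
  qed
  have abP: "a \<in> P" "b \<in> P" "b \<otimes> z \<in> P" "a \<otimes> z \<in> P" using ab As(2) zP sgD(7)[OF d(4)] by auto
  have cs: "a \<in> carrier G" "b \<in> carrier G" using abP Pc by auto
  have nAz: "x \<otimes> z \<notin> A" if "x \<in> A" for x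
  proof
    assume "x \<otimes> z \<in> A"
    then have "inv x \<otimes> (x \<otimes> z) \<in> A" using that sgD(6,7)[OF As(1)] by simp
    then show False using zA zc that sgD(5)[OF As(1)] by (simp add: m_assoc[symmetric])
  qed
  have abA: "a \<otimes> b \<in> A" using ab sgD(7)[OF As(1)] by simp
  have ab1: "a \<otimes> b \<noteq> \<one>"
  proof
    assume "a \<otimes> b = \<one>"
    then have "a \<otimes> b = a \<otimes> a" using sqA[OF ab(1)] by simp
    then show False using ab(5) cs by simp
  qed
  have nbz: "a \<noteq> b \<otimes> z" "a \<otimes> (b \<otimes> z) \<noteq> z" "b \<otimes> z \<noteq> z" "a \<otimes> z \<noteq> z" "a \<otimes> (b \<otimes> z) \<notin> A" "b \<otimes> z \<notin> A" "a \<otimes> z \<notin> A"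
  proof -
    have e: "a \<otimes> (b \<otimes> z) = (a \<otimes> b) \<otimes> z" using cs zc by (simp add: m_assoc)
    have "(a \<otimes> b) \<otimes> z \<noteq> z" using ab1 cs zc by simp
    then show "a \<otimes> (b \<otimes> z) \<noteq> z" using e by metis
    show "a \<otimes> (b \<otimes> z) \<notin> A" using e nAz[OF abA] by metis
    show "a \<noteq> b \<otimes> z" "b \<otimes> z \<noteq> z" "a \<otimes> z \<noteq> z" "b \<otimes> z \<notin> A" "a \<otimes> z \<notin> A"
      using nAz[OF ab(2)] nAz[OF ab(1)] ab cs zc by auto
  qed
  let ?Y2 = "{\<one>, a}" and ?Y3 = "{\<one>, a \<otimes> z}" and ?Y4 = "{\<one>, a, z, a \<otimes> z}" and ?Y5 = "{\<one>, a, b \<otimes> z, a \<otimes> (b \<otimes> z)}"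
  have Y: "?Y2 \<in> subs P" "?Y3 \<in> subs P" "?Y4 \<in> subs P" "?Y5 \<in> subs P"
    using klein_sg[OF d(4) sq] abP zP sgD(3,7)[OF d(4)] by (auto simp: subs_def)
  have oA: "\<one> \<in> A" by (rule sgD(3)[OF As(1)])
  have cY: "card ?Y2 = 2" "card ?Y3 = 2" "card ?Y4 = 4" "card ?Y5 = 4"
  proof -
    have n1: "a \<otimes> z \<noteq> \<one>" "a \<noteq> z" "a \<noteq> a \<otimes> z" "b \<otimes> z \<noteq> \<one>" "a \<otimes> (b \<otimes> z) \<noteq> \<one>"
      using nbz oA zA ab by metis+
    have "a \<noteq> a \<otimes> (b \<otimes> z)" using nbz(5) ab(1) by metis
    moreover have "b \<otimes> z \<noteq> a \<otimes> (b \<otimes> z)" using ab(3) cs zc by simp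
    ultimately show "card ?Y2 = 2" "card ?Y3 = 2" "card ?Y4 = 4" "card ?Y5 = 4"
      using n1 ab(3) z(2) nbz by (simp_all add: card_insert_if not_sym)
  qed
  have mv2: "moved S B" if B: "B \<in> subs P" "card B = 2" "\<not> z \<in> B" for B
  proof (rule ccontr)
    assume "\<not> moved S B"
    then have "card B mod 3 = card (B \<inter> ?C) mod 3" by (rule invariant_card_mod[OF c B(1)])
    moreover have "B \<inter> ?C = {\<one>}" using B sgD(3)[of B] z(1) by (auto simp: subs_def)
    ultimately show False using B(2) by simp
  qed
  have mv4: "moved S B" if B: "B \<in> subs P" "card B = 4" "z \<in> B" for B
  proof (rule ccontr)
    assume "\<not> moved S B"
    then have "card B mod 3 = card (B \<inter> ?C) mod 3" by (rule invariant_card_mod[OF c B(1)])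
    moreover have "B \<inter> ?C = {\<one>, z}" using B sgD(3)[of B] z(1) by (auto simp: subs_def)
    ultimately show False using B(2) z(2) by simp
  qed
  have m2: "moved S ?Y2" by (rule mv2[OF Y(1) cY(1)]) (use zA ab z in auto)
  have m3: "moved S ?Y3" by (rule mv2[OF Y(2) cY(2)]) (use nbz z in auto)
  have m4: "moved S ?Y4" by (rule mv4[OF Y(3) cY(3)]) simp
  have m5: "moved S ?Y5"
  proof (rule ccontr)
    assume n: "\<not> moved S ?Y5"
    have e: "?Y5 \<inter> A = ?Y2" using nbz oA ab by auto
    have "cj s ?Y2 = ?Y2" if "s \<in> S" for s
      using cj_Int[OF Sc[OF that], of ?Y5 A] n A(2) that e Y(4) sgD(1) As(1) unfolding moved_def subs_def
      by (metis (no_types, lifting) mem_Collect_eq)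
    then show False using m2 by (simp add: moved_def)
  qed
  have Ac: "A \<subseteq> carrier G" "?C \<subseteq> carrier G" using sgD(1)[OF As(1)] sgD(1)[OF d(15)] by auto
  have nmC: "\<not> moved S ?C" by (rule not_moved_simps(3)[OF c subset_refl])
  \<comment> \<open>The label separates the trivial subgroup, A, the centralizer, P, and four
    orbits of S, each of length at least 3.\<close>
  let ?\<kappa> = "\<lambda>Z. (card Z, Z \<subseteq> A, ?C \<subseteq> Z, moved S Z)"
  note ob = orbit_bound[OF c _ _ Ac(1) A(2) Ac(2) nmC]
  have b2: "(?Y2 \<subseteq> A) = True" "(?C \<subseteq> ?Y2) = False" using oA ab zA unfolding z(1) by auto
  have b3: "(?Y3 \<subseteq> A) = False" "(?C \<subseteq> ?Y3) = False" using nbz z(2) unfolding z(1) by auto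
  have b4: "(?Y4 \<subseteq> A) = False" "(?C \<subseteq> ?Y4) = True" using zA unfolding z(1) by auto
  have b5: "(?Y5 \<subseteq> A) = False" "(?C \<subseteq> ?Y5) = False" using nbz z(2) zA ab(1) unfolding z(1) by auto
  have o2: "3 \<le> card {Z \<in> subs P. ?\<kappa> Z = (2, True, False, True)}"
    using ob[OF Y(1) m2] unfolding cY(1) b2 .
  have o3: "3 \<le> card {Z \<in> subs P. ?\<kappa> Z = (2, False, False, True)}"
    using ob[OF Y(2) m3] unfolding cY(2) b3 .
  have o4: "3 \<le> card {Z \<in> subs P. ?\<kappa> Z = (4, False, True, True)}"
    using ob[OF Y(3) m4] unfolding cY(3) b4 .
  have o5: "3 \<le> card {Z \<in> subs P. ?\<kappa> Z = (4, False, False, True)}"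
    using ob[OF Y(4) m5] unfolding cY(4) b5 .
  have PinA: "\<not> P \<subseteq> A" using zP zA by auto
  have f1: "1 \<le> card {Z \<in> subs P. ?\<kappa> Z = (1, True, False, False)}"
    using one_bound[of "{\<one>}" P ?\<kappa>] sg_one sgD(3)[OF d(4)] oA z not_moved_simps(2)[OF c] by (auto simp: subs_def)
  have f2: "1 \<le> card {Z \<in> subs P. ?\<kappa> Z = (4, True, False, False)}"
    using one_bound[of A P ?\<kappa>] A z zA by auto
  have f3: "1 \<le> card {Z \<in> subs P. ?\<kappa> Z = (2, False, True, False)}"
  proof -
    have "?C \<in> subs P" using d(15) cen_sub by (simp add: subs_def)
    from one_bound[OF this, of ?\<kappa>] show ?thesis
      using C2 nmC z zA by (simp only: subset_refl simp_thms) auto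
  qed
  have f4: "1 \<le> card {Z \<in> subs P. ?\<kappa> Z = (8, False, True, False)}"
    using one_bound[of P P ?\<kappa>] P8 d(4) cen_sub[of P S] PinA not_moved_simps(1)[OF c] by (auto simp: subs_def)
  let ?L = "[((1::nat, True, False, False), 1), ((4, True, False, False), 1), ((2, False, True, False), 1), ((8, False, True, False), 1),
    ((2, True, False, True), 3), ((2, False, False, True), 3), ((4, False, True, True), 3), ((4, False, False, True), 3::nat)]"
  have "sum_list (map snd ?L) \<le> card (subs P)"
  proof (rule tagged_card_bound[OF subs_finite, where \<kappa> = ?\<kappa>])
    show "distinct (map fst ?L)" by simp
    have all: "\<forall>e\<in>set ?L. snd e \<le> card {x \<in> subs P. ?\<kappa> x = fst e}"
      by (simp only: list.set ball_simps fst_conv snd_conv o2 o3 o4 o5 f1 f2 f3 f4 simp_thms)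
    show "l \<le> card {x \<in> subs P. ?\<kappa> x = i}" if "(i, l) \<in> set ?L" for i l
      using bspec[OF all that] unfolding fst_conv snd_conv .
  qed
  then show ?thesis by simp
qed

lemma cj_cyc: assumes "r \<in> carrier G" "x \<in> carrier G" shows "cj r (cyc x) = cyc (r \<otimes> x \<otimes> inv r)"
proof -
  have x': "r \<otimes> x \<otimes> inv r \<in> carrier G" using assms by simp
  show ?thesis
  proof
    show "cj r (cyc x) \<subseteq> cyc (r \<otimes> x \<otimes> inv r)"
    proof
      fix y assume "y \<in> cj r (cyc x)"
      then obtain z where z: "z \<in> cyc x" "y = r \<otimes> z \<otimes> inv r" by (auto simp: cj_def)
      obtain k :: nat where "z = x [^] k" using cyc_powE[OF assms(2) z(1)] by blast
      then have "y = (r \<otimes> x \<otimes> inv r) [^] k" using z cj_pow assms by simp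
      then show "y \<in> cyc (r \<otimes> x \<otimes> inv r)" using cyc_pow[OF x'] by blast
    qed
    show "cyc (r \<otimes> x \<otimes> inv r) \<subseteq> cj r (cyc x)"
      by (rule cyc_least[OF cj_sg[OF assms(1) cyc_sg[OF assms(2)]]]) (use cyc_self[of x] in \<open>auto simp: cj_def\<close>)
  qed
qed

lemma index_two_square:
  assumes C: "subgroup C G" and M: "subgroup M G" "C \<subseteq> M" "card M = 2 * card C" and u: "u \<in> M"
  shows "u \<otimes> u \<in> C"
proof (cases "u \<in> C")
  case True then show ?thesis using sgD(7)[OF C] by simp
next
  case False
  have uc: "u \<in> carrier G" using u sgD(5)[OF M(1)] by simp
  have Cc: "x \<in> carrier G" if "x \<in> C" for x using sgD(5)[OF C that] .
  have img: "card ((\<lambda>x. u \<otimes> x) ` C) = card C" by (rule card_image) (use uc Cc in \<open>auto simp: inj_on_def\<close>)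
  have nC: "u \<otimes> x \<notin> C" if "x \<in> C" for x
  proof
    assume "u \<otimes> x \<in> C"
    then have "u \<otimes> x \<otimes> inv x \<in> C" using that sgD(6,7)[OF C] by simp
    then show False using False uc Cc[OF that] by (simp add: m_assoc)
  qed
  have "C \<inter> (\<lambda>x. u \<otimes> x) ` C = {}" using nC by auto
  then have "card (C \<union> (\<lambda>x. u \<otimes> x) ` C) = card M" using img M(3) sgD(2)[OF C] by (simp add: card_Un_disjoint)
  moreover have "C \<union> (\<lambda>x. u \<otimes> x) ` C \<subseteq> M" using M(2) u sgD(7)[OF M(1)] by auto
  ultimately have e: "C \<union> (\<lambda>x. u \<otimes> x) ` C = M" using card_subset_eq[OF sgD(2)[OF M(1)]] by simp
  show ?thesis
  proof (rule ccontr)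
    assume "u \<otimes> u \<notin> C"
    moreover have "u \<otimes> u \<in> M" using sgD(7)[OF M(1) u u] .
    ultimately have "u \<otimes> u \<in> (\<lambda>x. u \<otimes> x) ` C" using e by blast
    then obtain x where x: "x \<in> C" "u \<otimes> u = u \<otimes> x" by blast
    then have "u = x" using uc Cc by simp
    then show False using False x by simp
  qed
qed

text \<open>The centralizer C of S is normal in P, and P is covered by three subgroups M of order
8 that contain C, meet pairwise in C and are permuted by S. They are not cyclic, so each has
subgroups of order at most 4 outside C. Counting the subgroups of C, the group P, three groups M
and four of the small subgroups gives 11.\<close>

lemma order16_card_subs:
  assumes c: "coact 2 P 3 S" and P16: "card P = 16" and C4: "card (cen P S) = 4"
  shows "11 \<le> card (subs P)"
proof -
  note d = coactD[OF c]
  define C where "C = cen P S"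
  have C: "subgroup C G" "C \<subseteq> P" "card C = 4" using d(15) cen_sub C4 by (auto simp: C_def)
  have Pc: "x \<in> carrier G" if "x \<in> P" for x using sgD(5)[OF d(4) that] .
  have Sc: "x \<in> carrier G" if "x \<in> S" for x using sgD(5)[OF d(5) that] .
  have CS: "cj s C = C" if "s \<in> S" for s using cen_inv[OF d(4,5) _ that, of C] by (simp add: C_def)
  have fixC: "s \<otimes> x \<otimes> inv s = x" if "s \<in> S" "x \<in> C" for s x
  proof -
    have "x \<otimes> s = s \<otimes> x" using that by (auto simp: C_def cen_def)
    then show ?thesis using fixed_iff[OF Sc[OF that(1)] Pc] that C(2) by auto
  qed
  have P4: "card P = 2 ^ 4" using P16 by simp
  obtain k where k: "card S = 3 ^ k" using d(7) by blast
  have pow2: "card H = 1 \<or> card H = 2 \<or> card H = 4 \<or> card H = 8 \<or> card H = 16" if "subgroup H G" "H \<subseteq> P" for H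
  proof -
    have "card H dvd 2 ^ 4" using sg_dvd[OF that(1) d(4) that(2)] P4 by simp
    then obtain i where "card H = 2 ^ i" "i \<le> 4" by (metis divides_primepow_nat two_is_prime_nat)
    moreover then have "i = 0 \<or> i = 1 \<or> i = 2 \<or> i = 3 \<or> i = 4" by linarith
    ultimately show ?thesis by auto
  qed
  have grow: "card (nrm P H) > card H" if H: "subgroup H G" "H \<subseteq> P" "card H < 16" for H
  proof -
    have "H \<subset> P" using H P16 by auto
    then obtain x where x: "x \<in> P - H" "cj x H = H" using normalizer_grows[OF d(4) P4 two_is_prime_nat H(1)] by blast
    have N: "subgroup (nrm P H) G" by (rule nrm_sg[OF d(4) sgD(1)[OF H(1)]])
    have "H \<subset> nrm P H" using sub_nrm[OF H(1,2)] x by (auto simp: nrm_def)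
    then show ?thesis using psubset_card_mono[OF sgD(2)[OF N]] by simp
  qed
  \<comment> \<open>The normalizer of C is S-invariant and its fixed points are those in C, so its
    order is 4 modulo 3; among the orders 8 and 16 only 16 is.\<close>
  have nC: "nrm P C = P"
  proof -
    let ?N = "nrm P C"
    have N: "subgroup ?N G" by (rule nrm_sg[OF d(4) sgD(1)[OF C(1)]])
    have CN: "C \<subseteq> ?N" by (rule sub_nrm[OF C(1,2)])
    have "cj s ?N = ?N" if s: "s \<in> S" for s
    proof -
      have "cj s ?N \<subseteq> ?N"
      proof
        fix y assume "y \<in> cj s ?N"
        then obtain x where x: "x \<in> P" "cj x C = C" "y = s \<otimes> x \<otimes> inv s" by (auto simp: cj_def nrm_def)
        have "y \<in> P" using d(8)[OF s] x by (auto simp: cj_def)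
        moreover have "cj y C = cj s (cj x (cj (inv s) C))"
          using x Sc[OF s] Pc[OF x(1)] sgD(1)[OF C(1)] by (simp add: cj_mult cj_carrier)
        then have "cj y C = C" using CS s x(2) sgD(6)[OF d(5)] by simp
        ultimately show "y \<in> ?N" by (simp add: nrm_def)
      qed
      then show ?thesis using sg_eqI[OF cj_sg[OF Sc[OF s] N] N] cj_card[OF Sc[OF s] sgD(1)[OF N]] by simp
    qed
    then have "\<not> moved S ?N" by (simp add: moved_def)
    moreover have "?N \<in> subs P" using N nrm_sub by (simp add: subs_def)
    ultimately have "card ?N mod 3 = card (?N \<inter> C) mod 3" using invariant_card_mod[OF c, of ?N] by (simp add: C_def)
    moreover have "?N \<inter> C = C" using CN by auto
    ultimately have "card ?N mod 3 = 1" using C(3) by simp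
    moreover have "card ?N > 4" using grow[OF C(1,2)] C(3) by simp
    ultimately have "card ?N = 16" using pow2[OF N nrm_sub] by auto
    then show ?thesis using sg_eqI[OF N d(4) nrm_sub] P16 by simp
  qed
  \<comment> \<open>An element of P that has order two modulo C; together with C it generates
    M.\<close>
  obtain y where y: "y \<in> P" "y \<notin> C" "y \<otimes> y \<in> C"
  proof -
    have "\<not> P \<subseteq> C" using C P16 card_mono[OF sgD(2)[OF C(1)], of P] by auto
    then obtain x where x: "x \<in> P" "x \<notin> C" by blast
    define i where "i = (LEAST i. x [^] (2 ^ i :: nat) \<in> C)"
    have "x [^] (2 ^ 4 :: nat) \<in> C" using pow_card_one[OF d(4) x(1)] P16 sgD(3)[OF C(1)] by simp
    then have i1: "x [^] (2 ^ i :: nat) \<in> C" unfolding i_def by (rule LeastI)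
    have i0: "i \<noteq> 0" using i1 x Pc by (intro notI) simp
    have n: "x [^] (2 ^ (i - 1) :: nat) \<notin> C" using not_less_Least[of "i - 1" "\<lambda>i. x [^] (2 ^ i :: nat) \<in> C"] i0 by (simp add: i_def)
    have "(2::nat) ^ i = 2 ^ (i - 1) + 2 ^ (i - 1)" using i0 by (cases i) auto
    then have "x [^] (2 ^ (i - 1) :: nat) \<otimes> x [^] (2 ^ (i - 1) :: nat) \<in> C" using i1 Pc[OF x(1)] by (simp add: nat_pow_mult)
    then show ?thesis using that[of "x [^] (2 ^ (i - 1) :: nat)"] n sg_pow[OF d(4) x(1)] by simp
  qed
  have yc: "y \<in> carrier G" using Pc[OF y(1)] .
  define M where "M = C <#> cyc y"
  have cyP: "cyc y \<subseteq> P" by (rule cyc_least[OF d(4) y(1)])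
  have M: "subgroup M G" unfolding M_def
    by (rule prod_sg[OF C(1) cyc_sg[OF yc]]) (use cyP nC in \<open>auto simp: nrm_def\<close>)
  have CM: "C \<subseteq> M" unfolding M_def by (rule prod_sub1[OF cyc_sg[OF yc] sgD(1)[OF C(1)]])
  have yM: "y \<in> M" using prod_sub2[OF C(1) sgD(1)[OF cyc_sg[OF yc]]] cyc_self[of y] by (auto simp: M_def)
  have MP: "M \<subseteq> P" unfolding M_def by (rule prod_least[OF d(4) C(2) cyP])
  have M8: "card M = 8"
  proof -
    have sub: "M \<subseteq> C \<union> (\<lambda>x. y \<otimes> x) ` C"
    proof
      fix z assume "z \<in> M"
      then obtain a b where ab: "a \<in> C" "b \<in> cyc y" "z = a \<otimes> b" unfolding M_def by (rule set_multE)
      obtain l :: nat where l: "b = y [^] l" using cyc_powE[OF yc ab(2)] by blast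
      have ac: "a \<in> carrier G" using ab C(2) Pc by auto
      have ev: "y [^] (2 * j) \<in> C" for j :: nat
      proof -
        have "y [^] (2 * j) = (y [^] (2::nat)) [^] j" using yc by (simp add: nat_pow_pow)
        also have "y [^] (2::nat) = y \<otimes> y" using yc by (simp add: numeral_2_eq_2)
        finally show ?thesis using sg_pow[OF C(1) y(3)] by simp
      qed
      show "z \<in> C \<union> (\<lambda>x. y \<otimes> x) ` C"
      proof (cases "even l")
        case True
        then obtain j where "l = 2 * j" by blast
        then have "z \<in> C" using ab l ev sgD(7)[OF C(1)] by simp
        then show ?thesis by simp
      next
        case False
        then obtain j where j: "l = 2 * j + 1" by (rule oddE)
        have "b = y [^] (2 * j) \<otimes> y" using l j yc by simp
        then have b: "b = y \<otimes> y [^] (2 * j)" using yc by (metis nat_pow_Suc nat_pow_Suc2)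
        have "cj (inv y) C = C" using nC sgD(6)[OF d(4) y(1)] by (auto simp: nrm_def)
        then have "inv y \<otimes> a \<otimes> y \<in> C" using ab(1) yc unfolding cj_def by force
        then have 1: "(inv y \<otimes> a \<otimes> y) \<otimes> y [^] (2 * j) \<in> C" using ev sgD(7)[OF C(1)] by simp
        have "z = y \<otimes> ((inv y \<otimes> a \<otimes> y) \<otimes> y [^] (2 * j))"
          unfolding ab(3) b using yc ac by (simp add: m_assoc) (simp add: m_assoc[symmetric])
        then show ?thesis using 1 by blast
      qed
    qed
    have "card M \<le> card (C \<union> (\<lambda>x. y \<otimes> x) ` C)" by (rule card_mono[OF _ sub]) (use sgD(2)[OF C(1)] in auto)
    also have "\<dots> \<le> card C + card ((\<lambda>x. y \<otimes> x) ` C)" by (rule card_Un_le)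
    also have "\<dots> \<le> 8" using card_image_le[OF sgD(2)[OF C(1)], of "\<lambda>x. y \<otimes> x"] C(3) by simp
    finally have "card M \<le> 8" .
    moreover have "C \<subset> M" using CM yM y(2) by auto
    then have "card C < card M" by (rule psubset_card_mono[OF sgD(2)[OF M]])
    then have "card M > 4" using C(3) by simp
    ultimately show ?thesis using pow2[OF M MP] by auto
  qed
  have Msub: "M \<in> subs P" using M MP by (simp add: subs_def)
  have mvM: "moved S M"
  proof (rule ccontr)
    assume "\<not> moved S M"
    then have "card M mod 3 = card (M \<inter> C) mod 3" using invariant_card_mod[OF c Msub] by (simp add: C_def)
    moreover have "M \<inter> C = C" using CM by auto
    ultimately show False using M8 C(3) by simp
  qed
  define Ms where "Ms = cjs S M"
  have Ms3: "card Ms \<ge> 3" unfolding Ms_def by (rule cjs_ge[OF d(5) k d(2) M]) (use mvM in \<open>simp add: moved_def\<close>)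
  have fMs: "finite Ms" using sgD(2)[OF d(5)] by (simp add: Ms_def cjs_def)
  have Msf: "subgroup N G" "N \<subseteq> P" "card N = 8" "C \<subseteq> N" "\<exists>r\<in>S. N = cj r M" if N: "N \<in> Ms" for N
  proof -
    obtain r where r: "r \<in> S" "N = cj r M" using N by (auto simp: Ms_def cjs_def)
    show "subgroup N G" using r cj_sg[OF Sc M] by simp
    show "N \<subseteq> P" using r d(8) cj_mono[OF MP, of r] by simp
    show "card N = 8" using r cj_card[OF Sc sgD(1)[OF M]] M8 by simp
    show "C \<subseteq> N" using r CS cj_mono[OF CM, of r] by simp
    show "\<exists>r\<in>S. N = cj r M" using r by blast
  qed
  have MMs: "M \<in> Ms" unfolding Ms_def cjs_def using sgD(3)[OF d(5)] cj_one[OF sgD(1)[OF M]] by force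
  have Int: "N \<inter> N' = C" if N: "N \<in> Ms" "N' \<in> Ms" "N \<noteq> N'" for N N'
  proof -
    have i: "subgroup (N \<inter> N') G" by (rule sg_Int[OF Msf(1)[OF N(1)] Msf(1)[OF N(2)]])
    have CI: "C \<subseteq> N \<inter> N'" using Msf(4) N by auto
    have "card (N \<inter> N') \<noteq> 8 \<and> card (N \<inter> N') \<le> 8"
    proof
      show "card (N \<inter> N') \<le> 8" using card_mono[OF sgD(2)[OF Msf(1)[OF N(1)]], of "N \<inter> N'"] Msf(3)[OF N(1)] by simp
      show "card (N \<inter> N') \<noteq> 8"
      proof
        assume e: "card (N \<inter> N') = 8"
        have "N \<inter> N' = N" using sg_eqI[OF i Msf(1)[OF N(1)]] e Msf(3)[OF N(1)] by simp
        moreover have "N \<inter> N' = N'" using sg_eqI[OF i Msf(1)[OF N(2)]] e Msf(3)[OF N(2)] by simp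
        ultimately show False using N(3) by simp
      qed
    qed
    moreover have "N \<inter> N' \<subseteq> P" using Msf(2)[OF N(1)] by blast
    ultimately have "card (N \<inter> N') \<le> 4" using pow2[OF i] by auto
    then show ?thesis using sg_eqI[OF C(1) i CI] C(3) by simp
  qed
  have cover: "\<exists>N\<in>Ms. w \<in> N" if w: "w \<in> P - C" for w
  proof -
    have cN: "card (N - C) = 4" if "N \<in> Ms" for N
      using Msf(3,4)[OF that] C(3) sgD(2)[OF C(1)] by (simp add: card_Diff_subset)
    have "card (\<Union>N\<in>Ms. N - C) = (\<Sum>N\<in>Ms. card (N - C))"
    proof (rule card_UN_disjoint[OF fMs])
      show "\<forall>N\<in>Ms. finite (N - C)" using sgD(2)[OF Msf(1)] by blast
      show "\<forall>N\<in>Ms. \<forall>N'\<in>Ms. N \<noteq> N' \<longrightarrow> (N - C) \<inter> (N' - C) = {}" using Int by blast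
    qed
    also have "\<dots> = 4 * card Ms" using cN by simp
    finally have "12 \<le> card (\<Union>N\<in>Ms. N - C)" using Ms3 by simp
    moreover have "card (P - C) = 12" using C P16 sgD(2)[OF C(1)] by (simp add: card_Diff_subset)
    moreover have "(\<Union>N\<in>Ms. N - C) \<subseteq> P - C" using Msf(2) by blast
    ultimately have "(\<Union>N\<in>Ms. N - C) = P - C" using card_seteq[of "P - C"] sgD(2)[OF d(4)] by simp
    then show ?thesis using w by blast
  qed
  obtain M2 where M2: "M2 \<in> Ms" "M2 \<noteq> M"
  proof -
    have "\<not> Ms \<subseteq> {M}" using Ms3 card_mono[of "{M}" Ms] by auto
    then show ?thesis using that by blast
  qed
  obtain M3 where M3: "M3 \<in> Ms" "M3 \<noteq> M" "M3 \<noteq> M2"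
  proof -
    have "\<not> Ms \<subseteq> {M, M2}"
    proof
      assume "Ms \<subseteq> {M, M2}"
      then have "card Ms \<le> card {M, M2}" by (rule card_mono[rotated]) simp
      then show False using Ms3 M2(2) by simp
    qed
    then show ?thesis using that by blast
  qed
  obtain s where s: "s \<in> S" "M2 = cj s M" using Msf(5)[OF M2(1)] by blast
  obtain s3 where s3: "s3 \<in> S" "M3 = cj s3 M" using Msf(5)[OF M3(1)] by blast
  \<comment> \<open>If M were generated by x, its conjugate by s would be generated by the
    conjugate v of x, which has the same square as x. Then x and v commute up to an element e of
    order at most two, and w, the product of x with the inverse of v, has square e. But w lies
    outside C in one of the cyclic groups of order 8, whose elements with trivial fourth power all
    lie in C.\<close>
  have notcyc: "M \<noteq> cyc x" if x: "x \<in> M" for x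
  proof
    assume Mx: "M = cyc x"
    have xc: "x \<in> carrier G" "x \<in> P" using x MP Pc by auto
    note sc = Sc[OF s(1)]
    have xC: "x \<notin> C"
    proof
      assume "x \<in> C"
      then have "M \<subseteq> C" using cyc_least[OF C(1)] Mx by simp
      then show False using y(2) yM by auto
    qed
    define v where "v = s \<otimes> x \<otimes> inv s"
    have vc: "v \<in> carrier G" using sc xc by (simp add: v_def)
    have M2v: "M2 = cyc v" using s(2) Mx cj_cyc[OF sc xc(1)] by (simp add: v_def)
    have vM2: "v \<in> M2" using M2v cyc_self by simp
    have i12: "M \<inter> M2 = C" using Int[OF MMs M2(1)] M2(2) by simp
    have zC: "x \<otimes> x \<in> C" by (rule index_two_square[OF C(1) M CM _ x]) (use M8 C(3) in simp)
    have vz: "v \<otimes> v = x \<otimes> x"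
    proof -
      have "v [^] (2::nat) = s \<otimes> x [^] (2::nat) \<otimes> inv s" unfolding v_def by (rule cj_pow[OF sc xc(1), symmetric])
      then have "v \<otimes> v = s \<otimes> (x \<otimes> x) \<otimes> inv s" using xc vc by (simp add: numeral_2_eq_2)
      then show ?thesis using fixC[OF s(1) zC] by simp
    qed
    have nrm8: "cj g N = N" if N: "N \<in> Ms" and g: "g \<in> P" for N g
    proof -
      have n: "subgroup (nrm P N) G" by (rule nrm_sg[OF d(4) sgD(1)[OF Msf(1)[OF N]]])
      have "card (nrm P N) > 8" using grow[OF Msf(1,2)[OF N]] Msf(3)[OF N] by simp
      then have "card (nrm P N) = 16" using pow2[OF n nrm_sub] by auto
      then have "nrm P N = P" using sg_eqI[OF n d(4) nrm_sub] P16 by simp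
      then show ?thesis using g by (auto simp: nrm_def)
    qed
    have vP: "v \<in> P" using vM2 Msf(2)[OF M2(1)] by auto
    define e where "e = x \<otimes> v \<otimes> inv x \<otimes> inv v"
    have "x \<otimes> v \<otimes> inv x \<in> M2" using nrm8[OF M2(1) xc(2)] vM2 by (auto simp: cj_def)
    then have e2: "e \<in> M2" unfolding e_def using vM2 sgD(6,7)[OF Msf(1)[OF M2(1)]] by simp
    have "v \<otimes> inv x \<otimes> inv v \<in> M" using nrm8[OF MMs vP] sgD(6)[OF M x] by (auto simp: cj_def)
    then have "x \<otimes> (v \<otimes> inv x \<otimes> inv v) \<in> M" using x sgD(7)[OF M] by simp
    then have "e \<in> M" unfolding e_def using xc vc by (simp add: m_assoc)
    then have eC: "e \<in> C" using e2 i12 by blast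
    have ec: "e \<in> carrier G" using eC C(2) Pc by auto
    have ex: "e \<otimes> x = x \<otimes> e" by (rule cyc_comm[OF xc(1)]) (use \<open>e \<in> M\<close> Mx cyc_self in auto)
    have ev: "e \<otimes> v = v \<otimes> e" by (rule cyc_comm[OF vc]) (use e2 M2v cyc_self in auto)
    have xv: "x \<otimes> v = e \<otimes> v \<otimes> x" unfolding e_def using xc vc by (simp add: m_assoc)
    have zv: "(x \<otimes> x) \<otimes> v = v \<otimes> (x \<otimes> x)" unfolding vz[symmetric] using vc by (simp add: m_assoc)
    have ee: "e \<otimes> e = \<one>"
    proof -
      have "(x \<otimes> x) \<otimes> v = x \<otimes> (e \<otimes> v \<otimes> x)" using xv xc vc by (simp add: m_assoc)
      also have "\<dots> = e \<otimes> (x \<otimes> v) \<otimes> x" using ex xc vc ec by (simp add: m_assoc[symmetric])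
      also have "\<dots> = e \<otimes> e \<otimes> (v \<otimes> (x \<otimes> x))" unfolding xv using xc vc ec by (simp add: m_assoc)
      finally have "v \<otimes> (x \<otimes> x) = (e \<otimes> e) \<otimes> (v \<otimes> (x \<otimes> x))" using zv by simp
      then show ?thesis using vc xc ec by simp
    qed
    define w where "w = x \<otimes> inv v"
    have wc: "w \<in> carrier G" "w \<in> P" using xc vc vP sgD(6,7)[OF d(4)] by (auto simp: w_def)
    have wC: "w \<notin> C"
    proof
      assume "w \<in> C"
      then have "w \<in> M2" using Msf(4)[OF M2(1)] by auto
      then have "w \<otimes> v \<in> M2" using vM2 sgD(7)[OF Msf(1)[OF M2(1)]] by simp
      then have "x \<in> M2" using xc vc by (simp add: w_def m_assoc)
      then show False using xC x i12 by blast
    qed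
    have vx: "inv v \<otimes> x = e \<otimes> x \<otimes> inv v"
    proof -
      have "v \<otimes> (e \<otimes> x \<otimes> inv v) = (v \<otimes> e) \<otimes> x \<otimes> inv v" using vc ec xc by (simp add: m_assoc)
      also have "\<dots> = (e \<otimes> v \<otimes> x) \<otimes> inv v" unfolding ev[symmetric] by (rule refl)
      also have "\<dots> = x" unfolding xv[symmetric] using xc vc by (simp add: m_assoc)
      finally have "inv v \<otimes> (v \<otimes> (e \<otimes> x \<otimes> inv v)) = inv v \<otimes> x" by simp
      then show ?thesis using vc ec xc by (simp add: m_assoc[symmetric])
    qed
    have ww: "w \<otimes> w = e"
    proof -
      have "w \<otimes> w = x \<otimes> (inv v \<otimes> x) \<otimes> inv v" using xc vc by (simp add: w_def m_assoc)
      also have "\<dots> = (x \<otimes> e) \<otimes> x \<otimes> inv v \<otimes> inv v" unfolding vx using xc vc ec by (simp add: m_assoc)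
      also have "\<dots> = e \<otimes> (x \<otimes> x) \<otimes> inv (v \<otimes> v)" unfolding ex[symmetric] using xc vc ec by (simp add: m_assoc inv_mult_group)
      also have "\<dots> = e" unfolding vz using xc ec by (simp add: m_assoc)
      finally show ?thesis .
    qed
    have w4: "w [^] (4::nat) = \<one>"
    proof -
      have "w [^] (4::nat) = (w \<otimes> w) \<otimes> (w \<otimes> w)" using wc by (simp add: numeral_eq_Suc m_assoc)
      then show ?thesis using ww ee by simp
    qed
    obtain N where N: "N \<in> Ms" "w \<in> N" using cover wc(2) wC by blast
    obtain r where r: "r \<in> S" "N = cj r M" using Msf(5)[OF N(1)] by blast
    define x' where "x' = r \<otimes> x \<otimes> inv r"
    have x'c: "x' \<in> carrier G" using Sc[OF r(1)] xc by (simp add: x'_def)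
    have Nx: "N = cyc x'" using r(2) Mx cj_cyc[OF Sc[OF r(1)] xc(1)] by (simp add: x'_def)
    let ?Z = "{z \<in> cyc x'. z [^] (4::nat) = \<one>}"
    have Z: "subgroup ?Z G" by (rule roots_sg[OF x'c])
    have CZ: "C \<subseteq> ?Z"
    proof
      fix a assume a: "a \<in> C"
      then have "a \<in> cyc x'" using Msf(4)[OF N(1)] Nx by auto
      moreover have "a [^] (4::nat) = \<one>" using pow_card_one[OF C(1) a] C(3) by simp
      ultimately show "a \<in> ?Z" by simp
    qed
    have ZN: "?Z \<subseteq> N" using Nx by auto
    have "card ?Z \<noteq> 8"
    proof
      assume "card ?Z = 8"
      then have "?Z = N" using sg_eqI[OF Z Msf(1)[OF N(1)] ZN] Msf(3)[OF N(1)] by simp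
      then have "x' [^] (4::nat) = \<one>" using Nx cyc_self[of x'] by blast
      then have "ord x' dvd 4" using pow_eq_id[OF x'c] by simp
      moreover have "ord x' = 8" using generate_pow_card[OF x'c] Nx Msf(3)[OF N(1)] by simp
      ultimately show False by simp
    qed
    moreover have "card ?Z \<le> 8" using card_mono[OF sgD(2)[OF Msf(1)[OF N(1)]] ZN] Msf(3)[OF N(1)] by simp
    moreover have "?Z \<subseteq> P" using ZN Msf(2)[OF N(1)] by (rule subset_trans)
    ultimately have "card ?Z \<le> 4" using pow2[OF Z] by auto
    then have "C = ?Z" using sg_eqI[OF C(1) Z CZ] C(3) by simp
    then have "w \<in> C" using N(2) Nx w4 by blast
    then show False using wC by simp
  qed
  have small: "card (cyc u) \<le> 4" "cyc u - C \<subseteq> {u, u [^] (3::nat)}" if u: "u \<in> M" "u \<notin> C" for u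
  proof -
    have uc: "u \<in> carrier G" using u MP Pc by auto
    have cM: "cyc u \<subseteq> M" by (rule cyc_least[OF M u(1)])
    have "card (cyc u) \<noteq> 8" using notcyc[OF u(1)] sg_eqI[OF cyc_sg[OF uc] M cM] M8 by auto
    moreover have "card (cyc u) \<le> 8" using card_mono[OF sgD(2)[OF M] cM] M8 by simp
    ultimately have o: "card (cyc u) = 1 \<or> card (cyc u) = 2 \<or> card (cyc u) = 4"
      using pow2[OF cyc_sg[OF uc]] cM MP by auto
    then show "card (cyc u) \<le> 4" by auto
    have "card (cyc u) dvd 4" using o by auto
    then have u4: "u [^] (4::nat) = \<one>" using generate_pow_card[OF uc] pow_eq_id[OF uc] by simp
    have uu: "u \<otimes> u \<in> C" by (rule index_two_square[OF C(1) M CM _ u(1)]) (use M8 C(3) in simp)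
    show "cyc u - C \<subseteq> {u, u [^] (3::nat)}"
    proof
      fix z assume z: "z \<in> cyc u - C"
      then obtain l :: nat where l: "z = u [^] l" using cyc_powE[OF uc] by blast
      have "u [^] l = u [^] (l mod 4 + 4 * (l div 4))" by simp
      also have "\<dots> = u [^] (l mod 4) \<otimes> (u [^] (4::nat)) [^] (l div 4)" using uc by (simp only: nat_pow_mult nat_pow_pow)
      finally have z4: "z = u [^] (l mod 4)" using u4 uc l by simp
      have "l mod 4 < 4" by simp
      then consider "l mod 4 = 0" | "l mod 4 = 1" | "l mod 4 = 2" | "l mod 4 = 3" by linarith
      then show "z \<in> {u, u [^] (3::nat)}"
      proof cases
        case 1 then show ?thesis using z4 z sgD(3)[OF C(1)] by simp
      next
        case 2 then show ?thesis using z4 uc by simp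
      next
        case 3 then show ?thesis using z4 z uu uc by (simp add: numeral_2_eq_2)
      next
        case 4 then show ?thesis using z4 by simp
      qed
    qed
  qed
  obtain u where u: "u \<in> M" "u \<notin> C" using yM y(2) by blast
  obtain u' where u': "u' \<in> M" "u' \<notin> C" "u' \<notin> cyc u"
  proof -
    have "card (M - C) = 4" using M8 C(3) CM sgD(2)[OF C(1)] by (simp add: card_Diff_subset)
    moreover have "card (cyc u - C) \<le> 2"
    proof -
      have "card (cyc u - C) \<le> card {u, u [^] (3::nat)}" by (rule card_mono[OF _ small(2)[OF u]]) simp
      also have "\<dots> \<le> 2" by (simp add: card_insert_if)
      finally show ?thesis .
    qed
    moreover have "finite (cyc u - C)" using sgD(2)[OF cyc_sg] u(1) MP Pc by auto
    ultimately have "\<not> M - C \<subseteq> cyc u - C" using card_mono[of "cyc u - C" "M - C"] by auto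
    then show ?thesis using that by blast
  qed
  have uc: "u \<in> carrier G" "u' \<in> carrier G" using u u' MP Pc by auto
  let ?Y = "cyc u" and ?Y' = "cyc u'" and ?Y2 = "cj s (cyc u)" and ?Y3 = "cj s3 (cyc u)"
  have YM: "?Y \<subseteq> M" "?Y' \<subseteq> M" using cyc_least[OF M] u u' by auto
  have Y2M: "?Y2 \<subseteq> M2" "?Y3 \<subseteq> M3" using cj_mono[OF YM(1)] s(2) s3(2) by auto
  have nYC: "\<not> ?Y \<subseteq> C" "\<not> ?Y' \<subseteq> C" using cyc_self[of u] cyc_self[of u'] u u' by auto
  have nY2C: "\<not> cj g ?Y \<subseteq> C" if "g \<in> S" for g
    using cj_subset_iff[OF Sc[OF that] sgD(1)[OF cyc_sg[OF uc(1)]] sgD(1)[OF C(1)]] CS[OF that] nYC(1) by simp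
  have d1: "?Y \<noteq> ?Y'" using u'(3) cyc_self[of u'] by auto
  have d2: "?Y2 \<noteq> ?Y" "?Y2 \<noteq> ?Y'" "?Y3 \<noteq> ?Y" "?Y3 \<noteq> ?Y'" "?Y3 \<noteq> ?Y2"
  proof -
    have i: "M \<inter> M2 = C" "M \<inter> M3 = C" "M2 \<inter> M3 = C" using Int MMs M2 M3 by blast+
    show "?Y2 \<noteq> ?Y" using i(1) Y2M YM nYC by (metis Int_greatest)
    show "?Y2 \<noteq> ?Y'" using i(1) Y2M YM nYC by (metis Int_greatest)
    show "?Y3 \<noteq> ?Y" using i(2) Y2M YM nYC by (metis Int_greatest)
    show "?Y3 \<noteq> ?Y'" using i(2) Y2M YM nYC by (metis Int_greatest)
    show "?Y3 \<noteq> ?Y2" using i(3) Y2M nY2C[OF s(1)] by (metis Int_greatest)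
  qed
  let ?\<kappa> = "\<lambda>Z. if Z \<subseteq> C then 0 else if card Z = 16 then 1 else if card Z = 8 then 2 else 3 :: nat"
  have sC3: "card (subs C) \<ge> 3" by (rule card_subs_ge3[OF C(1) _ two_is_prime_nat, of 2]) (use C(3) in auto)
  have 0: "3 \<le> card {Z \<in> subs P. ?\<kappa> Z = 0}"
  proof -
    have "subs C \<subseteq> {Z \<in> subs P. ?\<kappa> Z = 0}" using C(2) by (auto simp: subs_def)
    then show ?thesis using card_mono[of "{Z \<in> subs P. ?\<kappa> Z = 0}" "subs C"] sC3 by simp
  qed
  have PC: "\<not> P \<subseteq> C" using y by auto
  have 1: "1 \<le> card {Z \<in> subs P. ?\<kappa> Z = 1}"
    using one_bound[of P P ?\<kappa>] d(4) PC P16 by (simp add: subs_def)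
  have 2: "3 \<le> card {Z \<in> subs P. ?\<kappa> Z = 2}"
  proof -
    have "Ms \<subseteq> {Z \<in> subs P. ?\<kappa> Z = 2}"
    proof
      fix N assume N: "N \<in> Ms"
      have "\<not> N \<subseteq> C" using card_mono[OF sgD(2)[OF C(1)], of N] Msf(3)[OF N] C(3) by auto
      then show "N \<in> {Z \<in> subs P. ?\<kappa> Z = 2}" using Msf(1,2,3)[OF N] by (simp add: subs_def)
    qed
    then have "card Ms \<le> card {Z \<in> subs P. ?\<kappa> Z = 2}" by (rule card_mono[rotated]) simp
    then show ?thesis using Ms3 by linarith
  qed
  have 3: "4 \<le> card {Z \<in> subs P. ?\<kappa> Z = 3}"
  proof -
    have sg: "subgroup ?Y G" "subgroup ?Y' G" "subgroup ?Y2 G" "subgroup ?Y3 G"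
      using cyc_sg uc cj_sg Sc s(1) s3(1) by auto
    have sp: "?Y \<subseteq> P" "?Y' \<subseteq> P" "?Y2 \<subseteq> P" "?Y3 \<subseteq> P" using YM Y2M MP Msf(2)[OF M2(1)] Msf(2)[OF M3(1)] by auto
    have cd: "card ?Y \<le> 4" "card ?Y' \<le> 4" "card ?Y2 \<le> 4" "card ?Y3 \<le> 4"
      using small(1)[OF u] small(1)[OF u'(1,2)] cj_card[OF Sc sgD(1)[OF cyc_sg[OF uc(1)]]] s(1) s3(1) by auto
    have el: "Z \<in> {Z \<in> subs P. ?\<kappa> Z = 3}" if "subgroup Z G" "Z \<subseteq> P" "card Z \<le> 4" "\<not> Z \<subseteq> C" for Z
      using that by (simp add: subs_def)
    have "{?Y, ?Y', ?Y2, ?Y3} \<subseteq> {Z \<in> subs P. ?\<kappa> Z = 3}"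
      using el[OF sg(1) sp(1) cd(1) nYC(1)] el[OF sg(2) sp(2) cd(2) nYC(2)]
        el[OF sg(3) sp(3) cd(3) nY2C[OF s(1)]] el[OF sg(4) sp(4) cd(4) nY2C[OF s3(1)]] by blast
    then have "card {?Y, ?Y', ?Y2, ?Y3} \<le> card {Z \<in> subs P. ?\<kappa> Z = 3}" by (rule card_mono[rotated]) simp
    moreover have "card {?Y, ?Y', ?Y2, ?Y3} = 4" using d1 d2 by (simp add: card_insert_if not_sym)
    ultimately show ?thesis by simp
  qed
  have all: "\<forall>e\<in>set [(0 :: nat, 3), (1, 1), (2, 3), (3, 4 :: nat)]. snd e \<le> card {x \<in> subs P. ?\<kappa> x = fst e}"
    by (simp only: list.set ball_simps fst_conv snd_conv 0 1 2 3 simp_thms)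
  have "sum_list (map snd [(0 :: nat, 3), (1, 1), (2, 3), (3, 4 :: nat)]) \<le> card (subs P)"
  proof (rule tagged_card_bound[OF subs_finite, where \<kappa> = ?\<kappa>])
    show "l \<le> card {x \<in> subs P. ?\<kappa> x = i}" if "(i, l) \<in> set [(0 :: nat, 3), (1, 1), (2, 3), (3, 4 :: nat)]" for i l
      using bspec[OF all that] unfolding fst_conv snd_conv .
  qed simp
  then show ?thesis by simp
qed

text \<open>By \<open>moved_index_two_group\<close>, q = 3 and the centralizer C of S has index 4;
a further prime would yield too many subgroups, so G = PS. If C is trivial, P has order 4 and every
fibre has 5 elements. If C has order 2, then either P has an invariant subgroup of order 4 and 16
subgroups, or the invariant subgroups are 1, C and P, and 3 divides s(P). If C has order 4, s(P)
\<ge> 11. For larger C, s(C) \<ge> 4 and s(P) \<ge> s(C) + 4 are too large.\<close>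

theorem no_normal_sylow_2:
  assumes num: "num_subgroups G = 23" and P: "nml P" "is_syl 2 (carrier G) P" and ne: "P \<noteq> {\<one>}" "P \<noteq> carrier G"
  shows False
proof -
  have p23: "prime (num_subgroups G)" unfolding num by simp
  obtain q S where S: "prime q" "q \<noteq> 2" "is_syl q (carrier G) S" "cen P S \<noteq> P"
    using prime_count_nontrivial_action[OF p23 P(1,2) ne] by blast
  note c0 = syl_coact[OF P(1,2) S(3,2)]
  have q3: "q = 3" using moved_index_two_group[OF num c0 P(1) S(4)] by simp
  have c: "coact 2 P 3 S" using c0 q3 by simp
  note d = coactD[OF c]
  let ?C = "cen P S"
  have n4: "card (cjs P S) = 4" using moved_index_two_group[OF num c P(1) S(4)] by simp
  define s where "s = card (subs P)"
  define t where "t = card (subs ?C)"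
  have bd: "s + 4 * t + 1 \<le> 23" using bound23(1)[OF num c P(1) S(4)] n4 by (simp add: s_def t_def)
  have PC: "card P = 4 * card ?C" using coact_card[OF c] n4 by simp
  obtain X where X: "X \<in> subs P" "moved S X" using moved_exists[OF c S(4)] by blast
  have Xs: "subgroup X G" "X \<subseteq> P" using X by (auto simp: subs_def)
  have st: "s \<ge> t + 4"
  proof -
    let ?\<kappa> = "\<lambda>Z. if Z \<subseteq> ?C then 0 else if card Z = card P then 1 else 2 :: nat"
    have "\<not> P \<subseteq> ?C" using S(4) cen_sub[of P S] by auto
    then have 1: "1 \<le> card {Z \<in> subs P. ?\<kappa> Z = 1}" using one_bound[of P P ?\<kappa>] d(4) by (simp add: subs_def)
    have 0: "t \<le> card {Z \<in> subs P. ?\<kappa> Z = 0}" unfolding t_def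
    proof (rule card_mono)
      show "subs ?C \<subseteq> {Z \<in> subs P. ?\<kappa> Z = 0}" using cen_sub[of P S] by (auto simp: subs_def)
    qed simp
    have XC: "\<not> X \<subseteq> ?C" using X(2) not_moved_simps(3)[OF c] by blast
    have XP: "card X \<noteq> card P" using X(2) not_moved_simps(1)[OF c] sg_eqI[OF Xs(1) d(4) Xs(2)] by auto
    have Cc: "?C \<subseteq> carrier G" by (rule sgD(1)[OF d(15)])
    have nmC: "\<not> moved S ?C" by (rule not_moved_simps(3)[OF c subset_refl])
    have "3 \<le> card {Z \<in> subs P. (card Z, Z \<subseteq> ?C, {} \<subseteq> Z, moved S Z) = (card X, X \<subseteq> ?C, {} \<subseteq> X, True)}"
      by (rule orbit_bound[OF c X Cc nmC]) (auto simp: moved_def cj_def)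
    also have "\<dots> \<le> card {Z \<in> subs P. ?\<kappa> Z = 2}" by (rule card_mono) (use XC XP in auto)
    finally have 2: "3 \<le> card {Z \<in> subs P. ?\<kappa> Z = 2}" .
    have all: "\<forall>e\<in>set [(0 :: nat, t), (1, 1), (2, 3)]. snd e \<le> card {x \<in> subs P. ?\<kappa> x = fst e}"
      by (simp only: list.set ball_simps fst_conv snd_conv 0 1 2 simp_thms)
    have "sum_list (map snd [(0 :: nat, t), (1, 1), (2, 3)]) \<le> card (subs P)"
    proof (rule tagged_card_bound[OF subs_finite, where \<kappa> = ?\<kappa>])
      show "l \<le> card {x \<in> subs P. ?\<kappa> x = i}" if "(i, l) \<in> set [(0 :: nat, t), (1, 1), (2, 3)]" for i l
        using bspec[OF all that] unfolding fst_conv snd_conv .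
    qed simp
    then show ?thesis by (simp add: s_def)
  qed
  have t1: "t \<ge> 1" unfolding t_def by (rule card_subs_pos[OF d(15)])
  have G: "P <#> S = carrier G"
  proof (rule two_prime_product[OF P(1,2)])
    show "is_syl 3 (carrier G) S" using S(3) q3 by simp
    show "3 \<noteq> (2::nat)" by simp
    fix r assume r: "prime r" "r dvd card (carrier G)"
    show "r = 2 \<or> r = 3"
    proof (rule ccontr)
      assume nr: "\<not> (r = 2 \<or> r = 3)"
      obtain R where R: "is_syl r (carrier G) R" using syl_ex[OF sg_carrier r(1)] by blast
      have "r \<noteq> 4" using r(1) by (intro notI) simp
      then have r5: "r \<noteq> 2" "r \<noteq> q" "r \<ge> 5" using nr q3 prime_ge_2_nat[OF r(1)] by auto
      note c' = syl_coact[OF P(1,2) R r5(1)]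
      have "cen P R = P" using moved_index_two_group[OF num c' P(1)] nr by auto
      then have "6 * s + card (fibre P (P <#> S)) \<le> 23"
        using other_prime_bound[OF num P(1,2) ne(1) S(3,2,4) R r(2) r5] by (simp add: s_def)
      then show False using st t1 by linarith
    qed
  qed
  obtain m where m: "card ?C = 2 ^ m"
  proof -
    obtain i where "card P = 2 ^ i" using d(6) by blast
    then have "card ?C dvd 2 ^ i" using sg_dvd[OF d(15,4) cen_sub] by simp
    then show ?thesis using that by (metis divides_primepow_nat two_is_prime_nat)
  qed
  have co: "coact 2 P 3 T" if T: "subgroup T G" "T \<subseteq> S" for T
  proof -
    obtain k where "card S = 3 ^ k" using d(7) by blast
    then have "card T dvd 3 ^ k" using sg_dvd[OF T(1) d(5) T(2)] by simp
    then obtain j where "card T = 3 ^ j" using d(2) by (metis divides_primepow_nat)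
    then show ?thesis using c T by (auto simp: coact_def)
  qed
  consider "m = 0" | "m = 1" | "m = 2" | "m \<ge> 3" by linarith
  then show False
  proof cases
    case 1
    then have P4: "card P = 4" using PC m by simp
    have s5: "s = 5"
    proof (rule antisym)
      have "subs P \<subseteq> insert {\<one>} (insert P ((\<lambda>x. {\<one>, x}) ` (P - {\<one>})))"
      proof
        fix A assume "A \<in> subs P"
        then have A: "subgroup A G" "A \<subseteq> P" by (auto simp: subs_def)
        have "card A dvd 2 ^ 2" using sg_dvd[OF A(1) d(4) A(2)] P4 by simp
        then obtain i where i: "card A = 2 ^ i" "i \<le> 2" by (metis divides_primepow_nat two_is_prime_nat)
        then consider "i = 0" | "i = 1" | "i = 2" by linarith
        then show "A \<in> insert {\<one>} (insert P ((\<lambda>x. {\<one>, x}) ` (P - {\<one>})))"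
        proof cases
          case 1 then show ?thesis using i sg_card1[OF A(1)] by simp
        next
          case 2
          then obtain x y where xy: "A = {x, y}" "x \<noteq> y" using i by (auto simp: card_2_iff)
          then show ?thesis using sgD(3)[OF A(1)] A(2) by auto
        next
          case 3 then show ?thesis using i P4 sg_eqI[OF A(1) d(4) A(2)] by simp
        qed
      qed
      then have "s \<le> card (insert {\<one>} (insert P ((\<lambda>x. {\<one>, x}) ` (P - {\<one>}))))"
        unfolding s_def by (rule card_mono[rotated]) (use sgD(2)[OF d(4)] in simp)
      also have "\<dots> \<le> Suc (card (insert P ((\<lambda>x. {\<one>, x}) ` (P - {\<one>}))))" by (rule card_insert_le_m1) (use sgD(2)[OF d(4)] in simp_all)
      also have "\<dots> \<le> Suc (Suc (card ((\<lambda>x. {\<one>, x}) ` (P - {\<one>}))))"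
        using card_insert_le_m1[of "Suc (card ((\<lambda>x. {\<one>, x}) ` (P - {\<one>})))" "(\<lambda>x. {\<one>, x}) ` (P - {\<one>})" P] sgD(2)[OF d(4)] by simp
      also have "card ((\<lambda>x. {\<one>, x}) ` (P - {\<one>})) \<le> card (P - {\<one>})" by (rule card_image_le) (use sgD(2)[OF d(4)] in simp)
      also have "card (P - {\<one>}) = 3" using P4 sgD(3)[OF d(4)] by (simp add: card_Diff_singleton)
      finally show "s \<le> 5" by simp
      show "5 \<le> s" using st t1 by linarith
    qed
    have "5 dvd num_subgroups G"
    proof (rule fibre_dvd_num[OF P(1) d(5) G])
      fix T assume T: "subgroup T G" "T \<subseteq> S"
      note cT = co[OF T]
      note e = coactD[OF cT]
      show "5 dvd card (fibre P (P <#> T))"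
      proof (cases "cen P T = P")
        case True
        then show ?thesis using fibre_trivial[OF cT P(1)] s5 by (simp add: s_def)
      next
        case False
        have n4T: "card (cjs P T) = 4" using moved_index_two_group[OF num cT P(1) False] by simp
        then have C1: "cen P T = {\<one>}" using coact_card[OF cT] P4 sg_card1[OF e(15)] by simp
        \<comment> \<open>An invariant subgroup of P has order 1 modulo 3, so it is trivial or
          P.\<close>
        have "fibre P (P <#> T) \<subseteq> insert (P <#> T) (cjs P T)"
        proof
          fix H assume H: "H \<in> fibre P (P <#> T)"
          obtain x where x: "x \<in> P" "cj x T \<subseteq> H" "H = (H \<inter> P) <#> cj x T" using fibre_form[OF cT P(1) H] by blast
          have xc: "x \<in> carrier G" using x sgD(5)[OF d(4)] by simp
          have Hs: "subgroup H G" using H by (simp add: fibre_def)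
          have HP: "subgroup (H \<inter> P) G" by (rule sg_Int[OF Hs d(4)])
          let ?A = "cj (inv x) (H \<inter> P)"
          have Ac: "H \<inter> P \<subseteq> carrier G" by (rule sgD(1)[OF HP])
          have As: "?A \<in> subs P"
            using cj_sg[OF inv_closed[OF xc] HP] cj_mono[of "H \<inter> P" P "inv x"] cj_self[OF d(4) sgD(6)[OF d(4) x(1)]] by (auto simp: subs_def)
          have nm: "\<not> moved T ?A"
          proof -
            have "cj g ?A = ?A" if g: "g \<in> T" for g
            proof -
              have gc: "g \<in> carrier G" using g sgD(5)[OF e(5)] by simp
              have gH: "x \<otimes> g \<otimes> inv x \<in> H" using x(2) g by (auto simp: cj_def)
              have hc: "x \<otimes> g \<otimes> inv x \<in> carrier G" using xc gc by simp
              have "cj (x \<otimes> g \<otimes> inv x) (H \<inter> P) = H \<inter> P"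
                unfolding cj_Int[OF hc sgD(1)[OF Hs] sgD(1)[OF d(4)]] cj_self[OF Hs gH] nmlD(2)[OF P(1) hc] by (rule refl)
              then have "cj (inv x) (cj (x \<otimes> g \<otimes> inv x) (H \<inter> P)) = ?A" by simp
              then have "cj (inv x \<otimes> (x \<otimes> g \<otimes> inv x)) (H \<inter> P) = ?A" using cj_mult[of "inv x" _ "H \<inter> P"] xc hc Ac by simp
              moreover have "inv x \<otimes> (x \<otimes> g \<otimes> inv x) = g \<otimes> inv x" using xc gc by (simp add: m_assoc[symmetric])
              ultimately show ?thesis using cj_mult[OF gc inv_closed[OF xc] Ac] by simp
            qed
            then show ?thesis by (simp add: moved_def)
          qed
          have i1: "?A \<inter> {\<one>} = {\<one>}" using As sgD(3) by (auto simp: subs_def)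
          have "card ?A mod 3 = 1" using invariant_card_mod[OF cT As nm] C1 i1 by simp
          then have cm: "card (H \<inter> P) mod 3 = 1" using cj_card[OF inv_closed[OF xc] Ac] by simp
          have "card (H \<inter> P) dvd 2 ^ 2" using sg_dvd[OF HP d(4)] P4 by simp
          then obtain i where i: "card (H \<inter> P) = 2 ^ i" "i \<le> 2" by (metis divides_primepow_nat two_is_prime_nat)
          then have "i = 0 \<or> i = 1 \<or> i = 2" by linarith
          then have "card (H \<inter> P) = 1 \<or> card (H \<inter> P) = 4" using i cm by auto
          then show "H \<in> insert (P <#> T) (cjs P T)"
          proof
            assume "card (H \<inter> P) = 1"
            then have "H \<inter> P = {\<one>}" using sg_card1[OF HP] by simp
            then have "H = {\<one>} <#> cj x T" using x(3) by simp
            moreover have "{\<one>} <#> cj x T = cj x T" using sgD(5)[OF cj_sg[OF xc e(5)]] by (force simp: set_mult_def)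
            ultimately show ?thesis using x(1) by (auto simp: cjs_def)
          next
            assume "card (H \<inter> P) = 4"
            then have HPP: "H \<inter> P = P" using sg_eqI[OF HP d(4)] P4 by simp
            then have "P <#> H = H" using prod_least[OF Hs, of P H] prod_sub2[OF d(4) sgD(1)[OF Hs]] by auto
            then show ?thesis using H by (simp add: fibre_def)
          qed
        qed
        then have "card (fibre P (P <#> T)) \<le> card (insert (P <#> T) (cjs P T))"
          by (rule card_mono[rotated]) (use sgD(2)[OF d(4)] in \<open>simp add: cjs_def\<close>)
        also have "\<dots> \<le> 5" using card_insert_le_m1[of 5 "cjs P T" "P <#> T"] n4T by simp
        finally have "card (fibre P (P <#> T)) = 5" using bound23(3)[OF num cT P(1) False] n4T by simp
        then show ?thesis by simp
      qed
    qed
    then show False using num by simp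
  next
    case 2
    then have C2: "card ?C = 2" and P8: "card P = 8" using PC m by simp_all
    have "\<not> (\<exists>A\<in>subs P. \<not> moved S A \<and> card A = 4)"
    proof
      assume "\<exists>A\<in>subs P. \<not> moved S A \<and> card A = 4"
      then have "s \<ge> 16" using order8_card_subs[OF c P8 C2] by (auto simp: s_def)
      moreover have "t \<ge> 2" unfolding t_def by (rule card_subs_ge2[OF d(15)]) (use C2 in auto)
      ultimately show False using bd by linarith
    qed
    then have n4': "moved S A" if "A \<in> subs P" "card A = 4" for A using that by blast
    have "{A \<in> subs P. \<forall>x\<in>S. cj x A = A} = {{\<one>}, ?C, P}"
    proof (intro equalityI subsetI)
      fix A assume "A \<in> {A \<in> subs P. \<forall>x\<in>S. cj x A = A}"
      then have A: "A \<in> subs P" "\<not> moved S A" by (auto simp: moved_def)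
      then have As: "subgroup A G" "A \<subseteq> P" by (auto simp: subs_def)
      have "card A dvd 2 ^ 3" using sg_dvd[OF As(1) d(4) As(2)] P8 by simp
      then obtain i where i: "card A = 2 ^ i" "i \<le> 3" by (metis divides_primepow_nat two_is_prime_nat)
      then consider "i = 0" | "i = 1" | "i = 2" | "i = 3" by linarith
      then show "A \<in> {{\<one>}, ?C, P}"
      proof cases
        case 1 then show ?thesis using i sg_card1[OF As(1)] by simp
      next
        case 2
        have I: "subgroup (A \<inter> ?C) G" by (rule sg_Int[OF As(1) d(15)])
        have "card (A \<inter> ?C) mod 3 = 2" using invariant_card_mod[OF c A] i 2 by simp
        moreover have "card (A \<inter> ?C) \<le> 2" using card_mono[OF sgD(2)[OF d(15)], of "A \<inter> ?C"] C2 by simp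
        ultimately have c2: "card (A \<inter> ?C) = 2" by (cases "card (A \<inter> ?C) = 2") (auto simp: numeral_2_eq_2 le_Suc_eq)
        have "A \<inter> ?C = A" using sg_eqI[OF I As(1)] c2 i 2 by simp
        moreover have "A \<inter> ?C = ?C" using sg_eqI[OF I d(15)] c2 C2 by simp
        ultimately show ?thesis by simp
      next
        case 3 then show ?thesis using n4'[OF A(1)] A(2) i by simp
      next
        case 4 then show ?thesis using i P8 sg_eqI[OF As(1) d(4) As(2)] by simp
      qed
    next
      fix A assume "A \<in> {{\<one>}, ?C, P}"
      then show "A \<in> {A \<in> subs P. \<forall>x\<in>S. cj x A = A}"
        using not_moved_simps[OF c] d(4,15) cen_sub[of P S] sg_one sgD(3)[OF d(4)] by (auto simp: subs_def moved_def)
    qed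
    moreover have "card {\<one>} \<noteq> card ?C" "card {\<one>} \<noteq> card P" "card ?C \<noteq> card P" using C2 P8 by simp_all
    then have "{\<one>} \<noteq> ?C" "{\<one>} \<noteq> P" "?C \<noteq> P" by metis+
    ultimately have "card {A \<in> subs P. \<forall>x\<in>S. cj x A = A} = 3" by simp
    moreover obtain k where "card S = 3 ^ k" using d(7) by blast
    ultimately have "card (subs P) mod 3 = 0" using subs_inv_mod[OF d(5) _ d(2,4,8), of k] by simp
    then have "3 dvd card (subs P)" by (simp add: dvd_eq_mod_eq_0)
    then have "3 dvd num_subgroups G" by (rule dvd_subs_imp_dvd_num[OF c P(1) G])
    then show False using num by simp
  next
    case 3
    then have "card ?C = 4" "card P = 16" using PC m by simp_all
    then have "s \<ge> 11" using order16_card_subs[OF c] by (simp add: s_def)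
    moreover have "t \<ge> 3" unfolding t_def by (rule card_subs_ge3[OF d(15) m two_is_prime_nat]) (use 3 in simp)
    ultimately show False using bd by linarith
  next
    case 4
    have "t \<ge> 4"
    proof -
      have k: "1 \<le> card {Z \<in> subs ?C. card Z = 2 ^ j}" if "j \<le> m" for j
      proof -
        have "(2::nat) ^ j dvd card ?C" using that m by (simp add: le_imp_power_dvd)
        then obtain Y where "subgroup Y G" "Y \<subseteq> ?C" "card Y = 2 ^ j" using sg_exists_prime_power[OF d(15) two_is_prime_nat] by blast
        then show ?thesis using one_bound[of Y ?C card] by (simp add: subs_def)
      qed
      have "sum_list (map snd [(1::nat, 1), (2, 1), (4, 1), (8, 1::nat)]) \<le> card (subs ?C)"
        by (rule tagged_card_bound[OF subs_finite, where \<kappa> = card]) (use k[of 0] k[of 1] k[of 2] k[of 3] 4 in auto)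
      then show ?thesis by (simp add: t_def)
    qed
    then show False using bd st by linarith
  qed
qed

section \<open>Groups without normal Sylow subgroups\<close>

abbreviation "n_syl r \<equiv> card (Syl r (carrier G))"

definition self_normalizing :: "nat \<Rightarrow> bool" where
  "self_normalizing r \<longleftrightarrow> (\<forall>R\<in>Syl r (carrier G). nrm (carrier G) R = R)"

definition prime_div :: "nat \<Rightarrow> bool" where
  "prime_div r \<longleftrightarrow> prime r \<and> r dvd card (carrier G)"

definition all_sylow_nonnormal :: bool where
  "all_sylow_nonnormal \<longleftrightarrow> (\<forall>r R. prime_div r \<longrightarrow> is_syl r (carrier G) R \<longrightarrow> \<not> nml R)"

definition syl_normalizers :: "nat \<Rightarrow> 'a set set" where
  "syl_normalizers r = nrm (carrier G) ` Syl r (carrier G)"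

lemma SylD: assumes "R \<in> Syl r (carrier G)" shows "is_syl r (carrier G) R" "subgroup R G" "prime r" "\<exists>k. card R = r ^ k" "R \<subseteq> carrier G"
  using assms sylD[of r "carrier G" R] by (auto simp: Syl_def)

lemma n_syl_card: assumes "R \<in> Syl r (carrier G)" shows "n_syl r * card (nrm (carrier G) R) = card (carrier G)"
  using card_cjs[OF sg_carrier sgD(1)[OF SylD(2)[OF assms]]] Syl_cjs[OF sg_carrier SylD(1)[OF assms]] by simp

lemma Syl_nonempty: assumes "prime r" shows "\<exists>R. R \<in> Syl r (carrier G)"
  using syl_ex[OF sg_carrier assms] by (auto simp: Syl_def)

lemma n_syl_mod: "prime r \<Longrightarrow> n_syl r mod r = 1"
  using Syl_nonempty[of r] Syl_count_mod[OF sg_carrier] SylD(1) by blast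

lemma syl_in_normalizer: assumes R: "R \<in> Syl r (carrier G)" and T: "subgroup T G" "T \<subseteq> nrm (carrier G) R" "card T = r ^ k"
  shows "T \<subseteq> R"
proof -
  have N: "subgroup (nrm (carrier G) R) G" by (rule nrm_sg[OF sg_carrier SylD(5)[OF R]])
  have "is_syl r (nrm (carrier G) R) R"
    by (rule syl_mono[OF SylD(1)[OF R] sg_carrier N sub_nrm[OF SylD(2,5)[OF R]] nrm_sub])
  then show ?thesis using syl_normal[OF N _ _ T] by (auto simp: nrm_def)
qed

text \<open>R is the only Sylow r-subgroup of its normalizer.\<close>

lemma syl_normalizers_card: "card (syl_normalizers r) = n_syl r"
proof -
  have "inj_on (nrm (carrier G)) (Syl r (carrier G))"
  proof (rule inj_onI)
    fix R T assume RT: "R \<in> Syl r (carrier G)" "T \<in> Syl r (carrier G)" "nrm (carrier G) R = nrm (carrier G) T"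
    obtain k where "card T = r ^ k" using SylD(4)[OF RT(2)] by blast
    then have "T \<subseteq> R" using syl_in_normalizer[OF RT(1) SylD(2)[OF RT(2)]] sub_nrm[OF SylD(2,5)[OF RT(2)]] RT(3) by simp
    then show "R = T" using sg_eqI[OF SylD(2)[OF RT(2)] SylD(2)[OF RT(1)]]
      syl_card_eq[OF SylD(1)[OF RT(2)] SylD(1)[OF RT(1)] sg_carrier] by simp
  qed
  then show ?thesis by (simp add: syl_normalizers_def card_image)
qed

lemma syl_normalizers_sub: "syl_normalizers r \<subseteq> subs (carrier G)"
  using nrm_sg[OF sg_carrier SylD(5)] nrm_sub unfolding syl_normalizers_def subs_def by blast

lemma Syl_sub: "Syl r (carrier G) \<subseteq> subs (carrier G)"
  using SylD(2,5) unfolding subs_def by blast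

lemma Syl_ne_one: assumes "prime_div r" "R \<in> Syl r (carrier G)" shows "R \<noteq> {\<one>}"
  using syl_nontrivial[OF SylD(1)[OF assms(2)]] assms(1) by (auto simp: prime_div_def)

lemma prime_power_sub:
  assumes "subgroup R G" "subgroup T G" "R \<subseteq> T" "card R = r ^ k" "card T = s ^ j" "prime r" "prime s" "R \<noteq> {\<one>}" shows "r = s"
proof (rule ccontr)
  assume "r \<noteq> s"
  then have "coprime (card R) (card T)" using primes_coprime[OF assms(6,7)] assms(4,5) by simp
  then have "R \<inter> T = {\<one>}" by (rule sg_coprime_Int[OF assms(1,2)])
  then show False using assms(3,8) by auto
qed

lemma Syl_disj: assumes "prime_div r" "r \<noteq> s" shows "Syl r (carrier G) \<inter> Syl s (carrier G) = {}"
proof (rule equals0I)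
  fix R assume R: "R \<in> Syl r (carrier G) \<inter> Syl s (carrier G)"
  then obtain k j where "card R = r ^ k" "card R = s ^ j" using SylD(4) by blast
  then have "r = s" using prime_power_sub[of R R r k s j] R SylD(2,3) Syl_ne_one[OF assms(1)] by blast
  then show False using assms by simp
qed

text \<open>If the normalizer of R has prime power order, it is R itself, and by conjugacy every
Sylow r-subgroup is its own normalizer.\<close>

lemma syl_normalizers_Syl_disj:
  assumes "prime_div r" "\<not> self_normalizing r" shows "syl_normalizers r \<inter> Syl s (carrier G) = {}"
proof (rule equals0I)
  fix N assume "N \<in> syl_normalizers r \<inter> Syl s (carrier G)"
  then obtain R where R: "R \<in> Syl r (carrier G)" "N = nrm (carrier G) R" and N: "N \<in> Syl s (carrier G)" by (auto simp: syl_normalizers_def)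
  obtain k j where kj: "card R = r ^ k" "card N = s ^ j" using SylD(4)[OF R(1)] SylD(4)[OF N] by blast
  have RN: "R \<subseteq> N" using sub_nrm[OF SylD(2,5)[OF R(1)]] R(2) by simp
  have "r = s" by (rule prime_power_sub[OF SylD(2)[OF R(1)] SylD(2)[OF N] RN kj SylD(3)[OF R(1)] SylD(3)[OF N] Syl_ne_one[OF assms(1) R(1)]])
  then have "card N = card R" using syl_card_eq[OF SylD(1)[OF N] _ sg_carrier] SylD(1)[OF R(1)] by simp
  then have e: "nrm (carrier G) R = R" using sg_eqI[OF SylD(2)[OF R(1)] SylD(2)[OF N] RN] R(2) by simp
  have "nrm (carrier G) T = T" if T: "T \<in> Syl r (carrier G)" for T
  proof -
    have "n_syl r * card (nrm (carrier G) T) = n_syl r * card R" using n_syl_card[OF T] n_syl_card[OF R(1)] e by simp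
    moreover have "n_syl r \<noteq> 0" using R(1) by auto
    ultimately have "card (nrm (carrier G) T) = card T"
      using syl_card_eq[OF SylD(1)[OF T] SylD(1)[OF R(1)] sg_carrier] by simp
    then show ?thesis using sg_eqI[OF SylD(2)[OF T] nrm_sg[OF sg_carrier SylD(5)[OF T]] sub_nrm[OF SylD(2,5)[OF T]]] by simp
  qed
  then show False using assms(2) by (simp add: self_normalizing_def)
qed

lemma syl_normalizers_disj: assumes "prime r" "n_syl r \<noteq> n_syl s" shows "syl_normalizers r \<inter> syl_normalizers s = {}"
proof (rule equals0I)
  fix N assume "N \<in> syl_normalizers r \<inter> syl_normalizers s"
  then obtain R T where "R \<in> Syl r (carrier G)" "N = nrm (carrier G) R" "T \<in> Syl s (carrier G)" "N = nrm (carrier G) T" by (auto simp: syl_normalizers_def)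
  then have "n_syl r * card N = n_syl s * card N" "card N \<noteq> 0"
    using n_syl_card[of R r] n_syl_card[of T s] sgD(4)[OF nrm_sg[OF sg_carrier SylD(5)]] by auto
  then show False using assms(2) by simp
qed

context
  assumes NS: "all_sylow_nonnormal"
begin

lemma n_syl_ge: assumes "prime_div r" shows "n_syl r \<ge> r + 1"
proof -
  obtain R where R: "R \<in> Syl r (carrier G)" using Syl_nonempty assms by (auto simp: prime_div_def)
  have "\<not> nml R" using NS assms SylD(1)[OF R] by (auto simp: all_sylow_nonnormal_def)
  then show ?thesis by (rule Syl_ge[OF SylD(1)[OF R]])
qed

lemma triv_disj:
  assumes "prime_div r" shows "{{\<one>}, carrier G} \<inter> Syl r (carrier G) = {}" "{{\<one>}, carrier G} \<inter> syl_normalizers r = {}"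
proof -
  have G: "nml (carrier G)" using sg_carrier cj_self[OF sg_carrier] by (simp add: nml_def)
  have ns: "\<not> nml R" if "R \<in> Syl r (carrier G)" for R using NS assms SylD(1)[OF that] by (auto simp: all_sylow_nonnormal_def)
  show "{{\<one>}, carrier G} \<inter> Syl r (carrier G) = {}" using ns G Syl_ne_one[OF assms] by auto
  have "nrm (carrier G) R \<noteq> carrier G" if "R \<in> Syl r (carrier G)" for R
    using ns[OF that] SylD(2)[OF that] by (auto simp: nrm_def nml_def)
  moreover have "nrm (carrier G) R \<noteq> {\<one>}" if "R \<in> Syl r (carrier G)" for R
    using sub_nrm[OF SylD(2,5)[OF that]] Syl_ne_one[OF assms that] sgD(3)[OF SylD(2)[OF that]] by auto
  ultimately show "{{\<one>}, carrier G} \<inter> syl_normalizers r = {}" by (auto simp: syl_normalizers_def)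
qed

lemma carrier_ne_one: assumes "prime_div r" shows "carrier G \<noteq> {\<one>}"
proof
  assume "carrier G = {\<one>}"
  then show False using assms prime_gt_1_nat[of r] by (auto simp: prime_div_def)
qed

text \<open>The trivial subgroup, G, the Sylow subgroups for the primes in ps and the normalizers
of Sylow subgroups for the primes in qs are all different; normalizers for different primes are
separated by their indices.\<close>

lemma sylow_family_bound:
  assumes ps: "distinct ps" "\<And>r. r \<in> set ps \<Longrightarrow> prime_div r"
    and qs: "distinct (map n_syl qs)" "\<And>r. r \<in> set qs \<Longrightarrow> prime_div r \<and> \<not> self_normalizing r" and ne: "ps \<noteq> []"
  shows "2 + sum_list (map n_syl ps) + sum_list (map n_syl qs) \<le> num_subgroups G"
proof -
  let ?As = "[{{\<one>}, carrier G}] @ map (\<lambda>r. Syl r (carrier G)) ps @ map syl_normalizers qs"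
  have "sum_list (map card ?As) \<le> card (subs (carrier G))"
  proof (rule disjoint_list_card[OF subs_finite])
    fix A assume "A \<in> set ?As"
    moreover have "{\<one>} \<in> subs (carrier G)" "carrier G \<in> subs (carrier G)"
      using sg_one sg_carrier by (simp_all add: subs_def)
    ultimately show "A \<subseteq> subs (carrier G)" using syl_normalizers_sub Syl_sub by auto
  next
    have 1: "sorted_wrt (\<lambda>r s. Syl r (carrier G) \<inter> Syl s (carrier G) = {}) ps"
      using ps
    proof (induction ps)
      case (Cons a l)
      have "Syl a (carrier G) \<inter> Syl b (carrier G) = {}" if "b \<in> set l" for b
        by (rule Syl_disj) (use Cons.prems that in auto)
      then show ?case using Cons by simp
    qed simp
    have 2: "sorted_wrt (\<lambda>r s. syl_normalizers r \<inter> syl_normalizers s = {}) qs"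
      using qs
    proof (induction qs)
      case (Cons a l)
      have "syl_normalizers a \<inter> syl_normalizers b = {}" if "b \<in> set l" for b
      proof (rule syl_normalizers_disj)
        show "prime a" using Cons.prems(2)[of a] by (simp add: prime_div_def)
        show "n_syl a \<noteq> n_syl b" using Cons.prems(1) that by auto
      qed
      then show ?case using Cons by simp
    qed simp
    have 3: "Syl r (carrier G) \<inter> syl_normalizers s = {}" if "s \<in> set qs" for r s
      using syl_normalizers_Syl_disj[of s r] qs(2)[OF that] by auto
    show "sorted_wrt (\<lambda>A B. A \<inter> B = {}) ?As"
      unfolding sorted_wrt_append sorted_wrt_map
      using 1 2 3 triv_disj ps(2) qs(2) by auto
  qed
  moreover have "carrier G \<noteq> {\<one>}" using carrier_ne_one ps(2) ne by (cases ps) auto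
  then have "card {{\<one>}, carrier G} = 2" by auto
  ultimately show ?thesis by (simp add: subs_carrier comp_def syl_normalizers_card)
qed

lemma self_normalizing_card: assumes "self_normalizing r" "R \<in> Syl r (carrier G)" shows "n_syl r * card R = card (carrier G)"
  using n_syl_card[OF assms(2)] assms by (simp add: self_normalizing_def)

lemma self_normalizing_dvd: assumes "prime_div r" "self_normalizing r" "prime_div s" "s \<noteq> r" shows "s dvd n_syl r"
proof -
  obtain R where R: "R \<in> Syl r (carrier G)" using Syl_nonempty assms by (auto simp: prime_div_def)
  obtain k where k: "card R = r ^ k" using SylD(4)[OF R] by blast
  have "s dvd n_syl r * r ^ k" using self_normalizing_card[OF assms(2) R] k assms(3) by (simp add: prime_div_def)
  then have "s dvd n_syl r \<or> s dvd r ^ k" using assms(3) by (simp add: prime_div_def prime_dvd_mult_iff)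
  moreover have "\<not> s dvd r ^ k" using assms by (metis prime_div_def prime_dvd_power primes_dvd_imp_eq)
  ultimately show ?thesis by blast
qed

text \<open>The Sylow numbers add up to at most 21, and the one of a prime that is not
self-normalizing counts twice. The Sylow number of a self-normalizing prime is divisible by all
other primes. So not all three primes are self-normalizing, and the primes are 2, 5, 7 or 2, 3, 7
or 2, 3, 5.\<close>

lemma no_three_primes:
  assumes num: "num_subgroups G = 23" and pr': "prime_div p" "prime_div q" "prime_div r" and lt: "p < q" "q < r"
  shows False
proof -
  have P: "prime p" "prime q" "prime r" using pr' by (auto simp: prime_div_def)
  have np: "x \<notin> {0, 1, 4, 6, 8, 9, 10, 12}" if "prime x" for x :: nat
    using that by (intro notI) auto
  have g: "n_syl p \<ge> p + 1" "n_syl q \<ge> q + 1" "n_syl r \<ge> r + 1" using n_syl_ge pr' by auto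
  have md: "n_syl p mod p = 1" "n_syl q mod q = 1" "n_syl r mod r = 1" using n_syl_mod P by auto
  have ps: "distinct [p, q, r]" "\<And>x. x \<in> set [p, q, r] \<Longrightarrow> prime_div x" using pr' lt by auto
  note fam = sylow_family_bound[OF ps]
  have b0: "n_syl p + n_syl q + n_syl r \<le> 21"
    using fam[of "[]"] num by simp
  have b1: "n_syl p + n_syl q + n_syl r + n_syl a \<le> 21" if "prime_div a" "\<not> self_normalizing a" for a
    using fam[of "[a]"] num that by simp
  have b2: "n_syl p + n_syl q + n_syl r + n_syl a + n_syl b \<le> 21"
    if "prime_div a" "\<not> self_normalizing a" "prime_div b" "\<not> self_normalizing b" "n_syl a \<noteq> n_syl b" for a b
  proof -
    have "\<And>x. x \<in> set [a, b] \<Longrightarrow> prime_div x \<and> \<not> self_normalizing x" using that by auto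
    moreover have "distinct (map n_syl [a, b])" using that by simp
    ultimately show ?thesis using fam[of "[a, b]"] num by simp
  qed
  have sd: "y * z \<le> n_syl x" if "prime_div x" "self_normalizing x" "prime_div y" "prime_div z" "y \<noteq> x" "z \<noteq> x" "y \<noteq> z" for x y z
  proof -
    have "coprime y z" using that primes_coprime by (auto simp: prime_div_def)
    then have "y * z dvd n_syl x" using self_normalizing_dvd that by (simp add: divides_mult)
    moreover have "n_syl x > 0" using n_syl_ge[OF that(1)] by simp
    ultimately show ?thesis by (simp add: dvd_imp_le)
  qed
  have p2: "p \<ge> 2" "q \<ge> 3" "r \<ge> 5"
  proof -
    show "p \<ge> 2" using P prime_ge_2_nat by blast
    then show "q \<ge> 3" using lt by simp
    then show "r \<ge> 5" using lt np[OF P(3)] by (cases "r = 4") auto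
  qed
  have "\<exists>a. prime_div a \<and> \<not> self_normalizing a \<and> a \<in> {p, q, r}"
  proof (rule ccontr)
    assume "\<not> ?thesis"
    then have "self_normalizing p" "self_normalizing q" using pr' by auto
    then have "q * r \<le> n_syl p" "p * r \<le> n_syl q" using sd pr' lt by auto
    moreover have "3 * 5 \<le> q * r" by (rule mult_mono) (use p2 in auto)
    moreover have "2 * 5 \<le> p * r" by (rule mult_mono) (use p2 in auto)
    ultimately show False using b0 by linarith
  qed
  then obtain a where a: "prime_div a" "\<not> self_normalizing a" "a \<in> {p, q, r}" by blast
  have "n_syl a \<ge> p + 1" using a(3) g lt by auto
  then have s: "2 * p + q + r \<le> 17" using b1[OF a(1,2)] g by linarith
  have pe: "p = 2"
  proof (rule ccontr)
    assume "p \<noteq> 2"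
    then have "p \<ge> 3" using p2 by simp
    then have "q \<ge> 5" using lt np[OF P(2)] by (cases "q = 4") auto
    then have "r \<ge> 7" using lt np[OF P(3)] by (cases "r = 6") auto
    then show False using s \<open>p \<ge> 3\<close> \<open>q \<ge> 5\<close> by linarith
  qed
  have "q = 3 \<or> q = 4 \<or> q = 5 \<or> q = 6" using s pe p2 lt by linarith
  then have qe: "q = 3 \<or> q = 5" using np[OF P(2)] by auto
  have re: "(q = 3 \<and> (r = 5 \<or> r = 7)) \<or> (q = 5 \<and> r = 7)"
    using qe
  proof
    assume q: "q = 3"
    then have "r = 5 \<or> r = 6 \<or> r = 7 \<or> r = 8 \<or> r = 9 \<or> r = 10" using s pe p2 by linarith
    then show ?thesis using np[OF P(3)] q by auto
  next
    assume q: "q = 5"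
    then have "r = 6 \<or> r = 7 \<or> r = 8" using s pe lt by linarith
    then show ?thesis using np[OF P(3)] q by auto
  qed
  then consider "q = 5" "r = 7" | "q = 3" "r = 7" | "q = 3" "r = 5" by auto
  then show False
  proof cases
    case 1
    have "self_normalizing q" using b1[of q] pr' g 1 pe by auto
    moreover have "self_normalizing r" using b1[of r] pr' g 1 pe by auto
    ultimately have "p * r \<le> n_syl q" "p * q \<le> n_syl r" using sd pr' lt by auto
    then show False using 1 pe b0 g by simp
  next
    case 2
    have "self_normalizing r" using b1[of r] pr' g 2 pe by auto
    then have d: "2 dvd n_syl r" "3 dvd n_syl r" using self_normalizing_dvd[of r p] self_normalizing_dvd[of r q] pr' lt 2 pe by auto
    have "n_syl r \<le> 14" using b0 g 2 pe by simp
    moreover have "n_syl r mod 7 = 1" "8 \<le> n_syl r" using md(3) g(3) 2(2) by simp_all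
    ultimately show False using d by presburger
  next
    case 3
    have n2: "\<not> self_normalizing p"
    proof
      assume "self_normalizing p"
      then have "q * r \<le> n_syl p" using sd pr' lt by auto
      then show False using 3 pe b0 g by simp
    qed
    show False
    proof (cases "self_normalizing r")
      case True
      then have d: "2 dvd n_syl r" "3 dvd n_syl r" using self_normalizing_dvd[of r p] self_normalizing_dvd[of r q] pr' lt 3 pe by auto
      have b: "2 * n_syl p + n_syl q + n_syl r \<le> 21" using b1[OF pr'(1) n2] by simp
      have "n_syl r \<le> 11" using b g 3 pe by simp
      moreover have m5: "n_syl r mod 5 = 1" "6 \<le> n_syl r" using md(3) g(3) 3(2) by simp_all
      ultimately have r6: "n_syl r = 6" using d by presburger
      have "n_syl q \<le> 9" using b r6 g 3 pe by simp
      moreover have "n_syl q mod 3 = 1" "4 \<le> n_syl q" using md(2) g(2) 3(1) by simp_all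
      ultimately have q47: "n_syl q = 4 \<or> n_syl q = 7" by presburger
      obtain R where R: "R \<in> Syl r (carrier G)" using Syl_nonempty P by blast
      obtain k where k: "card R = r ^ k" using SylD(4)[OF R] by blast
      have G: "card (carrier G) = 6 * 5 ^ k" using self_normalizing_card[OF True R] r6 k 3 by simp
      obtain T where T: "T \<in> Syl q (carrier G)" using Syl_nonempty P by blast
      have "n_syl q dvd 6 * 5 ^ k" using n_syl_card[OF T] G by (metis dvd_triv_left)
      with q47 show False
      proof (elim disjE)
        assume "n_syl q = 4" "n_syl q dvd 6 * 5 ^ k"
        then have "2 * 2 dvd 2 * (3 * 5 ^ k :: nat)" by simp
        then obtain w where "2 * (3 * 5 ^ k :: nat) = 2 * 2 * w" by (rule dvdE)
        then have "3 * 5 ^ k = 2 * w" by simp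
        then have "2 dvd (3 * 5 ^ k :: nat)" by (metis dvd_triv_left)
        then show False by simp
      next
        assume "n_syl q = 7" "n_syl q dvd 6 * 5 ^ k"
        then have "7 dvd 6 * (5 ^ k :: nat)" by simp
        moreover have p7: "prime (7::nat)" by simp
        ultimately have "7 dvd (6::nat) \<or> 7 dvd (5 ^ k :: nat)" by (simp add: prime_dvd_mult_iff)
        moreover have "\<not> 7 dvd (5 ^ k :: nat)" using prime_dvd_power[OF p7, of 5 k] by auto
        ultimately show False by simp
      qed
    next
      case False
      show False
      proof (cases "n_syl p = n_syl r")
        case True
        then have "n_syl r mod 2 = 1" "n_syl r mod 5 = 1" "6 \<le> n_syl r" using md(1,3) g(3) 3(2) pe by simp_all
        then have "n_syl r \<ge> 11" by presburger
        then show False using b0 True by simp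
      next
        case ne: False
        then show False using b2[OF pr'(1) n2 pr'(3) False] g 3 pe by simp
      qed
    qed
  qed
qed

text \<open>The Sylow q-subgroups meet trivially, and their nontrivial elements make up all of G
except for \<open>n_syl q\<close> elements. A Sylow p-subgroup of this order consists of exactly
the remaining elements, so it is normal.\<close>

lemma prime_order_self_normalizing_contra:
  assumes q: "prime_div q" "self_normalizing q" and R: "R \<in> Syl q (carrier G)" "card R = q"
    and p: "prime_div p" and T: "T \<in> Syl p (carrier G)" "card T = n_syl q" "p \<noteq> q"
  shows False
proof -
  have qp: "prime q" using q by (simp add: prime_div_def)
  let ?U = "\<Union>X\<in>Syl q (carrier G). X - {\<one>}"
  have cX: "card X = q" if "X \<in> Syl q (carrier G)" for X
    using syl_card_eq[OF SylD(1)[OF that] SylD(1)[OF R(1)] sg_carrier] R(2) by simp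
  have int: "X \<inter> Y = {\<one>}" if XY: "X \<in> Syl q (carrier G)" "Y \<in> Syl q (carrier G)" "X \<noteq> Y" for X Y
  proof -
    have i: "subgroup (X \<inter> Y) G" by (rule sg_Int[OF SylD(2)[OF XY(1)] SylD(2)[OF XY(2)]])
    have "card (X \<inter> Y) dvd q" using sg_dvd[OF i SylD(2)[OF XY(1)]] cX[OF XY(1)] by simp
    then have "card (X \<inter> Y) = 1 \<or> card (X \<inter> Y) = q" using qp by (metis prime_nat_iff)
    moreover have "card (X \<inter> Y) \<noteq> q"
    proof
      assume e: "card (X \<inter> Y) = q"
      have "X \<inter> Y = X" using sg_eqI[OF i SylD(2)[OF XY(1)]] e cX[OF XY(1)] by simp
      moreover have "X \<inter> Y = Y" using sg_eqI[OF i SylD(2)[OF XY(2)]] e cX[OF XY(2)] by simp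
      ultimately show False using XY(3) by simp
    qed
    ultimately show ?thesis using sg_card1[OF i] by blast
  qed
  have "card ?U = (\<Sum>X\<in>Syl q (carrier G). card (X - {\<one>}))"
  proof (rule card_UN_disjoint[OF Syl_finite])
    show "\<forall>X\<in>Syl q (carrier G). finite (X - {\<one>})" using sgD(2)[OF SylD(2)] by blast
    show "\<forall>X\<in>Syl q (carrier G). \<forall>Y\<in>Syl q (carrier G). X \<noteq> Y \<longrightarrow> (X - {\<one>}) \<inter> (Y - {\<one>}) = {}" using int by blast
  qed
  also have "\<dots> = n_syl q * (q - 1)" using cX sgD(3)[OF SylD(2)] by (simp add: card_Diff_singleton)
  finally have U: "card ?U = n_syl q * (q - 1)" .
  have Uc: "?U \<subseteq> carrier G" using SylD(5) by blast
  have "card (carrier G) = n_syl q * q" using self_normalizing_card[OF q(2) R(1)] R(2) by simp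
  then have D: "card (carrier G - ?U) = n_syl q"
    using U Uc card_Diff_subset[OF finite_subset[OF Uc fin] Uc] prime_gt_0_nat[OF qp] by (simp add: diff_mult_distrib2)
  have sub: "X = carrier G - ?U" if X: "X \<in> Syl p (carrier G)" for X
  proof -
    have "x \<notin> ?U" if x: "x \<in> X" for x
    proof
      assume "x \<in> ?U"
      then obtain Y where Y: "Y \<in> Syl q (carrier G)" "x \<in> Y" "x \<noteq> \<one>" by blast
      obtain i j where "card X = p ^ i" "card Y = q ^ j" using SylD(4)[OF X] SylD(4)[OF Y(1)] by blast
      then have "coprime (card X) (card Y)" using primes_coprime[OF SylD(3)[OF X] qp T(3)] by simp
      then have "X \<inter> Y = {\<one>}" by (rule sg_coprime_Int[OF SylD(2)[OF X] SylD(2)[OF Y(1)]])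
      then show False using x Y by blast
    qed
    then have "X \<subseteq> carrier G - ?U" using SylD(5)[OF X] by blast
    moreover have "card X = n_syl q" using syl_card_eq[OF SylD(1)[OF X] SylD(1)[OF T(1)] sg_carrier] T(2) by simp
    ultimately show ?thesis using card_subset_eq[of "carrier G - ?U" X] D fin by simp
  qed
  have "cj x T = T" if "x \<in> carrier G" for x
    using sub[OF T(1)] sub[of "cj x T"] syl_cj[OF SylD(1)[OF T(1)] sg_carrier that] by (simp add: Syl_def)
  then have "nml T" using SylD(2)[OF T(1)] by (simp add: nml_def)
  then show False using NS p SylD(1)[OF T(1)] by (auto simp: all_sylow_nonnormal_def)
qed

end

text \<open>Let R and T be different Sylow r-subgroups. R normalizes no other one, so it permutes
the other r transitively, and the stabilizer \<open>R \<inter> T\<close> of T has index r in R.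
This intersection normalizes R and T, hence also the remaining ones, which are too few for a
nontrivial orbit; so it lies in all of them.\<close>

lemma sylow_intersection:
  assumes r: "prime r" and n: "n_syl r = r + 1"
  defines "D \<equiv> \<Inter>(Syl r (carrier G))"
  shows "nml D" "\<And>R. R \<in> Syl r (carrier G) \<Longrightarrow> card R = r * card D \<and> D \<subseteq> R"
    "\<And>R T. R \<in> Syl r (carrier G) \<Longrightarrow> T \<in> Syl r (carrier G) \<Longrightarrow> R \<noteq> T \<Longrightarrow> R \<inter> T = D"
proof -
  have main: "card R = r * card (R \<inter> T) \<and> R \<inter> T = D"
    if RT: "R \<in> Syl r (carrier G)" "T \<in> Syl r (carrier G)" "R \<noteq> T" for R T
  proof -
    note R = SylD[OF RT(1)] and T = SylD[OF RT(2)]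
    obtain k where k: "card R = r ^ k" using R(4) by blast
    have nT: "nrm R T = R \<inter> T"
    proof
      show "R \<inter> T \<subseteq> nrm R T" using cj_self[OF T(2)] by (auto simp: nrm_def)
      have N: "subgroup (nrm R T) G" by (rule nrm_sg[OF R(2) T(5)])
      have "card (nrm R T) dvd r ^ k" using sg_dvd[OF N R(2) nrm_sub] k by simp
      then obtain j where "card (nrm R T) = r ^ j" using r by (auto simp: divides_primepow_nat)
      moreover have "nrm R T \<subseteq> nrm (carrier G) T" using R(5) by (auto simp: nrm_def)
      ultimately have "nrm R T \<subseteq> T" using syl_in_normalizer[OF RT(2) N] by blast
      then show "nrm R T \<subseteq> R \<inter> T" using nrm_sub by blast
    qed
    have cardRT: "card R = card T" by (rule syl_card_eq[OF R(1) T(1) sg_carrier])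
    have nf: "\<exists>s\<in>R. cj s T \<noteq> T"
    proof (rule ccontr)
      assume "\<not> ?thesis"
      then have "nrm R T = R" by (auto simp: nrm_def)
      then have "R \<subseteq> T" using nT by blast
      then show False using sg_eqI[OF R(2) T(2)] cardRT RT(3) by simp
    qed
    have sub: "cjs R T \<subseteq> Syl r (carrier G) - {R}"
    proof
      fix X assume "X \<in> cjs R T"
      then obtain x where x: "x \<in> R" "X = cj x T" by (auto simp: cjs_def)
      have xc: "x \<in> carrier G" using x R(5) by auto
      have "X \<in> Syl r (carrier G)" using syl_cj[OF T(1) sg_carrier xc] x(2) by (simp add: Syl_def)
      moreover have "X \<noteq> R"
      proof
        assume "X = R"
        then have "cj x T = cj x R" using x cj_self[OF R(2)] by simp
        then show False using cj_eq_iff[OF xc T(5) R(5)] RT(3) by simp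
      qed
      ultimately show "X \<in> Syl r (carrier G) - {R}" by simp
    qed
    have "card (cjs R T) \<ge> r" by (rule cjs_ge[OF R(2) k r T(2) nf])
    moreover have "card (cjs R T) \<le> r"
      using card_mono[OF _ sub] n RT(1) by (simp add: card_Diff_singleton)
    ultimately have "card (cjs R T) = r" by simp
    then have 1: "card R = r * card (R \<inter> T)" using card_cjs[OF R(2) T(5)] nT by simp
    have I: "subgroup (R \<inter> T) G" by (rule sg_Int[OF R(2) T(2)])
    have "card (R \<inter> T) dvd r ^ k" using sg_dvd[OF I R(2)] k by simp
    then obtain j where j: "card (R \<inter> T) = r ^ j" using r by (auto simp: divides_primepow_nat)
    \<comment> \<open>\<open>R \<inter> T\<close> stabilizes R and T, so an orbit of another Sylow
      subgroup X has at most r - 1 elements.\<close>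
    have "R \<inter> T \<subseteq> X" if X: "X \<in> Syl r (carrier G)" for X
    proof (cases "X = R \<or> X = T")
      case False
      note X' = SylD[OF X]
      have "\<not> (\<exists>s\<in>R \<inter> T. cj s X \<noteq> X)"
      proof
        assume m: "\<exists>s\<in>R \<inter> T. cj s X \<noteq> X"
        have "cjs (R \<inter> T) X \<subseteq> Syl r (carrier G) - {R, T}"
        proof
          fix Y assume "Y \<in> cjs (R \<inter> T) X"
          then obtain x where x: "x \<in> R" "x \<in> T" "Y = cj x X" by (auto simp: cjs_def)
          have xc: "x \<in> carrier G" using x R(5) by auto
          have "Y \<in> Syl r (carrier G)" using syl_cj[OF X'(1) sg_carrier xc] x(3) by (simp add: Syl_def)
          moreover have "Y \<noteq> R" using cj_eq_iff[OF xc X'(5) R(5)] cj_self[OF R(2) x(1)] x(3) False by auto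
          moreover have "Y \<noteq> T" using cj_eq_iff[OF xc X'(5) T(5)] cj_self[OF T(2) x(2)] x(3) False by auto
          ultimately show "Y \<in> Syl r (carrier G) - {R, T}" by simp
        qed
        then have "card (cjs (R \<inter> T) X) \<le> card (Syl r (carrier G) - {R, T})" by (rule card_mono[rotated]) simp
        also have "\<dots> = r - 1" using n RT by (simp add: card_Diff_subset)
        finally show False using cjs_ge[OF I j r X'(2) m] prime_gt_0_nat[OF r] by simp
      qed
      then have "R \<inter> T \<subseteq> nrm (carrier G) X" using R(5) by (auto simp: nrm_def)
      then show ?thesis by (rule syl_in_normalizer[OF X I _ j])
    qed auto
    then have "R \<inter> T = D" using RT unfolding D_def by blast
    then show ?thesis using 1 by simp
  qed
  have two: "\<exists>T\<in>Syl r (carrier G). T \<noteq> R" for R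
  proof (rule ccontr)
    assume "\<not> ?thesis"
    then have "Syl r (carrier G) \<subseteq> {R}" by blast
    then have "n_syl r \<le> 1" using card_mono[of "{R}"] by fastforce
    then show False using n prime_gt_1_nat[OF r] by simp
  qed
  show "R \<inter> T = D" if "R \<in> Syl r (carrier G)" "T \<in> Syl r (carrier G)" "R \<noteq> T" for R T
    using main[OF that] by simp
  show "card R = r * card D \<and> D \<subseteq> R" if R: "R \<in> Syl r (carrier G)" for R
  proof -
    obtain T where "T \<in> Syl r (carrier G)" "T \<noteq> R" using two by blast
    then show ?thesis using main[OF R, of T] by auto
  qed
  obtain R where R: "R \<in> Syl r (carrier G)" using Syl_nonempty[OF r] by blast
  obtain T where T: "T \<in> Syl r (carrier G)" "T \<noteq> R" using two by blast
  have Ds: "subgroup D G" using main[OF R T(1)] T(2) sg_Int[OF SylD(2)[OF R] SylD(2)[OF T(1)]] by auto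
  show "nml D"
  proof (rule nmlI[OF Ds])
    fix x assume x: "x \<in> carrier G"
    show "cj x D \<subseteq> D"
    proof -
      have "cj x D \<subseteq> X" if X: "X \<in> Syl r (carrier G)" for X
      proof -
        have "cj (inv x) X \<in> Syl r (carrier G)" using syl_cj[OF SylD(1)[OF X] sg_carrier, of "inv x"] x by (simp add: Syl_def)
        then have "D \<subseteq> cj (inv x) X" by (auto simp: D_def)
        then have "cj x D \<subseteq> cj x (cj (inv x) X)" by (rule cj_mono)
        then show ?thesis using cj_inv'[OF x SylD(5)[OF X]] by simp
      qed
      then show ?thesis by (auto simp: D_def)
    qed
  qed
qed

section \<open>Two prime divisors and no normal Sylow subgroup\<close>

lemma n_syl_prime_power:
  assumes "prime_div p" "prime q" "\<And>r. prime_div r \<Longrightarrow> r = p \<or> r = q" shows "\<exists>i. n_syl p = q ^ i"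
proof (rule single_prime_power[OF _ assms(2)])
  have p: "prime p" using assms by (simp add: prime_div_def)
  have m: "n_syl p mod p = 1" by (rule n_syl_mod[OF p])
  show "n_syl p \<noteq> 0" using m by (intro notI) simp
  fix r assume r: "prime r" "r dvd n_syl p"
  obtain R where R: "R \<in> Syl p (carrier G)" using Syl_nonempty[OF p] by blast
  have "r dvd card (carrier G)" using r(2) n_syl_card[OF R] by (metis dvd_mult2)
  then have "r = p \<or> r = q" using assms(3) r(1) by (simp add: prime_div_def)
  moreover have "r \<noteq> p" using r(2) m prime_gt_1_nat[OF p] by (auto simp: dvd_eq_mod_eq_0)
  ultimately show "r = q" by simp
qed

lemma two_prime_order:
  assumes "p \<noteq> q" "\<And>r. prime_div r \<Longrightarrow> r = p \<or> r = q" and R: "R \<in> Syl p (carrier G)" and T: "T \<in> Syl q (carrier G)"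
  shows "card (carrier G) = card R * card T"
proof -
  note R' = SylD[OF R] and T' = SylD[OF T]
  obtain i j where ij: "card R = p ^ i" "card T = q ^ j" using R'(4) T'(4) by blast
  have "coprime (card R) (card T)" using primes_coprime[OF R'(3) T'(3) assms(1)] ij by simp
  then have "card R * card T dvd card (carrier G)"
    using sg_dvd_carrier[OF R'(2)] sg_dvd_carrier[OF T'(2)] by (simp add: divides_mult)
  then obtain w where w: "card (carrier G) = card R * card T * w" by blast
  have "w = 1"
  proof (rule ccontr)
    assume "w \<noteq> 1"
    then obtain r where r: "prime r" "r dvd w" using prime_factor_nat by blast
    then have "r = p \<or> r = q" using assms(2) w by (simp add: prime_div_def)
    moreover have "card (carrier G) div card R = card T * w" "card (carrier G) div card T = card R * w"
      using w sgD(4)[OF R'(2)] sgD(4)[OF T'(2)] by simp_all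
    then have "\<not> p dvd card T * w" "\<not> q dvd card R * w" using sylD(4)[OF R'(1)] sylD(4)[OF T'(1)] by simp_all
    ultimately show False using r(2) by auto
  qed
  then show ?thesis using w by simp
qed

lemma family_card_le:
  assumes "F \<subseteq> subs K" "\<And>H. H \<in> F \<Longrightarrow> \<kappa> H = i" "m \<le> card F" shows "m \<le> card {H \<in> subs K. \<kappa> H = i}"
proof -
  have "F \<subseteq> {H \<in> subs K. \<kappa> H = i}" using assms(1,2) by blast
  then have "card F \<le> card {H \<in> subs K. \<kappa> H = i}" by (rule card_mono[rotated]) simp
  then show ?thesis using assms(3) by linarith
qed

text \<open>A subgroup moved by R has at least 3 conjugates under R and differs from P and the
trivial subgroup.\<close>

lemma nontrivial_core_subs:
  assumes c: "coact 2 P 3 R" and nt: "cen P R \<noteq> P" shows "card (subs P) \<ge> 5"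
proof -
  note d = coactD[OF c]
  obtain X where X: "X \<in> subs P" "moved R X" using moved_exists[OF c nt] by blast
  have Xs: "subgroup X G" "X \<subseteq> P" using X by (auto simp: subs_def)
  have X1: "card X \<noteq> 1" using X(2) not_moved_simps(2)[OF c] sg_card1[OF Xs(1)] by auto
  have XP: "card X \<noteq> card P" using X(2) not_moved_simps(1)[OF c] sg_eqI[OF Xs(1) d(4) Xs(2)] by auto
  have P1: "card P \<noteq> 1"
  proof
    assume "card P = 1"
    then have "X \<subseteq> {\<one>}" using sg_card1[OF d(4)] Xs(2) by simp
    then have "X = {\<one>}" using sgD(3)[OF Xs(1)] by blast
    then show False using X1 by simp
  qed
  have b1: "1 \<le> card {Z \<in> subs P. card Z = 1}" using one_bound[of "{\<one>}" P card] sg_one sgD(3)[OF d(4)] by (simp add: subs_def)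
  have bP: "1 \<le> card {Z \<in> subs P. card Z = card P}" using one_bound[of P P card] d(4) by (simp add: subs_def)
  have bX: "3 \<le> card {Z \<in> subs P. card Z = card X}" by (rule orbit_card_bound[OF c X])
  have "sum_list (map snd [(1, 1), (card P, 1), (card X, 3)]) \<le> card (subs P)"
    by (rule tagged_card_bound[OF subs_finite, where \<kappa> = card]) (use X1 XP P1 b1 bP bX in auto)
  then show ?thesis by simp
qed

text \<open>Otherwise PR, of index at most 2 in G, would normalize R, whose normalizer has index
4.\<close>

lemma noncentral_of_index:
  assumes P: "nml P" "card P = 2 ^ m" and R: "R \<in> Syl 3 (carrier G)" and n: "n_syl 3 = 4"
    and g: "card (carrier G) \<le> 2 * (card P * card R)"
  shows "coact 2 P 3 R" "cen P R \<noteq> P"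
proof -
  note R' = SylD[OF R]
  obtain k where k: "card R = 3 ^ k" using R'(4) by blast
  show c: "coact 2 P 3 R" by (rule coactI[OF P(1) two_is_prime_nat R'(3) _ P(2) R'(2) k]) simp
  note d = coactD[OF c]
  show "cen P R \<noteq> P"
  proof
    assume "cen P R = P"
    then have "nrm P R = P" using coact_nrm[OF c] by simp
    then have "P \<subseteq> nrm (carrier G) R" using sgD(1)[OF d(4)] by (auto simp: nrm_def)
    moreover have "R \<subseteq> nrm (carrier G) R" by (rule sub_nrm[OF R'(2,5)])
    moreover have N: "subgroup (nrm (carrier G) R) G" by (rule nrm_sg[OF sg_carrier R'(5)])
    ultimately have "P <#> R \<subseteq> nrm (carrier G) R" by (intro prod_least)
    then have "card P * card R \<le> card (nrm (carrier G) R)" using card_mono[OF sgD(2)[OF N]] d(13) by metis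
    moreover have "4 * card (nrm (carrier G) R) = card (carrier G)" using n_syl_card[OF R] n by simp
    moreover have "card P * card R > 0" using sgD(4)[OF d(4)] sgD(4)[OF d(5)] by simp
    ultimately show False using g by linarith
  qed
qed

text \<open>Let D be the intersection of the Sylow 2-subgroups and R a Sylow 3-subgroup. There are
at least 5 subgroups of D, the 4 Sylow 3-subgroups and their 4 normalizers, DR, G, the 3 Sylow
2-subgroups, and in each of these at least 2 proper subgroups that are not contained in D: it is
not cyclic, and the elements outside D cannot all lie in one proper cyclic subgroup.\<close>

lemma many_subs_3_4:
  assumes pr': "prime_div 2" "prime_div 3" "\<And>r. prime_div r \<Longrightarrow> r = 2 \<or> r = 3" and n: "n_syl 2 = 3" "n_syl 3 = 4"
  shows "num_subgroups G \<ge> 24"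
proof -
  define D where "D = \<Inter>(Syl 2 (carrier G))"
  have n2: "n_syl 2 = 2 + 1" using n by simp
  note I = sylow_intersection[OF two_is_prime_nat n2, folded D_def]
  define h where "h = card D"
  obtain R2 where R2: "R2 \<in> Syl 2 (carrier G)" using Syl_nonempty[OF two_is_prime_nat] by blast
  obtain R where R: "R \<in> Syl 3 (carrier G)" using Syl_nonempty[of 3] by auto
  note R' = SylD[OF R]
  define t where "t = card R"
  obtain b where b: "t = 3 ^ b" using R'(4) by (auto simp: t_def)
  have b0: "b \<noteq> 0" using b Syl_ne_one[OF pr'(2) R] sg_card1[OF R'(2)] by (intro notI) (simp add: t_def)
  have t3: "3 dvd t" "t \<ge> 3" using b b0 by (auto simp: dvd_power self_le_power)
  have Dn: "subgroup D G" using nmlD[OF I(1)] by simp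
  have c2: "card T = 2 * h" "D \<subseteq> T" if "T \<in> Syl 2 (carrier G)" for T using I(2)[OF that] by (simp_all add: h_def)
  have g: "card (carrier G) = 2 * h * t" using two_prime_order[OF _ pr'(3) R2 R] c2[OF R2] by (simp add: t_def)
  obtain a where a: "2 * h = 2 ^ a" using SylD(4)[OF R2] c2[OF R2] by auto
  have "h dvd 2 ^ a" using a by (metis dvd_triv_right)
  then obtain m where m: "h = 2 ^ m" by (metis divides_primepow_nat two_is_prime_nat)
  have mh: "card D = 2 ^ m" using m by (simp add: h_def)
  note nc = noncentral_of_index[OF I(1) mh R n(2)]
  have c: "coact 2 D 3 R" and nt: "cen D R \<noteq> D" using nc g by (simp_all add: h_def t_def)
  note d = coactD[OF c]
  have nd3: "\<not> 3 dvd (2 ^ i :: nat)" for i using prime_dvd_power[of 3 "2::nat" i] by auto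
  have n4: "card (cjs D R) = 4"
  proof (rule antisym)
    have "cjs D R \<subseteq> Syl 3 (carrier G)"
      using Syl_cjs[OF sg_carrier R'(1)] sgD(1)[OF Dn] by (auto simp: cjs_def)
    then show "card (cjs D R) \<le> 4" using card_mono[OF Syl_finite] n(2) by metis
    show "4 \<le> card (cjs D R)" using coact_index(2)[OF c nt] by simp
  qed
  define m' where "m' = card (cen D R)"
  have h4: "h = 4 * m'" using coact_card[OF c] n4 by (simp add: h_def m'_def)
  have m'1: "m' \<ge> 1" using sgD(4)[OF d(15)] by (simp add: m'_def)
  define w where "w = card (nrm (carrier G) R)"
  have wt: "w = 2 * (m' * t)" using n_syl_card[OF R] n(2) g h4 by (simp add: w_def)
  \<comment> \<open>Orders divisible by 3 serve as labels; they cannot collide with 0, 1, 2, which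
    stand for the subgroups of D, the Sylow 2-subgroups and the other 2-subgroups.\<close>
  let ?\<kappa> = "\<lambda>H. if H \<subseteq> D then 0 else if 3 dvd card H then card H else if card H = 2 * h then 1 else 2 :: nat"
  have notD: "\<not> H \<subseteq> D" if "subgroup H G" "3 dvd card H" for H
  proof
    assume "H \<subseteq> D"
    then have "card H dvd 2 ^ m" using sg_dvd[OF that(1) Dn] mh by simp
    then show False using that(2) nd3 by (meson dvd_trans)
  qed
  have mt: "m' * t \<ge> t" using m'1 by simp
  have 0: "5 \<le> card {H \<in> subs (carrier G). ?\<kappa> H = 0}"
    by (rule family_card_le[of "subs D"]) (use nontrivial_core_subs[OF c nt] subs_mono[OF sgD(1)[OF Dn]] in \<open>auto simp: subs_def\<close>)
  have 1: "4 \<le> card {H \<in> subs (carrier G). ?\<kappa> H = t}"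
  proof (rule family_card_le[OF Syl_sub[of 3]])
    fix H assume H: "H \<in> Syl 3 (carrier G)"
    have "card H = t" using syl_card_eq[OF SylD(1)[OF H] R'(1) sg_carrier] by (simp add: t_def)
    then show "?\<kappa> H = t" using notD[OF SylD(2)[OF H]] t3 by simp
  qed (use n in simp)
  have 2: "1 \<le> card {H \<in> subs (carrier G). ?\<kappa> H = 4 * (m' * t)}"
  proof (rule family_card_le[of "{D <#> R}"])
    have "card (D <#> R) = 4 * (m' * t)" using d(13) h4 by (simp add: h_def t_def)
    then show "?\<kappa> H = 4 * (m' * t)" if "H \<in> {D <#> R}" for H using that notD[OF d(12)] t3 by simp
  qed (use d(12) sgD(1) in \<open>auto simp: subs_def\<close>)
  have 3: "1 \<le> card {H \<in> subs (carrier G). ?\<kappa> H = 8 * (m' * t)}"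
  proof (rule family_card_le[of "{carrier G}"])
    have "card (carrier G) = 8 * (m' * t)" using g h4 by simp
    then show "?\<kappa> H = 8 * (m' * t)" if "H \<in> {carrier G}" for H using that notD[OF sg_carrier] t3 by simp
  qed (use sg_carrier in \<open>auto simp: subs_def\<close>)
  have 4: "4 \<le> card {H \<in> subs (carrier G). ?\<kappa> H = 2 * (m' * t)}"
  proof (rule family_card_le[OF syl_normalizers_sub[of 3]])
    fix H assume "H \<in> syl_normalizers 3"
    then obtain T where T: "T \<in> Syl 3 (carrier G)" "H = nrm (carrier G) T" by (auto simp: syl_normalizers_def)
    have "4 * card H = 4 * w" using n_syl_card[OF T(1)] n_syl_card[OF R] n(2) T(2) by (simp add: w_def)
    then have "card H = 2 * (m' * t)" using wt by simp
    moreover have "subgroup H G" using T nrm_sg[OF sg_carrier SylD(5)] by simp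
    ultimately show "?\<kappa> H = 2 * (m' * t)" using notD[of H] t3 by simp
  qed (use n syl_normalizers_card[of 3] in simp)
  have 5: "3 \<le> card {H \<in> subs (carrier G). ?\<kappa> H = 1}"
  proof (rule family_card_le[OF Syl_sub[of 2]])
    fix H assume H: "H \<in> Syl 2 (carrier G)"
    have cH: "card H = 2 * h" by (rule c2[OF H])
    have "\<not> H \<subseteq> D" using card_mono[OF sgD(2)[OF Dn], of H] cH sgD(4)[OF Dn] by (auto simp: h_def)
    moreover have "\<not> 3 dvd 2 * h" unfolding a by (rule nd3)
    ultimately show "?\<kappa> H = 1" using cH by simp
  qed (use n in simp)
  define YT where "YT T = {Y \<in> subs T. Y \<noteq> T \<and> \<not> Y \<subseteq> D}" for T
  have YT2: "card (YT T) \<ge> 2" if T: "T \<in> Syl 2 (carrier G)" for T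
  proof -
    note T' = SylD[OF T]
    have cT: "card T = 2 * h" "D \<subseteq> T" using c2[OF T] by auto
    have uc: "u \<in> carrier G" if "u \<in> T" for u using that T'(5) by auto
    \<comment> \<open>If T were cyclic, so would be D; its subgroup of order 2 would be fixed by R
      although the centralizer of R in D is trivial.\<close>
    have ncyc: "cyc u \<noteq> T" if u: "u \<in> T" for u
    proof
      assume e: "cyc u = T"
      note uc' = uc[OF u]
      have uu: "u \<otimes> u \<in> D" by (rule index_two_square[OF Dn T'(2) cT(2) _ u]) (use cT in \<open>simp add: h_def\<close>)
      have oT: "ord u = 2 * h" using generate_pow_card[OF uc'] e cT by simp
      have "ord (u [^] (2::nat)) = h" using ord_pow[OF uc', of 2] oT by simp
      moreover have u2: "u [^] (2::nat) = u \<otimes> u" using uc' by (simp add: numeral_2_eq_2)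
      ultimately have "card (cyc (u \<otimes> u)) = card D" using generate_pow_card[of "u \<otimes> u"] uc' by (simp add: h_def)
      then have Dc: "D = cyc (u \<otimes> u)" using sg_eqI[OF cyc_sg Dn cyc_least[OF Dn uu]] uc' by simp
      have C1: "cen D R = {\<one>}" by (rule cyclic_cen_trivial[OF c uu Dc nt])
      have "2 ^ 1 dvd card D" using h4 by (simp add: h_def)
      then obtain A where A: "subgroup A G" "A \<subseteq> D" "card A = 2 ^ 1" using sg_exists_prime_power[OF Dn two_is_prime_nat] by blast
      have "cj s A = A" if s: "s \<in> R" for s
      proof -
        have sc: "s \<in> carrier G" using s R'(5) by auto
        have "cj s A \<subseteq> D" using cj_mono[OF A(2), of s] d(8)[OF s] by simp
        then show ?thesis
          using cyc_prime_subgroup_unique[of "u \<otimes> u" 2 m "cj s A" A] uc' mh Dc cj_sg[OF sc A(1)] A cj_card[OF sc sgD(1)[OF A(1)]] by simp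
      qed
      then have nm: "\<not> moved R A" by (auto simp: moved_def)
      have "A \<in> subs D" using A by (simp add: subs_def)
      then have "card A mod 3 = card (A \<inter> {\<one>}) mod 3" using invariant_card_mod[OF c _ nm] C1 by simp
      moreover have "A \<inter> {\<one>} = {\<one>}" using sgD(3)[OF A(1)] by auto
      ultimately show False using A(3) by simp
    qed
    have cTD: "card (T - D) = h" using cT sgD(2)[OF Dn] by (simp add: card_Diff_subset h_def)
    have h0: "h > 0" using h4 m'1 by simp
    then have "T - D \<noteq> {}" using cTD by (intro notI) simp
    then obtain u where u: "u \<in> T" "u \<notin> D" by blast
    let ?Y = "cyc u"
    have Y: "subgroup ?Y G" "?Y \<subseteq> T" using cyc_sg[OF uc[OF u(1)]] cyc_least[OF T'(2) u(1)] by auto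
    have cY: "card ?Y \<le> h"
    proof -
      obtain v where v: "2 * h = card ?Y * v" using sg_dvd[OF Y(1) T'(2) Y(2)] cT by auto
      have "v \<noteq> 1" using v sg_eqI[OF Y(1) T'(2) Y(2)] ncyc[OF u(1)] cT by auto
      moreover have "v \<noteq> 0" using v h0 by (intro notI) simp
      ultimately have "2 \<le> v" by linarith
      then have "card ?Y * 2 \<le> card ?Y * v" by (rule mult_le_mono2)
      then show ?thesis using v by linarith
    qed
    have DY: "subgroup (D <#> ?Y) G" by (rule nml_prod[OF I(1) Y(1)])
    have DYT: "D <#> ?Y \<subseteq> T" by (rule prod_least[OF T'(2) cT(2) Y(2)])
    have DDY: "D \<subset> D <#> ?Y" using prod_sub1[OF Y(1) sgD(1)[OF Dn]] prod_sub2[OF Dn sgD(1)[OF Y(1)]] cyc_self[of u] u(2) by blast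
    have "card (D <#> ?Y) = 2 * h"
    proof -
      obtain v where v: "2 * h = card (D <#> ?Y) * v" using sg_dvd[OF DY T'(2) DYT] cT by auto
      have "h < card (D <#> ?Y)" using psubset_card_mono[OF sgD(2)[OF DY] DDY] by (simp add: h_def)
      then have "h * v < card (D <#> ?Y) * v \<or> v = 0" by auto
      then have "h * v < 2 * h \<or> v = 0" using v by simp
      then have "v < 2" using h0 by auto
      moreover have "v \<noteq> 0" using v h0 by (intro notI) simp
      ultimately have "v = 1" by linarith
      then show ?thesis using v by simp
    qed
    then have "2 * h * card (?Y \<inter> D) = h * card ?Y" using nml_prod_card[OF I(1) Y(1)] by (simp add: h_def)
    then have Y2: "2 * card (?Y \<inter> D) = card ?Y" using h0 by simp
    have "card (?Y - D) = card ?Y - card (?Y \<inter> D)" using sgD(2)[OF Y(1)] by (simp add: card_Diff_subset_Int)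
    then have "card (?Y - D) < card (T - D)" using Y2 cY cTD h0 by linarith
    then have "\<not> T - D \<subseteq> ?Y - D" using card_mono[of "?Y - D" "T - D"] sgD(2)[OF Y(1)] by auto
    then obtain u' where u': "u' \<in> T" "u' \<notin> D" "u' \<notin> ?Y" by blast
    have "{?Y, cyc u'} \<subseteq> YT T"
      using Y ncyc[OF u(1)] ncyc[OF u'(1)] cyc_sg[OF uc[OF u'(1)]] cyc_least[OF T'(2) u'(1)] u(2) u'(2) cyc_self[of u] cyc_self[of u']
      unfolding YT_def subs_def by blast
    then have "card {?Y, cyc u'} \<le> card (YT T)" by (rule card_mono[rotated]) (simp add: YT_def)
    moreover have "?Y \<noteq> cyc u'" using u'(3) cyc_self[of u'] by auto
    ultimately show ?thesis by simp
  qed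
  have 6: "6 \<le> card {H \<in> subs (carrier G). ?\<kappa> H = 2}"
  proof (rule family_card_le[of "\<Union>T\<in>Syl 2 (carrier G). YT T"])
    show "(\<Union>T\<in>Syl 2 (carrier G). YT T) \<subseteq> subs (carrier G)" using SylD(5) unfolding YT_def subs_def by blast
    show "?\<kappa> H = 2" if H: "H \<in> (\<Union>T\<in>Syl 2 (carrier G). YT T)" for H
    proof -
      obtain T where T: "T \<in> Syl 2 (carrier G)" "subgroup H G" "H \<subseteq> T" "H \<noteq> T" "\<not> H \<subseteq> D" using H by (auto simp: YT_def subs_def)
      have "card H dvd 2 ^ a" using sg_dvd[OF T(2) SylD(2)[OF T(1)] T(3)] c2[OF T(1)] a by simp
      then have "\<not> 3 dvd card H" using nd3 by (meson dvd_trans)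
      moreover have "card H \<noteq> 2 * h" using sg_eqI[OF T(2) SylD(2)[OF T(1)] T(3)] T(4) c2[OF T(1)] by auto
      ultimately show ?thesis using T(5) by simp
    qed
    have "card (\<Union>T\<in>Syl 2 (carrier G). YT T) = (\<Sum>T\<in>Syl 2 (carrier G). card (YT T))"
    proof (rule card_UN_disjoint[OF Syl_finite])
      show "\<forall>T\<in>Syl 2 (carrier G). finite (YT T)" by (simp add: YT_def)
      show "\<forall>T\<in>Syl 2 (carrier G). \<forall>U\<in>Syl 2 (carrier G). T \<noteq> U \<longrightarrow> YT T \<inter> YT U = {}"
      proof (intro ballI impI equals0I)
        fix T U Y assume "T \<in> Syl 2 (carrier G)" "U \<in> Syl 2 (carrier G)" "T \<noteq> U" "Y \<in> YT T \<inter> YT U"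
        then show False using I(3)[of T U] unfolding YT_def subs_def by blast
      qed
    qed
    also have "\<dots> \<ge> (\<Sum>T\<in>Syl 2 (carrier G). 2)" using YT2 by (intro sum_mono) simp
    finally show "6 \<le> card (\<Union>T\<in>Syl 2 (carrier G). YT T)" using n by simp
  qed
  let ?L = "[(0, 5), (t, 4), (4 * (m' * t), 1), (8 * (m' * t), 1), (2 * (m' * t), 4), (1, 3), (2, 6 :: nat)]"
  have all: "\<forall>e\<in>set ?L. snd e \<le> card {x \<in> subs (carrier G). ?\<kappa> x = fst e}"
    by (simp only: list.set ball_simps fst_conv snd_conv 0 1 2 3 4 5 6 simp_thms)
  have "sum_list (map snd ?L) \<le> card (subs (carrier G))"
  proof (rule tagged_card_bound[OF subs_finite, where \<kappa> = ?\<kappa>])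
    show "l \<le> card {x \<in> subs (carrier G). ?\<kappa> x = i}" if "(i, l) \<in> set ?L" for i l
      using bspec[OF all that] unfolding fst_conv snd_conv .
    have "t < 2 * (m' * t)" "m' * t \<ge> 3" using mt t3(2) by linarith+
    then show "distinct (map fst ?L)" using t3(2) by simp
  qed
  then show ?thesis by (simp add: subs_carrier)
qed

lemma only_conjugate:
  assumes "subgroup H G" "card (cjs (carrier G) H) = 1" shows "nml H"
proof -
  obtain X where X: "cjs (carrier G) H = {X}" using assms(2) by (rule card_1_singletonE)
  have m: "cj x H = X" if "x \<in> carrier G" for x
  proof -
    have "cj x H \<in> cjs (carrier G) H" unfolding cjs_def using that by (rule imageI)
    then show ?thesis unfolding X by (rule singletonD)
  qed
  have "cj \<one> H = H" by (rule cj_one[OF sgD(1)[OF assms(1)]])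
  then have "X = H" using m[OF one_closed] by simp
  then show ?thesis using m assms(1) by (simp add: nml_def)
qed

text \<open>The intersection A of the Sylow 3-subgroups has order 3. Its centralizer D has index
2, and a Sylow 2-subgroup R2 meets D in a subgroup E of index 2 in R2. The 24 subgroups are G, the
4 Sylow 3-subgroups, the 9 Sylow 2-subgroups, A, D, AE, the 3 conjugates of the product of A and
R2, and 4 small 2-subgroups.\<close>

lemma many_subs_9_4:
  assumes pr': "prime_div 2" "prime_div 3" "\<And>r. prime_div r \<Longrightarrow> r = 2 \<or> r = 3" and n: "n_syl 2 = 9" "n_syl 3 = 4" and self: "self_normalizing 2"
  shows "num_subgroups G \<ge> 24"
proof -
  have p3: "prime (3::nat)" by simp
  have n3: "n_syl 3 = 3 + 1" using n by simp
  define A where "A = \<Inter>(Syl 3 (carrier G))"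
  note I = sylow_intersection[OF p3 n3, folded A_def]
  obtain R2 where R2: "R2 \<in> Syl 2 (carrier G)" using Syl_nonempty[OF two_is_prime_nat] by blast
  obtain R where R: "R \<in> Syl 3 (carrier G)" using Syl_nonempty[OF p3] by blast
  note R' = SylD[OF R] and S = SylD[OF R2]
  define c where "c = card R2"
  obtain a where a: "c = 2 ^ a" using S(4) by (auto simp: c_def)
  have sf: "nrm (carrier G) R2 = R2" using self R2 by (simp add: self_normalizing_def)
  have g: "card (carrier G) = 9 * c" using n_syl_card[OF R2] sf n(1) by (simp add: c_def)
  have c0: "c > 0" using sgD(4)[OF S(2)] by (simp add: c_def)
  have t9: "card R = 9" using two_prime_order[OF _ pr'(3) R2 R] g c0 by (simp add: c_def)
  have cc4: "4 * card (nrm (carrier G) R) = 9 * c" using n_syl_card[OF R] n(2) g by simp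
  then have "4 dvd c" by presburger
  then obtain h' where h': "c = 4 * h'" by blast
  define h where "h = 2 * h'"
  have ch: "c = 2 * h" "even h" "h \<ge> 2" using h' c0 by (auto simp: h_def)
  have A3: "card A = 3" "A \<subseteq> R" using I(2)[OF R] t9 by simp_all
  note An = nmlD[OF I(1)]
  have Ac: "A \<subseteq> carrier G" by (rule sgD(1)[OF An(1)])
  have cA: "coact 3 A 2 R2" by (rule coactI[OF I(1) p3 two_is_prime_nat _ _ S(2), of 1 a]) (use A3 a in \<open>simp_all add: c_def\<close>)
  note dA = coactD[OF cA]
  have ntA: "cen A R2 \<noteq> A"
  proof
    assume "cen A R2 = A"
    then have "nrm A R2 = A" using coact_nrm[OF cA] by simp
    then have "A \<subseteq> nrm (carrier G) R2" using Ac by (auto simp: nrm_def)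
    then have "A \<subseteq> A \<inter> R2" using sf by simp
    then have "A \<subseteq> {\<one>}" using dA(9) by simp
    then show False using A3(1) card_mono[of "{\<one>}" A] by simp
  qed
  define D where "D = cen (carrier G) A"
  have Dn: "nml D" unfolding D_def by (rule cen_nml[OF I(1)])
  note D = nmlD[OF Dn]
  have cD: "2 * card D = card (carrier G)"
  proof -
    have "\<not> A \<subseteq> {\<one>}" using A3(1) card_mono[of "{\<one>}" A] by auto
    then obtain x where x: "x \<in> A" "x \<noteq> \<one>" by blast
    have xc: "x \<in> carrier G" using x Ac by auto
    have cx: "A = cyc x"
    proof -
      have s: "subgroup (cyc x) G" "cyc x \<subseteq> A" using cyc_sg[OF xc] cyc_least[OF An(1) x(1)] by auto
      have "card (cyc x) dvd 3" using sg_dvd[OF s(1) An(1) s(2)] A3 by simp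
      then have "card (cyc x) = 1 \<or> card (cyc x) = 3" using p3 by (metis prime_nat_iff)
      moreover have "card (cyc x) \<noteq> 1" using sg_card1[OF s(1)] cyc_self[of x] x(2) by auto
      ultimately show ?thesis using sg_eqI[OF s(1) An(1) s(2)] A3 by simp
    qed
    have ac: "acts (carrier G) (\<lambda>g x. g \<otimes> x \<otimes> inv g) A" by (rule acts_elem[OF sg_carrier Ac]) (use An(2) in simp)
    have st: "{g \<in> carrier G. g \<otimes> x \<otimes> inv g = x} = D"
    proof (intro equalityI subsetI)
      fix g assume "g \<in> {g \<in> carrier G. g \<otimes> x \<otimes> inv g = x}"
      then have gc: "g \<in> carrier G" "g \<otimes> x \<otimes> inv g = x" by auto
      have "g \<otimes> y = y \<otimes> g" if yA: "y \<in> A" for y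
      proof -
        obtain k :: nat where "y = x [^] k" using yA cx cyc_powE[OF xc] by blast
        then have "g \<otimes> y \<otimes> inv g = y" using cj_pow[OF gc(1) xc] gc(2) by simp
        then show ?thesis using fixed_iff[OF gc(1)] yA Ac by auto
      qed
      then show "g \<in> D" using gc by (simp add: D_def cen_def)
    next
      fix g assume "g \<in> D"
      then have gx: "g \<in> carrier G" "g \<otimes> x = x \<otimes> g" using x(1) unfolding D_def cen_def by blast+
      have "g \<otimes> x \<otimes> inv g = x" by (rule iffD2[OF fixed_iff[OF gx(1) xc] sym[OF gx(2)]])
      then show "g \<in> {g \<in> carrier G. g \<otimes> x \<otimes> inv g = x}" using gx(1) by blast
    qed
    let ?O = "(\<lambda>g. g \<otimes> x \<otimes> inv g) ` carrier G"
    have os: "card ?O * card D = card (carrier G)" using orbit_stabilizer[OF sg_carrier ac x(1)] st by simp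
    have "?O \<subseteq> A - {\<one>}"
    proof
      fix z assume "z \<in> ?O"
      then obtain g where z: "g \<in> carrier G" "z = g \<otimes> x \<otimes> inv g" by blast
      have "z \<in> A" using ac z x by (auto simp: acts_def)
      moreover have "z \<noteq> \<one>" using z x inj_onD[OF cj_inj[OF z(1)], of x \<one>] xc by auto
      ultimately show "z \<in> A - {\<one>}" by simp
    qed
    then have "card ?O \<le> card (A - {\<one>})" by (rule card_mono[rotated]) (use sgD(2)[OF An(1)] in simp)
    then have "card ?O \<le> 2" using A3 sgD(3)[OF An(1)] by (simp add: card_Diff_singleton)
    moreover have "card ?O \<noteq> 0" using os sgD(4)[OF sg_carrier] by (intro notI) simp
    moreover have "card ?O \<noteq> 1"
    proof
      assume "card ?O = 1"
      then have "card D = card (carrier G)" using os by simp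
      then have DG: "D = carrier G" using sg_eqI[OF D(1) sg_carrier sgD(1)[OF D(1)]] by simp
      have "x \<otimes> y = y \<otimes> x" if "x \<in> A" "y \<in> R2" for x y
      proof -
        have "y \<in> D" using that DG S(5) by auto
        then show ?thesis using that(1) unfolding D_def cen_def by simp
      qed
      then have "cen A R2 = A" unfolding cen_def by blast
      then show False using ntA by simp
    qed
    ultimately have "card ?O = 2" by linarith
    then show ?thesis using os by simp
  qed
  have D9: "card D = 9 * h" using cD g ch by simp
  define E where "E = R2 \<inter> D"
  have E: "subgroup E G" "E \<subseteq> R2" unfolding E_def using sg_Int[OF S(2) D(1)] by auto
  have R2D: "\<not> R2 \<subseteq> D"
  proof
    assume "R2 \<subseteq> D"
    then have "x \<otimes> y = y \<otimes> x" if "x \<in> A" "y \<in> R2" for x y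
    proof -
      have "y \<in> D" using that \<open>R2 \<subseteq> D\<close> by auto
      then show ?thesis using that(1) unfolding D_def cen_def by simp
    qed
    then have "cen A R2 = A" unfolding cen_def by blast
    then show False using ntA by simp
  qed
  have cE: "card E = h"
  proof -
    have DR: "subgroup (D <#> R2) G" by (rule nml_prod[OF Dn S(2)])
    have "D \<subset> D <#> R2" using prod_sub1[OF S(2) sgD(1)[OF D(1)]] prod_sub2[OF D(1) S(5)] R2D by blast
    then have lt: "card D < card (D <#> R2)" by (rule psubset_card_mono[OF sgD(2)[OF DR]])
    obtain v where v: "card (carrier G) = card (D <#> R2) * v" using sg_dvd_carrier[OF DR] by blast
    have "v \<noteq> 0" using v sgD(4)[OF sg_carrier] by (intro notI) simp
    moreover have "v < 2"
    proof (rule ccontr)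
      assume "\<not> v < 2"
      then have "card (D <#> R2) * 2 \<le> card (D <#> R2) * v" by (intro mult_le_mono2) simp
      then show False using v cD lt by linarith
    qed
    ultimately have "card (D <#> R2) = 18 * h" using v g ch by (cases "v = 1") auto
    then have "18 * h * card E = 9 * h * (2 * h)" using nml_prod_card[OF Dn S(2)] D9 ch by (simp add: E_def c_def)
    then show ?thesis using ch(3) by simp
  qed
  have nd3: "\<not> 3 dvd (2 ^ i :: nat)" for i using prime_dvd_power[of 3 "2::nat" i] by auto
  have "card E dvd 2 ^ a" using sg_dvd[OF E(1) S(2) E(2)] a by (simp add: c_def)
  then obtain e where e: "card E = 2 ^ e" by (metis divides_primepow_nat two_is_prime_nat)
  have Einv: "cj x A = A" if "x \<in> E" for x using An(2) that E(2) S(5) by blast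
  have comEA: "x \<otimes> y = y \<otimes> x" if "x \<in> A" "y \<in> E" for x y
    using that unfolding E_def D_def cen_def by simp
  define L where "L = A <#> R2"
  have L: "subgroup L G" "card L = 3 * c" using dA(12,13) A3 by (simp_all add: L_def c_def)
  have AE: "subgroup (A <#> E) G" by (rule prod_sg[OF An(1) E(1) Einv])
  have cAE: "card (A <#> E) = 3 * h"
  proof -
    have "A \<inter> E = {\<one>}" using dA(9) E(2) sgD(3)[OF An(1)] sgD(3)[OF E(1)] by blast
    then show ?thesis using prod_card[OF An(1) E(1)] A3 cE by simp
  qed
  have third: "card (cjs (carrier G) X) = 1 \<or> card (cjs (carrier G) X) = 3"
    if X: "subgroup X G" "L \<subseteq> nrm (carrier G) X" for X
  proof -
    have N: "subgroup (nrm (carrier G) X) G" by (rule nrm_sg[OF sg_carrier sgD(1)[OF X(1)]])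
    obtain v where v: "card (nrm (carrier G) X) = 3 * c * v" using sg_dvd[OF L(1) N X(2)] L(2) by auto
    have "card (cjs (carrier G) X) * (3 * c * v) = 9 * c" using card_cjs[OF sg_carrier sgD(1)[OF X(1)]] v g by simp
    then have "card (cjs (carrier G) X) * v = 3" using c0 by (simp add: mult.commute)
    then have "card (cjs (carrier G) X) dvd 3" by (metis dvd_triv_left)
    then show ?thesis using p3 by (metis prime_nat_iff)
  qed
  \<comment> \<open>If L were normal, it would contain all Sylow 2-subgroups of G, but there are
    at most 3 of them in L.\<close>
  have L3: "card (cjs (carrier G) L) = 3"
  proof (rule ccontr)
    assume "card (cjs (carrier G) L) \<noteq> 3"
    then have "card (cjs (carrier G) L) = 1" using third[OF L(1) sub_nrm[OF L(1) sgD(1)[OF L(1)]]] by simp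
    then have Lx: "cj x L = L" if "x \<in> carrier G" for x using nmlD(2)[OF only_conjugate[OF L(1)]] that by simp
    have "Syl 2 (carrier G) \<subseteq> cjs A R2"
    proof
      fix T assume T: "T \<in> Syl 2 (carrier G)"
      then obtain x where x: "x \<in> carrier G" "T = cj x R2" using syl_conj[OF sg_carrier S(1) SylD(1)[OF T]] by blast
      have "T \<subseteq> L" using x cj_mono[OF dA(17), of x] Lx[OF x(1)] by (simp add: L_def)
      then have "is_syl 2 L T" using syl_mono[OF SylD(1)[OF T] sg_carrier L(1)] sgD(1)[OF L(1)] by simp
      then show "T \<in> cjs A R2" using coact_Syl[OF cA] by (auto simp: L_def Syl_def)
    qed
    moreover have "finite (cjs A R2)" unfolding cjs_def using sgD(2)[OF An(1)] by (rule finite_imageI)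
    ultimately have "card (Syl 2 (carrier G)) \<le> card (cjs A R2)" by (intro card_mono)
    then have "9 \<le> card (cjs A R2)" unfolding n(1) .
    moreover have "card (cjs A R2) \<le> 3" using card_image_le[OF sgD(2)[OF An(1)], of "\<lambda>x. cj x R2"] A3 by (simp add: cjs_def)
    ultimately show False by simp
  qed
  have LE: "L \<subseteq> nrm (carrier G) E"
  proof -
    have N: "subgroup (nrm (carrier G) E) G" by (rule nrm_sg[OF sg_carrier sgD(1)[OF E(1)]])
    have "x \<in> nrm (carrier G) E" if x: "x \<in> R2" for x
    proof -
      have xc: "x \<in> carrier G" using x S(5) by auto
      have "cj x E = E" unfolding E_def cj_Int[OF xc S(5) sgD(1)[OF D(1)]] cj_self[OF S(2) x] D(2)[OF xc] by (rule refl)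
      then show ?thesis using xc by (simp add: nrm_def)
    qed
    moreover have "x \<in> nrm (carrier G) E" if x: "x \<in> A" for x
    proof -
      have xc: "x \<in> carrier G" using x Ac by auto
      have "x \<otimes> y \<otimes> inv x = y" if "y \<in> E" for y
        using comEA[OF x that] fixed_iff[OF xc, of y] that sgD(5)[OF E(1)] by simp
      then have "cj x E = E" by (auto simp: cj_def)
      then show ?thesis using xc by (simp add: nrm_def)
    qed
    ultimately show ?thesis unfolding L_def by (intro prod_least[OF N]) auto
  qed
  \<comment> \<open>These are the trivial subgroup and the 3 conjugates of E or, if E is normal in G, the subgroups of E.\<close>
  have "\<exists>F. F \<subseteq> subs (carrier G) \<and> 4 \<le> card F \<and> (\<forall>X\<in>F. \<exists>i. card X = 2 ^ i \<and> 2 ^ i < c)"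
  proof (cases "card (cjs (carrier G) E) = 3")
    case True
    let ?F = "insert {\<one>} (cjs (carrier G) E)"
    have el: "subgroup X G \<and> card X = h" if "X \<in> cjs (carrier G) E" for X
      using that cj_sg[OF _ E(1)] cj_card[OF _ sgD(1)[OF E(1)]] cE by (auto simp: cjs_def)
    have "{\<one>} \<notin> cjs (carrier G) E" using el[of "{\<one>}"] ch(3) by auto
    moreover have "finite (cjs (carrier G) E)" using fin by (simp add: cjs_def)
    ultimately have "card ?F = 4" using True by simp
    moreover have "?F \<subseteq> subs (carrier G)" using el sgD(1) sg_one by (auto simp: subs_def)
    moreover have "\<exists>i. card X = 2 ^ i \<and> 2 ^ i < c" if "X \<in> ?F" for X
    proof (cases "X = {\<one>}")
      case True
      then show ?thesis using ch by (intro exI[of _ 0]) simp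
    next
      case False
      then have "card X = 2 ^ e" using el[of X] that cE e by simp
      moreover have "2 ^ e < c" using cE e ch by simp
      ultimately show ?thesis by blast
    qed
    ultimately show ?thesis by (intro exI[of _ ?F]) auto
  next
    case False
    then have "card (cjs (carrier G) E) = 1" using third[OF E(1) LE] by simp
    then have En: "nml E" by (rule only_conjugate[OF E(1)])
    have "card (carrier G) \<le> 2 * (card E * card R)" using g t9 cE ch by simp
    note nc = noncentral_of_index[OF En e R n(2) this]
    have "card (subs E) \<ge> 5" by (rule nontrivial_core_subs[OF nc])
    moreover have "subs E \<subseteq> subs (carrier G)" by (rule subs_mono[OF sgD(1)[OF E(1)]])
    moreover have "\<exists>i. card X = 2 ^ i \<and> 2 ^ i < c" if "X \<in> subs E" for X
    proof -
      have X: "subgroup X G" "X \<subseteq> E" using that by (auto simp: subs_def)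
      have "card X dvd 2 ^ e" using sg_dvd[OF X(1) E(1) X(2)] e by simp
      then obtain i where i: "card X = 2 ^ i" by (metis divides_primepow_nat two_is_prime_nat)
      have "card X \<le> h" using card_mono[OF sgD(2)[OF E(1)] X(2)] cE by simp
      then show ?thesis using i ch by (intro exI[of _ i]) simp
    qed
    ultimately show ?thesis by (intro exI[of _ "subs E"]) auto
  qed
  then obtain F where F: "F \<subseteq> subs (carrier G)" "4 \<le> card F" "\<And>X. X \<in> F \<Longrightarrow> \<exists>i. card X = 2 ^ i \<and> 2 ^ i < c" by blast
  \<comment> \<open>Small 2-subgroups share the label 0; all other subgroups in question are
    labelled by their orders.\<close>
  let ?\<kappa> = "\<lambda>H. if 3 dvd card H \<or> card H \<ge> c then card H else 0"
  have 0: "4 \<le> card {H \<in> subs (carrier G). ?\<kappa> H = 0}"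
  proof (rule family_card_le[OF F(1) _ F(2)])
    fix H assume "H \<in> F"
    then obtain i where "card H = 2 ^ i" "2 ^ i < c" using F(3) by blast
    then show "?\<kappa> H = 0" using nd3[of i] by simp
  qed
  have 1: "1 \<le> card {H \<in> subs (carrier G). ?\<kappa> H = 18 * h}"
    by (rule family_card_le[of "{carrier G}"]) (use sg_carrier g ch in \<open>auto simp: subs_def\<close>)
  have 2: "4 \<le> card {H \<in> subs (carrier G). ?\<kappa> H = 9}"
  proof (rule family_card_le[OF Syl_sub[of 3]])
    fix H assume "H \<in> Syl 3 (carrier G)"
    then have "card H = 9" using syl_card_eq[OF SylD(1) R'(1) sg_carrier] t9 by simp
    then show "?\<kappa> H = 9" by simp
  qed (use n in simp)
  have 3: "9 \<le> card {H \<in> subs (carrier G). ?\<kappa> H = 2 * h}"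
  proof (rule family_card_le[OF Syl_sub[of 2]])
    fix H assume "H \<in> Syl 2 (carrier G)"
    then have "card H = c" using syl_card_eq[OF SylD(1) S(1) sg_carrier] by (simp add: c_def)
    then show "?\<kappa> H = 2 * h" using ch by simp
  qed (use n in simp)
  have 4: "1 \<le> card {H \<in> subs (carrier G). ?\<kappa> H = 3}"
    by (rule family_card_le[of "{A}"]) (use An(1) Ac A3 in \<open>auto simp: subs_def\<close>)
  have 5: "3 \<le> card {H \<in> subs (carrier G). ?\<kappa> H = 6 * h}"
  proof (rule family_card_le[of "cjs (carrier G) L"])
    have el: "subgroup X G \<and> card X = 6 * h" if "X \<in> cjs (carrier G) L" for X
      using that cj_sg[OF _ L(1)] cj_card[OF _ sgD(1)[OF L(1)]] L(2) ch by (auto simp: cjs_def)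
    show "cjs (carrier G) L \<subseteq> subs (carrier G)" using el sgD(1) by (auto simp: subs_def)
    show "?\<kappa> H = 6 * h" if "H \<in> cjs (carrier G) L" for H using el[OF that] by simp
  qed (use L3 in simp)
  have 6: "1 \<le> card {H \<in> subs (carrier G). ?\<kappa> H = 9 * h}"
    by (rule family_card_le[of "{D}"]) (use D(1) sgD(1)[OF D(1)] D9 in \<open>auto simp: subs_def\<close>)
  have 7: "1 \<le> card {H \<in> subs (carrier G). ?\<kappa> H = 3 * h}"
    by (rule family_card_le[of "{A <#> E}"]) (use AE sgD(1)[OF AE] cAE in \<open>auto simp: subs_def\<close>)
  let ?L = "[(0, 4), (18 * h, 1), (9, 4), (2 * h, 9), (3, 1), (6 * h, 3), (9 * h, 1), (3 * h, 1 :: nat)]"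
  have all: "\<forall>e\<in>set ?L. snd e \<le> card {x \<in> subs (carrier G). ?\<kappa> x = fst e}"
    by (simp only: list.set ball_simps fst_conv snd_conv 0 1 2 3 4 5 6 7 simp_thms)
  have "sum_list (map snd ?L) \<le> card (subs (carrier G))"
  proof (rule tagged_card_bound[OF subs_finite, where \<kappa> = ?\<kappa>])
    show "l \<le> card {x \<in> subs (carrier G). ?\<kappa> x = i}" if "(i, l) \<in> set ?L" for i l
      using bspec[OF all that] unfolding fst_conv snd_conv .
    show "distinct (map fst ?L)" using ch(2,3) by (auto elim!: evenE) presburger+
  qed
  then show ?thesis by (simp add: subs_carrier)
qed

text \<open>The Sylow number of q is a power of p that is at least q + 1 and at most 18; this
gives p = 2 and the numbers 4, 8 or 16. In the last two cases the Sylow number of 2 is q and both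
primes are self-normalizing, which the count of elements excludes. If it is 4, then q = 3, and the
Sylow number of 2 is 3 or 9.\<close>

lemma no_two_primes:
  assumes NS: all_sylow_nonnormal and num: "num_subgroups G = 23" and pr': "prime_div p" "prime_div q" "p < q" and only: "\<And>r. prime_div r \<Longrightarrow> r = p \<or> r = q"
  shows False
proof -
  have P: "prime p" "prime q" using pr' by (auto simp: prime_div_def)
  have ps: "distinct [p, q]" "\<And>x. x \<in> set [p, q] \<Longrightarrow> prime_div x" using pr' by auto
  note fam = sylow_family_bound[OF NS ps]
  have b0: "n_syl p + n_syl q \<le> 21" using fam[of "[]"] num by simp
  have b1: "n_syl p + n_syl q + n_syl a \<le> 21" if "prime_div a" "\<not> self_normalizing a" for a
    using fam[of "[a]"] num that by simp
  have g: "n_syl p \<ge> p + 1" "n_syl q \<ge> q + 1" using n_syl_ge[OF NS] pr' by auto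
  have md: "n_syl p mod p = 1" "n_syl q mod q = 1" using n_syl_mod P by auto
  obtain i where i: "n_syl p = q ^ i" using n_syl_prime_power[OF pr'(1) P(2) only] by blast
  obtain j where j: "n_syl q = p ^ j" using n_syl_prime_power[OF pr'(2) P(1)] only by blast
  have p2: "p \<ge> 2" using prime_ge_2_nat[OF P(1)] .
  have j2: "j \<ge> 2"
  proof (rule ccontr)
    assume "\<not> j \<ge> 2"
    then have "p ^ j \<le> p ^ 1" using p2 by (intro power_increasing) auto
    then show False using j g(2) pr'(3) by simp
  qed
  have nq: "n_syl q \<le> 18" using b0 g(1) p2 by linarith
  have pp: "p ^ 2 \<le> n_syl q" unfolding j using j2 p2 by (intro power_increasing) auto
  have p4: "p < 5"
  proof (rule ccontr)
    assume "\<not> p < 5"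
    then have "5 ^ 2 \<le> p ^ 2" by (intro power_mono) auto
    then show False using pp nq by simp
  qed
  have nn: "x \<notin> {0, 1, 4, 6, 8, 9, 10, 12, 14, 15, 16}" if "prime x" for x :: nat
    using that by (intro notI) auto
  have pe: "p = 2"
  proof (rule ccontr)
    assume "p \<noteq> 2"
    then have p3: "p = 3" using p2 p4 nn[OF P(1)] by (cases "p = 4") auto
    have "j < 3"
    proof (rule ccontr)
      assume "\<not> j < 3"
      then have "(3::nat) ^ 3 \<le> 3 ^ j" by (intro power_increasing) auto
      then show False using j nq p3 by simp
    qed
    then have n9: "n_syl q = 9" using j j2 p3 by (cases "j = 2") auto
    then have "q = 4 \<or> q = 5 \<or> q = 6 \<or> q = 7 \<or> q = 8" using g(2) pr'(3) p3 by linarith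
    then show False using md(2) n9 nn[OF P(2)] by auto
  qed
  have j5: "j < 5"
  proof (rule ccontr)
    assume "\<not> j < 5"
    then have "(2::nat) ^ 5 \<le> 2 ^ j" by (intro power_increasing) auto
    then show False using j nq pe by simp
  qed
  have "j = 2 \<or> j = 3 \<or> j = 4" using j2 j5 by linarith
  then have n2: "n_syl q = 4 \<or> n_syl q = 8 \<or> n_syl q = 16" using j pe by auto
  have q3: "q \<ge> 3" using pr'(3) pe by simp
  have npq: "i \<noteq> 0" using i g(1) pe by (intro notI) simp
  obtain R where R: "R \<in> Syl p (carrier G)" using Syl_nonempty P by blast
  obtain T where T: "T \<in> Syl q (carrier G)" using Syl_nonempty P by blast
  have GRT: "card (carrier G) = card R * card T" using two_prime_order[OF _ only R T] pr'(3) by simp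
  have big: False if n8: "n_syl q \<ge> 8" and np: "n_syl p = q"
  proof -
    have sp: "self_normalizing p" if "2 * n_syl p + n_syl q > 21" using b1[OF pr'(1)] that by (cases "self_normalizing p") auto
    have "q = 7 \<and> n_syl q = 8 \<or> n_syl q = 16"
    proof -
      have "n_syl q = 8 \<or> n_syl q = 16" using n2 n8 by auto
      moreover have "q = 7" if "n_syl q = 8"
      proof -
        have "q = 3 \<or> q = 4 \<or> q = 5 \<or> q = 6 \<or> q = 7" using g(2) q3 that by linarith
        then show ?thesis using md(2) that by auto
      qed
      ultimately show ?thesis by blast
    qed
    then have s21: "2 * n_syl p + n_syl q > 21" "n_syl p + 2 * n_syl q > 21" using np q3 by auto
    have sp: "self_normalizing p" using b1[OF pr'(1)] s21(1) by (cases "self_normalizing p") auto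
    have sq: "self_normalizing q" using b1[OF pr'(2)] s21(2) by (cases "self_normalizing q") auto
    have R0: "card R > 0" "card T > 0" using sgD(4)[OF SylD(2)[OF R]] sgD(4)[OF SylD(2)[OF T]] .
    have "card T = q" using self_normalizing_card[OF NS sp R] GRT R0 np by simp
    moreover have "card R = n_syl q" using self_normalizing_card[OF NS sq T] GRT R0 by simp
    ultimately show False using prime_order_self_normalizing_contra[OF NS pr'(2) sq T _ pr'(1) R] pr'(3) by simp
  qed
  have i1: "i = 1" if "q \<ge> 5"
  proof (rule ccontr)
    assume "i \<noteq> 1"
    then have "i \<ge> 2" using npq by linarith
    then have "q ^ 2 \<le> q ^ i" using q3 by (intro power_increasing) auto
    moreover have "5 ^ 2 \<le> q ^ 2" using that by (intro power_mono) auto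
    ultimately show False using i b0 by simp
  qed
  have q35: "q = 3 \<or> q \<ge> 5" using q3 nn[OF P(2)] by (cases "q = 4") auto
  from n2 show False
  proof (elim disjE)
    assume n4: "n_syl q = 4"
    then have "q = 3" using g(2) q3 by linarith
    have "i < 3"
    proof (rule ccontr)
      assume "\<not> i < 3"
      then have "(3::nat) ^ 3 \<le> 3 ^ i" by (intro power_increasing) auto
      then show False using i b0 \<open>q = 3\<close> by simp
    qed
    then have "i = 1 \<or> i = 2" using npq by linarith
    then have "n_syl p = 3 \<or> n_syl p = 9" using i \<open>q = 3\<close> by auto
    then show False
    proof
      assume "n_syl p = 3"
      then have "num_subgroups G \<ge> 24" using many_subs_3_4 pr' only pe \<open>q = 3\<close> n4 by simp
      then show False using num by simp
    next
      assume n9: "n_syl p = 9"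
      have "self_normalizing p" using b1[OF pr'(1)] n9 n4 by (cases "self_normalizing p") auto
      then have "num_subgroups G \<ge> 24" using many_subs_9_4 pr' only pe \<open>q = 3\<close> n4 n9 by simp
      then show False using num by simp
    qed
  next
    assume n8: "n_syl q = 8"
    then have "q = 3 \<or> q = 5 \<or> q = 6 \<or> q = 7" using g(2) q35 by linarith
    then have "q \<ge> 5" using md(2) n8 by auto
    then show False using big n8 i i1 by simp
  next
    assume n16: "n_syl q = 16"
    have "n_syl p \<le> 5" using b0 n16 by simp
    have "n_syl p = q"
    proof (cases "q = 3")
      case True
      have "i < 2"
      proof (rule ccontr)
        assume "\<not> i < 2"
        then have "(3::nat) ^ 2 \<le> 3 ^ i" by (intro power_increasing) auto
        then show False using i \<open>n_syl p \<le> 5\<close> True by simp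
      qed
      then have "i = 1" using npq by linarith
      then show ?thesis using i by simp
    next
      case False
      then show ?thesis using i i1 q35 by simp
    qed
    then show False using big n16 by simp
  qed
qed

theorem prime_power_order_of_23:
  assumes num: "num_subgroups G = 23"
  shows "\<exists>p k. prime p \<and> card (carrier G) = p ^ k"
proof (rule ccontr)
  assume no: "\<not> ?thesis"
  have proper: "R \<noteq> carrier G" if "is_syl r (carrier G) R" for r R
    using sylD(3,5)[OF that] no by auto
  have NS: all_sylow_nonnormal
    unfolding all_sylow_nonnormal_def
  proof (intro allI impI notI)
    fix r R assume r: "prime_div r" "is_syl r (carrier G) R" "nml R"
    have rp: "prime r" "r dvd card (carrier G)" using r(1) by (auto simp: prime_div_def)
    have ne: "R \<noteq> {\<one>}" "R \<noteq> carrier G" using syl_nontrivial[OF r(2) rp(2)] proper[OF r(2)] by auto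
    have "r \<noteq> 4" using rp(1) by (intro notI) simp
    then have "r = 2 \<or> r = 3 \<or> r \<ge> 5" using prime_ge_2_nat[OF rp(1)] by linarith
    then show False
    proof (elim disjE)
      assume "r = 2" then show False using no_normal_sylow_2[OF num r(3) _ ne] r(2) by simp
    next
      assume "r = 3" then show False using no_normal_sylow_3[OF num r(3) _ ne] r(2) by simp
    next
      assume "r \<ge> 5" then show False using no_normal_sylow_ge5[OF num r(3,2) _ ne] by simp
    qed
  qed
  have c1: "card (carrier G) \<noteq> 1"
  proof
    assume "card (carrier G) = 1"
    then have "card (carrier G) = 2 ^ 0" by simp
    then show False using no two_is_prime_nat by blast
  qed
  then obtain p where p: "prime p" "p dvd card (carrier G)" using prime_factor_nat by blast
  have cn: "card (carrier G) \<noteq> 0" using sgD(4)[OF sg_carrier] by simp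
  obtain q where q: "prime_div q" "q \<noteq> p" using single_prime_power[OF cn p(1)] no p(1) by (auto simp: prime_div_def)
  have pp: "prime_div p" using p by (simp add: prime_div_def)
  show False
  proof (cases "\<exists>r. prime_div r \<and> r \<noteq> p \<and> r \<noteq> q")
    case True
    then obtain r where r: "prime_div r" "r \<noteq> p" "r \<noteq> q" by blast
    consider "p < q \<and> q < r" | "p < r \<and> r < q" | "q < p \<and> p < r" | "q < r \<and> r < p" | "r < p \<and> p < q" | "r < q \<and> q < p"
      using q(2) r(2,3) by linarith
    then show False using no_three_primes[OF NS num] pp q(1) r(1) by cases blast+
  next
    case False
    then have only: "\<And>r. prime_div r \<Longrightarrow> r = p \<or> r = q" by blast
    show False
    proof (cases "p < q")
      case True
      then show False using no_two_primes[OF NS num pp q(1) True only] by simp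
    next
      case F: False
      then have "q < p" using q(2) by simp
      then show False using no_two_primes[OF NS num q(1) pp] only by blast
    qed
  qed
qed

section \<open>Nilpotency of groups of prime power order\<close>

text \<open>The preimage in G of the center of G/Z.\<close>

definition central_over :: "'a set \<Rightarrow> 'a set" where
  "central_over Z = {x \<in> carrier G. \<forall>g\<in>carrier G. x \<otimes> g \<otimes> inv x \<otimes> inv g \<in> Z}"

lemma nml_cj_mem: "nml Z \<Longrightarrow> z \<in> Z \<Longrightarrow> g \<in> carrier G \<Longrightarrow> g \<otimes> z \<otimes> inv g \<in> Z"
  using nmlD(2)[of Z g] by (auto simp: cj_def)

lemma central_over_nml:
  assumes Z: "nml Z"
  shows "nml (central_over Z)" and "Z \<subseteq> central_over Z"
proof -
  note Zs = nmlD(1)[OF Z]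
  have lc: "inv x \<otimes> (x \<otimes> y) = y" "x \<otimes> (inv x \<otimes> y) = y" if "x \<in> carrier G" "y \<in> carrier G" for x y
    using that by (simp_all add: m_assoc[symmetric])
  show sub: "Z \<subseteq> central_over Z"
  proof
    fix x assume x: "x \<in> Z"
    have "x \<otimes> g \<otimes> inv x \<otimes> inv g \<in> Z" if g: "g \<in> carrier G" for g
    proof -
      have "x \<otimes> (g \<otimes> inv x \<otimes> inv g) \<in> Z" using sgD(6,7)[OF Zs] nml_cj_mem[OF Z _ g] x by blast
      then show ?thesis using g sgD(5)[OF Zs x] by (simp add: m_assoc)
    qed
    then show "x \<in> central_over Z" using sgD(5)[OF Zs x] by (simp add: central_over_def)
  qed
  have s: "subgroup (central_over Z) G"
  proof (rule subgroupI)
    show "central_over Z \<subseteq> carrier G" by (auto simp: central_over_def)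
    show "central_over Z \<noteq> {}" using sub sgD(3)[OF Zs] by blast
    show "inv x \<in> central_over Z" if x: "x \<in> central_over Z" for x
    proof -
      have xc: "x \<in> carrier G" using x by (simp add: central_over_def)
      have "inv x \<otimes> g \<otimes> inv (inv x) \<otimes> inv g \<in> Z" if g: "g \<in> carrier G" for g
      proof -
        have "inv x \<otimes> inv (x \<otimes> g \<otimes> inv x \<otimes> inv g) \<otimes> inv (inv x) \<in> Z"
          using nml_cj_mem[OF Z sgD(6)[OF Zs], of _ "inv x"] x g xc by (simp add: central_over_def)
        then show ?thesis using g xc by (simp add: inv_mult_group m_assoc lc)
      qed
      then show ?thesis using xc by (simp add: central_over_def)
    qed
    show "x \<otimes> y \<in> central_over Z" if xy: "x \<in> central_over Z" "y \<in> central_over Z" for x y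
    proof -
      have c: "x \<in> carrier G" "y \<in> carrier G" using xy by (simp_all add: central_over_def)
      have "(x \<otimes> y) \<otimes> g \<otimes> inv (x \<otimes> y) \<otimes> inv g \<in> Z" if g: "g \<in> carrier G" for g
      proof -
        have "(x \<otimes> (y \<otimes> g \<otimes> inv y \<otimes> inv g) \<otimes> inv x) \<otimes> (x \<otimes> g \<otimes> inv x \<otimes> inv g) \<in> Z"
          using nml_cj_mem[OF Z _ c(1)] sgD(7)[OF Zs] xy g by (simp add: central_over_def)
        then show ?thesis using g c by (simp add: inv_mult_group m_assoc lc)
      qed
      then show ?thesis using c by (simp add: central_over_def)
    qed
  qed
  show "nml (central_over Z)"
  proof (rule nmlI[OF s])
    fix g assume g: "g \<in> carrier G"
    show "cj g (central_over Z) \<subseteq> central_over Z"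
    proof
      fix y assume "y \<in> cj g (central_over Z)"
      then obtain x where x: "x \<in> central_over Z" "y = g \<otimes> x \<otimes> inv g" by (auto simp: cj_def)
      have xc: "x \<in> carrier G" using x by (simp add: central_over_def)
      have "inv (x \<otimes> g \<otimes> inv x \<otimes> inv g) \<in> Z" using sgD(6)[OF Zs] x g by (simp add: central_over_def)
      then have "inv (x \<otimes> g \<otimes> inv x \<otimes> inv g) \<otimes> x \<in> central_over Z" using sub x(1) sgD(7)[OF s] by blast
      then show "y \<in> central_over Z" using x(2) xc g by (simp add: inv_mult_group m_assoc lc)
    qed
  qed
qed

text \<open>G permutes the cosets of Z by conjugation. Their number is divisible by p, and Z is a
fixed coset, so there is another one; its elements are central modulo Z.\<close>

lemma central_over_grows:
  assumes G: "card (carrier G) = p ^ m" "prime p" and Z: "nml Z" "Z \<noteq> carrier G"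
  shows "central_over Z \<noteq> Z"
proof -
  note Zs = nmlD(1)[OF Z(1)]
  note Zc = sgD(1)[OF Zs]
  let ?F = "(\<lambda>x. lc x Z) ` carrier G"
  let ?X = "{X \<in> ?F. \<forall>g\<in>carrier G. cj g X = X}"
  have fF: "finite ?F" using fin by simp
  have cjl: "cj g (lc x Z) = lc (g \<otimes> x \<otimes> inv g) Z" if "g \<in> carrier G" "x \<in> carrier G" for g x
  proof -
    have "lc y Z = {y} <#> Z" for y by (auto simp: l_coset_def set_mult_def)
    then show ?thesis using cj_prod[of g "{x}" Z] that Zc nmlD(2)[OF Z(1) that(1)] by (simp add: cj_def)
  qed
  have a: "acts (carrier G) cj ?F"
  proof (rule acts_cj[OF sg_carrier])
    show "X \<subseteq> carrier G" if "X \<in> ?F" for X using that Zc by (auto simp: l_coset_def)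
    show "cj g X \<in> ?F" if "g \<in> carrier G" "X \<in> ?F" for g X using that cjl by auto
  qed
  have c: "card ?F * card Z = card (carrier G)"
    by (rule coset_fixed(1)[OF sg_carrier Zs Zc sg_carrier subset_refl G])
  have "card ?F dvd p ^ m" using c G(1) by (metis dvd_triv_left)
  then obtain j where j: "card ?F = p ^ j" using G(2) by (auto simp: divides_primepow_nat)
  have "j \<noteq> 0" using j c Z(2) sg_eqI[OF Zs sg_carrier Zc] by (intro notI) simp
  then have "p dvd card ?F" using j by (simp add: dvd_power)
  then have pd: "p dvd card ?X" using fixed_points_mod[OF sg_carrier G a fF] by (simp add: dvd_eq_mod_eq_0)
  have "lc \<one> Z \<in> ?F" by blast
  then have "Z \<in> ?X" using lcos_mult_one[OF Zc] nmlD(2)[OF Z(1)] by simp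
  moreover have fX: "finite ?X" using fF by simp
  ultimately have "card ?X > 0" using card_gt_0_iff by blast
  then have "card ?X \<ge> 2" using pd prime_ge_2_nat[OF G(2)] dvd_imp_le order_trans by blast
  then have "\<not> ?X \<subseteq> {Z}" using card_mono[of "{Z}" ?X] by auto
  then obtain X where X: "X \<in> ?X" "X \<noteq> Z" by blast
  then obtain x where x: "x \<in> carrier G" "X = lc x Z" by blast
  have "x \<in> central_over Z"
  proof -
    have "x \<otimes> g \<otimes> inv x \<otimes> inv g \<in> Z" if g: "g \<in> carrier G" for g
    proof -
      have "lc (g \<otimes> x \<otimes> inv g) Z = lc x Z" using X(1) x cjl[OF g x(1)] g by simp
      moreover have "g \<otimes> x \<otimes> inv g \<in> lc (g \<otimes> x \<otimes> inv g) Z"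
        using sgD(3)[OF Zs] g x(1) by (force simp: l_coset_def)
      ultimately obtain z where z: "z \<in> Z" "g \<otimes> x \<otimes> inv g = x \<otimes> z" by (auto simp: l_coset_def)
      have "x \<otimes> g \<otimes> inv x \<otimes> inv g = x \<otimes> inv (g \<otimes> x \<otimes> inv g)" using g x(1) by (simp add: inv_mult_group m_assoc)
      also have "\<dots> = x \<otimes> inv z \<otimes> inv x" using z x(1) sgD(5)[OF Zs z(1)] by (simp add: inv_mult_group m_assoc)
      also have "\<dots> \<in> Z" by (rule nml_cj_mem[OF Z(1) sgD(6)[OF Zs z(1)] x(1)])
      finally show ?thesis .
    qed
    then show ?thesis using x(1) by (simp add: central_over_def)
  qed
  moreover have "x \<notin> Z"
  proof
    assume "x \<in> Z"
    then have "lc x Z = Z" using coset_join3[OF x(1) Zs] by simp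
    then show False using X(2) x(2) by simp
  qed
  ultimately show ?thesis by blast
qed

text \<open>The i-th term of the lower central series lies in the (c - i)-th term u (c - i) of the
upper central series, which reaches G at c, the order of G, at the latest.\<close>

lemma prime_power_nilpotent:
  assumes G: "card (carrier G) = p ^ m" "prime p"
  shows "nilpotent_group G"
proof -
  define u where "u n = (central_over ^^ n) {\<one>}" for n
  have u0: "u 0 = {\<one>}" and uS: "u (Suc n) = central_over (u n)" for n by (simp_all add: u_def)
  have nm: "nml (u n)" for n
  proof (induction n)
    case 0
    show ?case unfolding u0 by (rule nmlI[OF sg_one]) (simp add: cj_def)
  next
    case (Suc n)
    then show ?case unfolding uS by (rule central_over_nml(1))
  qed
  have grow: "u n = carrier G \<or> n < card (u n)" for n
  proof (induction n)
    case 0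
    show ?case by (simp add: u0)
  next
    case (Suc n)
    note s = sgD(1,2)[OF nmlD(1)[OF nm[of "Suc n"]]]
    have sub: "u n \<subseteq> u (Suc n)" unfolding uS by (rule central_over_nml(2)[OF nm])
    show ?case
    proof (cases "u n = carrier G")
      case True
      then show ?thesis using sub s(1) by simp
    next
      case False
      then have "u n \<subset> u (Suc n)" using sub central_over_grows[OF G nm False] unfolding uS by blast
      then have "card (u n) < card (u (Suc n))" by (rule psubset_card_mono[OF s(2)])
      then show ?thesis using Suc False by simp
    qed
  qed
  define c where "c = card (carrier G)"
  have "card (u c) \<le> c" unfolding c_def by (rule card_mono[OF fin sgD(1)[OF nmlD(1)[OF nm]]])
  then have uc: "u c = carrier G" using grow[of c] by simp
  have low: "i \<le> c \<Longrightarrow> lower_central_series G i \<subseteq> u (c - i)" for i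
  proof (induction i)
    case 0
    then show ?case using uc by simp
  next
    case (Suc i)
    have e: "c - i = Suc (c - Suc i)" using Suc.prems by simp
    have "lower_central_series G i \<subseteq> central_over (u (c - Suc i))" using Suc uS[of "c - Suc i"] e by simp
    then have "(\<Union>h \<in> lower_central_series G i. \<Union>k \<in> carrier G. {h \<otimes> k \<otimes> inv h \<otimes> inv k}) \<subseteq> u (c - Suc i)"
      by (auto simp: central_over_def subset_iff)
    then show ?case unfolding lower_central_series.simps commutator_subgroup_def
      by (rule generate_subgroup_incl[OF _ nmlD(1)[OF nm]])
  qed
  have "\<one> \<in> lower_central_series G c" by (cases c) (auto simp: commutator_subgroup_def intro: generate.one)
  then have "lower_central_series G c = {\<one>}" using low[of c] u0 by auto
  then show ?thesis unfolding nilpotent_group_def using is_group by blast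
qed

end

section \<open>Groups with 23 subgroups\<close>

theorem mainTheorem7:
  fixes G :: "('a, 'b) monoid_scheme"
  assumes "group G"
    and "finite (carrier G)"
    and "num_subgroups G = 23"
  shows "(\<exists>p. finite_p_group p G) \<and> nilpotent_group G"
proof -
  interpret fin_grp G using assms(1,2) by (simp add: fin_grp_def fin_grp_axioms_def)
  obtain p k where pk: "prime p" "card (carrier G) = p ^ k" using prime_power_order_of_23[OF assms(3)] by blast
  then have "finite_p_group p G" using assms(1) by (auto simp: finite_p_group_def order_def)
  then show ?thesis using prime_power_nilpotent[OF pk(2,1)] by blast
qed

end
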